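(* Let $n\ge1$, $s\in(0,1)$, $\varepsilon>0$, and let $u\in C^\infty_c(\mathbb{R}^n)$ satisfy $(-\Delta)^su=f$ in $\mathbb{R}^n$, where $f\in C^{s+\varepsilon}_{loc}(\mathbb{R}^n)\cap L^1_{s/2}(\mathbb{R}^n)$ and $\langle\nabla^s u,\nabla^s f\rangle\le0$ in a neighborhood of the origin. Then there exists $R_0>0$ such that the map $R\mapsto\mathfrak{J}^s_{ACF}(u,R)$ is monotone nondecreasing on $(0,R_0)$.
   Context: $B_r$ is the open ball of radius $r$ centered at $0$; $\langle\cdot,\cdot\rangle$ is the Euclidean inner product. $C_{n,s}:=\left(\int_{\mathbb{R}^n}\frac{1-\cos(\zeta_1)}{|\zeta|^{n+2s}}d\zeta\right)^{-1}$ and $(-\Delta)^s u(x):=C_{n,s}\lim_{\epsilon\to0}\int_{\mathbb{R}^n\setminus B_\epsilon(x)}\frac{u(x)-u(y)}{|x-y|^{n+2s}}dy$. For $t\in(0,1)$, $L^1_t(\mathbb{R}^n):=\{u\in L^1_{loc}:\int\frac{|u(x)|}{1+|x|^{n+2t}}dx<\infty\}$. For $\gamma>0$ not an integer, $C^{\gamma}_{loc}$ denotes $C^{k,\gamma-k}_{loc}$ with $k=\lfloor\gamma\rfloor$. With $\mu_{n,s}:=2^s\pi^{-n/2}\frac{\Gamma((n+s+1)/2)}{\Gamma((1-s)/2)}$, $\partial^s_i u(x):=\mu_{n,s}\int_{\mathbb{R}^n}\frac{(y_i-x_i)(u(y)-u(x))}{|y-x|^{n+s+1}}dy$, $\nabla^s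 u:=(\partial^s_1u,\dots,\partial^s_nu)$, $|\nabla^s u|$ its Euclidean norm. With $a_{n,s}:=\Gamma(n/2)\pi^{-n/2-1}\sin(\pi s)$, $K^s_r(0,y):=a_{n,s}\left(\frac{r^2}{|y|^2-r^2}\right)^s\frac{1}{|y|^n}$ for $|y|>r$, and $\mathfrak{J}^s_{ACF}(u,R):=\frac{1}{R^{1+s}}\int_0^R r^s\int_{\mathbb{R}^n\setminus B_r}K^s_r(0,y)|\nabla^s u(y)|^2\,dy\,dr$. *)

theory Defs
  imports "HOL-Analysis.Analysis"
begin

definition pd :: "'n::finite \<Rightarrow> (real^'n \<Rightarrow> real) \<Rightarrow> real^'n \<Rightarrow> real" where
  "pd i g x = deriv (\<lambda>t. g (x + t *\<^sub>R axis i 1)) 0"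

definition pdiff_at :: "'n::finite \<Rightarrow> (real^'n \<Rightarrow> real) \<Rightarrow> real^'n \<Rightarrow> bool" where
  "pdiff_at i g x \<longleftrightarrow> (\<lambda>t. g (x + t *\<^sub>R axis i 1)) differentiable (at 0)"

fun pds :: "'n::finite list \<Rightarrow> (real^'n \<Rightarrow> real) \<Rightarrow> real^'n \<Rightarrow> real" where
  "pds [] g = g"
| "pds (i # is) g = pd i (pds is g)"

definition Ck :: "nat \<Rightarrow> (real^'n::finite \<Rightarrow> real) \<Rightarrow> bool" where
  "Ck k g \<longleftrightarrow>
     (\<forall>is. length is \<le> k \<longrightarrow> continuous_on UNIV (pds is g)) \<and>
     (\<forall>is. length is < k \<longrightarrow> (\<forall>i x. pdiff_at i (pds is g) x))"

definition smooth :: "(real^'n::finite \<Rightarrow> real) \<Rightarrow> bool" where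
  "smooth g \<longleftrightarrow> (\<forall>k. Ck k g)"

definition Cinf_c :: "(real^'n::finite \<Rightarrow> real) \<Rightarrow> bool" where
  "Cinf_c u \<longleftrightarrow> smooth u \<and> compact (closure {x. u x \<noteq> 0})"

definition Holder_loc :: "nat \<Rightarrow> real \<Rightarrow> (real^'n::finite \<Rightarrow> real) \<Rightarrow> bool" where
  "Holder_loc k \<alpha> g \<longleftrightarrow> Ck k g \<and>
     (\<forall>is K. length is = k \<and> compact K \<longrightarrow>
        (\<exists>C. \<forall>x\<in>K. \<forall>y\<in>K. \<bar>pds is g x - pds is g y\<bar> \<le> C * dist x y powr \<alpha>))"

definition C_gamma_loc :: "real \<Rightarrow> (real^'n::finite \<Rightarrow> real) \<Rightarrow> bool" where
  "C_gamma_loc \<gamma> g \<longleftrightarrow> Holder_loc (nat \<lfloor>\<gamma>\<rfloor>) (\<gamma> - of_int \<lfloor>\<gamma>\<rfloor>) g"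

definition L1_w :: "real \<Rightarrow> (real^'n::finite \<Rightarrow> real) \<Rightarrow> bool" where
  "L1_w t g \<longleftrightarrow> (\<forall>K. compact K \<longrightarrow> set_integrable lborel K g) \<and>
     integrable lborel (\<lambda>x. \<bar>g x\<bar> / (1 + norm x powr (real CARD('n) + 2 * t)))"

text \<open>A fixed coordinate direction (the "first" one); by symmetry the choice is irrelevant.\<close>
definition idx1 :: "'n::finite" where "idx1 = (SOME i. True)"

definition C_ns :: "real \<Rightarrow> 'n::finite itself \<Rightarrow> real" where
  "C_ns s TYPE('n) = inverse (integral\<^sup>L lborel
      (\<lambda>\<zeta>::real^'n. (1 - cos (\<zeta> $ idx1)) / norm \<zeta> powr (real CARD('n) + 2 * s)))"

definition frac_lap_eq :: "real \<Rightarrow> (real^'n::finite \<Rightarrow> real) \<Rightarrow> (real^'n \<Rightarrow> real) \<Rightarrow> bool" where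
  "frac_lap_eq s u f \<longleftrightarrow> (\<forall>x.
     ((\<lambda>e. C_ns s TYPE('n) * set_lebesgue_integral lborel (- ball x e)
          (\<lambda>y. (u x - u y) / dist x y powr (real CARD('n) + 2 * s))) \<longlongrightarrow> f x) (at_right 0))"

definition mu_ns :: "real \<Rightarrow> 'n::finite itself \<Rightarrow> real" where
  "mu_ns s TYPE('n) = 2 powr s * pi powr (- real CARD('n) / 2) *
      Gamma ((real CARD('n) + s + 1) / 2) / Gamma ((1 - s) / 2)"

definition frac_pd :: "real \<Rightarrow> 'n::finite \<Rightarrow> (real^'n \<Rightarrow> real) \<Rightarrow> real^'n \<Rightarrow> real" where
  "frac_pd s i u x = mu_ns s TYPE('n) * integral\<^sup>L lborel
      (\<lambda>y. (y $ i - x $ i) * (u y - u x) / norm (y - x) powr (real CARD('n) + s + 1))"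

definition frac_grad :: "real \<Rightarrow> (real^'n::finite \<Rightarrow> real) \<Rightarrow> real^'n \<Rightarrow> real^'n" where
  "frac_grad s u x = (\<chi> i. frac_pd s i u x)"

definition a_ns :: "real \<Rightarrow> 'n::finite itself \<Rightarrow> real" where
  "a_ns s TYPE('n) = Gamma (real CARD('n) / 2) * pi powr (- real CARD('n) / 2 - 1) * sin (pi * s)"

text \<open>K^s_r(0,y), for |y| > r.\<close>
definition Ksr :: "real \<Rightarrow> real \<Rightarrow> real^'n::finite \<Rightarrow> real" where
  "Ksr s r y = a_ns s TYPE('n) * (r\<^sup>2 / ((norm y)\<^sup>2 - r\<^sup>2)) powr s / norm y ^ CARD('n)"

definition J_ACF :: "real \<Rightarrow> (real^'n::finite \<Rightarrow> real) \<Rightarrow> real \<Rightarrow> real" where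
  "J_ACF s u R = 1 / R powr (1 + s) *
     (LBINT r=0..R. r powr s * set_lebesgue_integral lborel (- ball 0 r)
        (\<lambda>y. Ksr s r y * (norm (frac_grad s u y))\<^sup>2))"

end

(*
  Write V for the fractional gradient of u, w = |V|^2, and A(t) for the integral of
  (|z|^2 - 1)^(-s) |z|^(-n) w(tz) over |z| > 1. After rescaling, J(R) is a positive multiple of the
  integral of t^s A(Rt) over 0 < t < 1, so it suffices that A is nondecreasing near 0.

  Since the fractional Laplacian commutes with V, the hypothesis on V(u) . V(f) and the pointwise
  inequality D(v^2) <= 2 v D(v) for second differences D show that w is s-subharmonic near 0.

  The derivative of the Green function of B_t in t is a multiple of (t^2 - |y|^2)^(s-1), so t A'(t)
  should equal a negative multiple of the integral over the unit ball of (1 - |y|^2)^(s-1) against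
  the fractional Laplacian of w(t.). This is proved by splitting the fractional Laplacian into
  one-dimensional ones over all directions. On a line the identity is conformally invariant: with
  y = tanh b and z = tanh a the kernel becomes sgn(a-b) |sinh(a-b)|^(-2s), which is odd, so the
  interior contributes nothing, and z = coth a computes the exterior contribution. Averaging the
  result over directions reproduces the kernel (|z|^2 - 1)^(-s) |z|^(-n) z up to a constant.
*)

theory Submission
  imports Defs
begin

section \<open>Integration along lines and change of variables\<close>

text \<open>The power (1 - |y|^2)^(s-1) is forced on a line: for y = tanh b its measure is
  cosh(b)^(-2s) db, which cancels exactly the cosh(b)^(2s) produced by the kernel and leaves an
  expression invariant under translation in b. One obstacle is the singularity: for s >= 1/2 the two
  halves of the line integral do not converge separately in general, and an excision symmetric about
  b is not symmetric about y = tanh b, so the mismatch must be shown to disappear in the limit. The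
  other is that chords of the ball have different lengths. A chord of half-length l carries the
  factor l^(2s-1), which for s < 1/2 is unbounded near tangent lines. Its average over directions
  has to be dominated before integrals may be exchanged, and its exact dependence on |z| comes from
  a dilation argument instead of the evaluation of a Beta integral. The mean A is never
  differentiated: its increments are written as integrals of the radial flux, so a Lipschitz
  gradient of w is enough regularity.\<close>

lemma nn_integral_lborel_affine:
  fixes f :: "'a::euclidean_space \<Rightarrow> ennreal"
  assumes [measurable]: "f \<in> borel_measurable borel" and c: "c \<noteq> 0"
  shows "(\<integral>\<^sup>+x. f x \<partial>lborel) = ennreal (\<bar>c\<bar> ^ DIM('a)) * (\<integral>\<^sup>+x. f (t + c *\<^sub>R x) \<partial>lborel)"
  by (subst lborel_affine[OF c, of t])
     (simp add: nn_integral_density nn_integral_distr nn_integral_cmult)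

lemma integrable_lborel_affine:
  fixes f :: "'a::euclidean_space \<Rightarrow> 'b::{banach, second_countable_topology}"
  assumes f: "integrable lborel f" and c: "c \<noteq> 0"
  shows "integrable lborel (\<lambda>x. f (t + c *\<^sub>R x))"
  using f f[THEN borel_measurable_integrable] unfolding integrable_iff_bounded
  by (subst (asm) nn_integral_lborel_affine[OF _ c, where t = t])
     (auto simp: ennreal_mult_less_top c)

lemma integrable_lborel_affine_iff:
  fixes f :: "'a::euclidean_space \<Rightarrow> 'b::{banach, second_countable_topology}"
  assumes c: "c \<noteq> 0"
  shows "integrable lborel (\<lambda>x. f (t + c *\<^sub>R x)) \<longleftrightarrow> integrable lborel f"
  using integrable_lborel_affine[OF _ c, of f t]
    integrable_lborel_affine[of "\<lambda>x. f (t + c *\<^sub>R x)" "1/c" "-t /\<^sub>R c"] c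
  by (auto simp add: algebra_simps)

lemma integral_lborel_affine:
  fixes f :: "'a::euclidean_space \<Rightarrow> 'b::{banach, second_countable_topology}"
  assumes c: "c \<noteq> 0"
  shows "(\<integral>x. f x \<partial>lborel) = \<bar>c\<bar> ^ DIM('a) *\<^sub>R (\<integral>x. f (t + c *\<^sub>R x) \<partial>lborel)"
proof cases
  assume f[measurable]: "integrable lborel f"
  then show ?thesis
    using c f[THEN borel_measurable_integrable] integrable_lborel_affine[OF f c, of t]
    by (subst lborel_affine[OF c, of t]) (simp add: integral_density integral_distr)
next
  assume "\<not> integrable lborel f" with c show ?thesis
    by (simp add: integrable_lborel_affine_iff not_integrable_integral_eq)
qed

text \<open>Integrability is transported in both directions, so it can be concluded on either side.
  The equality of integrals then carries no integrability premise: if one side fails to be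
  integrable so does the other, and both integrals take the default value 0.\<close>

lemma set_integrable_substitution_real:
  fixes f g g' :: "real \<Rightarrow> real"
  assumes S: "S \<in> sets borel" and gS: "g ` S \<in> sets borel"
    and der: "\<And>x. x \<in> S \<Longrightarrow> (g has_field_derivative g' x) (at x)"
    and inj: "inj_on g S"
    and f[measurable]: "f \<in> borel_measurable borel" and g[measurable]: "g \<in> borel_measurable borel"
    and g'[measurable]: "g' \<in> borel_measurable borel"
  shows "set_integrable lborel S (\<lambda>x. \<bar>g' x\<bar> * f (g x)) \<longleftrightarrow> set_integrable lborel (g ` S) f"
    and "(LINT x:S|lborel. \<bar>g' x\<bar> * f (g x)) = (LINT x:g ` S|lborel. f x)"
proof -
  have der': "(g has_field_derivative g' x) (at x within S)" if "x \<in> S" for x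
    using der[OF that] by (rule has_field_derivative_at_within)
  have SL: "S \<in> sets lebesgue" using S by simp
  have m1: "(\<lambda>x. indicator S x *\<^sub>R (\<bar>g' x\<bar> * f (g x))) \<in> borel_measurable lborel"
    using S by measurable
  have m2: "(\<lambda>x. indicator (g ` S) x *\<^sub>R f x) \<in> borel_measurable lborel"
    using gS by measurable
  have a1: "(\<lambda>x. \<bar>g' x\<bar> * f (g x)) absolutely_integrable_on S \<longleftrightarrow> set_integrable lborel S (\<lambda>x. \<bar>g' x\<bar> * f (g x))"
    unfolding set_integrable_def using integrable_completion[OF m1] by simp
  have a2: "f absolutely_integrable_on (g ` S) \<longleftrightarrow> set_integrable lborel (g ` S) f"
    unfolding set_integrable_def using integrable_completion[OF m2] by simp
  note cov = has_absolute_integral_change_of_variables_1'[OF SL der' inj, of f]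
  show iff: "set_integrable lborel S (\<lambda>x. \<bar>g' x\<bar> * f (g x)) \<longleftrightarrow> set_integrable lborel (g ` S) f"
    using cov a1 a2 by blast
  show "(LINT x:S|lborel. \<bar>g' x\<bar> * f (g x)) = (LINT x:g ` S|lborel. f x)"
  proof (cases "set_integrable lborel S (\<lambda>x. \<bar>g' x\<bar> * f (g x))")
    case True
    have "integral S (\<lambda>x. \<bar>g' x\<bar> * f (g x)) = integral (g ` S) f"
      using cov a1 True by blast
    then show ?thesis
      using True iff by (simp add: set_borel_integral_eq_integral)
  next
    case False
    then show ?thesis using iff
      unfolding set_lebesgue_integral_def set_integrable_def by (simp add: not_integrable_integral_eq)
  qed
qed

lemma set_nn_integral_substitution_real:
  fixes f g g' :: "real \<Rightarrow> real"
  assumes S[measurable]: "S \<in> sets borel" and gS[measurable]: "g ` S \<in> sets borel"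
    and der: "\<And>x. x \<in> S \<Longrightarrow> (g has_field_derivative g' x) (at x)"
    and inj: "inj_on g S"
    and f[measurable]: "f \<in> borel_measurable borel" and g[measurable]: "g \<in> borel_measurable borel"
    and g'[measurable]: "g' \<in> borel_measurable borel"
    and nonneg: "\<And>x. 0 \<le> f x"
  shows "(\<integral>\<^sup>+x\<in>S. ennreal (\<bar>g' x\<bar> * f (g x)) \<partial>lborel) = (\<integral>\<^sup>+x\<in>g ` S. ennreal (f x) \<partial>lborel)"
proof -
  have e1: "(\<integral>\<^sup>+x\<in>S. ennreal (\<bar>g' x\<bar> * f (g x)) \<partial>lborel) = (\<integral>\<^sup>+x. ennreal (indicator S x *\<^sub>R (\<bar>g' x\<bar> * f (g x))) \<partial>lborel)"
    by (intro nn_integral_cong) (auto split: split_indicator)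
  have e2: "(\<integral>\<^sup>+x\<in>g ` S. ennreal (f x) \<partial>lborel) = (\<integral>\<^sup>+x. ennreal (indicator (g ` S) x *\<^sub>R f x) \<partial>lborel)"
    by (intro nn_integral_cong) (auto split: split_indicator)
  note sub = set_integrable_substitution_real[OF S gS der inj f g g']
  show ?thesis
  proof (cases "set_integrable lborel S (\<lambda>x. \<bar>g' x\<bar> * f (g x))")
    case True
    with sub(1) have T2: "set_integrable lborel (g ` S) f" by blast
    show ?thesis unfolding e1 e2
      using True T2 sub(2) unfolding set_integrable_def set_lebesgue_integral_def
      by (subst (1 2) nn_integral_eq_integral) (auto simp: nonneg intro!: AE_I2 mult_nonneg_nonneg)
  next
    case False
    with sub(1) have F2: "\<not> set_integrable lborel (g ` S) f" by blast
    have "(\<integral>\<^sup>+x. ennreal (indicator S x *\<^sub>R (\<bar>g' x\<bar> * f (g x))) \<partial>lborel) = \<infinity>"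
      using False unfolding set_integrable_def integrable_iff_bounded
      by (auto simp: nonneg abs_mult less_top[symmetric])
    moreover have "(\<integral>\<^sup>+x. ennreal (indicator (g ` S) x *\<^sub>R f x) \<partial>lborel) = \<infinity>"
      using F2 unfolding set_integrable_def integrable_iff_bounded
      by (auto simp: nonneg abs_mult less_top[symmetric])
    ultimately show ?thesis unfolding e1 e2 by simp
  qed
qed

lemma nn_integral_unit_interval_shift:
  assumes c: "(c::real) > 0"
  shows "(\<integral>\<^sup>+\<tau>. indicator {0..<c} (a + \<tau> * c) \<partial>lborel) = (1::ennreal)"
proof -
  have "(\<integral>\<^sup>+\<tau>. indicator {0..<c} (a + \<tau> * c) \<partial>lborel) = (\<integral>\<^sup>+\<tau>. indicator {-a/c..<1-a/c} \<tau> \<partial>lborel)"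
    using c by (intro nn_integral_cong) (auto simp: field_simps split: split_indicator)
  also have "\<dots> = 1" using c by simp
  finally show ?thesis .
qed

text \<open>An averaging device in place of a measure on the hyperplane orthogonal to
  \<open>e\<close>: every line in direction \<open>e\<close> spends parameter time exactly 1 in the
  strip 0 <= y . e < e . e. Inserting this 1, exchanging integrals and translating moves the
  integration onto whole lines based in the strip, with no choice of basis.\<close>

lemma nn_integral_lines:
  fixes f :: "'a::euclidean_space \<Rightarrow> ennreal"
  assumes [measurable]: "f \<in> borel_measurable borel" and e: "e \<noteq> 0"
  shows "(\<integral>\<^sup>+x. f x \<partial>lborel) = (\<integral>\<^sup>+y. indicator {0..<e \<bullet> e} (y \<bullet> e) * (\<integral>\<^sup>+\<tau>. f (y + \<tau> *\<^sub>R e) \<partial>lborel) \<partial>lborel)"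
proof -
  let ?chi = "\<lambda>y. indicator {0..<e \<bullet> e} (y \<bullet> e) :: ennreal"
  have pos: "e \<bullet> e > 0" using e by simp
  have "(\<integral>\<^sup>+x. f x \<partial>lborel) = (\<integral>\<^sup>+x. (\<integral>\<^sup>+\<tau>. f x * ?chi (x + \<tau> *\<^sub>R e) \<partial>lborel) \<partial>lborel)"
  proof (intro nn_integral_cong)
    fix x :: 'a
    have "(\<integral>\<^sup>+\<tau>. ?chi (x + \<tau> *\<^sub>R e) \<partial>lborel) = 1"
      using nn_integral_unit_interval_shift[OF pos, of "x \<bullet> e"] by (simp add: inner_add_left)
    then show "f x = (\<integral>\<^sup>+\<tau>. f x * ?chi (x + \<tau> *\<^sub>R e) \<partial>lborel)"
      by (subst nn_integral_cmult) auto
  qed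
  also have "\<dots> = (\<integral>\<^sup>+\<tau>. (\<integral>\<^sup>+x. f x * ?chi (x + \<tau> *\<^sub>R e) \<partial>lborel) \<partial>lborel)"
    by (rule lborel_pair.Fubini') measurable
  also have "\<dots> = (\<integral>\<^sup>+\<tau>. (\<integral>\<^sup>+y. f (y - \<tau> *\<^sub>R e) * ?chi y \<partial>lborel) \<partial>lborel)"
  proof (rule nn_integral_cong)
    fix \<tau> :: real
    show "(\<integral>\<^sup>+x. f x * ?chi (x + \<tau> *\<^sub>R e) \<partial>lborel) = (\<integral>\<^sup>+y. f (y - \<tau> *\<^sub>R e) * ?chi y \<partial>lborel)"
      by (subst nn_integral_lborel_affine[where c=1 and t="- \<tau> *\<^sub>R e"]) (auto simp: algebra_simps)
  qed
  also have "\<dots> = (\<integral>\<^sup>+y. (\<integral>\<^sup>+\<tau>. f (y - \<tau> *\<^sub>R e) * ?chi y \<partial>lborel) \<partial>lborel)"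
    by (rule lborel_pair.Fubini') measurable
  also have "\<dots> = (\<integral>\<^sup>+y. ?chi y * (\<integral>\<^sup>+\<tau>. f (y - \<tau> *\<^sub>R e) \<partial>lborel) \<partial>lborel)"
    by (intro nn_integral_cong, subst nn_integral_multc) (auto simp: mult.commute)
  also have "\<dots> = (\<integral>\<^sup>+y. ?chi y * (\<integral>\<^sup>+\<tau>. f (y + \<tau> *\<^sub>R e) \<partial>lborel) \<partial>lborel)"
    by (intro nn_integral_cong, subst (2) nn_integral_real_affine[where c="-1" and t=0]) auto
  finally show ?thesis .
qed

text \<open>Each line parallel to \<open>e\<close> has a point orthogonal to \<open>e\<close>, and
  shifting the parameter does not change a line integral. Hence it is enough to compare lines based
  at orthogonal points, where norms split by Pythagoras.\<close>

lemma nn_integral_lines_cong: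
  fixes f g :: "'a::euclidean_space \<Rightarrow> ennreal"
  assumes [measurable]: "f \<in> borel_measurable borel" "g \<in> borel_measurable borel" and e: "e \<noteq> 0"
    and eq: "\<And>y. y \<bullet> e = 0 \<Longrightarrow> (\<integral>\<^sup>+\<tau>. f (y + \<tau> *\<^sub>R e) \<partial>lborel) = C * (\<integral>\<^sup>+\<tau>. g (y + \<tau> *\<^sub>R e) \<partial>lborel)"
  shows "(\<integral>\<^sup>+x. f x \<partial>lborel) = C * (\<integral>\<^sup>+x. g x \<partial>lborel)"
proof -
  have "(\<integral>\<^sup>+\<tau>. f (y + \<tau> *\<^sub>R e) \<partial>lborel) = C * (\<integral>\<^sup>+\<tau>. g (y + \<tau> *\<^sub>R e) \<partial>lborel)" for y
  proof -
    define a where "a = (y \<bullet> e) / (e \<bullet> e)"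
    define y0 where "y0 = y - a *\<^sub>R e"
    have p: "y0 \<bullet> e = 0" using e by (simp add: y0_def a_def inner_diff_left)
    have sh: "(\<integral>\<^sup>+\<tau>. h (y0 + \<tau> *\<^sub>R e) \<partial>lborel) = (\<integral>\<^sup>+\<tau>. h (y + \<tau> *\<^sub>R e) \<partial>lborel)"
      if [measurable]: "h \<in> borel_measurable borel" for h :: "'a \<Rightarrow> ennreal"
      by (subst nn_integral_real_affine[where c=1 and t=a]) (auto simp: y0_def algebra_simps)
    show ?thesis using eq[OF p] by (simp add: sh)
  qed
  then have "(\<integral>\<^sup>+x. f x \<partial>lborel) = (\<integral>\<^sup>+y. C * (indicator {0..<e \<bullet> e} (y \<bullet> e) * (\<integral>\<^sup>+\<tau>. g (y + \<tau> *\<^sub>R e) \<partial>lborel)) \<partial>lborel)"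
    by (subst nn_integral_lines[OF _ e]) (auto intro!: nn_integral_cong simp: mult_ac)
  also have "\<dots> = C * (\<integral>\<^sup>+x. g x \<partial>lborel)"
    by (subst nn_integral_cmult) (auto simp: nn_integral_lines[OF _ e, of g])
  finally show ?thesis .
qed

lemma integral_lines:
  fixes f :: "'a::euclidean_space \<Rightarrow> real"
  assumes f: "integrable lborel f" and e: "e \<noteq> 0"
  shows "(\<integral>x. f x \<partial>lborel) = (\<integral>y. indicator {0..<e \<bullet> e} (y \<bullet> e) * (\<integral>\<tau>. f (y + \<tau> *\<^sub>R e) \<partial>lborel) \<partial>lborel)"
proof -
  let ?chi = "\<lambda>y. indicator {0..<e \<bullet> e} (y \<bullet> e) :: real"
  note [measurable] = f[THEN borel_measurable_integrable]
  have pos: "e \<bullet> e > 0" using e by simp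
  have one: "(\<integral>\<tau>. ?chi (x + \<tau> *\<^sub>R e) \<partial>lborel) = 1" for x
  proof -
    have "(\<integral>\<^sup>+\<tau>. ennreal (?chi (x + \<tau> *\<^sub>R e)) \<partial>lborel) = 1"
      using nn_integral_unit_interval_shift[OF pos, of "x \<bullet> e"]
      by (simp add: inner_add_left ennreal_indicator)
    then show ?thesis by (subst integral_eq_nn_integral) auto
  qed
  have int: "integrable (lborel \<Otimes>\<^sub>M lborel) (\<lambda>(x, \<tau>). f x * ?chi (x + \<tau> *\<^sub>R e))"
  proof (rule integrableI_bounded)
    have "(\<integral>\<^sup>+p. ennreal (norm (case p of (x, \<tau>) \<Rightarrow> f x * ?chi (x + \<tau> *\<^sub>R e))) \<partial>(lborel \<Otimes>\<^sub>M lborel))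
       = (\<integral>\<^sup>+x. (\<integral>\<^sup>+\<tau>. ennreal (norm (f x * ?chi (x + \<tau> *\<^sub>R e))) \<partial>lborel) \<partial>lborel)"
      by (subst lborel.nn_integral_fst[symmetric]) auto
    also have "\<dots> = (\<integral>\<^sup>+x. ennreal (norm (f x)) \<partial>lborel)"
    proof (intro nn_integral_cong)
      fix x :: 'a
      have "(\<integral>\<^sup>+\<tau>. ennreal (norm (f x * ?chi (x + \<tau> *\<^sub>R e))) \<partial>lborel)
        = (\<integral>\<^sup>+\<tau>. ennreal (norm (f x)) * indicator {0..<e \<bullet> e} (x \<bullet> e + \<tau> * (e \<bullet> e)) \<partial>lborel)"
        by (intro nn_integral_cong) (auto simp: inner_add_left split: split_indicator)
      also have "\<dots> = ennreal (norm (f x))"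
        by (subst nn_integral_cmult) (auto simp: nn_integral_unit_interval_shift[OF pos])
      finally show "(\<integral>\<^sup>+\<tau>. ennreal (norm (f x * ?chi (x + \<tau> *\<^sub>R e))) \<partial>lborel) = ennreal (norm (f x))" .
    qed
    also have "\<dots> < \<infinity>" using f by (simp add: integrable_iff_bounded)
    finally show "(\<integral>\<^sup>+p. ennreal (norm (case p of (x, \<tau>) \<Rightarrow> f x * ?chi (x + \<tau> *\<^sub>R e))) \<partial>(lborel \<Otimes>\<^sub>M lborel)) < \<infinity>" .
  qed measurable
  \<comment> \<open>The integrals are exchanged back only after the translation, so the translated
    integrand needs its own integrability; its mass is computed by the nonnegative version.\<close>
  have int2: "integrable (lborel \<Otimes>\<^sub>M lborel) (\<lambda>(y, \<tau>). f (y + \<tau> *\<^sub>R e) * ?chi y)"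
  proof (rule integrableI_bounded)
    have "(\<integral>\<^sup>+p. ennreal (norm (case p of (y, \<tau>) \<Rightarrow> f (y + \<tau> *\<^sub>R e) * ?chi y)) \<partial>(lborel \<Otimes>\<^sub>M lborel))
       = (\<integral>\<^sup>+y. indicator {0..<e \<bullet> e} (y \<bullet> e) * (\<integral>\<^sup>+\<tau>. ennreal (norm (f (y + \<tau> *\<^sub>R e))) \<partial>lborel) \<partial>lborel)"
      by (subst lborel.nn_integral_fst[symmetric])
         (auto intro!: nn_integral_cong split: split_indicator)
    also have "\<dots> = (\<integral>\<^sup>+x. ennreal (norm (f x)) \<partial>lborel)"
      by (rule nn_integral_lines[symmetric]) (auto simp: e)
    also have "\<dots> < \<infinity>" using f by (simp add: integrable_iff_bounded)
    finally show "(\<integral>\<^sup>+p. ennreal (norm (case p of (y, \<tau>) \<Rightarrow> f (y + \<tau> *\<^sub>R e) * ?chi y)) \<partial>(lborel \<Otimes>\<^sub>M lborel)) < \<infinity>" .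
  qed measurable
  have "(\<integral>x. f x \<partial>lborel) = (\<integral>x. (\<integral>\<tau>. f x * ?chi (x + \<tau> *\<^sub>R e) \<partial>lborel) \<partial>lborel)"
    by (simp add: one)
  also have "\<dots> = (\<integral>\<tau>. (\<integral>x. f x * ?chi (x + \<tau> *\<^sub>R e) \<partial>lborel) \<partial>lborel)"
    by (rule lborel_pair.Fubini_integral[symmetric]) (rule int)
  also have "\<dots> = (\<integral>\<tau>. (\<integral>y. f (y - \<tau> *\<^sub>R e) * ?chi y \<partial>lborel) \<partial>lborel)"
  proof (rule Bochner_Integration.integral_cong[OF refl])
    fix \<tau> :: real
    show "(\<integral>x. f x * ?chi (x + \<tau> *\<^sub>R e) \<partial>lborel) = (\<integral>y. f (y - \<tau> *\<^sub>R e) * ?chi y \<partial>lborel)"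
      by (subst integral_lborel_affine[where c=1 and t="- \<tau> *\<^sub>R e"]) (auto simp: algebra_simps)
  qed
  also have "\<dots> = (\<integral>\<tau>. (\<integral>y. f (y + \<tau> *\<^sub>R e) * ?chi y \<partial>lborel) \<partial>lborel)"
    by (subst lborel_integral_real_affine[where c="-1" and t=0]) auto
  also have "\<dots> = (\<integral>y. (\<integral>\<tau>. f (y + \<tau> *\<^sub>R e) * ?chi y \<partial>lborel) \<partial>lborel)"
    by (rule lborel_pair.Fubini_integral) (rule int2)
  finally show ?thesis by (simp add: mult.commute)
qed

lemma integral_lines_cong:
  fixes f g :: "'a::euclidean_space \<Rightarrow> real"
  assumes f: "integrable lborel f" and g: "integrable lborel g" and e: "e \<noteq> 0"
    and eq: "\<And>y. y \<bullet> e = 0 \<Longrightarrow> (\<integral>\<tau>. f (y + \<tau> *\<^sub>R e) \<partial>lborel) = (\<integral>\<tau>. g (y + \<tau> *\<^sub>R e) \<partial>lborel)"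
  shows "(\<integral>x. f x \<partial>lborel) = (\<integral>x. g x \<partial>lborel)"
proof -
  have "(\<integral>\<tau>. f (y + \<tau> *\<^sub>R e) \<partial>lborel) = (\<integral>\<tau>. g (y + \<tau> *\<^sub>R e) \<partial>lborel)" for y
  proof -
    define a where "a = (y \<bullet> e) / (e \<bullet> e)"
    define y0 where "y0 = y - a *\<^sub>R e"
    have p: "y0 \<bullet> e = 0" using e by (simp add: y0_def a_def inner_diff_left)
    have sh: "(\<integral>\<tau>. h (y0 + \<tau> *\<^sub>R e) \<partial>lborel) = (\<integral>\<tau>. h (y + \<tau> *\<^sub>R e) \<partial>lborel)"
      for h :: "'a \<Rightarrow> real"
      by (subst lborel_integral_real_affine[where c=1 and t=a]) (auto simp: y0_def algebra_simps)
    show ?thesis using eq[OF p] by (simp add: sh)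
  qed
  then show ?thesis by (simp add: integral_lines[OF f e] integral_lines[OF g e])
qed

section \<open>Polar coordinates\<close>

lemma set_integrable_powr_0_1:
  fixes a :: real assumes "a > -1"
  shows "set_integrable lborel {0<..1} (\<lambda>x. x powr a)"
proof -
  have "(\<lambda>x. x powr a) absolutely_integrable_on {0..1}"
    using integrable_on_powr_from_0[OF assms, of 1]
    by (intro nonnegative_absolutely_integrable_1) auto
  then have "set_integrable lebesgue {0<..1} (\<lambda>x. x powr a)"
    by (rule set_integrable_subset) auto
  then show ?thesis
    unfolding set_integrable_def by (subst (asm) integrable_completion) auto
qed

lemma set_integrable_powr_ge_1:
  fixes a :: real assumes "a < -1"
  shows "set_integrable lborel {1..} (\<lambda>x. x powr a)"
proof -
  have "(\<lambda>x. x powr a) absolutely_integrable_on {1..}"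
    using has_integral_powr_to_inf[OF assms, of 1]
    by (intro nonnegative_absolutely_integrable_1) (auto simp: integrable_on_def)
  then show ?thesis
    unfolding set_integrable_def by (subst (asm) integrable_completion) auto
qed

definition shell :: "'a::euclidean_space set" where
  "shell = {h. 1 \<le> norm h \<and> norm h < exp 1}"

text \<open>Unnormalised surface measure of the unit sphere, obtained by projecting a solid shell
  radially. The density |h|^(-n) makes the radial factor dr/r, and a shell from 1 to e has
  logarithmic width 1, so polar coordinates come out without a constant.\<close>

definition sphere_measure :: "'a::euclidean_space measure" where
  "sphere_measure = distr (density lborel (\<lambda>h. ennreal (indicator shell h / norm h ^ DIM('a)))) borel sgn"

lemma borel_measurable_sgn_euclidean[measurable]: "(sgn :: 'a::euclidean_space \<Rightarrow> 'a) \<in> borel_measurable borel"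
  unfolding sgn_div_norm[abs_def] by measurable

lemma shell_borel[measurable]: "(shell :: 'a::euclidean_space set) \<in> sets borel"
  unfolding shell_def by measurable

lemma space_sphere_measure[simp]: "space (sphere_measure :: 'a::euclidean_space measure) = UNIV"
  and sets_sphere_measure[simp, measurable_cong]: "sets (sphere_measure :: 'a measure) = sets borel"
  by (auto simp: sphere_measure_def)

lemma nn_integral_sphere_measure:
  fixes f :: "'a::euclidean_space \<Rightarrow> ennreal"
  assumes [measurable]: "f \<in> borel_measurable borel"
  shows "(\<integral>\<^sup>+\<theta>. f \<theta> \<partial>sphere_measure) = (\<integral>\<^sup>+h. ennreal (indicator shell h / norm h ^ DIM('a)) * f (sgn h) \<partial>lborel)"
  unfolding sphere_measure_def by (subst nn_integral_distr) (auto simp: nn_integral_density)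

lemma emeasure_shell_finite: "emeasure lborel (shell :: 'a::euclidean_space set) < \<infinity>"
proof -
  have "shell \<subseteq> cball (0::'a) (exp 1)" by (auto simp: shell_def)
  then have "emeasure lborel (shell :: 'a set) \<le> emeasure lborel (cball (0::'a) (exp 1))"
    by (intro emeasure_mono) auto
  also have "\<dots> < \<infinity>" by (rule emeasure_lborel_cball_finite)
  finally show ?thesis .
qed

lemma finite_sphere_measure: "finite_measure (sphere_measure :: 'a::euclidean_space measure)"
proof
  have "emeasure (sphere_measure :: 'a measure) UNIV = (\<integral>\<^sup>+\<theta>. 1 \<partial>(sphere_measure :: 'a measure))"
    by simp
  also have "\<dots> = (\<integral>\<^sup>+h. ennreal (indicator shell (h::'a) / norm h ^ DIM('a)) \<partial>lborel)"
    by (subst nn_integral_sphere_measure) auto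
  also have "\<dots> \<le> (\<integral>\<^sup>+h. indicator shell (h::'a) \<partial>lborel)"
    by (intro nn_integral_mono) (auto simp: shell_def divide_le_eq_1 split: split_indicator)
  also have "\<dots> < \<infinity>" using emeasure_shell_finite by simp
  finally show "emeasure (sphere_measure :: 'a measure) (space sphere_measure) \<noteq> \<infinity>" by simp
qed

interpretation sphere: finite_measure "sphere_measure :: 'a::euclidean_space measure"
  by (rule finite_sphere_measure)

interpretation sphere_pair: pair_sigma_finite "sphere_measure :: 'a::euclidean_space measure" "lborel :: 'b::euclidean_space measure"
  by unfold_locales

text \<open>The measure lives on the whole space, so unit length of a direction is only an
  almost-everywhere fact and is invoked in this form throughout.\<close>

lemma AE_sphere_measure_norm: "AE \<theta> in (sphere_measure :: 'a::euclidean_space measure). norm \<theta> = 1"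
proof -
  have "AE h in density lborel (\<lambda>h::'a. ennreal (indicator shell h / norm h ^ DIM('a))). norm (sgn h) = 1"
    by (subst AE_density) (auto simp: shell_def norm_sgn split: split_indicator)
  then show ?thesis unfolding sphere_measure_def by (subst AE_distr_iff) auto
qed

text \<open>For x of norm a, the scalings l with x / l in \<open>shell\<close> form this interval;
  its mass under dl/l is the logarithmic width of the shell.\<close>

lemma nn_integral_log_shell:
  assumes a: "(a::real) > 0"
  shows "(\<integral>\<^sup>+l. ennreal (1 / l) * indicator {a / exp 1<..a} l \<partial>lborel) = 1"
proof -
  have "(\<integral>\<^sup>+l. ennreal (1 / l) * indicator {a / exp 1..a} l \<partial>lborel) = ennreal (ln a - ln (a / exp 1))"
  proof (rule nn_integral_FTC_Icc)
    show "a / exp 1 \<le> a" using a by (simp add: divide_le_eq)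
    have pos: "0 < x" if "a / exp 1 \<le> x" for x
      using that a by (meson divide_pos_pos exp_gt_zero less_le_trans)
    show "(ln has_real_derivative 1 / x) (at x)" if "x \<in> {a / exp 1..a}" for x
      using pos[of x] that by (auto intro!: derivative_eq_intros)
    show "0 \<le> 1 / x" if "x \<in> {a / exp 1..a}" for x
      using pos[of x] that by simp
  qed measurable
  also have "\<dots> = 1" using a by (simp add: ln_div)
  finally have "(\<integral>\<^sup>+l. ennreal (1 / l) * indicator {a / exp 1..a} l \<partial>lborel) = 1" .
  moreover have "(\<integral>\<^sup>+l. ennreal (1 / l) * indicator {a / exp 1<..a} l \<partial>lborel) =
     (\<integral>\<^sup>+l. ennreal (1 / l) * indicator {a / exp 1..a} l \<partial>lborel)"
    using AE_lborel_singleton[of "a / exp 1"]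
    by (intro nn_integral_cong_AE) (auto elim!: eventually_mono split: split_indicator)
  ultimately show ?thesis by simp
qed

text \<open>Pull the sphere integral back to the shell, scale the radius by |h|, exchange, and
  substitute x = l h. Each x other than 0 is then counted once for every l with x / l in the shell,
  against dl/l, and \<open>nn_integral_log_shell\<close> says that this total weight is 1.\<close>

lemma nn_integral_polar:
  fixes f :: "'a::euclidean_space \<Rightarrow> ennreal"
  assumes [measurable]: "f \<in> borel_measurable borel"
  shows "(\<integral>\<^sup>+x. f x \<partial>lborel) =
    (\<integral>\<^sup>+\<theta>. (\<integral>\<^sup>+\<tau>. f (\<tau> *\<^sub>R \<theta>) * ennreal (\<tau> ^ (DIM('a) - 1)) * indicator {0<..} \<tau> \<partial>lborel) \<partial>sphere_measure)"
proof -
  let ?n = "DIM('a)"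
  have n: "?n \<ge> 1" using DIM_positive[where 'a='a] by linarith
  have ind: "indicator {norm x / exp 1<..norm x} l = (if norm x / exp 1 < l \<and> l \<le> norm x then 1 else 0 :: ennreal)"
    for x :: 'a and l :: real by (simp add: indicator_def)
  have pw: "x ^ ?n = x * x ^ (?n - 1)" for x :: real using n by (metis power_eq_if DIM_positive not_gr0)
  have "(\<integral>\<^sup>+\<theta>. (\<integral>\<^sup>+\<tau>. f (\<tau> *\<^sub>R \<theta>) * ennreal (\<tau> ^ (?n - 1)) * indicator {0<..} \<tau> \<partial>lborel) \<partial>sphere_measure)
     = (\<integral>\<^sup>+h. ennreal (indicator shell h / norm h ^ ?n) *
          (\<integral>\<^sup>+\<tau>. f (\<tau> *\<^sub>R sgn h) * ennreal (\<tau> ^ (?n - 1)) * indicator {0<..} \<tau> \<partial>lborel) \<partial>lborel)"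
    by (subst nn_integral_sphere_measure) auto
  also have "\<dots> = (\<integral>\<^sup>+h. (\<integral>\<^sup>+l. indicator shell h *
          (f (l *\<^sub>R h) * ennreal (l ^ (?n - 1)) * indicator {0<..} l) \<partial>lborel) \<partial>lborel)"
  proof (rule nn_integral_cong)
    fix h :: 'a
    show "ennreal (indicator shell h / norm h ^ ?n) *
          (\<integral>\<^sup>+\<tau>. f (\<tau> *\<^sub>R sgn h) * ennreal (\<tau> ^ (?n - 1)) * indicator {0<..} \<tau> \<partial>lborel)
        = (\<integral>\<^sup>+l. indicator shell h *
          (f (l *\<^sub>R h) * ennreal (l ^ (?n - 1)) * indicator {0<..} l) \<partial>lborel)"
    proof (cases "h \<in> shell")
      case True
      then have h: "norm h > 0" "h \<noteq> 0" by (auto simp: shell_def)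
      have "(\<integral>\<^sup>+\<tau>. f (\<tau> *\<^sub>R sgn h) * ennreal (\<tau> ^ (?n - 1)) * indicator {0<..} \<tau> \<partial>lborel)
         = ennreal (norm h) * (\<integral>\<^sup>+l. f ((norm h * l) *\<^sub>R sgn h) * ennreal ((norm h * l) ^ (?n - 1)) * indicator {0<..} (norm h * l) \<partial>lborel)"
        using h by (subst nn_integral_real_affine[where c="norm h" and t=0]) auto
      also have "(\<integral>\<^sup>+l. f ((norm h * l) *\<^sub>R sgn h) * ennreal ((norm h * l) ^ (?n - 1)) * indicator {0<..} (norm h * l) \<partial>lborel)
         = (\<integral>\<^sup>+l. ennreal (norm h ^ (?n - 1)) * (f (l *\<^sub>R h) * ennreal (l ^ (?n - 1)) * indicator {0<..} l) \<partial>lborel)"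
        using h by (intro nn_integral_cong)
          (auto simp: sgn_div_norm power_mult_distrib ennreal_mult mult_ac zero_less_mult_iff split: split_indicator)
      also have "\<dots> = ennreal (norm h ^ (?n - 1)) * (\<integral>\<^sup>+l. f (l *\<^sub>R h) * ennreal (l ^ (?n - 1)) * indicator {0<..} l \<partial>lborel)"
        by (subst nn_integral_cmult) auto
      finally have eq: "(\<integral>\<^sup>+\<tau>. f (\<tau> *\<^sub>R sgn h) * ennreal (\<tau> ^ (?n - 1)) * indicator {0<..} \<tau> \<partial>lborel)
         = ennreal (norm h ^ ?n) * (\<integral>\<^sup>+l. f (l *\<^sub>R h) * ennreal (l ^ (?n - 1)) * indicator {0<..} l \<partial>lborel)"
        unfolding pw by (simp add: ennreal_mult mult.assoc)
      have "ennreal (1 / norm h ^ ?n) * (ennreal (norm h ^ ?n) * X) = X" for X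
        using h by (subst mult.assoc[symmetric], subst ennreal_mult[symmetric]) auto
      then show ?thesis unfolding eq using True by (simp add: nn_integral_cmult)
    next
      case False
      then show ?thesis by simp
    qed
  qed
  also have "\<dots> = (\<integral>\<^sup>+l. (\<integral>\<^sup>+h. indicator shell h *
          (f (l *\<^sub>R h) * ennreal (l ^ (?n - 1)) * indicator {0<..} l) \<partial>lborel) \<partial>lborel)"
    by (rule lborel_pair.Fubini') measurable
  also have "\<dots> = (\<integral>\<^sup>+l. (\<integral>\<^sup>+x. f x * (ennreal (1 / l) * indicator {norm x / exp 1<..norm x} l) \<partial>lborel) \<partial>lborel)"
  proof (rule nn_integral_cong)
    fix l :: real
    show "(\<integral>\<^sup>+h. indicator shell h * (f (l *\<^sub>R h) * ennreal (l ^ (?n - 1)) * indicator {0<..} l) \<partial>lborel)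
      = (\<integral>\<^sup>+x. f x * (ennreal (1 / l) * indicator {norm x / exp 1<..norm x} l) \<partial>lborel)"
    proof (cases "l > 0")
      case True
      have "(\<integral>\<^sup>+x. f x * (ennreal (1 / l) * indicator {norm x / exp 1<..norm x} l) \<partial>lborel)
         = ennreal (l ^ ?n) * (\<integral>\<^sup>+h. f (l *\<^sub>R h) * (ennreal (1 / l) * indicator {norm (l *\<^sub>R h) / exp 1<..norm (l *\<^sub>R h)} l) \<partial>lborel)"
        unfolding ind using True by (subst nn_integral_lborel_affine[where c=l and t=0]) auto
      also have "\<dots> = (\<integral>\<^sup>+h. ennreal (l ^ ?n) * (f (l *\<^sub>R h) * (ennreal (1 / l) * indicator {norm (l *\<^sub>R h) / exp 1<..norm (l *\<^sub>R h)} l)) \<partial>lborel)"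
        unfolding ind by (subst nn_integral_cmult) auto
      also have "\<dots> = (\<integral>\<^sup>+h. indicator shell h * (f (l *\<^sub>R h) * ennreal (l ^ (?n - 1)) * indicator {0<..} l) \<partial>lborel)"
      proof (rule nn_integral_cong)
        fix h :: 'a
        have "ennreal (l ^ ?n) * (y * ennreal (1 / l)) = y * ennreal (l ^ (?n - 1))" for y
        proof -
          have "ennreal (l ^ ?n) * (y * ennreal (1 / l)) = y * (ennreal (l ^ ?n) * ennreal (1 / l))"
            by (simp add: mult_ac)
          also have "ennreal (l ^ ?n) * ennreal (1 / l) = ennreal (l ^ (?n - 1))"
            unfolding pw using True by (subst ennreal_mult[symmetric]) auto
          finally show ?thesis .
        qed
        moreover have "l \<in> {norm (l *\<^sub>R h) / exp 1<..norm (l *\<^sub>R h)} \<longleftrightarrow> h \<in> shell"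
          using True by (auto simp: shell_def field_simps)
        ultimately show "ennreal (l ^ ?n) * (f (l *\<^sub>R h) * (ennreal (1 / l) * indicator {norm (l *\<^sub>R h) / exp 1<..norm (l *\<^sub>R h)} l))
          = indicator shell h * (f (l *\<^sub>R h) * ennreal (l ^ (?n - 1)) * indicator {0<..} l)"
          using True by (auto simp: indicator_def)
      qed
      finally show ?thesis by simp
    next
      case False
      then have "ennreal (1 / l) = 0" by (simp add: ennreal_neg)
      with False show ?thesis by simp
    qed
  qed
  also have "\<dots> = (\<integral>\<^sup>+x. (\<integral>\<^sup>+l. f x * (ennreal (1 / l) * indicator {norm x / exp 1<..norm x} l) \<partial>lborel) \<partial>lborel)"
    unfolding ind by (rule lborel_pair.Fubini') measurable
  also have "\<dots> = (\<integral>\<^sup>+x. f x \<partial>lborel)"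
  proof (rule nn_integral_cong_AE, use AE_lborel_singleton[of "0::'a"] in eventually_elim)
    case (elim x)
    then show ?case by (subst nn_integral_cmult) (auto simp: nn_integral_log_shell)
  qed
  finally show ?thesis by simp
qed

definition radial_measure :: "'a::euclidean_space itself \<Rightarrow> real measure" where
  "radial_measure TYPE('a) = density lborel (\<lambda>\<tau>. ennreal (\<tau> ^ (DIM('a) - 1)) * indicator {0<..} \<tau>)"

lemma sgn_flip:
  fixes x v :: "'a::euclidean_space"
  assumes v: "v \<noteq> 0"
  shows "norm (x - (2 * (x \<bullet> v) / (v \<bullet> v)) *\<^sub>R v) = norm x"
    and "sgn (x - (2 * (x \<bullet> v) / (v \<bullet> v)) *\<^sub>R v) = sgn x - (2 * (sgn x \<bullet> v) / (v \<bullet> v)) *\<^sub>R v"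
proof -
  define p q c where "p = x \<bullet> v" and "q = v \<bullet> v" and "c = 2 * p / q"
  have q: "q \<noteq> 0" using v by (simp add: q_def)
  have "(x - c *\<^sub>R v) \<bullet> (x - c *\<^sub>R v) = x \<bullet> x - 2 * c * p + c * c * q"
    by (simp add: inner_diff_left inner_diff_right inner_commute p_def q_def)
  also have "\<dots> = x \<bullet> x" using q by (simp add: c_def)
  finally have n: "norm (x - c *\<^sub>R v) = norm x" by (simp add: norm_eq)
  then show "norm (x - (2 * (x \<bullet> v) / (v \<bullet> v)) *\<^sub>R v) = norm x"
    by (simp add: c_def p_def q_def)
  have "sgn (x - c *\<^sub>R v) = sgn x - (2 * (sgn x \<bullet> v) / (v \<bullet> v)) *\<^sub>R v"
    unfolding sgn_div_norm n by (simp add: scaleR_diff_right c_def p_def q_def)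
  then show "sgn (x - (2 * (x \<bullet> v) / (v \<bullet> v)) *\<^sub>R v) = sgn x - (2 * (sgn x \<bullet> v) / (v \<bullet> v)) *\<^sub>R v"
    by (simp add: c_def p_def q_def)
qed

text \<open>On a line through a point orthogonal to \<open>v\<close> the reflection only reverses
  the parameter, so slicing along \<open>v\<close> reduces the invariance to the real line.\<close>

lemma nn_integral_flip_lborel:
  fixes v :: "'a::euclidean_space" and f :: "'a \<Rightarrow> ennreal"
  assumes [measurable]: "f \<in> borel_measurable borel" and v: "v \<noteq> 0"
  shows "(\<integral>\<^sup>+x. f (x - (2 * (x \<bullet> v) / (v \<bullet> v)) *\<^sub>R v) \<partial>lborel) = (\<integral>\<^sup>+x. f x \<partial>lborel)"
proof -
  have "(\<integral>\<^sup>+x. f (x - (2 * (x \<bullet> v) / (v \<bullet> v)) *\<^sub>R v) \<partial>lborel) = 1 * (\<integral>\<^sup>+x. f x \<partial>lborel)"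
  proof (rule nn_integral_lines_cong[OF _ _ v])
    fix y :: 'a assume y: "y \<bullet> v = 0"
    have "y + \<tau> *\<^sub>R v - (2 * ((y + \<tau> *\<^sub>R v) \<bullet> v) / (v \<bullet> v)) *\<^sub>R v = y + (- \<tau>) *\<^sub>R v" for \<tau>
    proof -
      have c: "2 * ((y + \<tau> *\<^sub>R v) \<bullet> v) / (v \<bullet> v) = 2 * \<tau>"
        using v by (simp add: y inner_add_left)
      have "\<tau> *\<^sub>R v - (2 * \<tau>) *\<^sub>R v = (- \<tau>) *\<^sub>R v"
        by (simp flip: scaleR_left_diff_distrib)
      then show ?thesis unfolding c by (simp only: add_diff_eq[symmetric])
    qed
    then have "(\<integral>\<^sup>+\<tau>. f (y + \<tau> *\<^sub>R v - (2 * ((y + \<tau> *\<^sub>R v) \<bullet> v) / (v \<bullet> v)) *\<^sub>R v) \<partial>lborel)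
       = (\<integral>\<^sup>+\<tau>. f (y + (- \<tau>) *\<^sub>R v) \<partial>lborel)" by (simp only:)
    then show "(\<integral>\<^sup>+\<tau>. f (y + \<tau> *\<^sub>R v - (2 * ((y + \<tau> *\<^sub>R v) \<bullet> v) / (v \<bullet> v)) *\<^sub>R v) \<partial>lborel)
       = 1 * (\<integral>\<^sup>+\<tau>. f (y + \<tau> *\<^sub>R v) \<partial>lborel)"
      by (subst (2) nn_integral_real_affine[where c="-1" and t=0]) auto
  qed auto
  then show ?thesis by simp
qed

text \<open>The angular computations rest on hyperplane reflections as their only rotational
  symmetry: these can exchange two given unit vectors, or reverse a single axis.\<close>

lemma distr_flip_sphere_measure:
  fixes v :: "'a::euclidean_space"
  assumes v: "v \<noteq> 0"
  shows "distr sphere_measure borel (\<lambda>x. x - (2 * (x \<bullet> v) / (v \<bullet> v)) *\<^sub>R v) = sphere_measure"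
proof (rule measure_eqI)
  fix A assume "A \<in> sets (distr sphere_measure borel (\<lambda>x. x - (2 * (x \<bullet> v) / (v \<bullet> v)) *\<^sub>R v))"
  then have A[measurable]: "A \<in> sets borel" by simp
  let ?F = "\<lambda>x. x - (2 * (x \<bullet> v) / (v \<bullet> v)) *\<^sub>R v"
  have "emeasure (distr sphere_measure borel ?F) A = (\<integral>\<^sup>+x. indicator A x \<partial>distr sphere_measure borel ?F)"
    by simp
  also have "\<dots> = (\<integral>\<^sup>+x. indicator A (?F x) \<partial>sphere_measure)"
    by (subst nn_integral_distr) auto
  also have "\<dots> = (\<integral>\<^sup>+h. ennreal (indicator shell (?F h) / norm (?F h) ^ DIM('a)) * indicator A (sgn (?F h)) \<partial>lborel)"
    by (subst nn_integral_sphere_measure) (auto simp: sgn_flip[OF v] shell_def indicator_def intro!: nn_integral_cong)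
  also have "\<dots> = (\<integral>\<^sup>+h. ennreal (indicator shell h / norm h ^ DIM('a)) * indicator A (sgn h) \<partial>lborel)"
    by (rule nn_integral_flip_lborel[OF _ v]) measurable
  also have "\<dots> = emeasure sphere_measure A"
    by (subst nn_integral_sphere_measure[symmetric]) auto
  finally show "emeasure (distr sphere_measure borel ?F) A = emeasure sphere_measure A" .
qed simp

text \<open>Measure-level form of polar coordinates, which gives access to signed integrands through
  the rules for image measures.\<close>

lemma distr_polar:
  "distr (sphere_measure \<Otimes>\<^sub>M radial_measure TYPE('a)) borel (\<lambda>(\<theta>, \<tau>). \<tau> *\<^sub>R \<theta>) = (lborel :: 'a::euclidean_space measure)"
proof (rule measure_eqI)
  fix A :: "'a set"
  interpret R: sigma_finite_measure "radial_measure TYPE('a)"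
    unfolding radial_measure_def
    by (subst sigma_finite_measure.sigma_finite_iff_density_finite[OF sigma_finite_lborel]) (auto simp: ennreal_mult_eq_top_iff indicator_def)
  have sR[measurable_cong]: "sets (radial_measure TYPE('a)) = sets borel" by (simp add: radial_measure_def)
  assume "A \<in> sets (distr (sphere_measure \<Otimes>\<^sub>M radial_measure TYPE('a)) borel (\<lambda>(\<theta>, \<tau>). \<tau> *\<^sub>R \<theta>))"
  then have A[measurable]: "A \<in> sets borel" by simp
  let ?D = "distr (sphere_measure \<Otimes>\<^sub>M radial_measure TYPE('a)) borel (\<lambda>(\<theta>::'a, \<tau>). \<tau> *\<^sub>R \<theta>)"
  have "emeasure ?D A = (\<integral>\<^sup>+x. indicator A x \<partial>?D)" by simp
  also have "\<dots> = (\<integral>\<^sup>+p. indicator A (case p of (\<theta>, \<tau>) \<Rightarrow> \<tau> *\<^sub>R \<theta>) \<partial>(sphere_measure \<Otimes>\<^sub>M radial_measure TYPE('a)))"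
    by (subst nn_integral_distr) auto
  also have "\<dots> = (\<integral>\<^sup>+\<theta>. (\<integral>\<^sup>+\<tau>. indicator A (\<tau> *\<^sub>R \<theta>) \<partial>radial_measure TYPE('a)) \<partial>sphere_measure)"
    by (subst R.nn_integral_fst[symmetric]) auto
  also have "\<dots> = (\<integral>\<^sup>+\<theta>. (\<integral>\<^sup>+\<tau>. indicator A (\<tau> *\<^sub>R \<theta>) * ennreal (\<tau> ^ (DIM('a) - 1)) * indicator {0<..} \<tau> \<partial>lborel) \<partial>sphere_measure)"
    unfolding radial_measure_def by (subst nn_integral_density) (auto simp: mult_ac)
  also have "\<dots> = emeasure lborel A"
    by (subst nn_integral_polar[symmetric]) auto
  finally show "emeasure ?D A = emeasure lborel A" .
qed simp

section \<open>A one-dimensional Riesz-type integral and hyperbolic coordinates\<close>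

lemma set_integrable_Ioi_powr_bound:
  fixes f :: "real \<Rightarrow> real"
  assumes [measurable]: "f \<in> borel_measurable borel" and a: "a > -1" and b: "b < -1"
    and le1: "\<And>t. 0 < t \<Longrightarrow> t \<le> 1 \<Longrightarrow> \<bar>f t\<bar> \<le> B * t powr a"
    and ge1: "\<And>t. 1 \<le> t \<Longrightarrow> \<bar>f t\<bar> \<le> B * t powr b"
  shows "set_integrable lborel {0<..} f"
proof -
  have "set_integrable lborel {0<..1} f"
  proof (rule set_integrable_bound)
    show "set_integrable lborel {0<..1} (\<lambda>t. B * t powr a)"
      using set_integrable_powr_0_1[OF a] by (rule set_integrable_mult_right)
    show "AE x in lborel. x \<in> {0<..1} \<longrightarrow> norm (f x) \<le> norm (B * x powr a)"
      using le1 by (intro AE_I2) (auto, smt (verit))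
  qed (auto simp: set_borel_measurable_def)
  moreover have "set_integrable lborel {1..} f"
  proof (rule set_integrable_bound)
    show "set_integrable lborel {1..} (\<lambda>t. B * t powr b)"
      using set_integrable_powr_ge_1[OF b] by (rule set_integrable_mult_right)
    show "AE x in lborel. x \<in> {1..} \<longrightarrow> norm (f x) \<le> norm (B * x powr b)"
      using ge1 by (intro AE_I2) (auto, smt (verit))
  qed (auto simp: set_borel_measurable_def)
  ultimately have "set_integrable lborel ({0<..1} \<union> {1..}) f"
    by (rule set_integrable_Un) auto
  moreover have "{0<..1} \<union> {1..} = {0::real<..}" by auto
  ultimately show ?thesis by simp
qed

lemma power2_powr: "t > 0 \<Longrightarrow> (t\<^sup>2) powr a = t powr (2 * a)" for t :: real
  by (simp add: powr_powr powr_numeral[symmetric] del: powr_numeral)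

lemma integrable_even_real:
  fixes f :: "real \<Rightarrow> real"
  assumes [measurable]: "f \<in> borel_measurable borel"
    and i: "set_integrable lborel {0<..} f" and even: "\<And>x. f (- x) = f x"
  shows "integrable lborel f"
proof -
  have "set_integrable lborel {..<0} f"
    using i unfolding set_integrable_def
    by (subst lborel_integrable_real_affine_iff[where c="-1" and t=0, symmetric])
       (auto simp: even indicator_def cong: if_cong)
  with i have "set_integrable lborel ({0<..} \<union> {..<0}) f"
    by (rule set_integrable_Un) auto
  then show ?thesis unfolding set_integrable_def
    by (rule integrable_cong_AE[THEN iffD1, rotated 3])
       (use AE_lborel_singleton[of "0::real"] in \<open>auto elim!: eventually_mono split: split_indicator\<close>)
qed

lemma exp_le_sinh:
  fixes x :: real
  assumes x: "x \<ge> 1" shows "exp x \<le> 4 * sinh x"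
proof -
  have a: "exp (- x) \<le> exp (- 1)" using x by simp
  have b: "exp (- 1 :: real) \<le> 1 / 2"
    using exp_ge_add_one_self[of 1] by (simp add: exp_minus field_simps)
  have c: "exp x \<ge> 1" using x by simp
  have "4 * sinh x = 2 * exp x - 2 * exp (- x)" by (simp add: sinh_field_def)
  then show ?thesis using a b c by linarith
qed

lemma set_integrable_exp_minus:
  assumes a: "(a::real) > 0"
  shows "set_integrable lborel {c..} (\<lambda>x. exp (- a * x))"
proof -
  have "(\<lambda>x. exp (- a * x)) absolutely_integrable_on {c..}"
    using has_integral_exp_minus_to_infinity[OF a, of c]
    by (intro nonnegative_absolutely_integrable_1) (auto simp: integrable_on_def)
  then show ?thesis
    unfolding set_integrable_def by (subst (asm) integrable_completion) auto
qed

lemma borel_measurable_hyperbolic[measurable]: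
  "(sinh :: real \<Rightarrow> real) \<in> borel_measurable borel"
  "(cosh :: real \<Rightarrow> real) \<in> borel_measurable borel"
  "(tanh :: real \<Rightarrow> real) \<in> borel_measurable borel"
  by (auto intro!: borel_measurable_continuous_onI continuous_intros)

lemma integrable_cosh_powr:
  assumes a: "(a::real) > 0"
  shows "integrable lborel (\<lambda>x. cosh x powr (- a))"
proof (rule integrable_even_real)
  have "set_integrable lborel {0..} (\<lambda>x. cosh x powr (- a))"
  proof (rule set_integrable_bound)
    show "set_integrable lborel {0..} (\<lambda>x. 2 powr a * exp (- a * x))"
      by (rule set_integrable_mult_right) (rule set_integrable_exp_minus[OF a])
    show "AE x in lborel. x \<in> {0..} \<longrightarrow> norm (cosh x powr - a) \<le> norm (2 powr a * exp (- a * x))"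
    proof (intro AE_I2 impI)
      fix x :: real
      have "exp x / 2 \<le> cosh x" by (simp add: cosh_field_def)
      then have "cosh x powr - a \<le> (exp x / 2) powr - a"
        using a by (intro powr_mono2') auto
      also have "\<dots> = 2 powr a * exp (- a * x)"
        by (simp add: powr_divide powr_minus exp_powr_real field_simps exp_minus)
      finally show "norm (cosh x powr - a) \<le> norm (2 powr a * exp (- a * x))" by simp
    qed
  qed (auto simp: set_borel_measurable_def)
  then show "set_integrable lborel {0<..} (\<lambda>x. cosh x powr (- a))"
    by (rule set_integrable_subset) auto
qed auto

lemma image_tanh_greaterThan: "(\<lambda>x::real. tanh (b + x) - tanh b) ` {d<..} = {tanh (b + d) - tanh b<..<1 - tanh b}"
proof (intro equalityI subsetI)
  fix y assume y: "y \<in> {tanh (b + d) - tanh b<..<1 - tanh b}"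
  define t where "t = y + tanh b"
  have t: "tanh (b + d) < t" "t < 1" using y by (auto simp: t_def)
  have "isCont tanh x" for x :: real by (rule isCont_tanh) simp
  have "\<forall>\<^sub>F x in at_top. t < tanh (x::real)"
    using order_tendstoD(1)[OF tanh_real_at_top t(2)] .
  then obtain N where N: "\<And>x. x \<ge> N \<Longrightarrow> t < tanh x" by (auto simp: eventually_at_top_linorder)
  define u where "u = max N (b + d)"
  have "\<exists>x\<ge>b + d. x \<le> u \<and> tanh x = t"
    using t N[of u] by (intro IVT) (auto simp: u_def intro!: isCont_tanh)
  then obtain x where x: "tanh x = t" by auto
  with t have "b + d < x" by (metis tanh_real_less_iff)
  then have "x - b \<in> {d<..}" "y = tanh (b + (x - b)) - tanh b" using x by (auto simp: t_def)
  then show "y \<in> (\<lambda>x. tanh (b + x) - tanh b) ` {d<..}" by blast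
qed (auto simp: tanh_real_lt_1)

lemma range_tanh: "range (tanh :: real \<Rightarrow> real) = {-1<..<1}"
proof (intro equalityI subsetI)
  fix y :: real assume y: "y \<in> {-1<..<1}"
  have "\<forall>\<^sub>F x in at_bot. tanh (x::real) < y"
    using order_tendstoD(2)[OF tanh_real_at_bot] y by auto
  then obtain N where N: "tanh N < y" by (auto simp: eventually_at_bot_linorder)
  with y have "y \<in> {tanh (N + 0) - tanh N + tanh N<..<1 - tanh N + tanh N}" by simp
  then have "y - tanh N \<in> {tanh (N + 0) - tanh N<..<1 - tanh N}" by simp
  then have "y - tanh N \<in> (\<lambda>x. tanh (N + x) - tanh N) ` {0<..}"
    by (simp only: image_tanh_greaterThan)
  then show "y \<in> range tanh" by auto
qed (use tanh_real_bounds in auto)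

text \<open>The source of the conformal invariance: up to factors depending on one variable each,
  the difference of two points is a function of a - b.\<close>

lemma tanh_diff_eq: "tanh a - tanh b = sinh (a - b) / (cosh a * cosh (b::real))"
proof -
  have "cosh a \<noteq> 0" "cosh b \<noteq> 0" by (auto simp: cosh_real_nonzero)
  then show ?thesis by (simp add: tanh_def sinh_diff field_simps)
qed

lemma one_minus_tanh_sq: "1 - (tanh x)\<^sup>2 = 1 / (cosh (x::real))\<^sup>2"
proof -
  have "cosh x \<noteq> 0" by (rule cosh_real_nonzero)
  then have "1 - (tanh x)\<^sup>2 = ((cosh x)\<^sup>2 - (sinh x)\<^sup>2) / (cosh x)\<^sup>2"
    by (simp add: tanh_def power_divide diff_divide_distrib)
  then show ?thesis by (simp only: hyperbolic_pythagoras)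
qed

text \<open>The model is the derivative of a weight along a line. The Lipschitz bound makes
  \<phi>(y+t) - \<phi>(y-t) of order t, which beats t^(-2s) at 0 because s < 1; decay of order 1/|x|
  gives t^(-1-2s) at infinity, integrable because s > 0.\<close>

locale lipschitz_decay =
  fixes \<phi> :: "real \<Rightarrow> real" and M s :: real
  assumes lip: "\<And>x y. \<bar>\<phi> x - \<phi> y\<bar> \<le> M * \<bar>x - y\<bar>"
    and dec: "\<And>x. \<bar>\<phi> x\<bar> * (1 + \<bar>x\<bar>) \<le> M"
    and s: "0 < s" "s < 1"
begin

lemma continuous_phi: "continuous_on A \<phi>"
proof -
  have "M-lipschitz_on A \<phi>" using lip dec[of 0]
    by (intro lipschitz_onI) (auto simp: dist_real_def)
  then show ?thesis by (rule lipschitz_on_continuous_on)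
qed

lemma phi_borel[measurable]: "\<phi> \<in> borel_measurable borel"
  by (rule borel_measurable_continuous_onI) (rule continuous_phi)

lemma M_nonneg: "M \<ge> 0" using dec[of 0] by simp

lemma phi_le_M: "\<bar>\<phi> x\<bar> \<le> M"
proof -
  have "\<bar>\<phi> x\<bar> * 1 \<le> \<bar>\<phi> x\<bar> * (1 + \<bar>x\<bar>)" by (intro mult_left_mono) auto
  with dec[of x] show ?thesis by simp
qed

lemma phi_shift_bound:
  assumes "t > 0" "\<bar>x\<bar> = t"
  shows "\<bar>\<phi> (y + x)\<bar> \<le> M * (1 + \<bar>y\<bar>) / t"
proof -
  have "1 + \<bar>x\<bar> \<le> (1 + \<bar>y + x\<bar>) * (1 + \<bar>y\<bar>)"
    by (simp add: algebra_simps) (smt (verit) mult_nonneg_nonneg)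
  then have "\<bar>\<phi> (y + x)\<bar> * (1 + \<bar>x\<bar>) \<le> \<bar>\<phi> (y + x)\<bar> * ((1 + \<bar>y + x\<bar>) * (1 + \<bar>y\<bar>))"
    by (intro mult_left_mono) auto
  also have "\<dots> \<le> M * (1 + \<bar>y\<bar>)"
    using mult_right_mono[OF dec[of "y + x"], of "1 + \<bar>y\<bar>"] by (simp add: mult_ac)
  finally have "\<bar>\<phi> (y + x)\<bar> * (1 + t) \<le> M * (1 + \<bar>y\<bar>)" using assms by simp
  moreover have "\<bar>\<phi> (y + x)\<bar> * t \<le> \<bar>\<phi> (y + x)\<bar> * (1 + t)" by (intro mult_left_mono) auto
  ultimately show ?thesis using assms by (simp add: field_simps)
qed

text \<open>Up to the factor -2s this is the one-dimensional second-difference form of the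
  fractional Laplacian of a primitive of \<phi>, written through the first derivative only. The
  symmetric difference takes the place of a principal value: for s >= 1/2 neither summand need be
  integrable at 0.\<close>

definition riesz_diff :: "real \<Rightarrow> real" where
  "riesz_diff y = (LINT t:{0<..}|lborel. (\<phi> (y + t) - \<phi> (y - t)) * t powr (- 2 * s))"

lemma riesz_diff_integrand_bound1:
  assumes "0 < t" shows "\<bar>(\<phi> (y + t) - \<phi> (y - t)) * t powr (- 2 * s)\<bar> \<le> 2 * M * (1 + \<bar>y\<bar>) * t powr (1 - 2 * s)"
proof -
  have "\<bar>\<phi> (y + t) - \<phi> (y - t)\<bar> \<le> M * (2 * t)" using lip[of "y + t" "y - t"] assms by simp
  also have "\<dots> \<le> 2 * M * (1 + \<bar>y\<bar>) * t" using assms M_nonneg by (simp add: algebra_simps)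
  finally have "\<bar>\<phi> (y + t) - \<phi> (y - t)\<bar> * t powr (- 2 * s) \<le> 2 * M * (1 + \<bar>y\<bar>) * t * t powr (- 2 * s)"
    by (rule mult_right_mono) simp
  also have "\<dots> = 2 * M * (1 + \<bar>y\<bar>) * t powr (1 - 2 * s)"
    using assms by (simp add: powr_diff powr_minus field_simps)
  finally show ?thesis by (simp add: abs_mult)
qed

lemma riesz_diff_integrand_bound2:
  assumes "0 < t" shows "\<bar>(\<phi> (y + t) - \<phi> (y - t)) * t powr (- 2 * s)\<bar> \<le> 2 * M * (1 + \<bar>y\<bar>) * t powr (- 1 - 2 * s)"
proof -
  have "\<bar>\<phi> (y + t) - \<phi> (y - t)\<bar> \<le> M * (1 + \<bar>y\<bar>) / t + M * (1 + \<bar>y\<bar>) / t"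
    using phi_shift_bound[of t t y] phi_shift_bound[of t "-t" y] assms by simp
  also have "\<dots> = 2 * M * (1 + \<bar>y\<bar>) / t" by (simp add: field_simps)
  finally have "\<bar>\<phi> (y + t) - \<phi> (y - t)\<bar> * t powr (- 2 * s) \<le> 2 * M * (1 + \<bar>y\<bar>) / t * t powr (- 2 * s)"
    by (rule mult_right_mono) simp
  also have "\<dots> = 2 * M * (1 + \<bar>y\<bar>) * t powr (- 1 - 2 * s)"
    using assms by (simp add: powr_diff powr_minus field_simps)
  finally show ?thesis by (simp add: abs_mult)
qed

lemma riesz_diff_integrable: "set_integrable lborel {0<..} (\<lambda>t. (\<phi> (y + t) - \<phi> (y - t)) * t powr (- 2 * s))"
  by (rule set_integrable_Ioi_powr_bound[where a="1 - 2 * s" and b="- 1 - 2 * s" and B="2 * M * (1 + \<bar>y\<bar>)"])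
     (use s riesz_diff_integrand_bound1 riesz_diff_integrand_bound2 in auto)

text \<open>What remains of \<phi>(z) dz / |z - y|^(2s) at z = tanh a, y = tanh b once cosh(b)^(2s)
  and |sinh(a-b)|^(-2s) are split off. The exponent 2s - 2 combines cosh(a)^(2s) from the kernel
  with the Jacobian cosh(a)^(-2).\<close>

definition Psi :: "real \<Rightarrow> real" where "Psi a = cosh a powr (2 * s - 2) * \<phi> (tanh a)"

lemma Psi_borel[measurable]: "Psi \<in> borel_measurable borel"
  unfolding Psi_def[abs_def] by measurable

lemma one_sided_integrable:
  assumes "e > 0" shows "set_integrable lborel {e<..} (\<lambda>t. \<phi> (y + t) * t powr (- 2 * s))"
    and "set_integrable lborel {e<..} (\<lambda>t. \<phi> (y - t) * t powr (- 2 * s))"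
proof -
  have *: "set_integrable lborel {e<..} (\<lambda>t. \<phi> (y + \<sigma> * t) * t powr (- 2 * s))" if "\<sigma> = 1 \<or> \<sigma> = -1" for \<sigma> :: real
  proof -
    let ?B = "M * (1 + \<bar>y\<bar>) + M * e powr (-2 * s)"
    have "set_integrable lborel {0<..} (\<lambda>t. indicator {e<..} t * (\<phi> (y + \<sigma> * t) * t powr (- 2 * s)))"
    proof (rule set_integrable_Ioi_powr_bound[where a=0 and b="- 1 - 2 * s" and B="?B"])
      fix t :: real assume t: "0 < t" "t \<le> 1"
      have nn: "0 \<le> M * (1 + \<bar>y\<bar>)" "0 \<le> M * e powr (- 2 * s)" using M_nonneg by simp_all
      have "\<bar>\<phi> (y + \<sigma> * t) * t powr (- 2 * s)\<bar> \<le> M * e powr (- 2 * s)" if "e < t"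
        unfolding abs_mult using that assms s phi_le_M M_nonneg by (intro mult_mono) (auto intro!: powr_mono2')
      then have "\<bar>indicator {e<..} t * (\<phi> (y + \<sigma> * t) * t powr (- 2 * s))\<bar> \<le> M * e powr (- 2 * s)"
        using nn(2) by (auto split: split_indicator)
      also have "\<dots> \<le> ?B" using nn(1) by linarith
      finally show "\<bar>indicator {e<..} t * (\<phi> (y + \<sigma> * t) * t powr (- 2 * s))\<bar> \<le> ?B * t powr 0"
        using t by simp
    next
      fix t :: real assume t: "1 \<le> t"
      have "\<bar>\<phi> (y + \<sigma> * t)\<bar> \<le> M * (1 + \<bar>y\<bar>) / t"
        using t that by (intro phi_shift_bound) auto
      then have "\<bar>\<phi> (y + \<sigma> * t)\<bar> * t powr (- 2 * s) \<le> M * (1 + \<bar>y\<bar>) / t * t powr (- 2 * s)"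
        by (rule mult_right_mono) simp
      also have "\<dots> = M * (1 + \<bar>y\<bar>) * t powr (- 1 - 2 * s)"
        using t by (simp add: powr_diff powr_minus field_simps)
      also have "\<dots> \<le> ?B * t powr (- 1 - 2 * s)" using M_nonneg by (intro mult_right_mono) auto
      finally show "\<bar>indicator {e<..} t * (\<phi> (y + \<sigma> * t) * t powr (- 2 * s))\<bar> \<le> ?B * t powr (- 1 - 2 * s)"
        using M_nonneg by (auto simp: abs_mult split: split_indicator)
    qed (use s in auto)
    then have "set_integrable lborel {e<..} (\<lambda>t. indicator {e<..} t * (\<phi> (y + \<sigma> * t) * t powr (- 2 * s)))"
      by (rule set_integrable_subset) (use assms in auto)
    then show ?thesis by (rule set_integrable_cong[THEN iffD1, rotated 3]) auto
  qed
  show "set_integrable lborel {e<..} (\<lambda>t. \<phi> (y + t) * t powr (- 2 * s))" using *[of 1] by simp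
  show "set_integrable lborel {e<..} (\<lambda>t. \<phi> (y - t) * t powr (- 2 * s))" using *[of "-1"] by simp
qed

lemma tanh_substitution_integrand:
  assumes "x > 0"
  shows "\<bar>1 - (tanh (b + x))\<^sup>2\<bar> * (\<phi> (tanh b + (tanh (b + x) - tanh b)) * (tanh (b + x) - tanh b) powr (- 2 * s))
     = cosh b powr (2 * s) * (Psi (b + x) * sinh x powr (- 2 * s))"
proof -
  have c: "cosh b > 0" "cosh (b + x) > 0" "sinh x > 0" using assms by (auto simp: cosh_real_pos)
  have "1 / (cosh (b + x))\<^sup>2 = cosh (b + x) powr (- 2)"
    using c by (simp add: powr_minus powr_numeral field_simps)
  moreover have "(tanh (b + x) - tanh b) powr (- 2 * s) = sinh x powr (- 2 * s) * cosh (b + x) powr (2 * s) * cosh b powr (2 * s)"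
    using c by (simp add: tanh_diff_eq powr_divide powr_mult powr_minus field_simps)
  moreover have "cosh (b + x) powr (- 2) * cosh (b + x) powr (2 * s) = cosh (b + x) powr (2 * s - 2)"
    by (simp add: powr_add[symmetric])
  ultimately show ?thesis
    by (simp add: one_minus_tanh_sq Psi_def mult_ac)
qed

text \<open>Since tanh only reaches points below 1, the ray is split at the end of the interval: the
  inner piece becomes an integral over the hyperbolic distance x, the piece beyond 1 is left as it
  stands. The lower limit is the image of x = d, which keeps everything away from the
  singularity.\<close>

lemma one_sided:
  assumes d: "d > 0"
  shows "set_integrable lborel {d<..} (\<lambda>x. Psi (b + x) * sinh x powr (- 2 * s))"
    and "(LINT t:{tanh (b + d) - tanh b<..}|lborel. \<phi> (tanh b + t) * t powr (- 2 * s))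
      = (LINT t:{1 - tanh b..}|lborel. \<phi> (tanh b + t) * t powr (- 2 * s))
        + cosh b powr (2 * s) * (LINT x:{d<..}|lborel. Psi (b + x) * sinh x powr (- 2 * s))"
proof -
  let ?f = "\<lambda>t. \<phi> (tanh b + t) * t powr (- 2 * s)"
  let ?g = "\<lambda>x. tanh (b + x) - tanh b"
  have e: "tanh (b + d) - tanh b > 0" using d by simp
  have lt: "tanh (b + d) - tanh b < 1 - tanh b" using tanh_real_lt_1[of "b + d"] by simp
  have U: "{tanh (b + d) - tanh b<..} = {tanh (b + d) - tanh b<..<1 - tanh b} \<union> {1 - tanh b..}"
    using lt by auto
  have i1: "set_integrable lborel {tanh (b + d) - tanh b<..<1 - tanh b} ?f"
    by (rule set_integrable_subset[OF one_sided_integrable(1)[OF e]]) auto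
  have i2: "set_integrable lborel {1 - tanh b..} ?f"
    by (rule set_integrable_subset[OF one_sided_integrable(1)[OF e]]) (use lt in auto)
  have split: "(LINT t:{tanh (b + d) - tanh b<..}|lborel. ?f t) =
     (LINT t:{tanh (b + d) - tanh b<..<1 - tanh b}|lborel. ?f t) + (LINT t:{1 - tanh b..}|lborel. ?f t)"
    unfolding U by (rule set_integral_Un) (use i1 i2 in auto)
  have sub: "set_integrable lborel {d<..} (\<lambda>x. \<bar>1 - (tanh (b + x))\<^sup>2\<bar> * ?f (?g x)) \<longleftrightarrow> set_integrable lborel (?g ` {d<..}) ?f"
    "(LINT x:{d<..}|lborel. \<bar>1 - (tanh (b + x))\<^sup>2\<bar> * ?f (?g x)) = (LINT t:?g ` {d<..}|lborel. ?f t)"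
    by (rule set_integrable_substitution_real;
        auto simp: image_tanh_greaterThan inj_on_def cosh_real_nonzero intro!: derivative_eq_intros)+
  have c: "set_integrable lborel {d<..} (\<lambda>x. \<bar>1 - (tanh (b + x))\<^sup>2\<bar> * ?f (?g x)) \<longleftrightarrow>
     set_integrable lborel {d<..} (\<lambda>x. cosh b powr (2 * s) * (Psi (b + x) * sinh x powr (- 2 * s)))"
    by (intro set_integrable_cong refl tanh_substitution_integrand) (use d in auto)
  have c2: "(LINT x:{d<..}|lborel. \<bar>1 - (tanh (b + x))\<^sup>2\<bar> * ?f (?g x)) =
     (LINT x:{d<..}|lborel. cosh b powr (2 * s) * (Psi (b + x) * sinh x powr (- 2 * s)))"
    by (intro set_lebesgue_integral_cong allI impI tanh_substitution_integrand) (use d in auto)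
  show i3: "set_integrable lborel {d<..} (\<lambda>x. Psi (b + x) * sinh x powr (- 2 * s))"
    using sub(1) i1 c cosh_real_pos[of b] by (simp add: image_tanh_greaterThan)
  show "(LINT t:{tanh (b + d) - tanh b<..}|lborel. ?f t)
      = (LINT t:{1 - tanh b..}|lborel. ?f t)
        + cosh b powr (2 * s) * (LINT x:{d<..}|lborel. Psi (b + x) * sinh x powr (- 2 * s))"
    unfolding split using sub(2) c2 by (simp add: image_tanh_greaterThan)
qed

end

lemma tendsto_set_integral_Ioi:
  fixes f :: "real \<Rightarrow> real"
  assumes f: "set_integrable lborel {0<..} f" and e: "\<And>n. e n > 0" "e \<longlonglongrightarrow> 0"
  shows "(\<lambda>n. LINT t:{e n<..}|lborel. f t) \<longlonglongrightarrow> (LINT t:{0<..}|lborel. f t)"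
  unfolding set_lebesgue_integral_def
proof (rule integral_dominated_convergence)
  show "integrable lborel (\<lambda>t. norm (indicator {0<..} t *\<^sub>R f t))"
    using f unfolding set_integrable_def by (rule integrable_norm)
  show m: "(\<lambda>t. indicator {0<..} t *\<^sub>R f t) \<in> borel_measurable lborel"
    using f unfolding set_integrable_def by measurable
  show "(\<lambda>t. indicator {e n<..} t *\<^sub>R f t) \<in> borel_measurable lborel" for n
  proof -
    have "(\<lambda>t. indicator {e n<..} t *\<^sub>R (indicator {0<..} t *\<^sub>R f t)) \<in> borel_measurable lborel"
      using m by measurable
    then show ?thesis
      by (rule measurable_cong[THEN iffD1, rotated]) (use e(1)[of n] in \<open>auto split: split_indicator\<close>)
  qed
  show "AE t in lborel. (\<lambda>n. indicator {e n<..} t *\<^sub>R f t) \<longlonglongrightarrow> indicator {0<..} t *\<^sub>R f t"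
  proof (intro AE_I2)
    fix t :: real
    show "(\<lambda>n. indicator {e n<..} t *\<^sub>R f t) \<longlonglongrightarrow> indicator {0<..} t *\<^sub>R f t"
    proof (cases "t > 0")
      case True
      have "\<forall>\<^sub>F n in sequentially. e n < t" using order_tendstoD(2)[OF e(2) True] .
      then have "\<forall>\<^sub>F n in sequentially. indicator {e n<..} t *\<^sub>R f t = indicator {0<..} t *\<^sub>R f t"
        by eventually_elim (use True in auto)
      then show ?thesis by (rule tendsto_eventually)
    next
      case False
      then have "indicator {e n<..} t *\<^sub>R f t = indicator {0<..} t *\<^sub>R f t" for n
        using less_trans[OF e(1)[of n], of t] by (auto split: split_indicator)
      then show ?thesis by (simp only: tendsto_const)
    qed
  qed
  show "AE t in lborel. norm (indicator {e n<..} t *\<^sub>R f t) \<le> norm (indicator {0<..} t *\<^sub>R f t)" for n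
    using e(1)[of n] by (intro AE_I2) (auto split: split_indicator)
qed

lemma set_integral_Ioi_diff_le:
  fixes f :: "real \<Rightarrow> real"
  assumes i: "set_integrable lborel {a<..} f" and ab: "a \<le> b"
    and B: "\<And>t. a < t \<Longrightarrow> t \<le> b \<Longrightarrow> \<bar>f t\<bar> \<le> B"
  shows "\<bar>(LINT t:{a<..}|lborel. f t) - (LINT t:{b<..}|lborel. f t)\<bar> \<le> B * (b - a)"
proof (cases "a = b")
  case False
  have U: "{a<..} = {a<..b} \<union> {b<..}" using ab by auto
  have i1: "set_integrable lborel {a<..b} f" and i2: "set_integrable lborel {b<..} f"
    by (rule set_integrable_subset[OF i]; use ab in auto)+
  have "(LINT t:{a<..}|lborel. f t) - (LINT t:{b<..}|lborel. f t) = (LINT t:{a<..b}|lborel. f t)"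
    unfolding U by (subst set_integral_Un) (use i1 i2 in auto)
  also have "\<bar>\<dots>\<bar> \<le> (\<integral>t. \<bar>indicator {a<..b} t *\<^sub>R f t\<bar> \<partial>lborel)"
    unfolding set_lebesgue_integral_def by (rule integral_abs_bound)
  also have "\<dots> \<le> (\<integral>t. indicator {a<..b} t *\<^sub>R B \<partial>lborel)"
  proof (intro integral_mono integrable_abs)
    show "integrable lborel (\<lambda>t. indicator {a<..b} t *\<^sub>R f t)"
      using i1 unfolding set_integrable_def .
    show "integrable lborel (\<lambda>t. indicator {a<..b} t *\<^sub>R B)"
      using ab by (intro integrable_scaleR_left) simp
  qed (use B in \<open>auto split: split_indicator\<close>)
  also have "\<dots> = B * (b - a)" using ab by simp
  finally show ?thesis .
qed simp

text \<open>Points at bounded hyperbolic distance have comparable weights, with a constant that does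
  not depend on where they lie.\<close>

lemma cosh_le_exp_cosh: "cosh b \<le> exp \<bar>b - x\<bar> * cosh (x::real)"
proof -
  have "cosh b = cosh x * cosh (b - x) + sinh x * sinh (b - x)"
    using cosh_add[of x "b - x"] by simp
  also have "sinh x * sinh (b - x) \<le> cosh x * \<bar>sinh (b - x)\<bar>"
  proof -
    have "\<bar>sinh x\<bar> \<le> cosh x" using sinh_le_cosh_real[of "\<bar>x\<bar>"] by simp
    then have "\<bar>sinh x\<bar> * \<bar>sinh (b - x)\<bar> \<le> cosh x * \<bar>sinh (b - x)\<bar>" by (rule mult_right_mono) simp
    then show ?thesis by (metis abs_ge_self abs_mult order_trans)
  qed
  also have "cosh x * cosh (b - x) + cosh x * \<bar>sinh (b - x)\<bar> = exp \<bar>b - x\<bar> * cosh x"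
    using cosh_plus_sinh[of "\<bar>b - x\<bar>"] by (simp add: algebra_simps flip: distrib_left)
  finally show ?thesis by simp
qed

lemma tanh_lipschitz: "\<bar>tanh x - tanh y\<bar> \<le> \<bar>x - (y::real)\<bar>"
proof -
  have "norm (tanh x - tanh y) \<le> 1 * norm (x - y)"
  proof (rule field_differentiable_bound[where S=UNIV and f'="\<lambda>x. 1 - (tanh x)\<^sup>2" and B=1])
    show "norm (1 - (tanh z)\<^sup>2) \<le> 1" for z :: real
      by (simp add: one_minus_tanh_sq) (simp add: cosh_real_ge_1 divide_le_eq_1 power2_eq_square mult_ge1_I)
  qed (auto intro!: derivative_eq_intros simp: cosh_real_nonzero)
  then show ?thesis by simp
qed

lemma sinh_le_twice: assumes "0 \<le> x" "x \<le> 1" shows "sinh x \<le> 2 * (x::real)"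
proof -
  have "norm (sinh x - sinh 0) \<le> 2 * norm (x - 0)"
  proof (rule field_differentiable_bound[where S="{0..1}" and f'=cosh and B=2])
    fix z :: real assume z: "z \<in> {0..1}"
    have "cosh z = (exp z + exp (- z)) / 2" by (simp add: cosh_field_def)
    also have "\<dots> \<le> (exp 1 + 1) / 2" using z by (intro divide_right_mono add_mono) auto
    also have "\<dots> \<le> 2" using exp_le by simp
    finally show "norm (cosh z) \<le> 2" by simp
  qed (use assms in \<open>auto intro!: derivative_eq_intros\<close>)
  then show ?thesis using assms by simp
qed

lemma set_integrable_sinh_weight:
  assumes s: "0 < s" "s < (1::real)"
  shows "set_integrable lborel {0<..} (\<lambda>x. min 1 x * sinh x powr (- 2 * s))"
proof -
  have "set_integrable lborel {0<..1} (\<lambda>x. min 1 x * sinh x powr (- 2 * s))"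
  proof (rule set_integrable_bound)
    show "set_integrable lborel {0<..1} (\<lambda>x. x powr (1 - 2 * s))"
      by (rule set_integrable_powr_0_1) (use s in auto)
    show "AE x in lborel. x \<in> {0<..1} \<longrightarrow> norm (min 1 x * sinh x powr (- 2 * s)) \<le> norm (x powr (1 - 2 * s))"
    proof (intro AE_I2 impI)
      fix x :: real assume x: "x \<in> {0<..1}"
      then have "x \<le> sinh x" using real_le_x_sinh[of x] by (simp add: sinh_field_def exp_minus)
      then have "sinh x powr (- 2 * s) \<le> x powr (- 2 * s)" using x s by (intro powr_mono2') auto
      then have "x * sinh x powr (- 2 * s) \<le> x * x powr (- 2 * s)" using x by (intro mult_left_mono) auto
      also have "\<dots> = x powr (1 - 2 * s)" using x by (simp add: powr_diff powr_minus field_simps)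
      finally show "norm (min 1 x * sinh x powr (- 2 * s)) \<le> norm (x powr (1 - 2 * s))" using x by simp
    qed
  qed (auto simp: set_borel_measurable_def)
  moreover have "set_integrable lborel {1..} (\<lambda>x. min 1 x * sinh x powr (- 2 * s))"
  proof (rule set_integrable_bound)
    show "set_integrable lborel {1..} (\<lambda>x. 4 powr (2 * s) * exp (- (2 * s) * x))"
      by (rule set_integrable_mult_right, rule set_integrable_exp_minus) (use s in auto)
    show "AE x in lborel. x \<in> {1..} \<longrightarrow> norm (min 1 x * sinh x powr (- 2 * s)) \<le> norm (4 powr (2 * s) * exp (- (2 * s) * x))"
    proof (intro AE_I2 impI)
      fix x :: real assume x: "x \<in> {1..}"
      have "exp x / 4 \<le> sinh x" using exp_le_sinh[of x] x by simp
      then have "sinh x powr (- 2 * s) \<le> (exp x / 4) powr (- 2 * s)" using x s by (intro powr_mono2') auto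
      also have "\<dots> = 4 powr (2 * s) * exp (- (2 * s) * x)"
        by (simp add: powr_divide powr_minus exp_powr_real field_simps exp_minus)
      finally show "norm (min 1 x * sinh x powr (- 2 * s)) \<le> norm (4 powr (2 * s) * exp (- (2 * s) * x))" using x by simp
    qed
  qed (auto simp: set_borel_measurable_def)
  ultimately have "set_integrable lborel ({0<..1} \<union> {1..}) (\<lambda>x. min 1 x * sinh x powr (- 2 * s))"
    by (rule set_integrable_Un) auto
  moreover have "{0<..1} \<union> {1..} = {0::real<..}" by auto
  ultimately show ?thesis by simp
qed

section \<open>Principal values in the hyperbolic coordinate\<close>

context lipschitz_decay
begin

lemma reflected: "lipschitz_decay (\<lambda>z. \<phi> (- z)) M s"
proof
  show "\<bar>\<phi> (- x) - \<phi> (- y)\<bar> \<le> M * \<bar>x - y\<bar>" for x y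
    using lip[of "-x" "-y"] by (simp add: abs_minus_commute)
  show "\<bar>\<phi> (- x)\<bar> * (1 + \<bar>x\<bar>) \<le> M" for x using dec[of "-x"] by simp
qed (use s in auto)

definition dPsi :: "real \<Rightarrow> real \<Rightarrow> real" where "dPsi b x = Psi (b + x) - Psi (b - x)"

lemma Psi_bound: "\<bar>Psi a\<bar> \<le> M * cosh a powr (2 * s - 2)"
  unfolding Psi_def abs_mult using phi_le_M[of "tanh a"] by (simp add: mult.commute mult_right_mono)

lemma cosh_powr_near:
  assumes "\<bar>b - x\<bar> \<le> 1" shows "cosh x powr (2 * s - 2) \<le> exp 2 * cosh b powr (2 * s - 2)"
proof -
  have "cosh b \<le> exp \<bar>b - x\<bar> * cosh x" by (rule cosh_le_exp_cosh)
  also have "\<dots> \<le> exp 1 * cosh x" using assms cosh_real_pos[of x] by (intro mult_right_mono) auto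
  finally have "exp (-1) * cosh b \<le> cosh x" by (simp add: exp_minus field_simps)
  then have "cosh x powr (2 * s - 2) \<le> (exp (-1) * cosh b) powr (2 * s - 2)"
    using s cosh_real_pos[of b] by (intro powr_mono2') auto
  also have "\<dots> = exp (2 - 2 * s) * cosh b powr (2 * s - 2)"
    by (simp add: powr_mult exp_powr_real algebra_simps)
  also have "\<dots> \<le> exp 2 * cosh b powr (2 * s - 2)" using s by (intro mult_right_mono) auto
  finally show ?thesis .
qed

text \<open>The factor x tames the singularity x^(-2s) of the hyperbolic kernel; the power of cosh b
  is kept because the same bound is later integrated over all b. Of the 6, 4 comes from the mean
  value theorem for the power of cosh over length 2x and 2 from the Lipschitz bound for \<phi>
  composed with tanh, while exp 2 compares powers of cosh at distance at most 1.\<close>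

lemma dPsi_bound_near:
  assumes x: "0 < x" "x \<le> 1" shows "\<bar>dPsi b x\<bar> \<le> 6 * exp 2 * M * x * cosh b powr (2 * s - 2)"
proof -
  let ?p = "\<lambda>a. cosh a powr (2 * s - 2)"
  have "norm (?p (b + x) - ?p (b - x)) \<le> (2 * (exp 2 * ?p b)) * norm ((b + x) - (b - x))"
  proof (rule field_differentiable_bound[where S="{b - 1..b + 1}" and f'="\<lambda>a. (2 * s - 2) * cosh a powr (2 * s - 3) * sinh a"])
    fix z assume z: "z \<in> {b - 1..b + 1}"
    have pos: "cosh z > 0" by (rule cosh_real_pos)
    show "(?p has_field_derivative (2 * s - 2) * cosh z powr (2 * s - 3) * sinh z) (at z within {b - 1..b + 1})"
    proof -
      have "(cosh has_field_derivative sinh z) (at z)" by (auto intro!: derivative_eq_intros)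
      from DERIV_fun_powr[OF this pos, of "2 * s - 2"] show ?thesis
        by (rule DERIV_cong[OF has_field_derivative_at_within]) (simp add: algebra_simps)
    qed
    have "\<bar>(2 * s - 2) * cosh z powr (2 * s - 3) * sinh z\<bar> \<le> 2 * (cosh z powr (2 * s - 3) * cosh z)"
      unfolding abs_mult mult.assoc
      using s sinh_le_cosh_real[of "\<bar>z\<bar>"] by (intro mult_mono) auto
    also have "cosh z powr (2 * s - 3) * cosh z = ?p z"
      using pos powr_add[of "cosh z" "2 * s - 3" 1] by simp
    also have "\<dots> \<le> exp 2 * ?p b" using z by (intro cosh_powr_near) auto
    finally show "norm ((2 * s - 2) * cosh z powr (2 * s - 3) * sinh z) \<le> 2 * (exp 2 * ?p b)" by simp
  qed (use x in auto)
  then have 1: "\<bar>?p (b + x) - ?p (b - x)\<bar> \<le> 4 * exp 2 * ?p b * x" using x by simp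
  have "\<bar>\<phi> (tanh (b + x)) - \<phi> (tanh (b - x))\<bar> \<le> M * \<bar>tanh (b + x) - tanh (b - x)\<bar>" by (rule lip)
  also have "\<dots> \<le> M * (2 * x)" using tanh_lipschitz[of "b + x" "b - x"] x M_nonneg by (intro mult_left_mono) auto
  finally have 2: "\<bar>\<phi> (tanh (b + x)) - \<phi> (tanh (b - x))\<bar> \<le> M * (2 * x)" .
  have 3: "?p (b - x) \<le> exp 2 * ?p b" using x by (intro cosh_powr_near) auto
  have "dPsi b x = (?p (b + x) - ?p (b - x)) * \<phi> (tanh (b + x)) + ?p (b - x) * (\<phi> (tanh (b + x)) - \<phi> (tanh (b - x)))"
    by (simp add: dPsi_def Psi_def algebra_simps)
  also have "\<bar>\<dots>\<bar> \<le> \<bar>?p (b + x) - ?p (b - x)\<bar> * \<bar>\<phi> (tanh (b + x))\<bar> + ?p (b - x) * \<bar>\<phi> (tanh (b + x)) - \<phi> (tanh (b - x))\<bar>"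
    by (rule order_trans[OF abs_triangle_ineq]) (simp add: abs_mult)
  also have "\<dots> \<le> (4 * exp 2 * ?p b * x) * M + (exp 2 * ?p b) * (M * (2 * x))"
    using 1 2 3 phi_le_M M_nonneg x by (intro add_mono mult_mono) auto
  also have "\<dots> = 6 * exp 2 * M * x * ?p b" by (simp add: algebra_simps)
  finally show ?thesis .
qed

lemma dPsi_bound: "\<bar>dPsi b x\<bar> \<le> M * cosh (b + x) powr (2 * s - 2) + M * cosh (b - x) powr (2 * s - 2)"
  unfolding dPsi_def using Psi_bound[of "b + x"] Psi_bound[of "b - x"] by linarith

lemma cosh_powr_le_1: "cosh a powr (2 * s - 2) \<le> 1"
proof -
  have "cosh a powr (2 * s - 2) \<le> 1 powr (2 * s - 2)"
    using cosh_real_ge_1[of a] s by (intro powr_mono2') auto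
  then show ?thesis by simp
qed

lemma dPsi_borel[measurable (raw)]:
  "f \<in> borel_measurable N \<Longrightarrow> g \<in> borel_measurable N \<Longrightarrow> (\<lambda>x. dPsi (f x) (g x)) \<in> borel_measurable N"
proof -
  assume [measurable]: "f \<in> borel_measurable N" "g \<in> borel_measurable N"
  have "(\<lambda>x. f x + g x) \<in> borel_measurable N" "(\<lambda>x. f x - g x) \<in> borel_measurable N" by measurable
  from this[THEN measurable_compose[OF _ Psi_borel]] show ?thesis
    unfolding dPsi_def by (rule borel_measurable_diff)
qed

lemma dPsi_integrable: "set_integrable lborel {0<..} (\<lambda>x. dPsi b x * sinh x powr (- 2 * s))"
proof (rule set_integrable_bound)
  let ?K = "6 * exp 2 * M + 2 * M"
  show "set_integrable lborel {0<..} (\<lambda>x. ?K * (min 1 x * sinh x powr (- 2 * s)))"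
    by (rule set_integrable_mult_right) (rule set_integrable_sinh_weight[OF s])
  show "AE x in lborel. x \<in> {0<..} \<longrightarrow> norm (dPsi b x * sinh x powr (- 2 * s)) \<le> norm (?K * (min 1 x * sinh x powr (- 2 * s)))"
  proof (intro AE_I2 impI)
    fix x :: real assume x: "x \<in> {0<..}"
    have "\<bar>dPsi b x\<bar> \<le> ?K * min 1 x"
    proof (cases "x \<le> 1")
      case True
      have "\<bar>dPsi b x\<bar> \<le> 6 * exp 2 * M * x * cosh b powr (2 * s - 2)"
        using x True by (intro dPsi_bound_near) auto
      also have "\<dots> \<le> 6 * exp 2 * M * x * 1"
        using x M_nonneg cosh_powr_le_1 by (intro mult_left_mono) auto
      also have "\<dots> \<le> ?K * min 1 x" using True x M_nonneg by (simp add: algebra_simps)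
      finally show ?thesis .
    next
      case False
      have "\<bar>dPsi b x\<bar> \<le> M * 1 + M * 1"
        by (rule order_trans[OF dPsi_bound])
           (intro add_mono mult_left_mono cosh_powr_le_1 M_nonneg)
      also have "\<dots> \<le> ?K * min 1 x" using False M_nonneg by simp
      finally show ?thesis .
    qed
    then have "\<bar>dPsi b x\<bar> * sinh x powr (- 2 * s) \<le> ?K * min 1 x * sinh x powr (- 2 * s)"
      by (rule mult_right_mono) simp
    then show "norm (dPsi b x * sinh x powr (- 2 * s)) \<le> norm (?K * (min 1 x * sinh x powr (- 2 * s)))"
      using x M_nonneg by (simp add: abs_mult mult.assoc)
  qed
qed (auto simp: set_borel_measurable_def)

definition Ext :: "real \<Rightarrow> real" where
  "Ext y = (LINT t:{1 - y..}|lborel. \<phi> (y + t) * t powr (- 2 * s)) - (LINT t:{1 + y..}|lborel. \<phi> (y - t) * t powr (- 2 * s))"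

text \<open>Excising hyperbolic distance d on both sides of b removes unequal lengths on the two
  sides of tanh b, hence the two different lower limits. The left half is the right half for the
  reflected function at -b.\<close>

lemma cut_identity:
  assumes d: "d > 0"
  shows "(LINT t:{tanh (b + d) - tanh b<..}|lborel. \<phi> (tanh b + t) * t powr (- 2 * s))
     - (LINT t:{tanh b - tanh (b - d)<..}|lborel. \<phi> (tanh b - t) * t powr (- 2 * s))
     = Ext (tanh b) + cosh b powr (2 * s) * (LINT x:{d<..}|lborel. dPsi b x * sinh x powr (- 2 * s))"
proof -
  interpret R: lipschitz_decay "\<lambda>z. \<phi> (- z)" M s by (rule reflected)
  have rP: "R.Psi (- b + x) = Psi (b - x)" for x
  proof -
    have "- b + x = - (b - x)" by simp
    then show ?thesis unfolding R.Psi_def Psi_def by (simp only: cosh_minus tanh_minus minus_minus)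
  qed
  have t: "tanh (- b + d) = - tanh (b - d)" by (metis tanh_minus minus_diff_eq uminus_add_conv_diff)
  note 1 = one_sided[OF d, of b]
  note 2 = R.one_sided[OF d, of "- b", unfolded rP t]
  have "(LINT x:{d<..}|lborel. dPsi b x * sinh x powr (- 2 * s)) =
     (LINT x:{d<..}|lborel. Psi (b + x) * sinh x powr (- 2 * s)) - (LINT x:{d<..}|lborel. Psi (b - x) * sinh x powr (- 2 * s))"
    unfolding dPsi_def left_diff_distrib by (rule set_integral_diff) (use 1(1) 2(1) in auto)
  moreover have "(LINT t:{tanh b - tanh (b - d)<..}|lborel. \<phi> (tanh b - t) * t powr (- 2 * s))
      = (LINT t:{1 + tanh b..}|lborel. \<phi> (tanh b - t) * t powr (- 2 * s))
        + cosh b powr (2 * s) * (LINT x:{d<..}|lborel. Psi (b - x) * sinh x powr (- 2 * s))"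
    using 2(2) by simp
  ultimately show ?thesis unfolding Ext_def 1(2) by (simp only: right_diff_distrib)
qed

text \<open>The two arms of the excised interval are at least of order d but differ only by order
  d^2. Against a kernel of size d^(-2s) the mismatch costs d^(2-2s), which vanishes with d since s <
  1. \<open>Q\<close> bounds cosh between b - 1 and b + 1, and 8 d^2 is 2 (2d)^2, from sinh d <=
  2d.\<close>

lemma cut_asymmetry:
  fixes b d :: real
  assumes d: "0 < d" "d \<le> 1"
  defines "Q \<equiv> exp (\<bar>b\<bar> + 1)"
  shows "d / Q\<^sup>2 \<le> tanh (b + d) - tanh b" "d / Q\<^sup>2 \<le> tanh b - tanh (b - d)"
    "\<bar>(tanh (b + d) - tanh b) - (tanh b - tanh (b - d))\<bar> \<le> 8 * d\<^sup>2"
proof -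
  have Q: "cosh z \<le> Q" if "\<bar>z\<bar> \<le> \<bar>b\<bar> + 1" for z
  proof -
    have "cosh z \<le> exp \<bar>z\<bar>" using cosh_le_exp_cosh[of z 0] by simp
    also have "\<dots> \<le> Q" using that by (simp add: Q_def)
    finally show ?thesis .
  qed
  have sd: "d \<le> sinh d" using real_le_x_sinh[of d] d by (simp add: sinh_field_def exp_minus)
  have q: "cosh z * cosh b \<le> Q\<^sup>2" "cosh z * cosh b > 0" if "\<bar>z\<bar> \<le> \<bar>b\<bar> + 1" for z
    using Q[OF that] Q[of b] cosh_real_pos[of b] cosh_real_pos[of z] unfolding power2_eq_square
    by (auto intro!: mult_mono simp: Q_def)
  have Qpos: "Q > 0" by (simp add: Q_def)
  have "d / Q\<^sup>2 \<le> sinh d / (cosh (b + d) * cosh b)"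
    using sd d q[of "b + d"] by (intro frac_le) auto
  then show "d / Q\<^sup>2 \<le> tanh (b + d) - tanh b" by (simp add: tanh_diff_eq)
  have "d / Q\<^sup>2 \<le> sinh d / (cosh (b - d) * cosh b)"
    using sd d q[of "b - d"] by (intro frac_le) auto
  then show "d / Q\<^sup>2 \<le> tanh b - tanh (b - d)" by (simp add: tanh_diff_eq mult.commute)
  have p: "cosh b > 0" "cosh (b + d) > 0" "cosh (b - d) > 0" by (rule cosh_real_pos)+
  have g: "cosh b \<ge> 1" "cosh (b + d) \<ge> 1" "cosh (b - d) \<ge> 1" by (rule cosh_real_ge_1)+
  have "(tanh (b + d) - tanh b) - (tanh b - tanh (b - d))
      = sinh d * (cosh (b - d) - cosh (b + d)) / (cosh b * cosh (b + d) * cosh (b - d))"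
    using p by (simp add: tanh_diff_eq field_simps)
  also have "cosh (b - d) - cosh (b + d) = - 2 * sinh b * sinh d"
    by (simp add: cosh_diff cosh_add)
  finally have "\<bar>(tanh (b + d) - tanh b) - (tanh b - tanh (b - d))\<bar>
     = 2 * (sinh d)\<^sup>2 * \<bar>sinh b\<bar> / (cosh b * cosh (b + d) * cosh (b - d))"
    using p d by (simp add: abs_mult power2_eq_square mult_ac)
  also have "\<dots> \<le> 2 * (sinh d)\<^sup>2 * cosh b / (cosh b * 1 * 1)"
    using p g sinh_le_cosh_real[of "\<bar>b\<bar>"]
    by (intro frac_le mult_mono mult_left_mono) auto
  also have "\<dots> = 2 * (sinh d)\<^sup>2" using p by simp
  also have "\<dots> \<le> 2 * (2 * d)\<^sup>2"
    using sinh_le_twice[of d] d by (intro mult_left_mono power_mono) auto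
  finally show "\<bar>(tanh (b + d) - tanh b) - (tanh b - tanh (b - d))\<bar> \<le> 8 * d\<^sup>2"
    by (simp add: power2_eq_square)
qed

lemma riesz_diff_tanh: "riesz_diff (tanh b) = Ext (tanh b) + cosh b powr (2 * s) * (LINT x:{0<..}|lborel. dPsi b x * sinh x powr (- 2 * s))"
proof -
  define d where "d = (\<lambda>n::nat. 1 / real (Suc n))"
  have d: "0 < d n" "d n \<le> 1" for n by (auto simp: d_def)
  have d0: "d \<longlonglongrightarrow> 0" unfolding d_def using LIMSEQ_inverse_real_of_nat by (simp add: inverse_eq_divide)
  define Q where "Q = exp (\<bar>b\<bar> + 1)"
  have Q: "Q > 0" by (simp add: Q_def)
  define y where "y = tanh b"
  define be al where "be = (\<lambda>n. tanh (b + d n) - tanh b)" and "al = (\<lambda>n. tanh b - tanh (b - d n))"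
  note asym = cut_asymmetry[OF d(1) d(2), where b = b, folded Q_def]
  have be: "0 < be n" "d n / Q\<^sup>2 \<le> be n" and al: "0 < al n" "d n / Q\<^sup>2 \<le> al n" and ba: "\<bar>be n - al n\<bar> \<le> 8 * (d n)\<^sup>2" for n
    using asym[of n] d[of n] by (auto simp: be_def al_def)
  have be0: "be \<longlonglongrightarrow> 0"
  proof -
    have "(\<lambda>n. tanh (b + d n) - tanh b) \<longlonglongrightarrow> tanh (b + 0) - tanh b"
      by (intro tendsto_intros d0) (auto simp: cosh_real_nonzero)
    then show ?thesis by (simp add: be_def)
  qed
  define F where "F = (\<lambda>t. \<phi> (y - t) * t powr (- 2 * s))"
  define L1 where "L1 = (\<lambda>n. LINT t:{be n<..}|lborel. (\<phi> (y + t) - \<phi> (y - t)) * t powr (- 2 * s))"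
  \<comment> \<open>The error made by starting the left-hand integral at \<open>be n\<close>, as the
    symmetric integral \<open>L1\<close> does, and not at its own limit \<open>al n\<close>.\<close>
  define C where "C = (\<lambda>n. (LINT t:{be n<..}|lborel. F t) - (LINT t:{al n<..}|lborel. F t))"
  have "L1 \<longlonglongrightarrow> riesz_diff y" unfolding L1_def riesz_diff_def
    by (rule tendsto_set_integral_Ioi[OF riesz_diff_integrable be(1) be0])
  moreover have "C \<longlonglongrightarrow> 0"
  proof (rule Lim_null_comparison)
    show "(\<lambda>n. 8 * M * Q powr (4 * s) * d n powr (2 - 2 * s)) \<longlonglongrightarrow> 0"
    proof -
      have "(\<lambda>n. 8 * M * Q powr (4 * s) * d n powr (2 - 2 * s)) \<longlonglongrightarrow> 8 * M * Q powr (4 * s) * 0 powr (2 - 2 * s)"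
        using s d(1) by (intro tendsto_intros d0) (auto intro!: always_eventually less_imp_le)
      then show ?thesis by simp
    qed
    \<comment> \<open>Stated for any ordered pair of limits, because which arm is the longer one
      depends on the sign of b.\<close>
    have bound: "\<bar>(LINT t:{u<..}|lborel. F t) - (LINT t:{v<..}|lborel. F t)\<bar> \<le> 8 * M * Q powr (4 * s) * d n powr (2 - 2 * s)"
      if u: "d n / Q\<^sup>2 \<le> u" "u \<le> v" "v - u \<le> 8 * (d n)\<^sup>2" for u v n
    proof -
      have dq: "d n / Q\<^sup>2 > 0" using d Q by simp
      with u have u0: "u > 0" by linarith
      have "\<bar>(LINT t:{u<..}|lborel. F t) - (LINT t:{v<..}|lborel. F t)\<bar> \<le> M * (d n / Q\<^sup>2) powr (- 2 * s) * (v - u)"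
      proof (rule set_integral_Ioi_diff_le)
        show "set_integrable lborel {u<..} F" unfolding F_def by (rule one_sided_integrable(2)[OF u0])
        fix t assume t: "u < t" "t \<le> v"
        have "t powr (- 2 * s) \<le> (d n / Q\<^sup>2) powr (- 2 * s)"
          using t u s dq by (intro powr_mono2') auto
        then show "\<bar>F t\<bar> \<le> M * (d n / Q\<^sup>2) powr (- 2 * s)"
          unfolding F_def abs_mult using phi_le_M M_nonneg by (intro mult_mono) auto
      qed (rule u(2))
      also have "\<dots> \<le> M * (d n / Q\<^sup>2) powr (- 2 * s) * (8 * (d n)\<^sup>2)"
        using u(3) M_nonneg by (intro mult_left_mono) auto
      also have "(d n / Q\<^sup>2) powr (- 2 * s) = d n powr (- 2 * s) * Q powr (4 * s)"
      proof -
        have "(Q\<^sup>2) powr (2 * s) = Q powr (4 * s)" using power2_powr[OF Q, of "2 * s"] by simp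
        then have "(d n / Q\<^sup>2) powr (2 * s) = d n powr (2 * s) / Q powr (4 * s)"
          using d[of n] Q by (simp add: powr_divide)
        then show ?thesis by (simp add: powr_minus) (simp add: divide_inverse mult.commute)
      qed
      also have "M * (d n powr (- 2 * s) * Q powr (4 * s)) * (8 * (d n)\<^sup>2) = 8 * M * Q powr (4 * s) * d n powr (2 - 2 * s)"
      proof -
        have "d n powr (2 - 2 * s) = d n powr (- 2 * s) * (d n)\<^sup>2"
          using d[of n] powr_add[of "d n" "- 2 * s" 2] by (simp add: powr_numeral)
        then show ?thesis by (simp add: mult_ac)
      qed
      finally show ?thesis .
    qed
    have "\<bar>C n\<bar> \<le> 8 * M * Q powr (4 * s) * d n powr (2 - 2 * s)" for n
    proof (cases "be n \<le> al n")
      case True then show ?thesis unfolding C_def using ba[of n] be[of n] by (intro bound) auto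
    next
      case False
      have "\<bar>C n\<bar> = \<bar>(LINT t:{al n<..}|lborel. F t) - (LINT t:{be n<..}|lborel. F t)\<bar>"
        unfolding C_def by (rule abs_minus_commute)
      also have "\<dots> \<le> 8 * M * Q powr (4 * s) * d n powr (2 - 2 * s)"
        using False ba[of n] al[of n] by (intro bound) auto
      finally show ?thesis .
    qed
    then show "\<forall>\<^sub>F n in sequentially. norm (C n) \<le> 8 * M * Q powr (4 * s) * d n powr (2 - 2 * s)"
      by simp
  qed
  ultimately have "(\<lambda>n. L1 n + C n) \<longlonglongrightarrow> riesz_diff y + 0" by (rule tendsto_add)
  moreover have "L1 n + C n = Ext y + cosh b powr (2 * s) * (LINT x:{d n<..}|lborel. dPsi b x * sinh x powr (- 2 * s))" for n
  proof -
    have "L1 n = (LINT t:{be n<..}|lborel. \<phi> (y + t) * t powr (- 2 * s)) - (LINT t:{be n<..}|lborel. F t)"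
      unfolding L1_def F_def left_diff_distrib
      by (rule set_integral_diff) (rule one_sided_integrable[OF be(1)])+
    then show ?thesis using cut_identity[OF d(1)[of n], of b]
      unfolding C_def F_def y_def be_def al_def by simp
  qed
  ultimately have l1: "(\<lambda>n. Ext y + cosh b powr (2 * s) * (LINT x:{d n<..}|lborel. dPsi b x * sinh x powr (- 2 * s))) \<longlonglongrightarrow> riesz_diff y"
    by simp
  have l2: "(\<lambda>n. Ext y + cosh b powr (2 * s) * (LINT x:{d n<..}|lborel. dPsi b x * sinh x powr (- 2 * s)))
     \<longlonglongrightarrow> Ext y + cosh b powr (2 * s) * (LINT x:{0<..}|lborel. dPsi b x * sinh x powr (- 2 * s))"
    by (intro tendsto_intros tendsto_set_integral_Ioi[OF dPsi_integrable d(1) d0])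
  show ?thesis using LIMSEQ_unique[OF l1 l2] by (simp add: y_def)
qed

end

section \<open>The exterior kernel and the identity on the interval (-1, 1)\<close>

definition cosh_integral :: "real \<Rightarrow> real" where
  "cosh_integral s = (\<integral>b. cosh b powr (- 2 * s) \<partial>lborel)"

text \<open>The constant is the Beta value B(s, 1/2), equal to the integral of (1 - y^2)^(s-1) over
  (-1, 1). Its strict positivity allows it to be divided out when a sign is read off from the flux
  identity. A vanishing integral would make a positive integrand zero almost everywhere.\<close>

lemma cosh_integral_pos:
  assumes "0 < s" shows "cosh_integral s > 0"
proof -
  have i: "integrable lborel (\<lambda>b::real. cosh b powr (- 2 * s))"
    using integrable_cosh_powr[of "2 * s"] assms by simp
  have ne: "cosh_integral s \<noteq> 0"
  proof
    assume "cosh_integral s = 0"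
    then have "AE b::real in lborel. cosh b powr (- 2 * s) = 0"
      unfolding cosh_integral_def using i by (subst (asm) integral_nonneg_eq_0_iff_AE) auto
    then have "AE b::real in lborel. False" by eventually_elim (simp add: cosh_real_nonzero)
    then have "emeasure (lborel :: real measure) {b \<in> space lborel. True} = 0"
      by (intro emeasure_eq_0_AE) simp
    then show False by simp
  qed
  have "cosh_integral s \<ge> 0" unfolding cosh_integral_def by simp
  with ne show ?thesis by simp
qed

text \<open>For z = coth a one has z - tanh b = cosh(b - a) / (sinh a cosh b). The powers of cosh b
  cancel, a shift in b leaves the constant, and sinh(a)^(2s) is (z^2 - 1)^(-s).\<close>

lemma kernel_integral:
  assumes z: "z > (1::real)" and s: "0 < s"
  shows "integrable lborel (\<lambda>b. cosh b powr (- 2 * s) * (z - tanh b) powr (- 2 * s))"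
    and "(\<integral>b. cosh b powr (- 2 * s) * (z - tanh b) powr (- 2 * s) \<partial>lborel) = cosh_integral s * (z\<^sup>2 - 1) powr (- s)"
proof -
  have "1 / z \<in> range tanh" unfolding range_tanh using z by (auto simp: field_simps)
  then obtain a where a: "tanh a = 1 / z" by auto
  have ap: "a > 0" using a z by (metis divide_pos_pos less_trans tanh_real_pos_iff zero_less_one)
  have ca: "cosh a > 0" "sinh a > 0" using ap by (auto simp: cosh_real_pos)
  have zc: "z = cosh a / sinh a" using a ca z by (simp add: tanh_def field_simps)
  have "z\<^sup>2 - 1 = ((cosh a)\<^sup>2 - (sinh a)\<^sup>2) / (sinh a)\<^sup>2" using ca by (simp add: zc power_divide diff_divide_distrib)
  then have z2: "z\<^sup>2 - 1 = 1 / (sinh a)\<^sup>2" by (simp only: hyperbolic_pythagoras)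
  have pw: "(z\<^sup>2 - 1) powr (- s) = sinh a powr (2 * s)"
  proof -
    have "((sinh a)\<^sup>2) powr s = sinh a powr (2 * s)" using ca by (intro power2_powr)
    then show ?thesis unfolding z2 using ca by (simp add: powr_divide powr_minus)
  qed
  have eq: "cosh b powr (- 2 * s) * (z - tanh b) powr (- 2 * s) = sinh a powr (2 * s) * cosh (- a + 1 * b) powr (- 2 * s)" for b
  proof -
    have cb: "cosh b > 0" "cosh (b - a) > 0" by (auto simp: cosh_real_pos)
    have "z - tanh b = cosh (b - a) / (sinh a * cosh b)"
      using ca cb by (simp add: zc tanh_def cosh_diff field_simps)
    then have "(z - tanh b) powr (2 * s) = cosh (b - a) powr (2 * s) / (sinh a powr (2 * s) * cosh b powr (2 * s))"
      using ca cb by (simp add: powr_divide powr_mult)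
    then have "(z - tanh b) powr (- 2 * s) = cosh (b - a) powr (- 2 * s) * sinh a powr (2 * s) * cosh b powr (2 * s)"
      by (simp add: powr_minus divide_inverse mult_ac)
    moreover have "cosh b powr (- 2 * s) * cosh b powr (2 * s) = 1"
      using cb by (simp add: powr_add[symmetric])
    ultimately show ?thesis by (simp add: mult_ac)
  qed
  have i: "integrable lborel (\<lambda>b::real. cosh b powr (- 2 * s))"
    using integrable_cosh_powr[of "2 * s"] s by simp
  show "integrable lborel (\<lambda>b. cosh b powr (- 2 * s) * (z - tanh b) powr (- 2 * s))"
    unfolding eq by (intro integrable_mult_right lborel_integrable_real_affine[OF i]) simp
  show "(\<integral>b. cosh b powr (- 2 * s) * (z - tanh b) powr (- 2 * s) \<partial>lborel) = cosh_integral s * (z\<^sup>2 - 1) powr (- s)"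
    unfolding eq pw cosh_integral_def
    by (subst (2) lborel_integral_real_affine[where c=1 and t="-a"]) auto
qed

context lipschitz_decay
begin

lemma phi_shift_bound_origin: "t \<ge> 1 \<Longrightarrow> \<bar>\<phi> t\<bar> \<le> M / t"
  using phi_shift_bound[of t t 0] by simp

text \<open>At the endpoint the kernel behaves like (z - 1)^(-s), integrable because s < 1. At
  infinity it is of order z^(-2s), and the decay of \<phi> supplies the missing power.\<close>

lemma exterior_integrable: "set_integrable lborel {1<..} (\<lambda>z. (z\<^sup>2 - 1) powr (- s) * \<phi> z)"
proof -
  have "set_integrable lborel {0<..} (\<lambda>t. ((1 + t)\<^sup>2 - 1) powr (- s) * \<phi> (1 + t))"
  proof (rule set_integrable_Ioi_powr_bound[where a="- s" and b="- 1 - 2 * s" and B=M])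
    fix t :: real assume t: "0 < t" "t \<le> 1"
    have "t \<le> (1 + t)\<^sup>2 - 1" using t by (simp add: power2_eq_square algebra_simps)
    then have "((1 + t)\<^sup>2 - 1) powr (- s) \<le> t powr (- s)" using t s by (intro powr_mono2') auto
    then show "\<bar>((1 + t)\<^sup>2 - 1) powr (- s) * \<phi> (1 + t)\<bar> \<le> M * t powr (- s)"
      unfolding abs_mult using phi_le_M[of "1 + t"] M_nonneg
      by (subst mult.commute) (intro mult_mono, auto)
  next
    fix t :: real assume t: "1 \<le> t"
    have "t\<^sup>2 \<le> (1 + t)\<^sup>2 - 1" using t by (simp add: power2_eq_square algebra_simps)
    then have "((1 + t)\<^sup>2 - 1) powr (- s) \<le> (t\<^sup>2) powr (- s)" using t s by (intro powr_mono2') auto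
    also have "(t\<^sup>2) powr (- s) = t powr (- 2 * s)" using power2_powr[of t "- s"] t by simp
    finally have 1: "((1 + t)\<^sup>2 - 1) powr (- s) \<le> t powr (- 2 * s)" .
    have "\<bar>\<phi> (1 + t)\<bar> \<le> M / (1 + t)" using t by (intro phi_shift_bound_origin) auto
    also have "\<dots> \<le> M / t" using t M_nonneg by (intro divide_left_mono) auto
    finally have "\<bar>((1 + t)\<^sup>2 - 1) powr (- s) * \<phi> (1 + t)\<bar> \<le> t powr (- 2 * s) * (M / t)"
      unfolding abs_mult using 1 M_nonneg t by (intro mult_mono) auto
    also have "\<dots> = M * t powr (- 1 - 2 * s)" using t by (simp add: powr_diff powr_minus field_simps)
    finally show "\<bar>((1 + t)\<^sup>2 - 1) powr (- s) * \<phi> (1 + t)\<bar> \<le> M * t powr (- 1 - 2 * s)" .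
  qed (use s in auto)
  then show ?thesis unfolding set_integrable_def
    by (subst lborel_integrable_real_affine_iff[where c=1 and t=1, symmetric]) (auto simp: indicator_def)
qed

definition ext_kernel :: "real \<Rightarrow> real \<Rightarrow> real" where
  "ext_kernel z b = indicator {1<..} z * \<phi> z * (cosh b powr (- 2 * s) * (z - tanh b) powr (- 2 * s))"

text \<open>The inner integral of the absolute value is exactly \<open>kernel_integral\<close>, so
  absolute integrability reduces to that of the exterior integrand.\<close>

lemma ext_kernel_integrable: "integrable (lborel \<Otimes>\<^sub>M lborel) (\<lambda>(z, b). ext_kernel z b)"
proof (rule lborel_pair.Fubini_integrable)
  show "(\<lambda>(z, b). ext_kernel z b) \<in> borel_measurable (lborel \<Otimes>\<^sub>M lborel)"
    unfolding ext_kernel_def by measurable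
  have eq: "(\<integral>b. norm (ext_kernel z b) \<partial>lborel) = cosh_integral s * norm (indicator {1<..} z *\<^sub>R ((z\<^sup>2 - 1) powr (- s) * \<phi> z))" for z
  proof (cases "z > 1")
    case True
    then have "(\<integral>b. norm (ext_kernel z b) \<partial>lborel) = \<bar>\<phi> z\<bar> * (\<integral>b. cosh b powr (- 2 * s) * (z - tanh b) powr (- 2 * s) \<partial>lborel)"
      by (simp add: ext_kernel_def abs_mult)
    then show ?thesis using True s by (simp only: kernel_integral(2)) (simp add: abs_mult)
  qed (simp add: ext_kernel_def)
  show "integrable lborel (\<lambda>z. \<integral>b. norm ((\<lambda>(z, b). ext_kernel z b) (z, b)) \<partial>lborel)"
    using exterior_integrable[unfolded set_integrable_def, THEN integrable_norm] by (simp add: eq[simplified real_norm_def])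
  show "AE z in lborel. integrable lborel (\<lambda>b. (\<lambda>(z, b). ext_kernel z b) (z, b))"
  proof (intro AE_I2)
    fix z :: real
    show "integrable lborel (\<lambda>b. (\<lambda>(z, b). ext_kernel z b) (z, b))"
      using kernel_integral(1)[of z s] s by (cases "z > 1") (auto simp: ext_kernel_def)
  qed
qed

lemma ext_half:
  shows "integrable lborel (\<lambda>b. cosh b powr (- 2 * s) * (LINT t:{1 - tanh b..}|lborel. \<phi> (tanh b + t) * t powr (- 2 * s)))"
    and "(\<integral>b. cosh b powr (- 2 * s) * (LINT t:{1 - tanh b..}|lborel. \<phi> (tanh b + t) * t powr (- 2 * s)) \<partial>lborel)
       = cosh_integral s * (LINT z:{1<..}|lborel. (z\<^sup>2 - 1) powr (- s) * \<phi> z)"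
proof -
  have eq: "(\<integral>z. ext_kernel z b \<partial>lborel) = cosh b powr (- 2 * s) * (LINT t:{1 - tanh b..}|lborel. \<phi> (tanh b + t) * t powr (- 2 * s))" for b
  proof -
    have "(\<integral>z. ext_kernel z b \<partial>lborel) = (\<integral>t. ext_kernel (tanh b + 1 * t) b \<partial>lborel)"
      by (subst lborel_integral_real_affine[where c=1 and t="tanh b"]) auto
    also have "\<dots> = (\<integral>t. cosh b powr (- 2 * s) * (indicator {1 - tanh b<..} t *\<^sub>R (\<phi> (tanh b + t) * t powr (- 2 * s))) \<partial>lborel)"
      by (intro Bochner_Integration.integral_cong) (auto simp: ext_kernel_def indicator_def)
    also have "\<dots> = cosh b powr (- 2 * s) * (LINT t:{1 - tanh b<..}|lborel. \<phi> (tanh b + t) * t powr (- 2 * s))"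
      unfolding set_lebesgue_integral_def by simp
    also have "(LINT t:{1 - tanh b<..}|lborel. \<phi> (tanh b + t) * t powr (- 2 * s)) = (LINT t:{1 - tanh b..}|lborel. \<phi> (tanh b + t) * t powr (- 2 * s))"
      unfolding set_lebesgue_integral_def using AE_lborel_singleton[of "1 - tanh b"]
      by (intro integral_cong_AE) (auto elim!: eventually_mono split: split_indicator)
    finally show ?thesis .
  qed
  have "integrable lborel (\<lambda>b. \<integral>z. ext_kernel z b \<partial>lborel)"
    by (rule lborel_pair.integrable_snd[OF ext_kernel_integrable])
  then show "integrable lborel (\<lambda>b. cosh b powr (- 2 * s) * (LINT t:{1 - tanh b..}|lborel. \<phi> (tanh b + t) * t powr (- 2 * s)))"
    by (simp only: eq)
  have "(\<integral>b. (\<integral>z. ext_kernel z b \<partial>lborel) \<partial>lborel) = (\<integral>z. (\<integral>b. ext_kernel z b \<partial>lborel) \<partial>lborel)"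
    by (rule lborel_pair.Fubini_integral[OF ext_kernel_integrable])
  also have "\<dots> = (\<integral>z. cosh_integral s * (indicator {1<..} z *\<^sub>R ((z\<^sup>2 - 1) powr (- s) * \<phi> z)) \<partial>lborel)"
  proof (rule Bochner_Integration.integral_cong[OF refl])
    fix z :: real
    show "(\<integral>b. ext_kernel z b \<partial>lborel) = cosh_integral s * (indicator {1<..} z *\<^sub>R ((z\<^sup>2 - 1) powr (- s) * \<phi> z))"
    proof (cases "z > 1")
      case True
      then have "(\<integral>b. ext_kernel z b \<partial>lborel) = \<phi> z * (\<integral>b. cosh b powr (- 2 * s) * (z - tanh b) powr (- 2 * s) \<partial>lborel)"
        by (simp add: ext_kernel_def)
      then show ?thesis using True s by (simp only: kernel_integral(2)) simp
    qed (simp add: ext_kernel_def)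
  qed
  also have "\<dots> = cosh_integral s * (LINT z:{1<..}|lborel. (z\<^sup>2 - 1) powr (- s) * \<phi> z)"
    unfolding set_lebesgue_integral_def by simp
  finally show "(\<integral>b. cosh b powr (- 2 * s) * (LINT t:{1 - tanh b..}|lborel. \<phi> (tanh b + t) * t powr (- 2 * s)) \<partial>lborel)
       = cosh_integral s * (LINT z:{1<..}|lborel. (z\<^sup>2 - 1) powr (- s) * \<phi> z)" unfolding eq .
qed

lemma integrable_cosh_2s: "integrable lborel (\<lambda>b. cosh b powr (2 * s - 2))"
  using integrable_cosh_powr[of "2 - 2 * s"] s by simp

text \<open>The exact cancellation behind the vanishing interior: at a fixed distance x the two
  terms are translates of one integrable function, so their integrals over b agree. The oddness of
  the kernel is already built into \<open>dPsi\<close>.\<close>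

lemma dPsi_slice:
  shows "integrable lborel (\<lambda>b. dPsi b x)" and "(\<integral>b. dPsi b x \<partial>lborel) = 0"
proof -
  have iPsi: "integrable lborel Psi"
    by (rule Bochner_Integration.integrable_bound[OF integrable_mult_right[OF integrable_cosh_2s, of M]])
       (auto intro!: AE_I2 order_trans[OF Psi_bound])
  have i: "integrable lborel (\<lambda>b. Psi (b + x))" "integrable lborel (\<lambda>b. Psi (b - x))"
    using lborel_integrable_real_affine[OF iPsi, of 1 x] lborel_integrable_real_affine[OF iPsi, of 1 "-x"]
    by (auto simp: add.commute)
  show "integrable lborel (\<lambda>b. dPsi b x)" unfolding dPsi_def using i by auto
  have "(\<integral>b. Psi (b + x) \<partial>lborel) = (\<integral>b. Psi b \<partial>lborel)" "(\<integral>b. Psi (b - x) \<partial>lborel) = (\<integral>b. Psi b \<partial>lborel)"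
    using lborel_integral_real_affine[of 1 Psi x] lborel_integral_real_affine[of 1 Psi "-x"]
    by (auto simp: add.commute)
  then show "(\<integral>b. dPsi b x \<partial>lborel) = 0" unfolding dPsi_def using i by simp
qed

text \<open>Exchanging the integrals in x and b makes the slicewise cancellation usable. For x <= 1
  the bound carrying the factor x is integrated over b, for larger x the bound by two translates;
  together they give a multiple of min 1 x, integrable against sinh(x)^(-2s).\<close>

lemma dPsi_joint: "integrable (lborel \<Otimes>\<^sub>M lborel) (\<lambda>(x, b). indicator {0<..} x *\<^sub>R (dPsi b x * sinh x powr (- 2 * s)))"
proof (rule lborel_pair.Fubini_integrable)
  let ?g = "\<lambda>x b. indicator {0<..} x *\<^sub>R (dPsi b x * sinh x powr (- 2 * s))"
  define I where "I = (\<integral>b. cosh b powr (2 * s - 2) \<partial>lborel)"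
  have I: "I \<ge> 0" unfolding I_def by simp
  let ?K = "(6 * exp 2 * M + 2 * M) * I"
  show m: "(\<lambda>(x, b). ?g x b) \<in> borel_measurable (lborel \<Otimes>\<^sub>M lborel)" by measurable
  have ib: "integrable lborel (\<lambda>b. ?g x b)" for x
    by (intro integrable_scaleR_right integrable_mult_left dPsi_slice)
  show "AE x in lborel. integrable lborel (\<lambda>b. (\<lambda>(x, b). ?g x b) (x, b))" using ib by simp
  have p: "integrable lborel (\<lambda>b. cosh (b + x) powr (2 * s - 2))" "(\<integral>b. cosh (b + x) powr (2 * s - 2) \<partial>lborel) = I" for x
    using lborel_integrable_real_affine[OF integrable_cosh_2s, of 1 x]
      lborel_integral_real_affine[of 1 "\<lambda>b. cosh b powr (2 * s - 2)" x]
    by (auto simp: add.commute I_def)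
  have bound: "(\<integral>b. \<bar>dPsi b x\<bar> \<partial>lborel) \<le> ?K * min 1 x" if x: "x > 0" for x
  proof (cases "x \<le> 1")
    case True
    have "(\<integral>b. \<bar>dPsi b x\<bar> \<partial>lborel) \<le> (\<integral>b. 6 * exp 2 * M * x * cosh b powr (2 * s - 2) \<partial>lborel)"
      using dPsi_bound_near[OF x True] by (intro integral_mono integrable_abs dPsi_slice integrable_mult_right integrable_cosh_2s) auto
    also have "\<dots> = 6 * exp 2 * M * x * I" by (simp add: I_def)
    also have "\<dots> \<le> ?K * min 1 x" using True x I M_nonneg by (simp add: algebra_simps)
    finally show ?thesis .
  next
    case False
    have "(\<integral>b. \<bar>dPsi b x\<bar> \<partial>lborel) \<le> (\<integral>b. M * cosh (b + x) powr (2 * s - 2) + M * cosh (b - x) powr (2 * s - 2) \<partial>lborel)"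
      using dPsi_bound p(1)[of "-x"] by (intro integral_mono integrable_abs dPsi_slice Bochner_Integration.integrable_add integrable_mult_right p) auto
    also have "\<dots> = 2 * M * I" using p[of x] p[of "-x"] by simp
    also have "\<dots> \<le> ?K * min 1 x" using False x I M_nonneg by (simp add: algebra_simps)
    finally show ?thesis .
  qed
  show "integrable lborel (\<lambda>x. \<integral>b. norm ((\<lambda>(x, b). ?g x b) (x, b)) \<partial>lborel)"
  proof (rule Bochner_Integration.integrable_bound)
    show "integrable lborel (\<lambda>x. ?K * (indicator {0<..} x *\<^sub>R (min 1 x * sinh x powr (- 2 * s))))"
      using set_integrable_sinh_weight[OF s] unfolding set_integrable_def by (rule integrable_mult_right)
    show "(\<lambda>x. \<integral>b. norm ((\<lambda>(x, b). ?g x b) (x, b)) \<partial>lborel) \<in> borel_measurable lborel"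
      by measurable
    show "AE x in lborel. norm (\<integral>b. norm ((\<lambda>(x, b). ?g x b) (x, b)) \<partial>lborel) \<le> norm (?K * (indicator {0<..} x *\<^sub>R (min 1 x * sinh x powr (- 2 * s))))"
    proof (intro AE_I2)
      fix x :: real
      have "(\<integral>b. norm ((\<lambda>(x, b). ?g x b) (x, b)) \<partial>lborel) = indicator {0<..} x * ((\<integral>b. \<bar>dPsi b x\<bar> \<partial>lborel) * sinh x powr (- 2 * s))"
        by (simp add: abs_mult)
      moreover have "x > 0 \<Longrightarrow> (\<integral>b. \<bar>dPsi b x\<bar> \<partial>lborel) * sinh x powr (- 2 * s) \<le> ?K * min 1 x * sinh x powr (- 2 * s)"
        by (intro mult_right_mono bound) auto
      moreover have "x > 0 \<Longrightarrow> 0 \<le> ?K * (min 1 x * sinh x powr (- 2 * s))" using M_nonneg I by simp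
      ultimately show "norm (\<integral>b. norm ((\<lambda>(x, b). ?g x b) (x, b)) \<partial>lborel) \<le> norm (?K * (indicator {0<..} x *\<^sub>R (min 1 x * sinh x powr (- 2 * s))))"
        by (cases "x > 0") (auto simp: mult.assoc)
    qed
  qed
qed

lemma interior_vanishes:
  shows "integrable lborel (\<lambda>b. LINT x:{0<..}|lborel. dPsi b x * sinh x powr (- 2 * s))"
    and "(\<integral>b. (LINT x:{0<..}|lborel. dPsi b x * sinh x powr (- 2 * s)) \<partial>lborel) = 0"
proof -
  show "integrable lborel (\<lambda>b. LINT x:{0<..}|lborel. dPsi b x * sinh x powr (- 2 * s))"
    unfolding set_lebesgue_integral_def by (rule lborel_pair.integrable_snd[OF dPsi_joint])
  have "(\<integral>b. (LINT x:{0<..}|lborel. dPsi b x * sinh x powr (- 2 * s)) \<partial>lborel)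
     = (\<integral>x. (\<integral>b. indicator {0<..} x *\<^sub>R (dPsi b x * sinh x powr (- 2 * s)) \<partial>lborel) \<partial>lborel)"
    unfolding set_lebesgue_integral_def by (rule lborel_pair.Fubini_integral[OF dPsi_joint])
  also have "\<dots> = 0" by (simp add: dPsi_slice)
  finally show "(\<integral>b. (LINT x:{0<..}|lborel. dPsi b x * sinh x powr (- 2 * s)) \<partial>lborel) = 0" .
qed

lemma riesz_diff_borel[measurable]: "riesz_diff \<in> borel_measurable borel"
  unfolding riesz_diff_def set_lebesgue_integral_def by measurable

text \<open>With y = tanh b the weight times dy is cosh(b)^(-2s) db, the inverse of the factor
  cosh(b)^(2s) in \<open>riesz_diff_tanh\<close>. What is left is an interior part with integral 0
  and two exterior halves, the left one being the right one for the reflected function after b is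
  replaced by -b.\<close>

theorem interval_identity:
  shows "set_integrable lborel {-1<..<1} (\<lambda>y. (1 - y\<^sup>2) powr (s - 1) * riesz_diff y)"
    and "(LINT y:{-1<..<1}|lborel. (1 - y\<^sup>2) powr (s - 1) * riesz_diff y)
       = cosh_integral s * (LINT z:{1<..}|lborel. (z\<^sup>2 - 1) powr (- s) * (\<phi> z - \<phi> (- z)))"
proof -
  interpret R: lipschitz_decay "\<lambda>z. \<phi> (- z)" M s by (rule reflected)
  let ?Y = "\<lambda>y. (1 - y\<^sup>2) powr (s - 1) * riesz_diff y"
  let ?A = "\<lambda>b. cosh b powr (- 2 * s) * (LINT t:{1 - tanh b..}|lborel. \<phi> (tanh b + t) * t powr (- 2 * s))"
  let ?B = "\<lambda>b. cosh b powr (- 2 * s) * (LINT t:{1 + tanh b..}|lborel. \<phi> (tanh b - t) * t powr (- 2 * s))"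
  let ?H = "\<lambda>b. LINT x:{0<..}|lborel. dPsi b x * sinh x powr (- 2 * s)"
  have B': "(\<lambda>b. cosh (0 + -1 * b) powr (- 2 * s) * (LINT t:{1 - tanh (0 + -1 * b)..}|lborel. \<phi> (- (tanh (0 + -1 * b) + t)) * t powr (- 2 * s))) = ?B"
    by (simp add: fun_eq_iff)
  have iB: "integrable lborel ?B"
    using lborel_integrable_real_affine[OF R.ext_half(1), of "-1" 0] unfolding B' by simp
  have eB: "(\<integral>b. ?B b \<partial>lborel) = cosh_integral s * (LINT z:{1<..}|lborel. (z\<^sup>2 - 1) powr (- s) * \<phi> (- z))"
    using lborel_integral_real_affine[of "-1" "\<lambda>b. cosh b powr (- 2 * s) * (LINT t:{1 - tanh b..}|lborel. \<phi> (- (tanh b + t)) * t powr (- 2 * s))" 0]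
    unfolding B' R.ext_half(2) by simp
  have key: "\<bar>1 - (tanh b)\<^sup>2\<bar> * ?Y (tanh b) = ?A b - ?B b + ?H b" for b
  proof -
    have c: "cosh b > 0" by (rule cosh_real_pos)
    have q: "1 - (tanh b)\<^sup>2 = cosh b powr (- 2)"
      using c by (simp add: one_minus_tanh_sq powr_minus powr_numeral field_simps)
    have "\<bar>1 - (tanh b)\<^sup>2\<bar> * (1 - (tanh b)\<^sup>2) powr (s - 1) = cosh b powr (- 2 * s)"
      unfolding q by (simp add: powr_powr powr_add[symmetric] algebra_simps)
    then have "\<bar>1 - (tanh b)\<^sup>2\<bar> * ?Y (tanh b) = cosh b powr (- 2 * s) * riesz_diff (tanh b)"
      by (simp only: mult.assoc[symmetric])
    also have "\<dots> = cosh b powr (- 2 * s) * Ext (tanh b) + ?H b"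
      unfolding riesz_diff_tanh distrib_left mult.assoc[symmetric] powr_add[symmetric] using c by simp
    also have "\<dots> = ?A b - ?B b + ?H b" by (simp add: Ext_def right_diff_distrib)
    finally show ?thesis .
  qed
  have sub: "set_integrable lborel UNIV (\<lambda>b. \<bar>1 - (tanh b)\<^sup>2\<bar> * ?Y (tanh b)) \<longleftrightarrow> set_integrable lborel (range tanh) ?Y"
    "(LINT b:UNIV|lborel. \<bar>1 - (tanh b)\<^sup>2\<bar> * ?Y (tanh b)) = (LINT y:range tanh|lborel. ?Y y)"
    by (rule set_integrable_substitution_real;
        auto simp: range_tanh inj_on_def cosh_real_nonzero intro!: derivative_eq_intros)+
  have i: "integrable lborel (\<lambda>b. ?A b - ?B b + ?H b)"
    using ext_half(1) iB interior_vanishes(1) by auto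
  show "set_integrable lborel {-1<..<1} ?Y"
    using sub(1) i unfolding key range_tanh by (simp add: set_integrable_def)
  have "(LINT y:{-1<..<1}|lborel. ?Y y) = (\<integral>b. ?A b - ?B b + ?H b \<partial>lborel)"
    using sub(2) unfolding key range_tanh by (simp add: set_lebesgue_integral_def)
  also have "\<dots> = (\<integral>b. ?A b \<partial>lborel) - (\<integral>b. ?B b \<partial>lborel)"
    using ext_half(1) iB interior_vanishes by simp
  also have "\<dots> = cosh_integral s * ((LINT z:{1<..}|lborel. (z\<^sup>2 - 1) powr (- s) * \<phi> z) - (LINT z:{1<..}|lborel. (z\<^sup>2 - 1) powr (- s) * \<phi> (- z)))"
    unfolding eB ext_half(2) by (simp add: right_diff_distrib)
  also have "\<dots> = cosh_integral s * (LINT z:{1<..}|lborel. (z\<^sup>2 - 1) powr (- s) * (\<phi> z - \<phi> (- z)))"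
    unfolding right_diff_distrib[of "(_::real) powr _"]
    by (subst set_integral_diff) (use exterior_integrable R.exterior_integrable in auto)
  finally show "(LINT y:{-1<..<1}|lborel. ?Y y) = cosh_integral s * (LINT z:{1<..}|lborel. (z\<^sup>2 - 1) powr (- s) * (\<phi> z - \<phi> (- z)))" .
qed

end

section \<open>Intervals of arbitrary length and integration by parts\<close>

lemma set_integrable_powr_Ioi_tail:
  fixes \<sigma> s :: real
  assumes "\<sigma> > 0" "s > 0"
  shows "set_integrable lborel {\<sigma><..} (\<lambda>t. t powr (- 1 - 2 * s))"
    and "(LINT t:{\<sigma><..}|lborel. t powr (- 1 - 2 * s)) = \<sigma> powr (- 2 * s) / (2 * s)"
proof -
  have hi: "((\<lambda>x. x powr (- 1 - 2 * s)) has_integral - (\<sigma> powr (- 1 - 2 * s + 1)) / (- 1 - 2 * s + 1)) {\<sigma>..}"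
    by (rule has_integral_powr_to_inf) (use assms in auto)
  have "(\<lambda>x. x powr (- 1 - 2 * s)) absolutely_integrable_on {\<sigma>..}"
    using hi by (intro nonnegative_absolutely_integrable_1) (auto simp: integrable_on_def)
  then have i: "set_integrable lborel {\<sigma>..} (\<lambda>x. x powr (- 1 - 2 * s))"
    unfolding set_integrable_def by (subst (asm) integrable_completion) auto
  then show "set_integrable lborel {\<sigma><..} (\<lambda>t. t powr (- 1 - 2 * s))"
    by (rule set_integrable_subset) auto
  have "(LINT t:{\<sigma><..}|lborel. t powr (- 1 - 2 * s)) = (LINT t:{\<sigma>..}|lborel. t powr (- 1 - 2 * s))"
    unfolding set_lebesgue_integral_def using AE_lborel_singleton[of \<sigma>]
    by (intro integral_cong_AE) (auto elim!: eventually_mono split: split_indicator)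
  also have "\<dots> = integral {\<sigma>..} (\<lambda>t. t powr (- 1 - 2 * s))"
    by (rule set_borel_integral_eq_integral(2)[OF i])
  also have "\<dots> = \<sigma> powr (- 2 * s) / (2 * s)"
    using integral_unique[OF hi] by simp
  finally show "(LINT t:{\<sigma><..}|lborel. t powr (- 1 - 2 * s)) = \<sigma> powr (- 2 * s) / (2 * s)" .
qed

context lipschitz_decay
begin

lemma scaled:
  assumes l: "l > 0" shows "lipschitz_decay (\<lambda>x. \<phi> (l * x)) (M * (1 + l + 1 / l)) s"
proof
  fix x y
  have "\<bar>\<phi> (l * x) - \<phi> (l * y)\<bar> \<le> M * \<bar>l * x - l * y\<bar>" by (rule lip)
  also have "\<bar>l * x - l * y\<bar> = l * \<bar>x - y\<bar>"
    using l abs_mult[of l "x - y"] by (simp add: right_diff_distrib)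
  also have "M * (l * \<bar>x - y\<bar>) = M * l * \<bar>x - y\<bar>" by simp
  also have "\<dots> \<le> M * (1 + l + 1 / l) * \<bar>x - y\<bar>"
    using l M_nonneg by (intro mult_right_mono mult_left_mono) auto
  finally show "\<bar>\<phi> (l * x) - \<phi> (l * y)\<bar> \<le> M * (1 + l + 1 / l) * \<bar>x - y\<bar>" .
  have "1 + \<bar>x\<bar> \<le> (1 + \<bar>l * x\<bar>) * (1 + l + 1 / l)"
  proof -
    have "(1 + \<bar>l * x\<bar>) * (1 + l + 1 / l) = 1 + l + 1 / l + l * \<bar>x\<bar> + l * \<bar>x\<bar> * l + \<bar>x\<bar>"
      using l by (simp add: abs_mult field_simps)
    then show ?thesis using l by simp
  qed
  then have "\<bar>\<phi> (l * x)\<bar> * (1 + \<bar>x\<bar>) \<le> \<bar>\<phi> (l * x)\<bar> * ((1 + \<bar>l * x\<bar>) * (1 + l + 1 / l))"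
    by (intro mult_left_mono) auto
  also have "\<dots> \<le> M * (1 + l + 1 / l)"
    unfolding mult.assoc[symmetric] using l by (intro mult_right_mono dec) auto
  finally show "\<bar>\<phi> (l * x)\<bar> * (1 + \<bar>x\<bar>) \<le> M * (1 + l + 1 / l)" .
qed (use s in auto)

text \<open>The form needed for a chord of half-length l of the unit ball. The power l^(2s-1) is
  pure scaling, and it is the factor that later becomes \<open>cone_kernel\<close>.\<close>

theorem scaled_interval_identity:
  assumes l: "l > 0"
  shows "set_integrable lborel {-l<..<l} (\<lambda>y. (l\<^sup>2 - y\<^sup>2) powr (s - 1) * riesz_diff y)"
    and "(LINT y:{-l<..<l}|lborel. (l\<^sup>2 - y\<^sup>2) powr (s - 1) * riesz_diff y)
       = cosh_integral s * l powr (2 * s - 1) * (LINT z:{l<..}|lborel. (z\<^sup>2 - l\<^sup>2) powr (- s) * (\<phi> z - \<phi> (- z)))"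
proof -
  interpret R: lipschitz_decay "\<lambda>x. \<phi> (l * x)" "M * (1 + l + 1 / l)" s by (rule scaled[OF l])
  have RP: "riesz_diff (l * y) = l powr (1 - 2 * s) * R.riesz_diff y" for y
  proof -
    have "riesz_diff (l * y) = l * (\<integral>t. indicator {0<..} (l * t) * ((\<phi> (l * y + l * t) - \<phi> (l * y - l * t)) * (l * t) powr (- 2 * s)) \<partial>lborel)"
      unfolding riesz_diff_def set_lebesgue_integral_def
      by (subst lborel_integral_real_affine[where c=l and t=0]) (use l in auto)
    also have "\<dots> = l * (\<integral>t. l powr (- 2 * s) * (indicator {0<..} t *\<^sub>R ((\<phi> (l * (y + t)) - \<phi> (l * (y - t))) * t powr (- 2 * s))) \<partial>lborel)"
      using l by (intro arg_cong[where f="\<lambda>x. l * x"] Bochner_Integration.integral_cong refl)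
        (auto simp: indicator_def powr_mult distrib_left right_diff_distrib zero_less_mult_iff)
    also have "\<dots> = l * l powr (- 2 * s) * R.riesz_diff y" unfolding R.riesz_diff_def set_lebesgue_integral_def by simp
    also have "l * l powr (- 2 * s) = l powr (1 - 2 * s)" using l by (simp add: powr_diff powr_minus divide_inverse)
    finally show ?thesis .
  qed
  have pw: "(l\<^sup>2 * r) powr a = l powr (2 * a) * r powr a" if "r \<ge> 0" for r a
  proof -
    have "(l\<^sup>2) powr a = l powr (2 * a)" using l by (rule power2_powr)
    then show ?thesis using that by (simp add: powr_mult)
  qed
  have mem: "l * y \<in> {-l<..<l} \<longleftrightarrow> y \<in> {-1<..<1}" for y
    using mult_less_cancel_left_pos[OF l, of y 1] mult_less_cancel_left_pos[OF l, of "-1" y] by simp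
  have fac: "indicator {-l<..<l} (l * y) *\<^sub>R ((l\<^sup>2 - (l * y)\<^sup>2) powr (s - 1) * riesz_diff (l * y))
     = l powr (- 1) * (indicator {-1<..<1} y *\<^sub>R ((1 - y\<^sup>2) powr (s - 1) * R.riesz_diff y))" for y
  proof (cases "y \<in> {-1<..<1}")
    case True
    then have y2: "1 - y\<^sup>2 \<ge> 0" by (simp add: abs_square_le_1 abs_le_iff)
    have m: "l * y \<in> {-l<..<l}" using True unfolding mem .
    have "l\<^sup>2 - (l * y)\<^sup>2 = l\<^sup>2 * (1 - y\<^sup>2)" by (simp add: power_mult_distrib right_diff_distrib)
    then have "(l\<^sup>2 - (l * y)\<^sup>2) powr (s - 1) = l powr (2 * (s - 1)) * (1 - y\<^sup>2) powr (s - 1)"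
      using pw[OF y2] by simp
    then have "(l\<^sup>2 - (l * y)\<^sup>2) powr (s - 1) * riesz_diff (l * y) = l powr (2 * (s - 1)) * l powr (1 - 2 * s) * ((1 - y\<^sup>2) powr (s - 1) * R.riesz_diff y)"
      unfolding RP by simp
    also have "l powr (2 * (s - 1)) * l powr (1 - 2 * s) = l powr (- 1)" by (simp add: powr_add[symmetric])
    finally show ?thesis using True m by simp
  next
    case False
    then have "l * y \<notin> {-l<..<l}" unfolding mem .
    with False show ?thesis by simp
  qed
  show "set_integrable lborel {-l<..<l} (\<lambda>y. (l\<^sup>2 - y\<^sup>2) powr (s - 1) * riesz_diff y)"
  proof -
    have "integrable lborel (\<lambda>y. indicator {-l<..<l} (0 + l * y) *\<^sub>R ((l\<^sup>2 - (0 + l * y)\<^sup>2) powr (s - 1) * riesz_diff (0 + l * y)))"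
      unfolding add_0 fac using R.interval_identity(1)[unfolded set_integrable_def] by (rule integrable_mult_right)
    then show ?thesis unfolding set_integrable_def
      using lborel_integrable_real_affine_iff[of l "\<lambda>y. indicator {-l<..<l} y *\<^sub>R ((l\<^sup>2 - y\<^sup>2) powr (s - 1) * riesz_diff y)" 0] l by simp
  qed
  have fac2: "indicator {l<..} (l * z) *\<^sub>R (((l * z)\<^sup>2 - l\<^sup>2) powr (- s) * (\<phi> (l * z) - \<phi> (- (l * z))))
    = l powr (- 2 * s) * (indicator {1<..} z *\<^sub>R ((z\<^sup>2 - 1) powr (- s) * (\<phi> (l * z) - \<phi> (l * - z))))" for z
  proof (cases "z > 1")
    case True
    then have z2: "z\<^sup>2 - 1 \<ge> 0" by simp
    have "(l * z)\<^sup>2 - l\<^sup>2 = l\<^sup>2 * (z\<^sup>2 - 1)" by (simp add: power_mult_distrib right_diff_distrib)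
    then have "((l * z)\<^sup>2 - l\<^sup>2) powr (- s) = l powr (- 2 * s) * (z\<^sup>2 - 1) powr (- s)"
      using pw[OF z2, of "- s"] by simp
    then show ?thesis using True l by simp
  qed (use l in auto)
  have "(LINT y:{-l<..<l}|lborel. (l\<^sup>2 - y\<^sup>2) powr (s - 1) * riesz_diff y) = l * (\<integral>y. l powr (- 1) * (indicator {-1<..<1} y *\<^sub>R ((1 - y\<^sup>2) powr (s - 1) * R.riesz_diff y)) \<partial>lborel)"
    unfolding set_lebesgue_integral_def fac[symmetric]
    using lborel_integral_real_affine[of l "\<lambda>y. indicator {-l<..<l} y *\<^sub>R ((l\<^sup>2 - y\<^sup>2) powr (s - 1) * riesz_diff y)" 0] l by simp
  also have "\<dots> = l * l powr (- 1) * (LINT y:{-1<..<1}|lborel. (1 - y\<^sup>2) powr (s - 1) * R.riesz_diff y)"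
    unfolding set_lebesgue_integral_def by simp
  also have "l * l powr (- 1) = 1" using l by (simp add: powr_minus)
  also have "1 * (LINT y:{-1<..<1}|lborel. (1 - y\<^sup>2) powr (s - 1) * R.riesz_diff y) =
     cosh_integral s * (LINT z:{1<..}|lborel. (z\<^sup>2 - 1) powr (- s) * (\<phi> (l * z) - \<phi> (l * - z)))"
    unfolding R.interval_identity(2) by simp
  finally have 1: "(LINT y:{-l<..<l}|lborel. (l\<^sup>2 - y\<^sup>2) powr (s - 1) * riesz_diff y) =
     cosh_integral s * (LINT z:{1<..}|lborel. (z\<^sup>2 - 1) powr (- s) * (\<phi> (l * z) - \<phi> (l * - z)))" .
  have "(LINT z:{l<..}|lborel. (z\<^sup>2 - l\<^sup>2) powr (- s) * (\<phi> z - \<phi> (- z)))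
    = l * (\<integral>z. l powr (- 2 * s) * (indicator {1<..} z *\<^sub>R ((z\<^sup>2 - 1) powr (- s) * (\<phi> (l * z) - \<phi> (l * - z)))) \<partial>lborel)"
    unfolding set_lebesgue_integral_def fac2[symmetric]
    using lborel_integral_real_affine[of l "\<lambda>z. indicator {l<..} z *\<^sub>R ((z\<^sup>2 - l\<^sup>2) powr (- s) * (\<phi> z - \<phi> (- z)))" 0] l by simp
  also have "\<dots> = l * l powr (- 2 * s) * (LINT z:{1<..}|lborel. (z\<^sup>2 - 1) powr (- s) * (\<phi> (l * z) - \<phi> (l * - z)))"
    unfolding set_lebesgue_integral_def by simp
  also have "l * l powr (- 2 * s) = l powr (1 - 2 * s)" using l by (simp add: powr_diff powr_minus divide_inverse)
  finally have 2: "l powr (2 * s - 1) * (LINT z:{l<..}|lborel. (z\<^sup>2 - l\<^sup>2) powr (- s) * (\<phi> z - \<phi> (- z)))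
    = l powr (2 * s - 1) * l powr (1 - 2 * s) * (LINT z:{1<..}|lborel. (z\<^sup>2 - 1) powr (- s) * (\<phi> (l * z) - \<phi> (l * - z)))" by simp
  have "l powr (2 * s - 1) * l powr (1 - 2 * s) = 1" using l by (simp add: powr_add[symmetric])
  then show "(LINT y:{-l<..<l}|lborel. (l\<^sup>2 - y\<^sup>2) powr (s - 1) * riesz_diff y)
       = cosh_integral s * l powr (2 * s - 1) * (LINT z:{l<..}|lborel. (z\<^sup>2 - l\<^sup>2) powr (- s) * (\<phi> z - \<phi> (- z)))"
    unfolding 1 mult.assoc 2 by simp
qed

text \<open>The second difference of g at step t is minus the integral of \<phi>(y+r) - \<phi>(y-r)
  over 0 < r < t. After exchanging the integrals, the tail of t^(-1-2s) beyond r contributes r^(-2s)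
  / (2s). Using Fubini for this integration by parts avoids boundary terms at 0 and at
  infinity.\<close>

lemma riesz_diff_by_parts:
  assumes g: "\<And>x. (g has_real_derivative \<phi> x) (at x)"
  shows "(LINT t:{0<..}|lborel. (2 * g y - g (y + t) - g (y - t)) * t powr (- 1 - 2 * s)) = - (riesz_diff y / (2 * s))"
proof -
  define \<psi> where "\<psi> = (\<lambda>\<sigma>. \<phi> (y + \<sigma>) - \<phi> (y - \<sigma>))"
  have \<psi>_borel[measurable]: "\<psi> \<in> borel_measurable borel" unfolding \<psi>_def by measurable
  define J where "J = (\<lambda>\<sigma> t. (if 0 < \<sigma> \<and> \<sigma> < t then \<psi> \<sigma> * t powr (- 1 - 2 * s) else 0))"
  have J: "J \<sigma> t = indicator {0<..} \<sigma> * \<psi> \<sigma> * (indicator {\<sigma><..} t *\<^sub>R t powr (- 1 - 2 * s))" for \<sigma> t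
    by (auto simp: J_def indicator_def)
  have inner: "(\<integral>t. J \<sigma> t \<partial>lborel) = indicator {0<..} \<sigma> *\<^sub>R (\<psi> \<sigma> * \<sigma> powr (- 2 * s)) / (2 * s)" for \<sigma>
    using set_integrable_powr_Ioi_tail(2)[of \<sigma> s] s
    unfolding J set_lebesgue_integral_def by (cases "\<sigma> > 0") auto
  have joint: "integrable (lborel \<Otimes>\<^sub>M lborel) (\<lambda>(\<sigma>, t). J \<sigma> t)"
  proof (rule lborel_pair.Fubini_integrable)
    show "(\<lambda>(\<sigma>, t). J \<sigma> t) \<in> borel_measurable (lborel \<Otimes>\<^sub>M lborel)" unfolding J_def by measurable
    have "(\<integral>t. norm (J \<sigma> t) \<partial>lborel) = norm (indicator {0<..} \<sigma> *\<^sub>R (\<psi> \<sigma> * \<sigma> powr (- 2 * s))) / (2 * s)" for \<sigma>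
    proof -
      have "norm (J \<sigma> t) = indicator {0<..} \<sigma> * \<bar>\<psi> \<sigma>\<bar> * (indicator {\<sigma><..} t *\<^sub>R t powr (- 1 - 2 * s))" for t
        by (auto simp: J abs_mult)
      then show ?thesis
        using set_integrable_powr_Ioi_tail(2)[of \<sigma> s] s
        unfolding set_lebesgue_integral_def by (cases "\<sigma> > 0") (auto simp: abs_mult)
    qed
    then show "integrable lborel (\<lambda>\<sigma>. \<integral>t. norm ((\<lambda>(\<sigma>, t). J \<sigma> t) (\<sigma>, t)) \<partial>lborel)"
      using riesz_diff_integrable[of y, unfolded set_integrable_def, THEN integrable_norm] by (simp add: \<psi>_def)
    show "AE \<sigma> in lborel. integrable lborel (\<lambda>t. (\<lambda>(\<sigma>, t). J \<sigma> t) (\<sigma>, t))"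
    proof (intro AE_I2)
      fix \<sigma> :: real
      show "integrable lborel (\<lambda>t. (\<lambda>(\<sigma>, t). J \<sigma> t) (\<sigma>, t))"
        using set_integrable_powr_Ioi_tail(1)[of \<sigma> s] s
        by (cases "\<sigma> > 0") (auto simp: J set_integrable_def)
    qed
  qed
  have outer: "(\<integral>\<sigma>. J \<sigma> t \<partial>lborel) = - (indicator {0<..} t *\<^sub>R ((2 * g y - g (y + t) - g (y - t)) * t powr (- 1 - 2 * s)))" for t
  proof (cases "t > 0")
    case True
    have der: "((\<lambda>\<sigma>. g (y + \<sigma>) + g (y - \<sigma>)) has_real_derivative \<psi> x) (at x)" for x
    proof -
      have "((\<lambda>\<sigma>. y + \<sigma>) has_real_derivative 1) (at x)" "((\<lambda>\<sigma>. y - \<sigma>) has_real_derivative - 1) (at x)"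
        by (auto intro!: derivative_eq_intros)
      from DERIV_add[OF DERIV_chain2[OF g this(1)] DERIV_chain2[OF g this(2)]] show ?thesis
        by (simp add: \<psi>_def)
    qed
    have cont: "continuous_on UNIV \<psi>" unfolding \<psi>_def
      by (intro continuous_on_diff continuous_on_compose2[OF continuous_phi[of UNIV]] continuous_on_add continuous_on_const continuous_on_id subset_UNIV)
    have ftc: "(\<integral>\<sigma>. indicator {0..t} \<sigma> *\<^sub>R \<psi> \<sigma> \<partial>lborel) = (g (y + t) + g (y - t)) - (g (y + 0) + g (y - 0))"
    proof (rule integral_FTC_Icc)
      fix x :: real
      show "((\<lambda>\<sigma>. g (y + \<sigma>) + g (y - \<sigma>)) has_vector_derivative \<psi> x) (at x within {0..t})"
        using der[of x] unfolding has_real_derivative_iff_has_vector_derivative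
        by (rule has_vector_derivative_at_within)
    next
      show "continuous_on {0..t} \<psi>" using cont by (rule continuous_on_subset) simp
    qed (use True in auto)
    have "(\<integral>\<sigma>. J \<sigma> t \<partial>lborel) = (\<integral>\<sigma>. (indicator {0..t} \<sigma> *\<^sub>R \<psi> \<sigma>) * t powr (- 1 - 2 * s) \<partial>lborel)"
    proof (rule integral_cong_AE)
      show "(\<lambda>\<sigma>. J \<sigma> t) \<in> borel_measurable lborel" unfolding J_def by measurable
      show "AE \<sigma> in lborel. J \<sigma> t = (indicator {0..t} \<sigma> *\<^sub>R \<psi> \<sigma>) * t powr (- 1 - 2 * s)"
        using AE_lborel_singleton[of "0::real"] AE_lborel_singleton[of t]
        by eventually_elim (auto simp: J_def indicator_def less_le)
    qed measurable
    also have "\<dots> = ((g (y + t) + g (y - t)) - (g (y + 0) + g (y - 0))) * t powr (- 1 - 2 * s)"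
      by (simp only: integral_mult_left_zero ftc)
    finally show ?thesis using True by (simp add: algebra_simps)
  next
    case False
    then have "J \<sigma> t = 0" for \<sigma> by (auto simp: J_def)
    with False show ?thesis by simp
  qed
  have "(\<integral>t. (\<integral>\<sigma>. J \<sigma> t \<partial>lborel) \<partial>lborel) = (\<integral>\<sigma>. (\<integral>t. J \<sigma> t \<partial>lborel) \<partial>lborel)"
    by (rule lborel_pair.Fubini_integral[OF joint])
  then show ?thesis
    unfolding outer inner riesz_diff_def set_lebesgue_integral_def \<psi>_def by simp
qed

end

lemma integrable_radial:
  fixes \<phi> :: "real \<Rightarrow> real"
  assumes [measurable]: "\<phi> \<in> borel_measurable borel"
    and i: "set_integrable lborel {0<..} (\<lambda>\<tau>. \<phi> \<tau> * \<tau> ^ (DIM('a) - 1))"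
  shows "integrable lborel (\<lambda>x::'a::euclidean_space. \<phi> (norm x))"
proof (rule integrableI_bounded)
  let ?I = "\<integral>\<^sup>+\<tau>. ennreal (norm (indicator {0<..} \<tau> *\<^sub>R (\<phi> \<tau> * \<tau> ^ (DIM('a) - 1)))) \<partial>lborel"
  have fin: "?I < \<infinity>" using i unfolding set_integrable_def integrable_iff_bounded by simp
  have "(\<integral>\<^sup>+x. ennreal (norm (\<phi> (norm (x::'a)))) \<partial>lborel) =
     (\<integral>\<^sup>+\<theta>. (\<integral>\<^sup>+\<tau>. ennreal (norm (\<phi> (norm (\<tau> *\<^sub>R (\<theta>::'a))))) * ennreal (\<tau> ^ (DIM('a) - 1)) * indicator {0<..} \<tau> \<partial>lborel) \<partial>sphere_measure)"
    by (subst nn_integral_polar) auto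
  also have "\<dots> = (\<integral>\<^sup>+\<theta>. ?I \<partial>(sphere_measure :: 'a measure))"
  proof (rule nn_integral_cong_AE, use AE_sphere_measure_norm in eventually_elim)
    fix \<theta> :: 'a assume "norm \<theta> = 1"
    then show "(\<integral>\<^sup>+\<tau>. ennreal (norm (\<phi> (norm (\<tau> *\<^sub>R \<theta>)))) * ennreal (\<tau> ^ (DIM('a) - 1)) * indicator {0<..} \<tau> \<partial>lborel) = ?I"
      by (intro nn_integral_cong) (auto simp: abs_mult ennreal_mult split: split_indicator)
  qed
  also have "\<dots> = ?I * emeasure (sphere_measure :: 'a measure) UNIV" by simp
  also have "\<dots> < \<infinity>"
    using fin sphere.emeasure_finite[where A=UNIV and 'a='a]
    by (simp only: ennreal_mult_less_top infinity_ennreal_def less_top) simp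
  finally show "(\<integral>\<^sup>+x. ennreal (norm (\<phi> (norm (x::'a)))) \<partial>lborel) < \<infinity>" .
qed measurable

text \<open>The exponents are taken relative to the dimension, so that a > 0 expresses integrability
  at the origin and b < 0 integrability at infinity in every dimension.\<close>

lemma integrable_radial_bound:
  fixes f :: "'a::euclidean_space \<Rightarrow> real" and a b B :: real
  assumes [measurable]: "f \<in> borel_measurable borel" and a: "a > 0" and b: "b < 0"
    and le1: "\<And>x. x \<noteq> 0 \<Longrightarrow> norm x \<le> 1 \<Longrightarrow> \<bar>f x\<bar> \<le> B * norm x powr (a - DIM('a))"
    and ge1: "\<And>x. 1 \<le> norm x \<Longrightarrow> \<bar>f x\<bar> \<le> B * norm x powr (b - DIM('a))"
  shows "integrable lborel f"
proof -
  define \<phi> where "\<phi> = (\<lambda>t::real. B * (if t \<le> 1 then t powr (a - DIM('a)) else t powr (b - DIM('a))))"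
  have [measurable]: "\<phi> \<in> borel_measurable borel" unfolding \<phi>_def by measurable
  have pw: "t powr (c - DIM('a)) * t ^ (DIM('a) - 1) = t powr (c - 1)" if "t > 0" for t c :: real
  proof -
    have "t ^ (DIM('a) - 1) = t powr (real (DIM('a) - 1))" by (rule powr_realpow[OF that, symmetric])
    also have "real (DIM('a) - 1) = real (DIM('a)) - 1" 
      using DIM_positive[where 'a='a] by (metis One_nat_def Suc_leI of_nat_1 of_nat_diff)
    finally show ?thesis using that by (simp add: powr_add[symmetric])
  qed
  have \<phi>1: "\<phi> t * t ^ (DIM('a) - 1) = B * t powr (a - 1)" if "0 < t" "t \<le> 1" for t
    using that pw[of t a] by (simp add: \<phi>_def mult.assoc)
  have \<phi>2: "\<bar>\<phi> t * t ^ (DIM('a) - 1)\<bar> \<le> \<bar>B\<bar> * t powr (b - 1)" if "1 \<le> t" for t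
    using that pw[of t b] pw[of t a] by (cases "t = 1") (simp_all add: \<phi>_def mult.assoc abs_mult)
  have "set_integrable lborel {0<..} (\<lambda>\<tau>. \<phi> \<tau> * \<tau> ^ (DIM('a) - 1))"
  proof (rule set_integrable_Ioi_powr_bound[where a="a - 1" and b="b - 1" and B="\<bar>B\<bar>"])
    fix t :: real assume "0 < t" "t \<le> 1"
    then show "\<bar>\<phi> t * t ^ (DIM('a) - 1)\<bar> \<le> \<bar>B\<bar> * t powr (a - 1)"
      by (simp only: \<phi>1 abs_mult) simp
  qed (use a b \<phi>2 in auto)
  then have "integrable lborel (\<lambda>x::'a. \<phi> (norm x))" by (rule integrable_radial[rotated]) measurable
  then show ?thesis
  proof (rule Bochner_Integration.integrable_bound)
    show "AE x in lborel. norm (f x) \<le> norm (\<phi> (norm x))"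
      using AE_lborel_singleton[of "0::'a"]
    proof eventually_elim
      case (elim x)
      have "\<bar>f x\<bar> \<le> \<phi> (norm x)"
      proof (cases "norm x \<le> 1")
        case True then show ?thesis using le1[of x] elim by (simp add: \<phi>_def)
      next
        case False then show ?thesis using ge1[of x] by (simp add: \<phi>_def)
      qed
      then show ?case by simp
    qed
  qed measurable
qed

section \<open>Angular averages over a family of cones\<close>

lemma sigma_finite_radial_measure: "sigma_finite_measure (radial_measure TYPE('a::euclidean_space))"
  unfolding radial_measure_def
  by (subst sigma_finite_measure.sigma_finite_iff_density_finite[OF sigma_finite_lborel])
     (auto simp: ennreal_mult_eq_top_iff indicator_def)

lemma sets_radial_measure[measurable_cong]: "sets (radial_measure TYPE('a::euclidean_space)) = sets borel"
  by (simp add: radial_measure_def)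

lemma integral_polar:
  fixes f :: "'a::euclidean_space \<Rightarrow> real"
  assumes f: "integrable lborel f"
  shows "(\<integral>x. f x \<partial>lborel) =
    (\<integral>\<theta>. (LINT \<tau>:{0<..}|lborel. f (\<tau> *\<^sub>R \<theta>) * \<tau> ^ (DIM('a) - 1)) \<partial>sphere_measure)"
proof -
  interpret R: sigma_finite_measure "radial_measure TYPE('a)" by (rule sigma_finite_radial_measure)
  interpret PS: pair_sigma_finite "sphere_measure :: 'a measure" "radial_measure TYPE('a)" ..
  have f_borel[measurable]: "f \<in> borel_measurable borel" using f by simp
  have i: "integrable (sphere_measure \<Otimes>\<^sub>M radial_measure TYPE('a)) (\<lambda>(\<theta>::'a, \<tau>). f (\<tau> *\<^sub>R \<theta>))"
  proof -
    have "integrable (distr (sphere_measure \<Otimes>\<^sub>M radial_measure TYPE('a)) borel (\<lambda>(\<theta>::'a, \<tau>). \<tau> *\<^sub>R \<theta>)) f"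
      unfolding distr_polar by (rule f)
    then show ?thesis by (subst (asm) integrable_distr_eq) (auto simp: case_prod_beta')
  qed
  have "(\<integral>x. f x \<partial>lborel) = (\<integral>x. f x \<partial>distr (sphere_measure \<Otimes>\<^sub>M radial_measure TYPE('a)) borel (\<lambda>(\<theta>, \<tau>). \<tau> *\<^sub>R \<theta>))"
    unfolding distr_polar ..
  also have "\<dots> = (\<integral>p. (case p of (\<theta>::'a, \<tau>) \<Rightarrow> f (\<tau> *\<^sub>R \<theta>)) \<partial>(sphere_measure \<Otimes>\<^sub>M radial_measure TYPE('a)))"
    by (subst integral_distr) (auto simp: case_prod_beta')
  also have "\<dots> = (\<integral>\<theta>. (\<integral>\<tau>. f (\<tau> *\<^sub>R \<theta>) \<partial>radial_measure TYPE('a)) \<partial>sphere_measure)"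
    using PS.integral_fst[OF i] by simp
  also have "\<dots> = (\<integral>\<theta>. (LINT \<tau>:{0<..}|lborel. f (\<tau> *\<^sub>R \<theta>) * \<tau> ^ (DIM('a) - 1)) \<partial>sphere_measure)"
  proof (rule Bochner_Integration.integral_cong[OF refl])
    fix \<theta> :: 'a
    have rd: "radial_measure TYPE('a) = density lborel (\<lambda>\<tau>. ennreal (indicator {0<..} \<tau> * \<tau> ^ (DIM('a) - 1)))"
      unfolding radial_measure_def by (intro density_cong) (auto simp: indicator_def)
    show "(\<integral>\<tau>. f (\<tau> *\<^sub>R \<theta>) \<partial>radial_measure TYPE('a)) = (LINT \<tau>:{0<..}|lborel. f (\<tau> *\<^sub>R \<theta>) * \<tau> ^ (DIM('a) - 1))"
      unfolding set_lebesgue_integral_def rd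
      by (subst integral_density)
        (auto intro!: AE_I2 Bochner_Integration.integral_cong simp: indicator_def)
  qed
  finally show ?thesis .
qed

text \<open>At x = l^2 with l > 0 this is l^(2s-1), the factor carried by a chord of half-length l.
  The squared half-length of the chord through z in the unit direction \<theta> is 1 - |z|^2 + (z .
  \<theta>)^2; it is negative when the line misses the closed ball, and there the kernel is 0 even
  for s <= 1/2, because \<open>0 powr a = 0\<close> for every exponent.\<close>

definition cone_kernel :: "real \<Rightarrow> real \<Rightarrow> real" where
  "cone_kernel s x = max 0 x powr (s - 1 / 2)"

lemma cone_kernel_nonneg[simp]: "cone_kernel s x \<ge> 0"
  and cone_kernel_neg: "x \<le> 0 \<Longrightarrow> cone_kernel s x = 0"
  by (auto simp: cone_kernel_def max_def)

lemma cone_kernel_borel[measurable]: "cone_kernel s \<in> borel_measurable borel"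
  unfolding cone_kernel_def[abs_def] by measurable

text \<open>The density of \<open>sphere_measure\<close> as a function of a scalar, so that it can
  be evaluated at |e . h| as well as at the norm of h.\<close>

definition shell_weight :: "nat \<Rightarrow> real \<Rightarrow> real" where
  "shell_weight n N = (if 1 \<le> N \<and> N < exp 1 then 1 / N ^ n else 0)"

lemma shell_weight_borel[measurable]: "shell_weight n \<in> borel_measurable borel"
  unfolding shell_weight_def[abs_def] by measurable

lemma shell_weight_nonneg[simp]: "shell_weight n N \<ge> 0" by (simp add: shell_weight_def)

lemma nn_integral_even:
  fixes f :: "real \<Rightarrow> ennreal"
  assumes [measurable]: "f \<in> borel_measurable borel" and even: "\<And>x. f (- x) = f x"
  shows "(\<integral>\<^sup>+x. f x \<partial>lborel) = 2 * (\<integral>\<^sup>+x\<in>{0<..}. f x \<partial>lborel)"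
proof -
  have "(\<integral>\<^sup>+x. f x \<partial>lborel) = (\<integral>\<^sup>+x. f x * indicator {0<..} x + f x * indicator {..<0} x \<partial>lborel)"
    using AE_lborel_singleton[of "0::real"]
    by (intro nn_integral_cong_AE) (auto elim!: eventually_mono split: split_indicator)
  also have "\<dots> = (\<integral>\<^sup>+x\<in>{0<..}. f x \<partial>lborel) + (\<integral>\<^sup>+x\<in>{..<0}. f x \<partial>lborel)"
    by (rule nn_integral_add) auto
  also have "(\<integral>\<^sup>+x\<in>{..<0}. f x \<partial>lborel) = (\<integral>\<^sup>+x\<in>{0<..}. f x \<partial>lborel)"
    by (subst nn_integral_real_affine[where c="-1" and t=0])
       (auto simp: even intro!: nn_integral_cong split: split_indicator)
  finally show ?thesis by (simp add: mult_2)
qed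

text \<open>Along a line at distance b from the origin the norm is N = sqrt(b^2 + r^2), and dN = (r
  / N) dr absorbs the factor |e . \<theta>|. The substitution only reaches N > b, but the kernel
  vanishes for N <= b because \<rho> >= 1, so the range extends to the whole half-line.\<close>

lemma cone_line_substitution:
  fixes b \<rho> s :: real
  assumes b: "b \<ge> 0" and \<rho>: "\<rho> \<ge> 1"
  shows "(\<integral>\<^sup>+\<tau>. ennreal (shell_weight n (sqrt (b\<^sup>2 + \<tau>\<^sup>2)) * (cone_kernel s (1 - \<rho>\<^sup>2 * b\<^sup>2 / (b\<^sup>2 + \<tau>\<^sup>2)) * (\<bar>\<tau>\<bar> / sqrt (b\<^sup>2 + \<tau>\<^sup>2)))) \<partial>lborel)
    = (\<integral>\<^sup>+\<tau>. ennreal (shell_weight n \<bar>\<tau>\<bar> * cone_kernel s (1 - \<rho>\<^sup>2 * b\<^sup>2 / \<tau>\<^sup>2)) \<partial>lborel)"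
proof -
  let ?f = "\<lambda>N. shell_weight n N * cone_kernel s (1 - \<rho>\<^sup>2 * b\<^sup>2 / N\<^sup>2)"
  let ?g = "\<lambda>\<tau>. sqrt (b\<^sup>2 + \<tau>\<^sup>2)"
  have im: "?g ` {0<..} = {b<..}"
  proof (intro equalityI subsetI)
    fix N assume "N \<in> ?g ` {0<..}"
    then obtain \<tau> where "\<tau> > 0" "N = ?g \<tau>" by auto
    then show "N \<in> {b<..}" using b by (auto intro!: real_less_rsqrt)
  next
    fix N assume N: "N \<in> {b<..}"
    then have "b\<^sup>2 < N\<^sup>2" using b by (simp add: power_strict_mono)
    then have "sqrt (N\<^sup>2 - b\<^sup>2) \<in> {0<..}" "N = ?g (sqrt (N\<^sup>2 - b\<^sup>2))" using N b by auto
    then show "N \<in> ?g ` {0<..}" by blast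
  qed
  have pos: "b\<^sup>2 + x\<^sup>2 > 0" if "x > 0" for x :: real using that by (simp add: add_nonneg_pos)
  have "(\<integral>\<^sup>+\<tau>. ennreal (shell_weight n (?g \<tau>) * (cone_kernel s (1 - \<rho>\<^sup>2 * b\<^sup>2 / (b\<^sup>2 + \<tau>\<^sup>2)) * (\<bar>\<tau>\<bar> / ?g \<tau>))) \<partial>lborel)
    = 2 * (\<integral>\<^sup>+\<tau>\<in>{0<..}. ennreal (shell_weight n (?g \<tau>) * (cone_kernel s (1 - \<rho>\<^sup>2 * b\<^sup>2 / (b\<^sup>2 + \<tau>\<^sup>2)) * (\<bar>\<tau>\<bar> / ?g \<tau>))) \<partial>lborel)"
    by (rule nn_integral_even) auto
  also have "(\<integral>\<^sup>+\<tau>\<in>{0<..}. ennreal (shell_weight n (?g \<tau>) * (cone_kernel s (1 - \<rho>\<^sup>2 * b\<^sup>2 / (b\<^sup>2 + \<tau>\<^sup>2)) * (\<bar>\<tau>\<bar> / ?g \<tau>))) \<partial>lborel)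
     = (\<integral>\<^sup>+\<tau>\<in>{0<..}. ennreal (\<bar>\<tau> / ?g \<tau>\<bar> * ?f (?g \<tau>)) \<partial>lborel)"
  proof (rule nn_integral_cong)
    fix \<tau> :: real
    have "(?g \<tau>)\<^sup>2 = b\<^sup>2 + \<tau>\<^sup>2" by simp
    then show "ennreal (shell_weight n (?g \<tau>) * (cone_kernel s (1 - \<rho>\<^sup>2 * b\<^sup>2 / (b\<^sup>2 + \<tau>\<^sup>2)) * (\<bar>\<tau>\<bar> / ?g \<tau>))) * indicator {0<..} \<tau>
      = ennreal (\<bar>\<tau> / ?g \<tau>\<bar> * ?f (?g \<tau>)) * indicator {0<..} \<tau>"
      by (simp only: abs_divide) (simp add: mult_ac)
  qed
  also have "\<dots> = (\<integral>\<^sup>+N\<in>?g ` {0<..}. ennreal (?f N) \<partial>lborel)"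
  proof (rule set_nn_integral_substitution_real)
    show "?g ` {0<..} \<in> sets borel" unfolding im by simp
    show "(?g has_real_derivative x / ?g x) (at x)" if "x \<in> {0<..}" for x
      using pos[of x] that by (auto intro!: derivative_eq_intros simp: field_simps)
    show "inj_on ?g {0<..}" by (auto simp: inj_on_def)
  qed auto
  also have "\<dots> = (\<integral>\<^sup>+N\<in>{0<..}. ennreal (?f N) \<partial>lborel)"
  proof (rule nn_integral_cong)
    fix N :: real
    have "cone_kernel s (1 - \<rho>\<^sup>2 * b\<^sup>2 / N\<^sup>2) = 0" if "0 < N" "N \<le> b"
    proof (rule cone_kernel_neg)
      have "N\<^sup>2 \<le> b\<^sup>2" using that by (intro power_mono) auto
      also have "\<dots> \<le> \<rho>\<^sup>2 * b\<^sup>2" using \<rho> by (simp add: mult_le_cancel_right1)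
      finally show "1 - \<rho>\<^sup>2 * b\<^sup>2 / N\<^sup>2 \<le> 0" using that by simp
    qed
    then show "ennreal (?f N) * indicator (?g ` {0<..}) N = ennreal (?f N) * indicator {0<..} N"
      unfolding im using b by (auto split: split_indicator)
  qed
  also have "2 * \<dots> = 2 * (\<integral>\<^sup>+\<tau>\<in>{0<..}. ennreal (shell_weight n \<bar>\<tau>\<bar> * cone_kernel s (1 - \<rho>\<^sup>2 * b\<^sup>2 / \<tau>\<^sup>2)) \<partial>lborel)"
    by (intro arg_cong[where f="\<lambda>x. 2 * x"] nn_integral_cong) (auto split: split_indicator)
  also have "\<dots> = (\<integral>\<^sup>+\<tau>. ennreal (shell_weight n \<bar>\<tau>\<bar> * cone_kernel s (1 - \<rho>\<^sup>2 * b\<^sup>2 / \<tau>\<^sup>2)) \<partial>lborel)"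
    by (rule nn_integral_even[symmetric]) auto
  finally show ?thesis .
qed

text \<open>Exchanges the spherical shell for the slab 1 <= |e . h| < exp 1, line by line parallel
  to e. In the slab form \<rho> only multiplies the component of h orthogonal to e, so a dilation
  can remove it; the sphere does not have that freedom.\<close>

lemma angular_eq_slab:
  fixes e :: "'a::euclidean_space"
  assumes e: "norm e = 1" and \<rho>: "\<rho> \<ge> (1::real)"
  shows "(\<integral>\<^sup>+\<theta>. ennreal (cone_kernel s (1 - \<rho>\<^sup>2 + \<rho>\<^sup>2 * (e \<bullet> \<theta>)\<^sup>2) * \<bar>e \<bullet> \<theta>\<bar>) \<partial>sphere_measure)
    = (\<integral>\<^sup>+h. ennreal (shell_weight DIM('a) \<bar>e \<bullet> h\<bar> * cone_kernel s (1 - \<rho>\<^sup>2 * ((norm h)\<^sup>2 - (e \<bullet> h)\<^sup>2) / (e \<bullet> h)\<^sup>2)) \<partial>lborel)"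
proof -
  let ?F = "\<lambda>h::'a. ennreal (shell_weight DIM('a) (norm h) * (cone_kernel s (1 - \<rho>\<^sup>2 + \<rho>\<^sup>2 * (e \<bullet> sgn h)\<^sup>2) * \<bar>e \<bullet> sgn h\<bar>))"
  let ?H = "\<lambda>h::'a. ennreal (shell_weight DIM('a) \<bar>e \<bullet> h\<bar> * cone_kernel s (1 - \<rho>\<^sup>2 * ((norm h)\<^sup>2 - (e \<bullet> h)\<^sup>2) / (e \<bullet> h)\<^sup>2))"
  have e0: "e \<noteq> 0" using e by auto
  have ee: "e \<bullet> e = 1" using e by (simp add: norm_eq_sqrt_inner)
  have "(\<integral>\<^sup>+\<theta>. ennreal (cone_kernel s (1 - \<rho>\<^sup>2 + \<rho>\<^sup>2 * (e \<bullet> \<theta>)\<^sup>2) * \<bar>e \<bullet> \<theta>\<bar>) \<partial>sphere_measure) = (\<integral>\<^sup>+h. ?F h \<partial>lborel)"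
    by (subst nn_integral_sphere_measure)
       (auto intro!: nn_integral_cong simp: shell_weight_def shell_def ennreal_mult[symmetric] split: split_indicator)
  also have "\<dots> = 1 * (\<integral>\<^sup>+h. ?H h \<partial>lborel)"
  proof (rule nn_integral_lines_cong[OF _ _ e0])
    fix y :: 'a assume y: "y \<bullet> e = 0"
    define b where "b = norm y"
    have n: "norm (y + \<tau> *\<^sub>R e) = sqrt (b\<^sup>2 + \<tau>\<^sup>2)" for \<tau>
      unfolding norm_eq_sqrt_inner b_def using y ee
      by (simp add: inner_add_left inner_add_right inner_commute power2_eq_square)
    have n2: "(norm (y + \<tau> *\<^sub>R e))\<^sup>2 = b\<^sup>2 + \<tau>\<^sup>2" for \<tau> unfolding n by simp
    have i: "e \<bullet> (y + \<tau> *\<^sub>R e) = \<tau>" for \<tau> using y ee by (simp add: inner_add_right inner_commute)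
    have isg: "e \<bullet> sgn (y + \<tau> *\<^sub>R e) = \<tau> / sqrt (b\<^sup>2 + \<tau>\<^sup>2)" for \<tau>
      unfolding sgn_div_norm inner_scaleR_right i n by (simp add: divide_inverse mult.commute)
    have F: "?F (y + \<tau> *\<^sub>R e) = ennreal (shell_weight DIM('a) (sqrt (b\<^sup>2 + \<tau>\<^sup>2)) * (cone_kernel s (1 - \<rho>\<^sup>2 * b\<^sup>2 / (b\<^sup>2 + \<tau>\<^sup>2)) * (\<bar>\<tau>\<bar> / sqrt (b\<^sup>2 + \<tau>\<^sup>2))))" for \<tau>
    proof (cases "b\<^sup>2 + \<tau>\<^sup>2 = 0")
      case True
      then show ?thesis unfolding n isg by (simp add: shell_weight_def)
    next
      case False
      then have p: "b\<^sup>2 + \<tau>\<^sup>2 > 0" by (smt (verit) zero_le_power2)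
      have eq: "1 - \<rho>\<^sup>2 + \<rho>\<^sup>2 * (\<tau> / sqrt (b\<^sup>2 + \<tau>\<^sup>2))\<^sup>2 = 1 - \<rho>\<^sup>2 * b\<^sup>2 / (b\<^sup>2 + \<tau>\<^sup>2)"
      proof -
        define D where "D = b\<^sup>2 + \<tau>\<^sup>2"
        have D: "D > 0" "\<tau>\<^sup>2 = D - b\<^sup>2" using p by (simp_all add: D_def)
        show ?thesis unfolding D_def[symmetric] power_divide D(2) using D(1)
          by (simp add: diff_divide_distrib right_diff_distrib)
      qed
      have ab: "\<bar>\<tau> / sqrt (b\<^sup>2 + \<tau>\<^sup>2)\<bar> = \<bar>\<tau>\<bar> / sqrt (b\<^sup>2 + \<tau>\<^sup>2)"
        using p by (simp add: abs_divide)
      show ?thesis unfolding n isg eq ab ..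
    qed
    have H: "?H (y + \<tau> *\<^sub>R e) = ennreal (shell_weight DIM('a) \<bar>\<tau>\<bar> * cone_kernel s (1 - \<rho>\<^sup>2 * b\<^sup>2 / \<tau>\<^sup>2))" for \<tau>
      unfolding n2 i by simp
    show "(\<integral>\<^sup>+\<tau>. ?F (y + \<tau> *\<^sub>R e) \<partial>lborel) = 1 * (\<integral>\<^sup>+\<tau>. ?H (y + \<tau> *\<^sub>R e) \<partial>lborel)"
      unfolding F H using cone_line_substitution[of b \<rho>] \<rho> by (simp add: b_def)
  qed measurable
  finally show ?thesis by simp
qed

text \<open>In effect the orthogonal complement of e is dilated by 1 / \<rho>, which costs
  \<rho>^(1-n). This is carried out as a dilation of the whole space, with factor \<rho>^(-n),
  followed by the inverse dilation along lines parallel to e, with factor \<rho>.\<close>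

lemma slab_scaling:
  fixes e :: "'a::euclidean_space"
  assumes e: "norm e = 1" and \<rho>: "\<rho> \<ge> (1::real)"
  shows "(\<integral>\<^sup>+h. ennreal (shell_weight DIM('a) \<bar>e \<bullet> h\<bar> * cone_kernel s (1 - \<rho>\<^sup>2 * ((norm h)\<^sup>2 - (e \<bullet> h)\<^sup>2) / (e \<bullet> h)\<^sup>2)) \<partial>lborel)
    = ennreal (\<rho> / \<rho> ^ DIM('a)) * (\<integral>\<^sup>+h. ennreal (shell_weight DIM('a) \<bar>e \<bullet> h\<bar> * cone_kernel s (1 - ((norm h)\<^sup>2 - (e \<bullet> h)\<^sup>2) / (e \<bullet> h)\<^sup>2)) \<partial>lborel)"
proof -
  let ?H = "\<lambda>h::'a. ennreal (shell_weight DIM('a) \<bar>e \<bullet> h\<bar> * cone_kernel s (1 - \<rho>\<^sup>2 * ((norm h)\<^sup>2 - (e \<bullet> h)\<^sup>2) / (e \<bullet> h)\<^sup>2))"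
  let ?H' = "\<lambda>h::'a. ennreal (shell_weight DIM('a) (\<bar>e \<bullet> h\<bar> / \<rho>) * cone_kernel s (1 - \<rho>\<^sup>2 * ((norm h)\<^sup>2 - (e \<bullet> h)\<^sup>2) / (e \<bullet> h)\<^sup>2))"
  let ?H1 = "\<lambda>h::'a. ennreal (shell_weight DIM('a) \<bar>e \<bullet> h\<bar> * cone_kernel s (1 - ((norm h)\<^sup>2 - (e \<bullet> h)\<^sup>2) / (e \<bullet> h)\<^sup>2))"
  have e0: "e \<noteq> 0" using e by auto
  have ee: "e \<bullet> e = 1" using e by (simp add: norm_eq_sqrt_inner)
  have sc: "?H (0 + (1 / \<rho>) *\<^sub>R h) = ?H' h" for h
  proof -
    have "\<rho>\<^sup>2 * ((norm ((1 / \<rho>) *\<^sub>R h))\<^sup>2 - (e \<bullet> ((1 / \<rho>) *\<^sub>R h))\<^sup>2) / (e \<bullet> ((1 / \<rho>) *\<^sub>R h))\<^sup>2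
       = \<rho>\<^sup>2 * ((norm h)\<^sup>2 - (e \<bullet> h)\<^sup>2) / (e \<bullet> h)\<^sup>2"
    proof (cases "e \<bullet> h = 0")
      case False
      then show ?thesis using \<rho> by (simp add: power_divide field_simps)
    qed simp
    then show ?thesis using \<rho> by (simp add: abs_divide)
  qed
  have "(\<integral>\<^sup>+h. ?H h \<partial>lborel) = ennreal (\<bar>1 / \<rho>\<bar> ^ DIM('a)) * (\<integral>\<^sup>+h. ?H (0 + (1 / \<rho>) *\<^sub>R h) \<partial>lborel)"
    using \<rho> by (intro nn_integral_lborel_affine) auto
  also have "(\<integral>\<^sup>+h. ?H (0 + (1 / \<rho>) *\<^sub>R h) \<partial>lborel) = (\<integral>\<^sup>+h. ?H' h \<partial>lborel)"
    unfolding sc ..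
  also have "\<dots> = ennreal \<rho> * (\<integral>\<^sup>+h. ?H1 h \<partial>lborel)"
  proof (rule nn_integral_lines_cong[OF _ _ e0])
    fix y :: 'a assume y: "y \<bullet> e = 0"
    define b where "b = norm y"
    have n2: "(norm (y + \<tau> *\<^sub>R e))\<^sup>2 = b\<^sup>2 + \<tau>\<^sup>2" for \<tau>
      unfolding power2_norm_eq_inner b_def using y ee
      by (simp add: inner_add_left inner_add_right inner_commute power2_eq_square)
    have i: "e \<bullet> (y + \<tau> *\<^sub>R e) = \<tau>" for \<tau> using y ee by (simp add: inner_add_right inner_commute)
    have "(\<integral>\<^sup>+\<tau>. ?H' (y + \<tau> *\<^sub>R e) \<partial>lborel)
       = (\<integral>\<^sup>+\<tau>. ennreal (shell_weight DIM('a) (\<bar>\<tau>\<bar> / \<rho>) * cone_kernel s (1 - \<rho>\<^sup>2 * b\<^sup>2 / \<tau>\<^sup>2)) \<partial>lborel)"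
      unfolding n2 i by simp
    also have "\<dots> = ennreal \<bar>\<rho>\<bar> * (\<integral>\<^sup>+\<tau>. ennreal (shell_weight DIM('a) (\<bar>0 + \<rho> * \<tau>\<bar> / \<rho>) * cone_kernel s (1 - \<rho>\<^sup>2 * b\<^sup>2 / (0 + \<rho> * \<tau>)\<^sup>2)) \<partial>lborel)"
      using \<rho> by (intro nn_integral_real_affine) auto
    also have "(\<integral>\<^sup>+\<tau>. ennreal (shell_weight DIM('a) (\<bar>0 + \<rho> * \<tau>\<bar> / \<rho>) * cone_kernel s (1 - \<rho>\<^sup>2 * b\<^sup>2 / (0 + \<rho> * \<tau>)\<^sup>2)) \<partial>lborel)
       = (\<integral>\<^sup>+\<tau>. ?H1 (y + \<tau> *\<^sub>R e) \<partial>lborel)"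
      unfolding n2 i using \<rho> by (simp add: abs_mult power_mult_distrib)
    finally show "(\<integral>\<^sup>+\<tau>. ?H' (y + \<tau> *\<^sub>R e) \<partial>lborel) = ennreal \<rho> * (\<integral>\<^sup>+\<tau>. ?H1 (y + \<tau> *\<^sub>R e) \<partial>lborel)"
      using \<rho> by simp
  qed measurable
  also have "ennreal (\<bar>1 / \<rho>\<bar> ^ DIM('a)) * (ennreal \<rho> * (\<integral>\<^sup>+h. ?H1 h \<partial>lborel)) = ennreal (\<rho> / \<rho> ^ DIM('a)) * (\<integral>\<^sup>+h. ?H1 h \<partial>lborel)"
    using \<rho> by (simp add: mult.assoc[symmetric] ennreal_mult[symmetric] power_divide)
  finally show ?thesis .
qed

text \<open>The exponent 1 - n found here is what produces |z|^(-n) z, since the unit vector z / |z|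
  supplies the remaining power.\<close>

lemma angular_scaling:
  fixes e :: "'a::euclidean_space"
  assumes e: "norm e = 1" and \<rho>: "\<rho> \<ge> (1::real)"
  shows "(\<integral>\<^sup>+\<theta>. ennreal (cone_kernel s (1 - \<rho>\<^sup>2 + \<rho>\<^sup>2 * (e \<bullet> \<theta>)\<^sup>2) * \<bar>e \<bullet> \<theta>\<bar>) \<partial>sphere_measure)
    = ennreal (\<rho> / \<rho> ^ DIM('a)) * (\<integral>\<^sup>+\<theta>. ennreal (cone_kernel s ((e \<bullet> \<theta>)\<^sup>2) * \<bar>e \<bullet> \<theta>\<bar>) \<partial>sphere_measure)"
  using angular_eq_slab[OF e \<rho>, of s] slab_scaling[OF e \<rho>, of s] angular_eq_slab[OF e order_refl, of s] by simp

text \<open>The reflection in the hyperplane orthogonal to e - e' exchanges the two unit vectors and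
  preserves the sphere measure.\<close>

lemma nn_integral_sphere_axis:
  fixes e e' :: "'a::euclidean_space" and f :: "real \<Rightarrow> ennreal"
  assumes e: "norm e = 1" "norm e' = 1" and [measurable]: "f \<in> borel_measurable borel"
  shows "(\<integral>\<^sup>+\<theta>. f (e \<bullet> \<theta>) \<partial>sphere_measure) = (\<integral>\<^sup>+\<theta>. f (e' \<bullet> \<theta>) \<partial>sphere_measure)"
proof (cases "e = e'")
  case False
  define v where "v = e - e'"
  have v: "v \<noteq> 0" using False by (simp add: v_def)
  have ee: "e \<bullet> e = 1" "e' \<bullet> e' = 1" using e by (simp_all add: norm_eq_sqrt_inner)
  have vv: "v \<bullet> v = 2 * (v \<bullet> e)"
    unfolding v_def by (simp add: inner_diff_left inner_diff_right inner_commute ee)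
  then have ve: "v \<bullet> e \<noteq> 0" using v by auto
  have F: "e \<bullet> (\<theta> - (2 * (\<theta> \<bullet> v) / (v \<bullet> v)) *\<^sub>R v) = e' \<bullet> \<theta>" for \<theta>
  proof -
    have "(2 * (\<theta> \<bullet> v) / (v \<bullet> v)) * (e \<bullet> v) = \<theta> \<bullet> v"
      unfolding vv using ve by (simp add: inner_commute)
    then show ?thesis by (simp add: inner_diff_right) (simp add: v_def inner_diff_right inner_commute)
  qed
  have "(\<integral>\<^sup>+\<theta>. f (e \<bullet> \<theta>) \<partial>sphere_measure) = (\<integral>\<^sup>+\<theta>. f (e \<bullet> \<theta>) \<partial>distr sphere_measure borel (\<lambda>x. x - (2 * (x \<bullet> v) / (v \<bullet> v)) *\<^sub>R v))"
    unfolding distr_flip_sphere_measure[OF v] ..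
  also have "\<dots> = (\<integral>\<^sup>+\<theta>. f (e' \<bullet> \<theta>) \<partial>sphere_measure)"
    by (subst nn_integral_distr) (auto simp: F)
  finally show ?thesis .
qed simp

definition angular_const :: "real \<Rightarrow> 'a::euclidean_space itself \<Rightarrow> real" where
  "angular_const s TYPE('a) = (\<integral>\<theta>. cone_kernel s (((SOME i. i \<in> Basis) \<bullet> \<theta>)\<^sup>2) * \<bar>(SOME i. i \<in> Basis) \<bullet> \<theta>\<bar> \<partial>(sphere_measure :: 'a measure))"

lemma some_Basis: "(SOME i. i \<in> (Basis :: 'a::euclidean_space set)) \<in> Basis"
  using nonempty_Basis by (rule some_in_eq[THEN iffD2])

text \<open>The weight |x| raises the exponent from 2s - 1 to 2s, so the product stays bounded
  although the kernel alone is unbounded for s < 1/2.\<close>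

lemma cone_kernel_mult_le_1:
  assumes s: "0 < s" and x: "\<bar>x\<bar> \<le> 1"
  shows "cone_kernel s (x\<^sup>2) * \<bar>x\<bar> \<le> 1"
proof (cases "x = 0")
  case False
  have "x\<^sup>2 = \<bar>x\<bar> powr 2" using False by (simp add: powr_numeral)
  then have "(x\<^sup>2) powr (s - 1 / 2) = \<bar>x\<bar> powr (2 * (s - 1 / 2))" by (simp only: powr_powr)
  then have "cone_kernel s (x\<^sup>2) * \<bar>x\<bar> = \<bar>x\<bar> powr (2 * (s - 1 / 2)) * \<bar>x\<bar> powr 1"
    by (simp add: cone_kernel_def max_absorb2)
  also have "\<dots> = \<bar>x\<bar> powr (2 * s)" by (simp only: powr_add[symmetric]) simp
  also have "\<dots> \<le> 1" using s x by (intro powr_le1) auto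
  finally show ?thesis .
qed simp

lemma angular_integrable:
  fixes e :: "'a::euclidean_space"
  assumes e: "norm e = 1" and s: "0 < s"
  shows "integrable sphere_measure (\<lambda>\<theta>. cone_kernel s ((e \<bullet> \<theta>)\<^sup>2) * \<bar>e \<bullet> \<theta>\<bar>)"
proof (rule sphere.integrable_const_bound[where B=1])
  show "AE \<theta> in sphere_measure. norm (cone_kernel s ((e \<bullet> \<theta>)\<^sup>2) * \<bar>e \<bullet> \<theta>\<bar>) \<le> 1"
    using AE_sphere_measure_norm
  proof eventually_elim
    case (elim \<theta>)
    then have "\<bar>e \<bullet> \<theta>\<bar> \<le> 1" using Cauchy_Schwarz_ineq2[of e \<theta>] e by simp
    then show ?case using cone_kernel_mult_le_1[OF s, of "e \<bullet> \<theta>"] by (simp add: abs_mult)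
  qed
qed measurable

lemma nn_integral_angular_const:
  fixes e :: "'a::euclidean_space"
  assumes e: "norm e = 1" and s: "0 < s"
  shows "(\<integral>\<^sup>+\<theta>. ennreal (cone_kernel s ((e \<bullet> \<theta>)\<^sup>2) * \<bar>e \<bullet> \<theta>\<bar>) \<partial>sphere_measure) = ennreal (angular_const s TYPE('a))"
proof -
  let ?i = "SOME i. i \<in> (Basis :: 'a set)"
  have i: "norm ?i = 1" using some_Basis by (rule norm_Basis)
  have "(\<integral>\<^sup>+\<theta>. ennreal (cone_kernel s ((e \<bullet> \<theta>)\<^sup>2) * \<bar>e \<bullet> \<theta>\<bar>) \<partial>sphere_measure)
     = (\<integral>\<^sup>+\<theta>. ennreal (cone_kernel s ((?i \<bullet> \<theta>)\<^sup>2) * \<bar>?i \<bullet> \<theta>\<bar>) \<partial>sphere_measure)"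
    by (rule nn_integral_sphere_axis[OF e i, where f="\<lambda>x. ennreal (cone_kernel s (x\<^sup>2) * \<bar>x\<bar>)"]) measurable
  also have "\<dots> = ennreal (angular_const s TYPE('a))"
    unfolding angular_const_def by (rule nn_integral_eq_integral[OF angular_integrable[OF i s]]) simp
  finally show ?thesis .
qed

text \<open>If the constant vanished, almost every direction would be orthogonal to one axis, so by
  polar coordinates the complement of a hyperplane would be null. That complement and a translate of
  it cover the space, which has positive measure.\<close>

lemma angular_const_pos:
  assumes s: "0 < s" shows "angular_const s TYPE('a::euclidean_space) > 0"
proof (rule ccontr)
  assume "\<not> angular_const s TYPE('a) > 0"
  then have z: "ennreal (angular_const s TYPE('a)) = 0" by (simp add: ennreal_neg)
  let ?e = "SOME i. i \<in> (Basis :: 'a set)"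
  have e: "norm ?e = 1" using some_Basis by (rule norm_Basis)
  have ee: "?e \<bullet> ?e = 1" using e by (simp add: norm_eq_sqrt_inner)
  have "(\<integral>\<^sup>+\<theta>. ennreal (cone_kernel s ((?e \<bullet> \<theta>)\<^sup>2) * \<bar>?e \<bullet> \<theta>\<bar>) \<partial>sphere_measure) = 0"
    unfolding nn_integral_angular_const[OF e s] by (rule z)
  then have "AE \<theta> in sphere_measure. ennreal (cone_kernel s ((?e \<bullet> \<theta>)\<^sup>2) * \<bar>?e \<bullet> \<theta>\<bar>) = 0"
    by (subst (asm) nn_integral_0_iff_AE) auto
  then have ae: "AE \<theta> in sphere_measure. ?e \<bullet> \<theta> = 0"
  proof eventually_elim
    case (elim \<theta>)
    show ?case
    proof (rule ccontr)
      assume n: "?e \<bullet> \<theta> \<noteq> 0"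
      then have "cone_kernel s ((?e \<bullet> \<theta>)\<^sup>2) * \<bar>?e \<bullet> \<theta>\<bar> > 0"
        by (simp add: cone_kernel_def max_absorb2)
      with elim show False by (simp add: ennreal_eq_0_iff)
    qed
  qed
  have z1: "(\<integral>\<^sup>+x. indicator {x. ?e \<bullet> x \<noteq> 0} x \<partial>lborel) = (0::ennreal)"
  proof -
    have m: "{x. ?e \<bullet> x \<noteq> 0} \<in> sets borel" by measurable
    have "(\<integral>\<^sup>+x. indicator {x. ?e \<bullet> x \<noteq> 0} x \<partial>lborel) =
      (\<integral>\<^sup>+\<theta>. (\<integral>\<^sup>+\<tau>. indicator {x. ?e \<bullet> x \<noteq> 0} (\<tau> *\<^sub>R \<theta>) * ennreal (\<tau> ^ (DIM('a) - 1)) * indicator {0<..} \<tau> \<partial>lborel) \<partial>sphere_measure)"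
      by (rule nn_integral_polar) (use m in measurable)
    also have "\<dots> = (\<integral>\<^sup>+\<theta>. 0 \<partial>(sphere_measure :: 'a measure))"
      by (rule nn_integral_cong_AE, use ae in eventually_elim) simp
    finally show ?thesis by simp
  qed
  have z2: "(\<integral>\<^sup>+x. indicator {x. ?e \<bullet> x \<noteq> 0} (?e + 1 *\<^sub>R x) \<partial>lborel) = (0::ennreal)"
    using z1 by (subst (asm) nn_integral_lborel_affine[where c=1 and t="?e"]) auto
  have "(\<integral>\<^sup>+x. 1 \<partial>(lborel :: 'a measure)) \<le> (\<integral>\<^sup>+x. indicator {x. ?e \<bullet> x \<noteq> 0} x + indicator {x. ?e \<bullet> x \<noteq> 0} (?e + 1 *\<^sub>R x) \<partial>lborel)"
    by (intro nn_integral_mono) (auto simp: indicator_def inner_add_right ee)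
  also have "\<dots> = 0" by (subst nn_integral_add) (auto simp: z1 z2[simplified])
  finally show False by simp
qed

section \<open>Domination and averages of the cone kernel over directions\<close>

lemma cone_arg:
  fixes z \<theta> :: "'a::euclidean_space"
  assumes "z \<noteq> 0"
  shows "1 - (norm z)\<^sup>2 + (z \<bullet> \<theta>)\<^sup>2 = 1 - (norm z)\<^sup>2 + (norm z)\<^sup>2 * (sgn z \<bullet> \<theta>)\<^sup>2"
proof -
  have "norm z *\<^sub>R sgn z = z" by (simp add: sgn_div_norm assms)
  then have "norm z * (sgn z \<bullet> \<theta>) = z \<bullet> \<theta>" by (metis inner_scaleR_left)
  then show ?thesis by (metis power_mult_distrib)
qed

text \<open>Where the kernel is nonzero, |z . \<theta>| is at least sqrt(|z|^2 - 1). So the factor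
  |e . \<theta>| with e = z / |z|, which \<open>angular_scaling\<close> requires, can be inserted at
  the cost of |z| / sqrt(|z|^2 - 1).\<close>

lemma cone_mass_le:
  fixes z :: "'a::euclidean_space"
  assumes z: "norm z > 1" and s: "0 < s"
  shows "(\<integral>\<^sup>+\<theta>. ennreal (cone_kernel s (1 - (norm z)\<^sup>2 + (z \<bullet> \<theta>)\<^sup>2)) \<partial>sphere_measure)
    \<le> ennreal (norm z / sqrt ((norm z)\<^sup>2 - 1) * (norm z / norm z ^ DIM('a) * angular_const s TYPE('a)))"
proof -
  let ?\<rho> = "norm z" and ?e = "sgn z"
  let ?k = "\<lambda>\<theta>. cone_kernel s (1 - ?\<rho>\<^sup>2 + ?\<rho>\<^sup>2 * (?e \<bullet> \<theta>)\<^sup>2)"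
  have z0: "z \<noteq> 0" using z by auto
  have e: "norm ?e = 1" using z0 by (simp add: norm_sgn)
  define q where "q = sqrt (?\<rho>\<^sup>2 - 1)"
  have r2: "?\<rho>\<^sup>2 - 1 > 0" using z by simp
  then have q: "q > 0" "q\<^sup>2 = ?\<rho>\<^sup>2 - 1" by (auto simp: q_def)
  have pt: "?k \<theta> \<le> ?\<rho> / q * (?k \<theta> * \<bar>?e \<bullet> \<theta>\<bar>)" for \<theta>
  proof (cases "1 - ?\<rho>\<^sup>2 + ?\<rho>\<^sup>2 * (?e \<bullet> \<theta>)\<^sup>2 \<le> 0")
    case True then show ?thesis by (simp add: cone_kernel_neg)
  next
    case False
    then have "q\<^sup>2 \<le> (?\<rho> * \<bar>?e \<bullet> \<theta>\<bar>)\<^sup>2" by (simp add: q power_mult_distrib)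
    then have "q \<le> ?\<rho> * \<bar>?e \<bullet> \<theta>\<bar>" by (rule power2_le_imp_le) simp
    then have "1 \<le> ?\<rho> / q * \<bar>?e \<bullet> \<theta>\<bar>" using q by (simp add: field_simps)
    then have "?k \<theta> * 1 \<le> ?k \<theta> * (?\<rho> / q * \<bar>?e \<bullet> \<theta>\<bar>)" by (intro mult_left_mono) auto
    then show ?thesis by (simp add: mult_ac)
  qed
  have "(\<integral>\<^sup>+\<theta>. ennreal (cone_kernel s (1 - (norm z)\<^sup>2 + (z \<bullet> \<theta>)\<^sup>2)) \<partial>sphere_measure)
      \<le> (\<integral>\<^sup>+\<theta>. ennreal (?\<rho> / q) * ennreal (?k \<theta> * \<bar>?e \<bullet> \<theta>\<bar>) \<partial>sphere_measure)"
    unfolding cone_arg[OF z0] using pt q by (intro nn_integral_mono) (simp add: ennreal_mult[symmetric])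
  also have "\<dots> = ennreal (?\<rho> / q) * (ennreal (?\<rho> / ?\<rho> ^ DIM('a)) * ennreal (angular_const s TYPE('a)))"
    using angular_scaling[OF e, of ?\<rho> s] z by (subst nn_integral_cmult) (auto simp: nn_integral_angular_const[OF e s])
  also have "\<dots> = ennreal (?\<rho> / q * (?\<rho> / ?\<rho> ^ DIM('a) * angular_const s TYPE('a)))"
    using q angular_const_pos[OF s, where 'a='a] by (simp add: ennreal_mult[symmetric])
  finally show ?thesis unfolding q_def .
qed

text \<open>For s >= 1/2 the loss in \<open>cone_mass_le\<close> is too large, as (|z|^2 -
  1)^(-s-1/2) is not integrable near the unit sphere. In that range, however, the exponent s - 1/2
  is nonnegative and the kernel is at most 1 for unit directions.\<close>

lemma cone_mass_le_sphere:
  fixes z :: "'a::euclidean_space"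
  assumes z: "norm z > 1" and s: "1 / 2 \<le> s"
  shows "(\<integral>\<^sup>+\<theta>. ennreal (cone_kernel s (1 - (norm z)\<^sup>2 + (z \<bullet> \<theta>)\<^sup>2)) \<partial>sphere_measure)
    \<le> ennreal (measure (sphere_measure :: 'a measure) UNIV)"
proof -
  have "(\<integral>\<^sup>+\<theta>. ennreal (cone_kernel s (1 - (norm z)\<^sup>2 + (z \<bullet> \<theta>)\<^sup>2)) \<partial>sphere_measure) \<le> (\<integral>\<^sup>+\<theta>. 1 \<partial>(sphere_measure :: 'a measure))"
  proof (rule nn_integral_mono_AE, use AE_sphere_measure_norm in eventually_elim)
    fix \<theta> :: 'a assume "norm \<theta> = 1"
    then have "\<bar>z \<bullet> \<theta>\<bar> \<le> norm z" using Cauchy_Schwarz_ineq2[of z \<theta>] by simp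
    then have "(z \<bullet> \<theta>)\<^sup>2 \<le> (norm z)\<^sup>2" by (metis abs_le_square_iff abs_norm_cancel)
    then have "cone_kernel s (1 - (norm z)\<^sup>2 + (z \<bullet> \<theta>)\<^sup>2) \<le> 1"
      unfolding cone_kernel_def using s by (intro powr_le1) auto
    then show "ennreal (cone_kernel s (1 - (norm z)\<^sup>2 + (z \<bullet> \<theta>)\<^sup>2)) \<le> 1" by simp
  qed
  then show ?thesis by (simp add: sphere.emeasure_eq_measure)
qed

lemma cone_integrable:
  fixes z :: "'a::euclidean_space"
  assumes z: "norm z > 1" and s: "0 < s"
  shows "integrable sphere_measure (\<lambda>\<theta>. cone_kernel s (1 - (norm z)\<^sup>2 + (z \<bullet> \<theta>)\<^sup>2))"
  using cone_mass_le[OF z s] by (intro integrableI_bounded) (auto intro: le_less_trans)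

text \<open>The component of g orthogonal to z contributes nothing: reversing the axis of z flips
  sgn(z . \<theta>) and leaves that component's product with \<theta> unchanged. Along z the sign
  turns e . \<theta> into |e . \<theta>|, and \<open>angular_scaling\<close> gives the dependence on
  |z|.\<close>

lemma cone_vector_integral:
  fixes z g :: "'a::euclidean_space"
  assumes z: "norm z > 1" and s: "0 < s"
  shows "integrable sphere_measure (\<lambda>\<theta>. cone_kernel s (1 - (norm z)\<^sup>2 + (z \<bullet> \<theta>)\<^sup>2) * (sgn (z \<bullet> \<theta>) * (g \<bullet> \<theta>)))"
    and "(\<integral>\<theta>. cone_kernel s (1 - (norm z)\<^sup>2 + (z \<bullet> \<theta>)\<^sup>2) * (sgn (z \<bullet> \<theta>) * (g \<bullet> \<theta>)) \<partial>sphere_measure)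
      = angular_const s TYPE('a) / norm z ^ DIM('a) * (g \<bullet> z)"
proof -
  let ?k = "\<lambda>\<theta>. cone_kernel s (1 - (norm z)\<^sup>2 + (z \<bullet> \<theta>)\<^sup>2)"
  define r e where "r = norm z" and "e = sgn z"
  have z0: "z \<noteq> 0" using z by auto
  have e: "norm e = 1" "e \<noteq> 0" using z0 by (simp_all add: norm_sgn sgn_zero_iff e_def)
  have ee: "e \<bullet> e = 1" using e(1) by (simp add: norm_eq_sqrt_inner)
  have zs: "z = r *\<^sub>R e" by (simp add: sgn_div_norm z0 r_def e_def)
  have r: "r > 1" using z by (simp add: r_def)
  have zi: "z \<bullet> x = r * (e \<bullet> x)" for x unfolding zs by simp
  have int: "integrable sphere_measure (\<lambda>\<theta>. ?k \<theta> * (sgn (z \<bullet> \<theta>) * (h \<bullet> \<theta>)))" for h :: 'a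
  proof (rule Bochner_Integration.integrable_bound)
    show "integrable sphere_measure (\<lambda>\<theta>. norm h * ?k \<theta>)"
      using cone_integrable[OF z s] by simp
    show "AE \<theta> in sphere_measure. norm (?k \<theta> * (sgn (z \<bullet> \<theta>) * (h \<bullet> \<theta>))) \<le> norm (norm h * ?k \<theta>)"
      using AE_sphere_measure_norm
    proof eventually_elim
      case (elim \<theta>)
      have "\<bar>h \<bullet> \<theta>\<bar> \<le> norm h" using Cauchy_Schwarz_ineq2[of h \<theta>] elim by simp
      then have "\<bar>sgn (z \<bullet> \<theta>)\<bar> * \<bar>h \<bullet> \<theta>\<bar> \<le> 1 * norm h" by (intro mult_mono) (auto simp: abs_sgn_eq)
      then have "?k \<theta> * (\<bar>sgn (z \<bullet> \<theta>)\<bar> * \<bar>h \<bullet> \<theta>\<bar>) \<le> ?k \<theta> * norm h" by (intro mult_left_mono) auto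
      then show ?case by (simp add: abs_mult mult.commute)
    qed
  qed measurable
  show "integrable sphere_measure (\<lambda>\<theta>. ?k \<theta> * (sgn (z \<bullet> \<theta>) * (g \<bullet> \<theta>)))" by (rule int)
  define gp where "gp = g - (g \<bullet> e) *\<^sub>R e"
  have gpe: "gp \<bullet> e = 0" by (simp add: gp_def inner_diff_left ee)
  have dec: "g \<bullet> \<theta> = (g \<bullet> e) * (e \<bullet> \<theta>) + gp \<bullet> \<theta>" for \<theta> by (simp add: gp_def inner_diff_left)
  have kk: "?k \<theta> = cone_kernel s (1 - r\<^sup>2 + r\<^sup>2 * (e \<bullet> \<theta>)\<^sup>2)" for \<theta>
    unfolding r_def e_def by (rule arg_cong[OF cone_arg[OF z0]])
  have par: "(\<integral>\<theta>. ?k \<theta> * (sgn (z \<bullet> \<theta>) * (e \<bullet> \<theta>)) \<partial>sphere_measure) = r / r ^ DIM('a) * angular_const s TYPE('a)"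
  proof -
    have c: "sgn (z \<bullet> \<theta>) * (e \<bullet> \<theta>) = \<bar>e \<bullet> \<theta>\<bar>" for \<theta>
      using r by (simp add: zi sgn_mult) (simp only: abs_sgn mult.commute)
    have "(\<integral>\<theta>. ?k \<theta> * (sgn (z \<bullet> \<theta>) * (e \<bullet> \<theta>)) \<partial>sphere_measure) = enn2real (\<integral>\<^sup>+\<theta>. ennreal (?k \<theta> * \<bar>e \<bullet> \<theta>\<bar>) \<partial>sphere_measure)"
      unfolding c by (intro integral_eq_nn_integral) auto
    also have "(\<integral>\<^sup>+\<theta>. ennreal (?k \<theta> * \<bar>e \<bullet> \<theta>\<bar>) \<partial>sphere_measure) = ennreal (r / r ^ DIM('a)) * ennreal (angular_const s TYPE('a))"
      unfolding kk using angular_scaling[OF e(1), of r s] r by (simp add: nn_integral_angular_const[OF e(1) s])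
    also have "enn2real \<dots> = r / r ^ DIM('a) * angular_const s TYPE('a)"
      using angular_const_pos[OF s, where 'a='a] r by (simp add: ennreal_mult[symmetric])
    finally show ?thesis .
  qed
  have perp: "(\<integral>\<theta>. ?k \<theta> * (sgn (z \<bullet> \<theta>) * (gp \<bullet> \<theta>)) \<partial>sphere_measure) = 0"
  proof -
    let ?h = "\<lambda>\<theta>. ?k \<theta> * (sgn (z \<bullet> \<theta>) * (gp \<bullet> \<theta>))"
    let ?F = "\<lambda>x::'a. x - (2 * (x \<bullet> e) / (e \<bullet> e)) *\<^sub>R e"
    have zF: "z \<bullet> ?F \<theta> = - (z \<bullet> \<theta>)" for \<theta>
    proof -
      have "e \<bullet> ?F \<theta> = - (e \<bullet> \<theta>)" by (simp add: inner_diff_right ee inner_commute)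
      then show ?thesis unfolding zi by simp
    qed
    have gF: "gp \<bullet> ?F \<theta> = gp \<bullet> \<theta>" for \<theta> by (simp add: inner_diff_right gpe)
    have "(\<integral>\<theta>. ?h \<theta> \<partial>sphere_measure) = (\<integral>\<theta>. ?h \<theta> \<partial>distr sphere_measure borel ?F)"
      unfolding distr_flip_sphere_measure[OF e(2)] ..
    also have "\<dots> = (\<integral>\<theta>. ?h (?F \<theta>) \<partial>sphere_measure)"
      by (intro integral_distr) measurable
    also have "\<dots> = (\<integral>\<theta>. - ?h \<theta> \<partial>sphere_measure)"
      unfolding zF gF by (simp add: sgn_minus)
    finally show ?thesis by simp
  qed
  have "(\<integral>\<theta>. ?k \<theta> * (sgn (z \<bullet> \<theta>) * (g \<bullet> \<theta>)) \<partial>sphere_measure)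
     = (\<integral>\<theta>. (g \<bullet> e) * (?k \<theta> * (sgn (z \<bullet> \<theta>) * (e \<bullet> \<theta>))) + ?k \<theta> * (sgn (z \<bullet> \<theta>) * (gp \<bullet> \<theta>)) \<partial>sphere_measure)"
  proof (rule Bochner_Integration.integral_cong[OF refl])
    fix \<theta> :: 'a
    show "?k \<theta> * (sgn (z \<bullet> \<theta>) * (g \<bullet> \<theta>)) = (g \<bullet> e) * (?k \<theta> * (sgn (z \<bullet> \<theta>) * (e \<bullet> \<theta>))) + ?k \<theta> * (sgn (z \<bullet> \<theta>) * (gp \<bullet> \<theta>))"
      by (subst dec) (simp only: distrib_left mult_ac)
  qed
  also have "\<dots> = (g \<bullet> e) * (r / r ^ DIM('a) * angular_const s TYPE('a))"
    using int by (simp add: par perp)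
  also have "\<dots> = angular_const s TYPE('a) / norm z ^ DIM('a) * (g \<bullet> z)"
  proof -
    have "g \<bullet> z = r * (g \<bullet> e)" using zi[of g] by (simp add: inner_commute)
    then show ?thesis by (simp add: r_def)
  qed
  finally show "(\<integral>\<theta>. ?k \<theta> * (sgn (z \<bullet> \<theta>) * (g \<bullet> \<theta>)) \<partial>sphere_measure) = angular_const s TYPE('a) / norm z ^ DIM('a) * (g \<bullet> z)" .
qed

text \<open>Near the unit sphere with s >= 1/2 the total mass is the usable bound; in all other
  cases, in particular at infinity, the algebraic bound supplies the decay of order
  \<rho>^(1-n).\<close>

definition cone_bound :: "real \<Rightarrow> 'a::euclidean_space itself \<Rightarrow> real \<Rightarrow> real" where
  "cone_bound s TYPE('a) \<rho> = (if 1 / 2 \<le> s \<and> \<rho> \<le> 2 then measure (sphere_measure :: 'a measure) UNIV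
     else \<rho> / sqrt (\<rho>\<^sup>2 - 1) * (\<rho> / \<rho> ^ DIM('a) * angular_const s TYPE('a)))"

lemma cone_bound_borel[measurable]: "cone_bound s TYPE('a::euclidean_space) \<in> borel_measurable borel"
  unfolding cone_bound_def[abs_def] by measurable

lemma cone_mass_le_bound:
  fixes z :: "'a::euclidean_space"
  assumes z: "norm z > 1" and s: "0 < s"
  shows "(\<integral>\<^sup>+\<theta>. ennreal (cone_kernel s (1 - (norm z)\<^sup>2 + (z \<bullet> \<theta>)\<^sup>2)) \<partial>sphere_measure)
    \<le> ennreal (cone_bound s TYPE('a) (norm z))"
  using cone_mass_le[OF z s] cone_mass_le_sphere[OF z, of s] by (auto simp: cone_bound_def)

lemma cone_bound_nonneg: "\<rho> > 1 \<Longrightarrow> 0 < s \<Longrightarrow> cone_bound s TYPE('a::euclidean_space) \<rho> \<ge> 0"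
  using angular_const_pos[of s, where 'a='a] by (simp add: cone_bound_def)

text \<open>Measures the radius from the unit sphere, so that a singularity there sits at t = 0,
  where the power tests apply.\<close>

lemma integrable_radial_outside:
  fixes \<beta> :: "real \<Rightarrow> real"
  assumes [measurable]: "\<beta> \<in> borel_measurable borel" and z: "\<And>\<rho>. \<rho> \<le> 1 \<Longrightarrow> \<beta> \<rho> = 0"
    and i: "set_integrable lborel {0<..} (\<lambda>t. \<beta> (1 + t) * (1 + t) ^ (DIM('a) - 1))"
  shows "integrable lborel (\<lambda>x::'a::euclidean_space. \<beta> (norm x))"
proof -
  have "integrable lborel (\<lambda>t. (\<lambda>\<rho>. indicator {0<..} \<rho> *\<^sub>R (\<beta> \<rho> * \<rho> ^ (DIM('a) - 1))) (1 + 1 * t))"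
    using i unfolding set_integrable_def
  proof (rule Bochner_Integration.integrable_cong[THEN iffD1, rotated -1])
    show "indicator {0<..} t *\<^sub>R (\<beta> (1 + t) * (1 + t) ^ (DIM('a) - 1))
      = (\<lambda>\<rho>. indicator {0<..} \<rho> *\<^sub>R (\<beta> \<rho> * \<rho> ^ (DIM('a) - 1))) (1 + 1 * t)" for t
      using z[of "1 + t"] by (auto split: split_indicator)
  qed simp
  then have "set_integrable lborel {0<..} (\<lambda>\<rho>. \<beta> \<rho> * \<rho> ^ (DIM('a) - 1))"
    unfolding set_integrable_def by (subst (asm) lborel_integrable_real_affine_iff) auto
  then show ?thesis by (rule integrable_radial[rotated]) measurable
qed

text \<open>The factor 1 / (1 + |z|) stands for the decay of the gradient of the weight. Against the
  volume factor \<rho>^(n-1) the dimension drops out, and the tail is of order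
  \<rho>^(-1-2s).\<close>

lemma cone_bound_integrable:
  assumes s: "0 < s" "s < 1"
  shows "integrable lborel (\<lambda>z::'a::euclidean_space. indicator {z. norm z > 1} z *
     (((norm z)\<^sup>2 - 1) powr (- s) * cone_bound s TYPE('a) (norm z) / (1 + norm z)))"
proof -
  let ?n = "DIM('a)"
  define K where "K = angular_const s TYPE('a)"
  define S where "S = measure (sphere_measure :: 'a measure) UNIV"
  have K: "K > 0" using angular_const_pos[OF s(1)] by (simp add: K_def)
  have S: "S \<ge> 0" by (simp add: S_def)
  define \<beta> where "\<beta> = (\<lambda>\<rho>. indicator {1<..} \<rho> * ((\<rho>\<^sup>2 - 1) powr (- s) * cone_bound s TYPE('a) \<rho> / (1 + \<rho>)))"
  have [measurable]: "\<beta> \<in> borel_measurable borel" unfolding \<beta>_def by measurable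
  \<comment> \<open>The power of \<rho> - 1 at the unit sphere in the two regimes: it exceeds -1
    because s < 1 in the first and because s < 1/2 in the second.\<close>
  define a where "a = (if 1 / 2 \<le> s then - s else - s - 1 / 2)"
  have a: "a > -1" using s by (auto simp: a_def)
  have pwn: "\<rho> / \<rho> ^ ?n * \<rho> ^ (?n - 1) = 1" if "\<rho> > 0" for \<rho> :: real
    using that DIM_positive[where 'a='a] by (cases "DIM('a)") (auto simp: field_simps)
  have main: "\<beta> (1 + t) * (1 + t) ^ (?n - 1) \<le> K * ((1 + t)\<^sup>2 - 1) powr (- s - 1 / 2)"
    if t: "t > 0" "\<not> (1 / 2 \<le> s \<and> 1 + t \<le> 2)" for t :: real
  proof -
    define \<rho> where "\<rho> = 1 + t"
    have \<rho>: "\<rho> > 1" using t by (simp add: \<rho>_def)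
    have r2: "\<rho>\<^sup>2 - 1 > 0" using \<rho> by simp
    have "\<beta> \<rho> * \<rho> ^ (?n - 1) = (\<rho>\<^sup>2 - 1) powr (- s) * (\<rho> / sqrt (\<rho>\<^sup>2 - 1) * K) / (1 + \<rho>) * (\<rho> / \<rho> ^ ?n * \<rho> ^ (?n - 1))"
    proof -
      have c: "cone_bound s TYPE('a) \<rho> = \<rho> / sqrt (\<rho>\<^sup>2 - 1) * (\<rho> / \<rho> ^ ?n * K)"
        unfolding cone_bound_def K_def \<rho>_def by (rule if_not_P[OF t(2)])
      show ?thesis unfolding \<beta>_def c using \<rho> by (simp add: mult_ac)
    qed
    also have "\<dots> = K * ((\<rho>\<^sup>2 - 1) powr (- s) * (1 / sqrt (\<rho>\<^sup>2 - 1))) * (\<rho> / (1 + \<rho>))"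
      using pwn[of \<rho>] \<rho> by simp
    also have "(\<rho>\<^sup>2 - 1) powr (- s) * (1 / sqrt (\<rho>\<^sup>2 - 1)) = (\<rho>\<^sup>2 - 1) powr (- s - 1 / 2)"
      using r2 by (simp add: powr_diff powr_half_sqrt)
    also have "K * (\<rho>\<^sup>2 - 1) powr (- s - 1 / 2) * (\<rho> / (1 + \<rho>)) \<le> K * (\<rho>\<^sup>2 - 1) powr (- s - 1 / 2) * 1"
      using K \<rho> by (intro mult_left_mono) auto
    finally show ?thesis by (simp add: \<rho>_def)
  qed
  have nonneg: "\<beta> \<rho> * \<rho> ^ (?n - 1) \<ge> 0" if "\<rho> > 0" for \<rho>
    using that cone_bound_nonneg[of \<rho> s, where 'a='a] s by (auto simp: \<beta>_def split: split_indicator)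
  let ?B = "K + S * 2 ^ (?n - 1)"
  have B: "K \<le> ?B" "S * 2 ^ (?n - 1) \<le> ?B" using K S by auto
  have "set_integrable lborel {0<..} (\<lambda>t. \<beta> (1 + t) * (1 + t) ^ (?n - 1))"
  proof (rule set_integrable_Ioi_powr_bound[where a=a and b="- 1 - 2 * s" and B="?B"])
    fix t :: real assume t: "0 < t" "t \<le> 1"
    have tt: "t \<le> (1 + t)\<^sup>2 - 1" using t by (simp add: power2_eq_square algebra_simps)
    have "\<beta> (1 + t) * (1 + t) ^ (?n - 1) \<le> ?B * t powr a"
    proof (cases "1 / 2 \<le> s")
      case True
      have "\<beta> (1 + t) * (1 + t) ^ (?n - 1) = ((1 + t)\<^sup>2 - 1) powr (- s) * (S / (2 + t) * (1 + t) ^ (?n - 1))"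
        using t True by (simp add: \<beta>_def cone_bound_def S_def)
      also have "\<dots> \<le> t powr (- s) * (S * 2 ^ (?n - 1))"
      proof (intro mult_mono)
        show "((1 + t)\<^sup>2 - 1) powr (- s) \<le> t powr (- s)" using tt t s by (intro powr_mono2') auto
        show "S / (2 + t) \<le> S" using S t by (simp add: divide_le_eq mult_le_cancel_left1)
        show "(1 + t) ^ (?n - 1) \<le> 2 ^ (?n - 1)" using t by (intro power_mono) auto
      qed (use S t in auto)
      also have "\<dots> \<le> t powr a * ?B" using True B by (intro mult_mono) (auto simp: a_def S)
      finally show ?thesis by (simp add: mult.commute)
    next
      case False
      have "\<beta> (1 + t) * (1 + t) ^ (?n - 1) \<le> K * ((1 + t)\<^sup>2 - 1) powr (- s - 1 / 2)"
        using t False by (intro main) auto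
      also have "\<dots> \<le> ?B * t powr a"
        using tt t s K B S False by (intro mult_mono) (auto simp: a_def intro!: powr_mono2')
      finally show ?thesis .
    qed
    then show "\<bar>\<beta> (1 + t) * (1 + t) ^ (?n - 1)\<bar> \<le> ?B * t powr a" using nonneg[of "1 + t"] t by simp
  next
    fix t :: real assume t: "1 \<le> t"
    show "\<bar>\<beta> (1 + t) * (1 + t) ^ (?n - 1)\<bar> \<le> ?B * t powr (- 1 - 2 * s)"
    proof (cases "1 / 2 \<le> s \<and> 1 + t \<le> 2")
      case True
      then have t1: "t = 1" using t by simp
      have "\<beta> 2 * 2 ^ (?n - 1) = 3 powr (- s) * (S / 3 * 2 ^ (?n - 1))"
        using True by (simp add: \<beta>_def cone_bound_def S_def)
      also have "\<dots> \<le> 1 * (S * 2 ^ (?n - 1))"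
      proof (intro mult_mono)
        have "(3::real) powr (- s) \<le> 3 powr 0" using s by (intro powr_mono) auto
        then show "(3::real) powr (- s) \<le> 1" by simp
      qed (use S in auto)
      finally have "\<beta> 2 * 2 ^ (?n - 1) \<le> ?B" using B by linarith
      then show ?thesis using nonneg[of 2] t1 by simp
    next
      case False
      have "t\<^sup>2 \<le> (1 + t)\<^sup>2 - 1" using t by (simp add: power2_eq_square algebra_simps)
      then have "((1 + t)\<^sup>2 - 1) powr (- s - 1 / 2) \<le> (t\<^sup>2) powr (- s - 1 / 2)" using t s by (intro powr_mono2') auto
      also have "(t\<^sup>2) powr (- s - 1 / 2) = t powr (- 1 - 2 * s)"
      proof -
        have e: "2 * (- s - 1 / 2) = - 1 - 2 * s" by simp
        show ?thesis using power2_powr[of t "- s - 1 / 2"] t unfolding e by simp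
      qed
      finally have *: "((1 + t)\<^sup>2 - 1) powr (- s - 1 / 2) \<le> t powr (- 1 - 2 * s)" .
      have "\<beta> (1 + t) * (1 + t) ^ (?n - 1) \<le> K * ((1 + t)\<^sup>2 - 1) powr (- s - 1 / 2)"
        using t False by (intro main) auto
      also have "\<dots> \<le> ?B * t powr (- 1 - 2 * s)" using * K B S by (intro mult_mono) auto
      finally show ?thesis using nonneg[of "1 + t"] t by simp
    qed
  qed (use a s in auto)
  then have "integrable lborel (\<lambda>z::'a. \<beta> (norm z))"
    by (rule integrable_radial_outside[rotated 2]) (auto simp: \<beta>_def)
  moreover have "\<beta> (norm z) = indicator {z. norm z > 1} z * (((norm z)\<^sup>2 - 1) powr (- s) * cone_bound s TYPE('a) (norm z) / (1 + norm z))" for z :: 'a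
    by (simp add: \<beta>_def indicator_def)
  ultimately show ?thesis by simp
qed

text \<open>The singular factor is (1 - \<rho>)^(s-1), integrable because s > 0. The other factor (1
  + \<rho>)^(s-1) is at most 1 or at most 2^(s-1) on the ball, depending on the sign of s - 1, hence
  at most their sum.\<close>

lemma ball_weight_integrable:
  assumes s: "0 < s"
  shows "integrable lborel (\<lambda>y::'a::euclidean_space. indicator {y. norm y < 1} y * (1 - (norm y)\<^sup>2) powr (s - 1))"
proof -
  let ?n = "DIM('a)"
  define \<beta> where "\<beta> = (\<lambda>\<rho>::real. indicator {..<1} \<rho> * (1 - \<rho>\<^sup>2) powr (s - 1))"
  have [measurable]: "\<beta> \<in> borel_measurable borel" unfolding \<beta>_def by measurable
  have "set_integrable lborel {0<..1} (\<lambda>t. (1 + 2 powr (s - 1)) * t powr (s - 1))"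
    using set_integrable_powr_0_1[of "s - 1"] s by (intro set_integrable_mult_right) auto
  then have "integrable lborel (\<lambda>t. indicator {0<..1} t *\<^sub>R ((1 + 2 powr (s - 1)) * t powr (s - 1)))" unfolding set_integrable_def .
  from lborel_integrable_real_affine[OF this, of "-1" 1]
  have i: "integrable lborel (\<lambda>\<rho>. indicator {0<..1} (1 - \<rho>) *\<^sub>R ((1 + 2 powr (s - 1)) * (1 - \<rho>) powr (s - 1)))" by simp
  have "set_integrable lborel {0<..} (\<lambda>\<rho>. \<beta> \<rho> * \<rho> ^ (?n - 1))"
    unfolding set_integrable_def
  proof (rule Bochner_Integration.integrable_bound[OF i])
    show "AE \<rho> in lborel. norm (indicator {0<..} \<rho> *\<^sub>R (\<beta> \<rho> * \<rho> ^ (?n - 1))) \<le> norm (indicator {0<..1} (1 - \<rho>) *\<^sub>R ((1 + 2 powr (s - 1)) * (1 - \<rho>) powr (s - 1)))"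
    proof (intro AE_I2)
      fix \<rho> :: real
      show "norm (indicator {0<..} \<rho> *\<^sub>R (\<beta> \<rho> * \<rho> ^ (?n - 1))) \<le> norm (indicator {0<..1} (1 - \<rho>) *\<^sub>R ((1 + 2 powr (s - 1)) * (1 - \<rho>) powr (s - 1)))"
      proof (cases "0 < \<rho> \<and> \<rho> < 1")
        case True
        have "(1 - \<rho>\<^sup>2) powr (s - 1) = (1 + \<rho>) powr (s - 1) * (1 - \<rho>) powr (s - 1)"
          using True by (subst powr_mult[symmetric]) (auto simp: power2_eq_square algebra_simps)
        moreover have "(1 + \<rho>) powr (s - 1) \<le> 1 + 2 powr (s - 1)"
        proof (cases "s \<le> 1")
          case True2: True
          have "(1 + \<rho>) powr (s - 1) \<le> (1 + \<rho>) powr 0" using True True2 by (intro powr_mono) auto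
          then show ?thesis using True by (simp add: add_increasing2)
        next
          case False
          have "(1 + \<rho>) powr (s - 1) \<le> 2 powr (s - 1)" using True False by (intro powr_mono2) auto
          then show ?thesis by simp
        qed
        ultimately have "(1 - \<rho>\<^sup>2) powr (s - 1) \<le> (1 + 2 powr (s - 1)) * (1 - \<rho>) powr (s - 1)"
          by (simp only:) (rule mult_right_mono, auto)
        moreover have "\<rho> ^ (?n - 1) \<le> 1" using True by (intro power_le_one) auto
        ultimately have "(1 - \<rho>\<^sup>2) powr (s - 1) * \<rho> ^ (?n - 1) \<le> (1 + 2 powr (s - 1)) * (1 - \<rho>) powr (s - 1) * 1"
          using True by (intro mult_mono) auto
        then show ?thesis using True by (simp add: \<beta>_def abs_mult)
      next
        case False then show ?thesis by (auto simp: \<beta>_def split: split_indicator)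
      qed
    qed
  qed measurable
  then have "integrable lborel (\<lambda>z::'a. \<beta> (norm z))" by (rule integrable_radial[rotated]) measurable
  moreover have "\<beta> (norm y) = indicator {y. norm y < 1} y * (1 - (norm y)\<^sup>2) powr (s - 1)" for y :: 'a
    by (simp add: \<beta>_def indicator_def)
  ultimately show ?thesis by simp
qed

section \<open>The flux identity in the unit ball\<close>

context lipschitz_decay
begin

text \<open>It depends on s alone, which makes the bound below uniform over all lines and
  directions.\<close>

definition riesz_diff_const :: real where
  "riesz_diff_const = (LINT t:{0<..}|lborel. (if t \<le> 1 then t powr (1 - 2 * s) else t powr (- 1 - 2 * s)))"

lemma riesz_diff_bound: "\<bar>riesz_diff y\<bar> \<le> 2 * M * (1 + \<bar>y\<bar>) * riesz_diff_const"
proof -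
  let ?h = "\<lambda>t. if t \<le> 1 then t powr (1 - 2 * s) else t powr (- 1 - 2 * s)"
  have ih: "set_integrable lborel {0<..} ?h"
    by (rule set_integrable_Ioi_powr_bound[where a="1 - 2 * s" and b="- 1 - 2 * s" and B=1]) (use s in auto)
  have "\<bar>riesz_diff y\<bar> \<le> (\<integral>t. \<bar>indicator {0<..} t *\<^sub>R ((\<phi> (y + t) - \<phi> (y - t)) * t powr (- 2 * s))\<bar> \<partial>lborel)"
    unfolding riesz_diff_def set_lebesgue_integral_def by (rule integral_abs_bound)
  also have "\<dots> \<le> (\<integral>t. 2 * M * (1 + \<bar>y\<bar>) * (indicator {0<..} t *\<^sub>R ?h t) \<partial>lborel)"
  proof (intro integral_mono integrable_abs integrable_mult_right)
    fix t :: real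
    show "\<bar>indicator {0<..} t *\<^sub>R ((\<phi> (y + t) - \<phi> (y - t)) * t powr (- 2 * s))\<bar> \<le> 2 * M * (1 + \<bar>y\<bar>) * (indicator {0<..} t *\<^sub>R ?h t)"
      using riesz_diff_integrand_bound1[of t y] riesz_diff_integrand_bound2[of t y] by (auto split: split_indicator)
  qed (use riesz_diff_integrable ih in \<open>auto simp: set_integrable_def\<close>)
  also have "\<dots> = 2 * M * (1 + \<bar>y\<bar>) * riesz_diff_const" unfolding riesz_diff_const_def set_lebesgue_integral_def by simp
  finally show ?thesis .
qed

text \<open>Gathers the two rays outside a chord into one integral over the line. The sign that
  records the side becomes sgn(z . \<theta>) for a point z of space.\<close>

lemma exterior_line:
  assumes l: "l > 0"
  shows "(\<integral>\<tau>. indicator {\<tau>. l\<^sup>2 < \<tau>\<^sup>2} \<tau> * ((\<tau>\<^sup>2 - l\<^sup>2) powr (- s) * (sgn \<tau> * \<phi> \<tau>)) \<partial>lborel)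
    = (LINT z:{l<..}|lborel. (z\<^sup>2 - l\<^sup>2) powr (- s) * (\<phi> z - \<phi> (- z)))"
proof -
  have half: "set_integrable lborel {l<..} (\<lambda>z. (z\<^sup>2 - l\<^sup>2) powr (- s) * \<psi> z)"
    if "lipschitz_decay \<psi> M s" for \<psi>
  proof -
    interpret Q: lipschitz_decay \<psi> M s by (rule that)
    interpret R: lipschitz_decay "\<lambda>x. \<psi> (l * x)" "M * (1 + l + 1 / l)" s by (rule Q.scaled[OF l])
    have "integrable lborel (\<lambda>z. l powr (- 2 * s) * (indicator {1<..} z *\<^sub>R ((z\<^sup>2 - 1) powr (- s) * \<psi> (l * z))))"
      using R.exterior_integrable unfolding set_integrable_def by (rule integrable_mult_right)
    also have "(\<lambda>z. l powr (- 2 * s) * (indicator {1<..} z *\<^sub>R ((z\<^sup>2 - 1) powr (- s) * \<psi> (l * z))))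
      = (\<lambda>z. indicator {l<..} (0 + l * z) *\<^sub>R (((0 + l * z)\<^sup>2 - l\<^sup>2) powr (- s) * \<psi> (0 + l * z)))"
    proof
      fix z
      show "l powr (- 2 * s) * (indicator {1<..} z *\<^sub>R ((z\<^sup>2 - 1) powr (- s) * \<psi> (l * z)))
        = indicator {l<..} (0 + l * z) *\<^sub>R (((0 + l * z)\<^sup>2 - l\<^sup>2) powr (- s) * \<psi> (0 + l * z))"
      proof (cases "z > 1")
        case True
        have "(l\<^sup>2) powr (- s) = l powr (- 2 * s)" using power2_powr[OF l, of "- s"] by simp
        moreover have "(l * z)\<^sup>2 - l\<^sup>2 = l\<^sup>2 * (z\<^sup>2 - 1)" by (simp add: power_mult_distrib right_diff_distrib)
        ultimately have "((l * z)\<^sup>2 - l\<^sup>2) powr (- s) = l powr (- 2 * s) * (z\<^sup>2 - 1) powr (- s)"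
          using True by (simp add: powr_mult)
        then show ?thesis using True l by simp
      qed (use l in auto)
    qed
    finally show ?thesis unfolding set_integrable_def
      using lborel_integrable_real_affine_iff[of l "\<lambda>z. indicator {l<..} z *\<^sub>R ((z\<^sup>2 - l\<^sup>2) powr (- s) * \<psi> z)" 0] l by simp
  qed
  let ?u = "\<lambda>z. indicator {l<..} z *\<^sub>R ((z\<^sup>2 - l\<^sup>2) powr (- s) * \<phi> z)"
  let ?v = "\<lambda>z. indicator {l<..} z *\<^sub>R ((z\<^sup>2 - l\<^sup>2) powr (- s) * \<phi> (- z))"
  have iu: "integrable lborel ?u" using half[OF lipschitz_decay_axioms] unfolding set_integrable_def .
  have iv: "integrable lborel ?v" using half[OF reflected] unfolding set_integrable_def .
  have iv': "integrable lborel (\<lambda>z. ?v (- z))" using lborel_integrable_real_affine[OF iv, of "-1" 0] by simp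
  have ev: "(\<integral>z. ?v (- z) \<partial>lborel) = (\<integral>z. ?v z \<partial>lborel)" using lborel_integral_real_affine[of "-1" ?v 0] by simp
  have pt: "indicator {\<tau>. l\<^sup>2 < \<tau>\<^sup>2} \<tau> * ((\<tau>\<^sup>2 - l\<^sup>2) powr (- s) * (sgn \<tau> * \<phi> \<tau>)) = ?u \<tau> - ?v (- \<tau>)" for \<tau>
  proof -
    have "l\<^sup>2 < \<tau>\<^sup>2 \<longleftrightarrow> l < \<bar>\<tau>\<bar>" using l by (metis abs_le_square_iff abs_of_pos not_le)
    then show ?thesis using l by (cases "\<tau> > 0"; cases "\<tau> = 0") (auto simp: indicator_def)
  qed
  have "(\<integral>\<tau>. indicator {\<tau>. l\<^sup>2 < \<tau>\<^sup>2} \<tau> * ((\<tau>\<^sup>2 - l\<^sup>2) powr (- s) * (sgn \<tau> * \<phi> \<tau>)) \<partial>lborel) = (\<integral>\<tau>. ?u \<tau> \<partial>lborel) - (\<integral>\<tau>. ?v \<tau> \<partial>lborel)"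
    unfolding pt using iu iv' ev by simp
  also have "\<dots> = (\<integral>\<tau>. ?u \<tau> - ?v \<tau> \<partial>lborel)" using iu iv by simp
  also have "\<dots> = (LINT z:{l<..}|lborel. (z\<^sup>2 - l\<^sup>2) powr (- s) * (\<phi> z - \<phi> (- z)))"
    unfolding set_lebesgue_integral_def by (intro Bochner_Integration.integral_cong) (auto simp: right_diff_distrib)
  finally show ?thesis .
qed

end

section \<open>Second differences and weights with Lipschitz gradient\<close>

definition second_diff :: "('a::real_vector \<Rightarrow> real) \<Rightarrow> 'a \<Rightarrow> 'a \<Rightarrow> real" where
  "second_diff w h x = 2 * w x - w (x + h) - w (x - h)"

text \<open>The form of the fractional Laplacian symmetrised in h, absolutely convergent for the
  functions considered here; the factor C_{n,s} / 2 that turns it into the normalised operator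
  appears in \<open>frac_lap_value\<close>.\<close>

definition sd_integral :: "real \<Rightarrow> ('a::euclidean_space \<Rightarrow> real) \<Rightarrow> 'a \<Rightarrow> real" where
  "sd_integral s w x = (\<integral>h. second_diff w h x / norm h powr (real DIM('a) + 2 * s) \<partial>lborel)"

lemma sd_dom_integrable:
  assumes s: "0 < s" "s < 1"
  shows "integrable lborel (\<lambda>h::'a::euclidean_space. min 1 ((norm h)\<^sup>2) / norm h powr (real DIM('a) + 2 * s))"
proof (rule integrable_radial_bound[where a="2 - 2 * s" and b="- 2 * s" and B=1])
  fix h :: "'a"
  have pw: "norm h powr c / norm h powr (real DIM('a) + 2 * s) = norm h powr (c - 2 * s - real DIM('a))" for c
  proof -
    have "c - (real DIM('a) + 2 * s) = c - 2 * s - real DIM('a)" by simp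
    then show ?thesis by (metis powr_diff)
  qed
  {
    assume h: "h \<noteq> 0" "norm h \<le> 1"
    then have "(norm h)\<^sup>2 \<le> 1" by (simp add: power_le_one)
    then have "min 1 ((norm h)\<^sup>2) = norm h powr 2" using h by (simp add: powr_numeral min_absorb2)
    then have "min 1 ((norm h)\<^sup>2) / norm h powr (real DIM('a) + 2 * s) = norm h powr (2 - 2 * s - real DIM('a))" by (simp only: pw)
    then show "\<bar>min 1 ((norm h)\<^sup>2) / norm h powr (real DIM('a) + 2 * s)\<bar> \<le> 1 * norm h powr (2 - 2 * s - real DIM('a))" by simp
  }
  {
    assume h: "1 \<le> norm h"
    then have "1 \<le> (norm h)\<^sup>2" "h \<noteq> 0" by (auto simp: one_le_power)
    then have "min 1 ((norm h)\<^sup>2) = norm h powr 0" by (simp add: min_absorb1)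
    then have "min 1 ((norm h)\<^sup>2) / norm h powr (real DIM('a) + 2 * s) = norm h powr (0 - 2 * s - real DIM('a))" by (simp only: pw)
    then show "\<bar>min 1 ((norm h)\<^sup>2) / norm h powr (real DIM('a) + 2 * s)\<bar> \<le> 1 * norm h powr (- 2 * s - real DIM('a))" by simp
  }
qed (use s in auto)

lemma sd_integrand_integrable:
  fixes w :: "'a::euclidean_space \<Rightarrow> real"
  assumes s: "0 < s" "s < 1" and w[measurable]: "w \<in> borel_measurable borel"
    and b: "\<And>h. \<bar>second_diff w h x\<bar> \<le> B * min 1 ((norm h)\<^sup>2)"
  shows "integrable lborel (\<lambda>h. second_diff w h x / norm h powr (real DIM('a) + 2 * s))"
proof (rule Bochner_Integration.integrable_bound[OF integrable_mult_right[OF sd_dom_integrable[OF s], of B]])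
  show "(\<lambda>h. second_diff w h x / norm h powr (real DIM('a) + 2 * s)) \<in> borel_measurable lborel"
    unfolding second_diff_def by measurable
  show "AE h in lborel. norm (second_diff w h x / norm h powr (real DIM('a) + 2 * s))
    \<le> norm (B * (min 1 ((norm h)\<^sup>2) / norm h powr (real DIM('a) + 2 * s)))"
  proof (rule AE_I2)
    fix h :: 'a
    have "norm (second_diff w h x / norm h powr (real DIM('a) + 2 * s)) = \<bar>second_diff w h x\<bar> / norm h powr (real DIM('a) + 2 * s)"
      by (simp add: abs_divide)
    also have "\<dots> \<le> B * min 1 ((norm h)\<^sup>2) / norm h powr (real DIM('a) + 2 * s)"
      by (intro divide_right_mono b) simp
    also have "\<dots> \<le> norm (B * (min 1 ((norm h)\<^sup>2) / norm h powr (real DIM('a) + 2 * s)))"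
      by (simp only: real_norm_def times_divide_eq_right abs_ge_self)
    finally show "norm (second_diff w h x / norm h powr (real DIM('a) + 2 * s))
      \<le> norm (B * (min 1 ((norm h)\<^sup>2) / norm h powr (real DIM('a) + 2 * s)))" .
  qed
qed

text \<open>Tailored to the squared length of the fractional gradient, which does not inherit
  compact support: only the gradient \<open>G\<close> of the weight is asked to decay, by one power.
  A Lipschitz gradient makes second differences quadratic for small h, boundedness controls them for
  large h, and both gradient bounds pass to restrictions to lines.\<close>

locale acf_weight =
  fixes w :: "'a::euclidean_space \<Rightarrow> real" and G :: "'a \<Rightarrow> 'a" and M s :: real
  assumes deriv: "\<And>x. (w has_derivative (\<lambda>h. G x \<bullet> h)) (at x)"
    and lipG: "\<And>x y. norm (G x - G y) \<le> M * norm (x - y)"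
    and decG: "\<And>x. norm (G x) * (1 + norm x) \<le> M"
    and bnd: "\<And>x. \<bar>w x\<bar> \<le> M"
    and s: "0 < s" "s < 1"
begin

lemma M_nonneg: "M \<ge> 0" using order_trans[OF abs_ge_zero bnd] .

lemma w_borel[measurable]: "w \<in> borel_measurable borel"
  by (rule borel_measurable_continuous_onI)
     (auto intro!: continuous_at_imp_continuous_on has_derivative_continuous[OF deriv])

lemma G_borel[measurable]: "G \<in> borel_measurable borel"
proof (rule borel_measurable_continuous_onI)
  have "M-lipschitz_on UNIV G" using lipG M_nonneg by (intro lipschitz_onI) (auto simp: dist_norm)
  then show "continuous_on UNIV G" by (rule lipschitz_on_continuous_on)
qed

lemma line:
  assumes \<theta>: "norm \<theta> = 1" shows "lipschitz_decay (\<lambda>\<tau>. G (y + \<tau> *\<^sub>R \<theta>) \<bullet> \<theta>) (M * (1 + norm y)) s"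
proof
  have ci: "\<bar>v \<bullet> \<theta>\<bar> \<le> norm v" for v using Cauchy_Schwarz_ineq2[of v \<theta>] \<theta> by simp
  fix a b :: real
  have "\<bar>G (y + a *\<^sub>R \<theta>) \<bullet> \<theta> - G (y + b *\<^sub>R \<theta>) \<bullet> \<theta>\<bar> \<le> norm (G (y + a *\<^sub>R \<theta>) - G (y + b *\<^sub>R \<theta>))"
    using ci by (simp add: inner_diff_left[symmetric])
  also have "\<dots> \<le> M * norm ((a - b) *\<^sub>R \<theta>)" using lipG[of "y + a *\<^sub>R \<theta>" "y + b *\<^sub>R \<theta>"] by (simp add: scaleR_diff_left)
  also have "\<dots> = M * \<bar>a - b\<bar>" using \<theta> by simp
  also have "\<dots> \<le> M * (1 + norm y) * \<bar>a - b\<bar>" using M_nonneg by (intro mult_right_mono) (auto simp: algebra_simps)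
  finally show "\<bar>G (y + a *\<^sub>R \<theta>) \<bullet> \<theta> - G (y + b *\<^sub>R \<theta>) \<bullet> \<theta>\<bar> \<le> M * (1 + norm y) * \<bar>a - b\<bar>" .
  have "\<bar>a\<bar> = norm (y + a *\<^sub>R \<theta> - y)" using \<theta> by simp
  also have "\<dots> \<le> norm (y + a *\<^sub>R \<theta>) + norm y" by (rule norm_triangle_ineq4)
  finally have "1 + \<bar>a\<bar> \<le> 1 + norm (y + a *\<^sub>R \<theta>) + norm y" by simp
  also have "\<dots> \<le> (1 + norm (y + a *\<^sub>R \<theta>)) * (1 + norm y)" by (simp add: algebra_simps)
  finally have "\<bar>G (y + a *\<^sub>R \<theta>) \<bullet> \<theta>\<bar> * (1 + \<bar>a\<bar>) \<le> norm (G (y + a *\<^sub>R \<theta>)) * ((1 + norm (y + a *\<^sub>R \<theta>)) * (1 + norm y))"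
    using ci by (intro mult_mono) auto
  also have "\<dots> \<le> M * (1 + norm y)"
    unfolding mult.assoc[symmetric] by (intro mult_right_mono decG) auto
  finally show "\<bar>G (y + a *\<^sub>R \<theta>) \<bullet> \<theta>\<bar> * (1 + \<bar>a\<bar>) \<le> M * (1 + norm y)" .
qed (use s in auto)

definition dirP :: "'a \<Rightarrow> 'a \<Rightarrow> real" where
  "dirP \<theta> y = (LINT t:{0<..}|lborel. (G (y + t *\<^sub>R \<theta>) \<bullet> \<theta> - G (y - t *\<^sub>R \<theta>) \<bullet> \<theta>) * t powr (- 2 * s))"

lemma dirP_borel[measurable (raw)]:
  "f \<in> borel_measurable N \<Longrightarrow> g \<in> borel_measurable N \<Longrightarrow> (\<lambda>x. dirP (f x) (g x)) \<in> borel_measurable N"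
proof -
  have m: "(\<lambda>p. dirP (fst p) (snd p)) \<in> borel_measurable (borel \<Otimes>\<^sub>M borel)"
    unfolding dirP_def set_lebesgue_integral_def by measurable
  assume fg: "f \<in> borel_measurable N" "g \<in> borel_measurable N"
  have "(\<lambda>x. (f x, g x)) \<in> N \<rightarrow>\<^sub>M (borel \<Otimes>\<^sub>M borel)" using fg by measurable
  from measurable_compose[OF this m] show ?thesis by simp
qed

lemma riesz_diff_line:
  assumes \<theta>: "norm \<theta> = 1"
  shows "lipschitz_decay.riesz_diff (\<lambda>\<tau>. G (y + \<tau> *\<^sub>R \<theta>) \<bullet> \<theta>) s \<tau> = dirP \<theta> (y + \<tau> *\<^sub>R \<theta>)"
proof -
  interpret L: lipschitz_decay "\<lambda>\<tau>. G (y + \<tau> *\<^sub>R \<theta>) \<bullet> \<theta>" "M * (1 + norm y)" s by (rule line[OF \<theta>])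
  show ?thesis unfolding L.riesz_diff_def dirP_def by (simp add: algebra_simps)
qed

lemma dirP_bound:
  assumes \<theta>: "norm \<theta> = 1"
  shows "\<bar>dirP \<theta> y\<bar> \<le> 2 * M * (1 + norm y) * lipschitz_decay.riesz_diff_const s"
proof -
  interpret L: lipschitz_decay "\<lambda>\<tau>. G (y + \<tau> *\<^sub>R \<theta>) \<bullet> \<theta>" "M * (1 + norm y)" s by (rule line[OF \<theta>])
  show ?thesis using L.riesz_diff_bound[of 0] riesz_diff_line[OF \<theta>, of y 0] by simp
qed

text \<open>For short steps the tangent plane at x is subtracted from both w(x+h) and w(x-h); the
  linear terms cancel and the Lipschitz gradient leaves a quadratic error. For long steps the 4
  counts the values of w, with w(x) taken twice.\<close>

lemma second_diff_bound: "\<bar>second_diff w h x\<bar> \<le> (4 * M) * min 1 ((norm h)\<^sup>2)"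
proof -
  have lin: "\<bar>w (x + h) - w x - G x \<bullet> h\<bar> \<le> M * (norm h)\<^sup>2" for h
  proof -
    let ?f = "\<lambda>z. w z - G x \<bullet> z"
    have "norm (?f (x + h) - ?f x) \<le> (M * norm h) * norm ((x + h) - x)"
    proof (rule differentiable_bound[where S="cball x (norm h)" and f'="\<lambda>z h. (G z - G x) \<bullet> h"])
      fix z assume z: "z \<in> cball x (norm h)"
      have "(?f has_derivative (\<lambda>h. G z \<bullet> h - G x \<bullet> h)) (at z)"
        by (intro has_derivative_diff deriv) (auto intro!: derivative_eq_intros)
      then show "(?f has_derivative (\<lambda>h. (G z - G x) \<bullet> h)) (at z within cball x (norm h))"
        by (simp add: inner_diff_left has_derivative_at_withinI)
      have "onorm (\<lambda>h. (G z - G x) \<bullet> h) \<le> norm (G z - G x)"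
      proof (rule onorm_bound)
        show "norm ((G z - G x) \<bullet> v) \<le> norm (G z - G x) * norm v" for v
          using Cauchy_Schwarz_ineq2 by simp
      qed simp
      also have "\<dots> \<le> M * norm (z - x)" by (rule lipG)
      also have "\<dots> \<le> M * norm h" using z M_nonneg by (intro mult_left_mono) (auto simp: dist_norm norm_minus_commute)
      finally show "onorm (\<lambda>h. (G z - G x) \<bullet> h) \<le> M * norm h" .
    qed (auto simp: dist_norm)
    then show ?thesis by (simp add: inner_add_right power2_eq_square algebra_simps)
  qed
  have "second_diff w h x = - (w (x + h) - w x - G x \<bullet> h) - (w (x + (- h)) - w x - G x \<bullet> (- h))"
    by (simp add: second_diff_def)
  then have "\<bar>second_diff w h x\<bar> \<le> M * (norm h)\<^sup>2 + M * (norm (- h))\<^sup>2"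
    using lin[of h] lin[of "- h"] by linarith
  moreover have "0 \<le> M * (norm h)\<^sup>2" using M_nonneg by simp
  ultimately have 1: "\<bar>second_diff w h x\<bar> \<le> 4 * M * (norm h)\<^sup>2" by simp
  have 2: "\<bar>second_diff w h x\<bar> \<le> 4 * M" unfolding second_diff_def
    using bnd[of x] bnd[of "x + h"] bnd[of "x - h"] by linarith
  show ?thesis
  proof (cases "(norm h)\<^sup>2 \<le> 1")
    case True then show ?thesis using 1 by (simp add: min_absorb2)
  next
    case False then show ?thesis using 2 by (simp add: min_absorb1)
  qed
qed

text \<open>On each ray |h|^(-n-2s) dh becomes t^(-1-2s) dt, so the dimension disappears and
  \<open>riesz_diff_by_parts\<close> applies to the primitive w(y + t \<theta>) of the directional
  derivative.\<close>

lemma sd_integral_polar: "sd_integral s w y = - (1 / (2 * s)) * (\<integral>\<theta>. dirP \<theta> y \<partial>sphere_measure)"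
proof -
  let ?f = "\<lambda>h. second_diff w h y / norm h powr (real DIM('a) + 2 * s)"
  have int: "integrable lborel ?f"
    by (rule sd_integrand_integrable[OF s w_borel second_diff_bound])
  have "sd_integral s w y = (\<integral>\<theta>. (LINT \<tau>:{0<..}|lborel. ?f (\<tau> *\<^sub>R \<theta>) * \<tau> ^ (DIM('a) - 1)) \<partial>sphere_measure)"
    unfolding sd_integral_def by (rule integral_polar[OF int])
  also have "\<dots> = (\<integral>\<theta>. - (dirP \<theta> y / (2 * s)) \<partial>sphere_measure)"
  proof (rule integral_cong_AE)
    show "AE \<theta> in sphere_measure. (LINT \<tau>:{0<..}|lborel. ?f (\<tau> *\<^sub>R \<theta>) * \<tau> ^ (DIM('a) - 1)) = - (dirP \<theta> y / (2 * s))"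
      using AE_sphere_measure_norm
    proof eventually_elim
      case (elim \<theta>)
      interpret L: lipschitz_decay "\<lambda>\<tau>. G (y + \<tau> *\<^sub>R \<theta>) \<bullet> \<theta>" "M * (1 + norm y)" s by (rule line[OF elim])
      have pw: "\<tau> ^ (DIM('a) - 1) / \<tau> powr (real DIM('a) + 2 * s) = \<tau> powr (- 1 - 2 * s)" if "\<tau> > 0" for \<tau> :: real
      proof -
        have "\<tau> ^ (DIM('a) - 1) = \<tau> powr (real (DIM('a) - 1))" by (rule powr_realpow[OF that, symmetric])
        also have "real (DIM('a) - 1) = real (DIM('a)) - 1"
          using DIM_positive[where 'a='a] by (metis One_nat_def Suc_leI of_nat_1 of_nat_diff)
        finally show ?thesis using that by (simp add: powr_diff[symmetric])
      qed
      have "(LINT \<tau>:{0<..}|lborel. ?f (\<tau> *\<^sub>R \<theta>) * \<tau> ^ (DIM('a) - 1))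
         = (LINT t:{0<..}|lborel. (2 * w (y + 0 *\<^sub>R \<theta>) - w (y + (0 + t) *\<^sub>R \<theta>) - w (y + (0 - t) *\<^sub>R \<theta>)) * t powr (- 1 - 2 * s))"
      proof (rule set_lebesgue_integral_cong, simp, intro allI impI)
        fix t :: real assume "t \<in> {0<..}"
        then have t: "t > 0" by simp
        then show "?f (t *\<^sub>R \<theta>) * t ^ (DIM('a) - 1) = (2 * w (y + 0 *\<^sub>R \<theta>) - w (y + (0 + t) *\<^sub>R \<theta>) - w (y + (0 - t) *\<^sub>R \<theta>)) * t powr (- 1 - 2 * s)"
          unfolding pw[OF t, symmetric] using elim by (simp add: second_diff_def)
      qed
      also have "\<dots> = - (L.riesz_diff 0 / (2 * s))"
      proof (rule L.riesz_diff_by_parts)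
        fix x :: real
        have "((\<lambda>\<tau>. y + \<tau> *\<^sub>R \<theta>) has_derivative (\<lambda>h. h *\<^sub>R \<theta>)) (at x)"
          by (auto intro!: derivative_eq_intros)
        from has_derivative_compose[OF this deriv]
        have "((\<lambda>\<tau>. w (y + \<tau> *\<^sub>R \<theta>)) has_derivative (\<lambda>h. G (y + x *\<^sub>R \<theta>) \<bullet> (h *\<^sub>R \<theta>))) (at x)" .
        then show "((\<lambda>\<tau>. w (y + \<tau> *\<^sub>R \<theta>)) has_real_derivative G (y + x *\<^sub>R \<theta>) \<bullet> \<theta>) (at x)"
          by (simp add: has_field_derivative_def mult_commute_abs)
      qed
      also have "L.riesz_diff 0 = dirP \<theta> y" using riesz_diff_line[OF elim, of y 0] by simp
      finally show ?case .
    qed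
    show "(\<lambda>\<theta>. LINT \<tau>:{0<..}|lborel. ?f (\<tau> *\<^sub>R \<theta>) * \<tau> ^ (DIM('a) - 1)) \<in> borel_measurable sphere_measure"
      unfolding second_diff_def set_lebesgue_integral_def by measurable
  qed measurable
  finally show ?thesis by simp
qed

definition ball_int :: "'a \<Rightarrow> 'a \<Rightarrow> real" where
  "ball_int \<theta> y = indicator {y. norm y < 1} y * (1 - (norm y)\<^sup>2) powr (s - 1) * dirP \<theta> y"

text \<open>On the line z = y + r \<theta> with y orthogonal to \<theta> and l^2 = 1 - |y|^2, one
  has |z|^2 - 1 = r^2 - l^2 and 1 - |z|^2 + (z . \<theta>)^2 = l^2. This is therefore the exterior
  integrand of the chord identity, factor l^(2s-1) included, written in terms of z alone.\<close>

definition ext_int :: "'a \<Rightarrow> 'a \<Rightarrow> real" where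
  "ext_int \<theta> z = indicator {z. 1 < norm z} z * ((norm z)\<^sup>2 - 1) powr (- s) *
     (cone_kernel s (1 - (norm z)\<^sup>2 + (z \<bullet> \<theta>)\<^sup>2) * (sgn (z \<bullet> \<theta>) * (G z \<bullet> \<theta>)))"

lemma ball_int_joint: "integrable (sphere_measure \<Otimes>\<^sub>M lborel) (\<lambda>(\<theta>, y). ball_int \<theta> y)"
proof -
  let ?K = "4 * M * lipschitz_decay.riesz_diff_const s"
  let ?b = "\<lambda>y::'a. indicator {y. norm y < 1} y * (1 - (norm y)\<^sup>2) powr (s - 1)"
  have pc: "lipschitz_decay.riesz_diff_const s \<ge> 0"
  proof -
    interpret Z: lipschitz_decay "\<lambda>x. 0" 0 s by unfold_locales (use s in auto)
    show ?thesis unfolding Z.riesz_diff_const_def set_lebesgue_integral_def by (intro integral_nonneg_AE AE_I2) (auto split: split_indicator)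
  qed
  have ib: "integrable lborel (\<lambda>y. ?K * ?b y)" using ball_weight_integrable[OF s(1)] by (rule integrable_mult_right)
  have bound: "\<bar>ball_int \<theta> y\<bar> \<le> ?K * ?b y" if "norm \<theta> = 1" for \<theta> y
  proof (cases "norm y < 1")
    case True
    have "\<bar>dirP \<theta> y\<bar> \<le> 2 * M * (1 + norm y) * lipschitz_decay.riesz_diff_const s" by (rule dirP_bound[OF that])
    also have "\<dots> \<le> 2 * M * 2 * lipschitz_decay.riesz_diff_const s" using True M_nonneg pc by (intro mult_right_mono mult_left_mono) auto
    finally have "\<bar>dirP \<theta> y\<bar> \<le> ?K" by simp
    then show ?thesis using True by (simp add: ball_int_def abs_mult mult.commute mult_right_mono)
  qed (simp add: ball_int_def)
  show ?thesis
  proof (rule sphere_pair.Fubini_integrable)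
    show m: "(\<lambda>(\<theta>, y). ball_int \<theta> y) \<in> borel_measurable (sphere_measure \<Otimes>\<^sub>M lborel)"
      unfolding ball_int_def by measurable
    have int: "integrable lborel (ball_int \<theta>)" if "norm \<theta> = 1" for \<theta>
    proof (rule Bochner_Integration.integrable_bound[OF ib])
      show "ball_int \<theta> \<in> borel_measurable lborel" unfolding ball_int_def[abs_def] by measurable
      show "AE x in lborel. norm (ball_int \<theta> x) \<le> norm (?K * ?b x)"
        using bound[OF that] by (intro AE_I2) (simp, smt (verit))
    qed
    show "AE \<theta> in sphere_measure. integrable lborel (\<lambda>y. (\<lambda>(\<theta>, y). ball_int \<theta> y) (\<theta>, y))"
      using AE_sphere_measure_norm by eventually_elim (use int in simp)
    show "integrable sphere_measure (\<lambda>\<theta>. \<integral>y. norm ((\<lambda>(\<theta>, y). ball_int \<theta> y) (\<theta>, y)) \<partial>lborel)"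
    proof (rule sphere.integrable_const_bound[where B="\<integral>y. ?K * ?b y \<partial>lborel"])
      show "AE \<theta> in sphere_measure. norm (\<integral>y. norm ((\<lambda>(\<theta>, y). ball_int \<theta> y) (\<theta>, y)) \<partial>lborel) \<le> (\<integral>y. ?K * ?b y \<partial>lborel)"
        using AE_sphere_measure_norm
      proof eventually_elim
        case (elim \<theta>)
        have "(\<integral>y. \<bar>ball_int \<theta> y\<bar> \<partial>lborel) \<le> (\<integral>y. ?K * ?b y \<partial>lborel)"
          by (intro integral_mono ib integrable_abs int elim bound)
        then show ?case by simp
      qed
      show "(\<lambda>\<theta>. \<integral>y. norm ((\<lambda>(\<theta>, y). ball_int \<theta> y) (\<theta>, y)) \<partial>lborel) \<in> borel_measurable sphere_measure"
        using m by measurable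
    qed
  qed
qed

text \<open>The direction is integrated first, where \<open>cone_bound\<close> dominates the
  possibly unbounded kernel; the remaining integral converges thanks to the factor 1 / (1 + |z|)
  taken from the decay of G.\<close>

lemma ext_int_joint: "integrable (sphere_measure \<Otimes>\<^sub>M lborel) (\<lambda>(\<theta>, z). ext_int \<theta> z)"
proof (rule integrableI_bounded)
  show m: "(\<lambda>(\<theta>, z). ext_int \<theta> z) \<in> borel_measurable (sphere_measure \<Otimes>\<^sub>M lborel)"
    unfolding ext_int_def by measurable
  let ?c = "\<lambda>z::'a. indicator {z. norm z > 1} z * (((norm z)\<^sup>2 - 1) powr (- s) * cone_bound s TYPE('a) (norm z) / (1 + norm z))"
  have "(\<integral>\<^sup>+p. ennreal (norm (case p of (\<theta>, z) \<Rightarrow> ext_int \<theta> z)) \<partial>(sphere_measure \<Otimes>\<^sub>M lborel))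
     = (\<integral>\<^sup>+z. (\<integral>\<^sup>+\<theta>. ennreal (norm (ext_int \<theta> z)) \<partial>sphere_measure) \<partial>lborel)"
    using m by (subst sphere_pair.nn_integral_snd[symmetric]) auto
  also have "\<dots> \<le> (\<integral>\<^sup>+z. ennreal (M * ?c z) \<partial>lborel)"
  proof (rule nn_integral_mono)
    fix z :: 'a
    show "(\<integral>\<^sup>+\<theta>. ennreal (norm (ext_int \<theta> z)) \<partial>sphere_measure) \<le> ennreal (M * ?c z)"
    proof (cases "norm z > 1")
      case True
      let ?a = "((norm z)\<^sup>2 - 1) powr (- s) * (M / (1 + norm z))"
      have a0: "?a \<ge> 0" using M_nonneg by simp
      have "(\<integral>\<^sup>+\<theta>. ennreal (norm (ext_int \<theta> z)) \<partial>sphere_measure)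
        \<le> (\<integral>\<^sup>+\<theta>. ennreal ?a * ennreal (cone_kernel s (1 - (norm z)\<^sup>2 + (z \<bullet> \<theta>)\<^sup>2)) \<partial>sphere_measure)"
      proof (rule nn_integral_mono_AE, use AE_sphere_measure_norm in eventually_elim)
        fix \<theta> :: 'a assume \<theta>: "norm \<theta> = 1"
        have "norm (G z) \<le> M / (1 + norm z)" using decG[of z] by (simp add: field_simps add_pos_nonneg)
        moreover have "\<bar>G z \<bullet> \<theta>\<bar> \<le> norm (G z)" using Cauchy_Schwarz_ineq2[of "G z" \<theta>] \<theta> by simp
        ultimately have g: "\<bar>sgn (z \<bullet> \<theta>)\<bar> * \<bar>G z \<bullet> \<theta>\<bar> \<le> 1 * (M / (1 + norm z))"
          by (intro mult_mono) (auto simp: abs_sgn_eq)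
        have "norm (ext_int \<theta> z) = ((norm z)\<^sup>2 - 1) powr (- s) * (cone_kernel s (1 - (norm z)\<^sup>2 + (z \<bullet> \<theta>)\<^sup>2) * (\<bar>sgn (z \<bullet> \<theta>)\<bar> * \<bar>G z \<bullet> \<theta>\<bar>))"
          using True by (simp add: ext_int_def abs_mult)
        also have "\<dots> \<le> ((norm z)\<^sup>2 - 1) powr (- s) * (cone_kernel s (1 - (norm z)\<^sup>2 + (z \<bullet> \<theta>)\<^sup>2) * (1 * (M / (1 + norm z))))"
          by (intro mult_left_mono g) auto
        also have "\<dots> = ?a * cone_kernel s (1 - (norm z)\<^sup>2 + (z \<bullet> \<theta>)\<^sup>2)" by simp
        finally show "ennreal (norm (ext_int \<theta> z)) \<le> ennreal ?a * ennreal (cone_kernel s (1 - (norm z)\<^sup>2 + (z \<bullet> \<theta>)\<^sup>2))"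
          using a0 by (simp add: ennreal_mult[symmetric])
      qed
      also have "\<dots> = ennreal ?a * (\<integral>\<^sup>+\<theta>. ennreal (cone_kernel s (1 - (norm z)\<^sup>2 + (z \<bullet> \<theta>)\<^sup>2)) \<partial>sphere_measure)"
        by (rule nn_integral_cmult) measurable
      also have "\<dots> \<le> ennreal ?a * ennreal (cone_bound s TYPE('a) (norm z))"
        by (intro mult_left_mono cone_mass_le_bound[OF True s(1)]) simp
      also have "\<dots> = ennreal (M * ?c z)"
        using True a0 cone_bound_nonneg[OF True s(1), where 'a='a] by (simp add: ennreal_mult[symmetric] mult_ac)
      finally show ?thesis .
    qed (simp add: ext_int_def)
  qed
  also have "\<dots> < \<infinity>"
  proof -
    have "integrable lborel (\<lambda>z. M * ?c z)" by (intro integrable_mult_right cone_bound_integrable s)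
    then have "(\<integral>\<^sup>+z. ennreal (norm (M * ?c z)) \<partial>lborel) < \<infinity>" by (simp add: integrable_iff_bounded)
    moreover have "(\<integral>\<^sup>+z. ennreal (M * ?c z) \<partial>lborel) \<le> (\<integral>\<^sup>+z. ennreal (norm (M * ?c z)) \<partial>lborel)"
      by (intro nn_integral_mono ennreal_leI) (simp only: real_norm_def abs_ge_self)
    ultimately show ?thesis by (rule le_less_trans[rotated])
  qed
  finally show "(\<integral>\<^sup>+p. ennreal (norm (case p of (\<theta>, z) \<Rightarrow> ext_int \<theta> z)) \<partial>(sphere_measure \<Otimes>\<^sub>M lborel)) < \<infinity>" .
qed

text \<open>Both sides are sliced along lines parallel to \<theta>. A line meeting the open ball
  gives the chord identity with half-length sqrt(1 - |y|^2). A line missing it gives 0 = 0: it has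
  no interior points, and \<open>cone_kernel\<close> vanishes.\<close>

lemma direction_identity:
  assumes \<theta>: "norm \<theta> = 1" and ib: "integrable lborel (ball_int \<theta>)" and ie: "integrable lborel (ext_int \<theta>)"
  shows "(\<integral>y. ball_int \<theta> y \<partial>lborel) = cosh_integral s * (\<integral>z. ext_int \<theta> z \<partial>lborel)"
proof -
  have \<theta>0: "\<theta> \<noteq> 0" using \<theta> by auto
  have tt: "\<theta> \<bullet> \<theta> = 1" using \<theta> by (simp add: norm_eq_sqrt_inner)
  have "(\<integral>y. ball_int \<theta> y \<partial>lborel) = (\<integral>z. cosh_integral s * ext_int \<theta> z \<partial>lborel)"
  proof (rule integral_lines_cong[OF ib integrable_mult_right[OF ie] \<theta>0])
    fix y assume y: "y \<bullet> \<theta> = 0"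
    have n2: "(norm (y + \<tau> *\<^sub>R \<theta>))\<^sup>2 = (norm y)\<^sup>2 + \<tau>\<^sup>2" for \<tau>
      unfolding power2_norm_eq_inner using y tt
      by (simp add: inner_add_left inner_add_right inner_commute power2_eq_square)
    have i: "(y + \<tau> *\<^sub>R \<theta>) \<bullet> \<theta> = \<tau>" for \<tau> using y tt by (simp add: inner_add_left)
    have lt1: "norm z < 1 \<longleftrightarrow> (norm z)\<^sup>2 < 1" for z :: 'a by (simp add: abs_square_less_1)
    have gt1: "1 < norm z \<longleftrightarrow> 1 < (norm z)\<^sup>2" for z :: 'a
      by (metis abs_norm_cancel abs_square_le_1 not_le)
    interpret L: lipschitz_decay "\<lambda>\<tau>. G (y + \<tau> *\<^sub>R \<theta>) \<bullet> \<theta>" "M * (1 + norm y)" s by (rule line[OF \<theta>])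
    have B: "ball_int \<theta> (y + \<tau> *\<^sub>R \<theta>) = (if \<tau>\<^sup>2 < 1 - (norm y)\<^sup>2 then (1 - (norm y)\<^sup>2 - \<tau>\<^sup>2) powr (s - 1) * L.riesz_diff \<tau> else 0)" for \<tau>
      unfolding ball_int_def riesz_diff_line[OF \<theta>] by (simp add: indicator_def lt1 n2 algebra_simps)
    have E: "ext_int \<theta> (y + \<tau> *\<^sub>R \<theta>) = (if 1 - (norm y)\<^sup>2 < \<tau>\<^sup>2 then (\<tau>\<^sup>2 - (1 - (norm y)\<^sup>2)) powr (- s) * (cone_kernel s (1 - (norm y)\<^sup>2) * (sgn \<tau> * (G (y + \<tau> *\<^sub>R \<theta>) \<bullet> \<theta>))) else 0)" for \<tau>
      unfolding ext_int_def n2 i by (simp add: indicator_def gt1 n2 algebra_simps)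
    show "(\<integral>\<tau>. ball_int \<theta> (y + \<tau> *\<^sub>R \<theta>) \<partial>lborel) = (\<integral>\<tau>. cosh_integral s * ext_int \<theta> (y + \<tau> *\<^sub>R \<theta>) \<partial>lborel)"
    proof (cases "norm y < 1")
      case False
      then have ge: "1 - (norm y)\<^sup>2 \<le> 0" using lt1[of y] by simp
      then have "\<not> \<tau>\<^sup>2 < 1 - (norm y)\<^sup>2" for \<tau> by (smt (verit) zero_le_power2)
      then have "ball_int \<theta> (y + \<tau> *\<^sub>R \<theta>) = 0" for \<tau> unfolding B by simp
      moreover have "cone_kernel s (1 - (norm y)\<^sup>2) = 0" by (rule cone_kernel_neg[OF ge])
      then have "ext_int \<theta> (y + \<tau> *\<^sub>R \<theta>) = 0" for \<tau> unfolding E by simp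
      ultimately show ?thesis by simp
    next
      case True
      define l where "l = sqrt (1 - (norm y)\<^sup>2)"
      have l2: "1 - (norm y)\<^sup>2 = l\<^sup>2" and l: "l > 0" using True lt1[of y] by (auto simp: l_def)
      have ck: "cone_kernel s (l\<^sup>2) = l powr (2 * s - 1)"
      proof -
        have "(l\<^sup>2) powr (s - 1 / 2) = l powr (2 * (s - 1 / 2))" using l by (rule power2_powr)
        also have "2 * (s - 1 / 2) = 2 * s - 1" by simp
        finally show ?thesis by (simp add: cone_kernel_def max_absorb2)
      qed
      have mem: "\<tau>\<^sup>2 < l\<^sup>2 \<longleftrightarrow> \<tau> \<in> {-l<..<l}" for \<tau>
      proof -
        have "\<tau>\<^sup>2 < l\<^sup>2 \<longleftrightarrow> \<bar>\<tau>\<bar> < l" using l by (metis abs_le_square_iff abs_of_pos not_le)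
        then show ?thesis by auto
      qed
      have "(\<integral>\<tau>. ball_int \<theta> (y + \<tau> *\<^sub>R \<theta>) \<partial>lborel) = (LINT \<tau>:{-l<..<l}|lborel. (l\<^sup>2 - \<tau>\<^sup>2) powr (s - 1) * L.riesz_diff \<tau>)"
        unfolding B l2 mem set_lebesgue_integral_def by (intro Bochner_Integration.integral_cong) (auto simp: indicator_def)
      also have "\<dots> = cosh_integral s * l powr (2 * s - 1) * (\<integral>\<tau>. indicator {\<tau>. l\<^sup>2 < \<tau>\<^sup>2} \<tau> * ((\<tau>\<^sup>2 - l\<^sup>2) powr (- s) * (sgn \<tau> * (G (y + \<tau> *\<^sub>R \<theta>) \<bullet> \<theta>))) \<partial>lborel)"
        unfolding L.exterior_line[OF l] by (rule L.scaled_interval_identity(2)[OF l])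
      also have "\<dots> = (\<integral>\<tau>. (cosh_integral s * l powr (2 * s - 1)) * (indicator {\<tau>. l\<^sup>2 < \<tau>\<^sup>2} \<tau> * ((\<tau>\<^sup>2 - l\<^sup>2) powr (- s) * (sgn \<tau> * (G (y + \<tau> *\<^sub>R \<theta>) \<bullet> \<theta>)))) \<partial>lborel)"
        by simp
      also have "\<dots> = (\<integral>\<tau>. cosh_integral s * ext_int \<theta> (y + \<tau> *\<^sub>R \<theta>) \<partial>lborel)"
        unfolding E l2 ck by (intro Bochner_Integration.integral_cong) (auto simp: indicator_def)
      finally show ?thesis .
    qed
  qed
  then show ?thesis by simp
qed

definition outer_flux :: "'a \<Rightarrow> real" where
  "outer_flux z = indicator {z. 1 < norm z} z * (((norm z)\<^sup>2 - 1) powr (- s) / norm z ^ DIM('a) * (G z \<bullet> z))"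

lemma ext_int_angular: "(\<integral>\<theta>. ext_int \<theta> z \<partial>sphere_measure) = angular_const s TYPE('a) * outer_flux z"
proof (cases "norm z > 1")
  case True
  then show ?thesis unfolding ext_int_def using cone_vector_integral(2)[OF True s(1), of "G z"]
    by (simp add: outer_flux_def)
qed (simp add: ext_int_def outer_flux_def)

text \<open>Each factor of the constant has its own source: 1 / (2s) from the integration by parts
  along rays, \<open>cosh_integral\<close> from the chord identity, \<open>angular_const\<close>
  from averaging the exterior integrand over directions. All are positive, so the minus sign decides
  the sign of the flux.\<close>

theorem ball_flux_identity:
  "(\<integral>y. indicator {y. norm y < 1} y * (1 - (norm y)\<^sup>2) powr (s - 1) * sd_integral s w y \<partial>lborel)
    = - (cosh_integral s * angular_const s TYPE('a) / (2 * s)) * (\<integral>z. outer_flux z \<partial>lborel)"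
proof -
  have "(\<integral>y. indicator {y. norm y < 1} y * (1 - (norm y)\<^sup>2) powr (s - 1) * sd_integral s w y \<partial>lborel)
     = (\<integral>y. - (1 / (2 * s)) * (\<integral>\<theta>. ball_int \<theta> y \<partial>sphere_measure) \<partial>lborel)"
    unfolding sd_integral_polar ball_int_def by (intro Bochner_Integration.integral_cong) auto
  also have "\<dots> = - (1 / (2 * s)) * (\<integral>y. (\<integral>\<theta>. ball_int \<theta> y \<partial>sphere_measure) \<partial>lborel)" by simp
  also have "(\<integral>y. (\<integral>\<theta>. ball_int \<theta> y \<partial>sphere_measure) \<partial>lborel) = (\<integral>\<theta>. (\<integral>y. ball_int \<theta> y \<partial>lborel) \<partial>sphere_measure)"
    by (rule sphere_pair.Fubini_integral[OF ball_int_joint])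
  also have "\<dots> = (\<integral>\<theta>. cosh_integral s * (\<integral>z. ext_int \<theta> z \<partial>lborel) \<partial>sphere_measure)"
  proof (rule integral_cong_AE)
    show "AE \<theta> in sphere_measure. (\<integral>y. ball_int \<theta> y \<partial>lborel) = cosh_integral s * (\<integral>z. ext_int \<theta> z \<partial>lborel)"
      using AE_sphere_measure_norm sphere_pair.AE_integrable_fst[OF ball_int_joint] sphere_pair.AE_integrable_fst[OF ext_int_joint]
      by eventually_elim (rule direction_identity)
    show "(\<lambda>\<theta>. \<integral>y. ball_int \<theta> y \<partial>lborel) \<in> borel_measurable sphere_measure"
      unfolding ball_int_def by measurable
    show "(\<lambda>\<theta>. cosh_integral s * (\<integral>z. ext_int \<theta> z \<partial>lborel)) \<in> borel_measurable sphere_measure"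
      unfolding ext_int_def by measurable
  qed
  also have "\<dots> = cosh_integral s * (\<integral>\<theta>. (\<integral>z. ext_int \<theta> z \<partial>lborel) \<partial>sphere_measure)" by simp
  also have "(\<integral>\<theta>. (\<integral>z. ext_int \<theta> z \<partial>lborel) \<partial>sphere_measure) = (\<integral>z. (\<integral>\<theta>. ext_int \<theta> z \<partial>sphere_measure) \<partial>lborel)"
    by (rule sphere_pair.Fubini_integral[OF ext_int_joint, symmetric])
  also have "\<dots> = angular_const s TYPE('a) * (\<integral>z. outer_flux z \<partial>lborel)"
    unfolding ext_int_angular by simp
  finally show ?thesis by simp
qed

end

section \<open>Monotonicity of the averaged means\<close>

lemma outer_kernel_integrable:
  assumes s: "0 < s" "s < 1"
  shows "integrable lborel (\<lambda>z::'a::euclidean_space. indicator {z. 1 < norm z} z * (((norm z)\<^sup>2 - 1) powr (- s) / norm z ^ DIM('a)))"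
proof -
  let ?n = "DIM('a)"
  define \<beta> where "\<beta> = (\<lambda>\<rho>::real. indicator {1<..} \<rho> * ((\<rho>\<^sup>2 - 1) powr (- s) / \<rho> ^ ?n))"
  have [measurable]: "\<beta> \<in> borel_measurable borel" unfolding \<beta>_def by measurable
  have pwn: "1 / \<rho> ^ ?n * \<rho> ^ (?n - 1) = 1 / \<rho>" if "\<rho> > 0" for \<rho> :: real
    using that DIM_positive[where 'a='a] by (cases "DIM('a)") (auto simp: field_simps)
  have val: "\<beta> (1 + t) * (1 + t) ^ (?n - 1) = ((1 + t)\<^sup>2 - 1) powr (- s) / (1 + t)" if "t > 0" for t
  proof -
    have "\<beta> (1 + t) * (1 + t) ^ (?n - 1) = ((1 + t)\<^sup>2 - 1) powr (- s) * (1 / (1 + t) ^ ?n * (1 + t) ^ (?n - 1))"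
      using that by (simp add: \<beta>_def)
    also have "1 / (1 + t) ^ ?n * (1 + t) ^ (?n - 1) = 1 / (1 + t)" using that by (intro pwn) simp
    finally show ?thesis by simp
  qed
  have "set_integrable lborel {0<..} (\<lambda>t. \<beta> (1 + t) * (1 + t) ^ (?n - 1))"
  proof (rule set_integrable_Ioi_powr_bound[where a="- s" and b="- 1 - 2 * s" and B=1])
    fix t :: real assume t: "0 < t" "t \<le> 1"
    have "t \<le> (1 + t)\<^sup>2 - 1" using t by (simp add: power2_eq_square algebra_simps)
    then have "((1 + t)\<^sup>2 - 1) powr (- s) \<le> t powr (- s)" using t s by (intro powr_mono2') auto
    then have "((1 + t)\<^sup>2 - 1) powr (- s) / (1 + t) \<le> t powr (- s) / 1" using t by (intro frac_le) auto
    then show "\<bar>\<beta> (1 + t) * (1 + t) ^ (?n - 1)\<bar> \<le> 1 * t powr (- s)" unfolding val[OF t(1)] using t by simp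
  next
    fix t :: real assume t: "1 \<le> t"
    have "t\<^sup>2 \<le> (1 + t)\<^sup>2 - 1" using t by (simp add: power2_eq_square algebra_simps)
    then have "((1 + t)\<^sup>2 - 1) powr (- s) \<le> (t\<^sup>2) powr (- s)" using t s by (intro powr_mono2') auto
    also have "(t\<^sup>2) powr (- s) = t powr (- 2 * s)" using power2_powr[of t "- s"] t by simp
    finally have "((1 + t)\<^sup>2 - 1) powr (- s) / (1 + t) \<le> t powr (- 2 * s) / t" using t by (intro frac_le) auto
    also have "\<dots> = t powr (- 1 - 2 * s)" using t by (simp add: powr_diff powr_minus field_simps)
    finally show "\<bar>\<beta> (1 + t) * (1 + t) ^ (?n - 1)\<bar> \<le> 1 * t powr (- 1 - 2 * s)"
      using t val[of t] by simp
  qed (use s in auto)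
  then have "integrable lborel (\<lambda>z::'a. \<beta> (norm z))"
    by (rule integrable_radial_outside[rotated 2]) (auto simp: \<beta>_def)
  moreover have "\<beta> (norm z) = indicator {z. 1 < norm z} z * (((norm z)\<^sup>2 - 1) powr (- s) / norm z ^ DIM('a))" for z :: 'a
    by (simp add: \<beta>_def indicator_def)
  ultimately show ?thesis by simp
qed

text \<open>The Poisson kernel of the unit ball for the fractional Laplacian with pole at the
  centre, without the factor \<open>a_ns\<close>.\<close>

definition outer_kernel :: "real \<Rightarrow> 'a::euclidean_space \<Rightarrow> real" where
  "outer_kernel s z = indicator {z. 1 < norm z} z * (((norm z)\<^sup>2 - 1) powr (- s) / norm z ^ DIM('a))"

lemma outer_kernel_nonneg[simp]: "outer_kernel s z \<ge> 0" by (simp add: outer_kernel_def)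

lemma outer_kernel_borel[measurable]: "outer_kernel s \<in> borel_measurable borel"
  unfolding outer_kernel_def[abs_def] by measurable

lemma integrable_outer_kernel: "0 < s \<Longrightarrow> s < 1 \<Longrightarrow> integrable lborel (outer_kernel s)"
  unfolding outer_kernel_def[abs_def] by (rule outer_kernel_integrable)

definition outer_mean :: "real \<Rightarrow> ('a::euclidean_space \<Rightarrow> real) \<Rightarrow> real \<Rightarrow> real" where
  "outer_mean s w t = (\<integral>z. outer_kernel s z * w (t *\<^sub>R z) \<partial>lborel)"

lemma sd_integral_scale:
  fixes w :: "'a::euclidean_space \<Rightarrow> real"
  assumes t: "t > 0"
  shows "sd_integral s (\<lambda>x. w (t *\<^sub>R x)) y = t powr (2 * s) * sd_integral s w (t *\<^sub>R y)"
proof -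
  have pw: "t ^ DIM('a) / t powr (real DIM('a) + 2 * s) = t powr (- 2 * s)"
  proof -
    have "t ^ DIM('a) = t powr real DIM('a)" by (rule powr_realpow[OF t, symmetric])
    then show ?thesis by (simp add: powr_diff[symmetric])
  qed
  have "sd_integral s w (t *\<^sub>R y) = t ^ DIM('a) * (\<integral>h. second_diff w (t *\<^sub>R h) (t *\<^sub>R y) / norm (t *\<^sub>R h) powr (real DIM('a) + 2 * s) \<partial>lborel)"
    unfolding sd_integral_def using t by (subst integral_lborel_affine[where c=t and t=0]) auto
  also have "(\<lambda>h. second_diff w (t *\<^sub>R h) (t *\<^sub>R y) / norm (t *\<^sub>R h) powr (real DIM('a) + 2 * s))
    = (\<lambda>h. 1 / t powr (real DIM('a) + 2 * s) * (second_diff (\<lambda>x. w (t *\<^sub>R x)) h y / norm h powr (real DIM('a) + 2 * s)))"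
    using t by (auto simp: second_diff_def scaleR_add_right scaleR_diff_right powr_mult)
  also have "t ^ DIM('a) * (\<integral>h. 1 / t powr (real DIM('a) + 2 * s) * (second_diff (\<lambda>x. w (t *\<^sub>R x)) h y / norm h powr (real DIM('a) + 2 * s)) \<partial>lborel)
    = (t ^ DIM('a) / t powr (real DIM('a) + 2 * s)) * sd_integral s (\<lambda>x. w (t *\<^sub>R x)) y"
    unfolding sd_integral_def by (simp only: integral_mult_right_zero) simp
  finally have "sd_integral s w (t *\<^sub>R y) = t powr (- 2 * s) * sd_integral s (\<lambda>x. w (t *\<^sub>R x)) y" unfolding pw .
  moreover have "t powr (2 * s) * t powr (- 2 * s) = 1" using t by (simp add: powr_add[symmetric])
  ultimately show ?thesis by (simp add: mult.assoc[symmetric])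
qed

context acf_weight
begin

lemma scaled_weight:
  assumes t: "t > 0"
  shows "acf_weight (\<lambda>x. w (t *\<^sub>R x)) (\<lambda>x. t *\<^sub>R G (t *\<^sub>R x)) (M * (1 + t + t\<^sup>2)) s"
proof
  fix x y :: 'a
  have "((\<lambda>x. t *\<^sub>R x) has_derivative (\<lambda>h. t *\<^sub>R h)) (at x)" by (auto intro!: derivative_eq_intros)
  from has_derivative_compose[OF this deriv[of "t *\<^sub>R x"]]
  show "((\<lambda>x. w (t *\<^sub>R x)) has_derivative (\<lambda>h. (t *\<^sub>R G (t *\<^sub>R x)) \<bullet> h)) (at x)" by simp
  have "norm (t *\<^sub>R G (t *\<^sub>R x) - t *\<^sub>R G (t *\<^sub>R y)) = t * norm (G (t *\<^sub>R x) - G (t *\<^sub>R y))"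
    using t by (simp add: scaleR_diff_right[symmetric])
  also have "\<dots> \<le> t * (M * norm (t *\<^sub>R x - t *\<^sub>R y))" using t lipG by (intro mult_left_mono) auto
  also have "\<dots> = M * t\<^sup>2 * norm (x - y)" using t by (simp add: scaleR_diff_right[symmetric] power2_eq_square)
  also have "\<dots> \<le> M * (1 + t + t\<^sup>2) * norm (x - y)" using t M_nonneg by (intro mult_right_mono mult_left_mono) auto
  finally show "norm (t *\<^sub>R G (t *\<^sub>R x) - t *\<^sub>R G (t *\<^sub>R y)) \<le> M * (1 + t + t\<^sup>2) * norm (x - y)" .
  have "norm (t *\<^sub>R G (t *\<^sub>R x)) * (1 + norm x) = norm (G (t *\<^sub>R x)) * (t + t * norm x)" using t by (simp add: algebra_simps)
  also have "\<dots> \<le> norm (G (t *\<^sub>R x)) * ((1 + norm (t *\<^sub>R x)) * (1 + t))"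
    using t by (intro mult_left_mono) (auto simp: algebra_simps)
  also have "\<dots> \<le> M * (1 + t)" unfolding mult.assoc[symmetric] using t by (intro mult_right_mono decG) auto
  also have "\<dots> \<le> M * (1 + t + t\<^sup>2)" using M_nonneg by (intro mult_left_mono) auto
  finally show "norm (t *\<^sub>R G (t *\<^sub>R x)) * (1 + norm x) \<le> M * (1 + t + t\<^sup>2)" .
  have "M \<le> M * (1 + t + t\<^sup>2)" using M_nonneg t by (simp add: algebra_simps)
  then show "\<bar>w (t *\<^sub>R x)\<bar> \<le> M * (1 + t + t\<^sup>2)" using bnd[of "t *\<^sub>R x"] by linarith
qed (use s in auto)

text \<open>The flux identity is applied to the dilated weight w(t x), whose gradient is t G(t x);
  the sign condition on the ball of radius t becomes one on the unit ball because
  \<open>sd_integral\<close> scales by the positive factor t^(2s).\<close>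

lemma flux_nonneg:
  assumes t: "t > 0" and sub: "\<And>x. norm x < t \<Longrightarrow> sd_integral s w x \<le> 0"
  shows "(\<integral>z. outer_kernel s z * (G (t *\<^sub>R z) \<bullet> z) \<partial>lborel) \<ge> 0"
proof -
  interpret W: acf_weight "\<lambda>x. w (t *\<^sub>R x)" "\<lambda>x. t *\<^sub>R G (t *\<^sub>R x)" "M * (1 + t + t\<^sup>2)" s by (rule scaled_weight[OF t])
  let ?c = "cosh_integral s * angular_const s TYPE('a) / (2 * s)"
  have c: "?c > 0" using cosh_integral_pos[OF s(1)] angular_const_pos[OF s(1), where 'a='a] s by simp
  have "(\<integral>y. indicator {y. norm y < 1} y * (1 - (norm y)\<^sup>2) powr (s - 1) * - sd_integral s (\<lambda>x. w (t *\<^sub>R x)) y \<partial>lborel) \<ge> 0"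
  proof (rule integral_nonneg_AE, rule AE_I2)
    fix y :: 'a
    show "0 \<le> indicator {y. norm y < 1} y * (1 - (norm y)\<^sup>2) powr (s - 1) * - sd_integral s (\<lambda>x. w (t *\<^sub>R x)) y"
    proof (cases "norm y < 1")
      case True
      then have "norm (t *\<^sub>R y) < t" using t by simp
      then have "t powr (2 * s) * - sd_integral s w (t *\<^sub>R y) \<ge> 0" using sub[of "t *\<^sub>R y"] by (intro mult_nonneg_nonneg) auto
      then have "- sd_integral s (\<lambda>x. w (t *\<^sub>R x)) y \<ge> 0" unfolding sd_integral_scale[OF t] by simp
      then show ?thesis by (intro mult_nonneg_nonneg) auto
    qed simp
  qed
  also have "(\<integral>y. indicator {y. norm y < 1} y * (1 - (norm y)\<^sup>2) powr (s - 1) * - sd_integral s (\<lambda>x. w (t *\<^sub>R x)) y \<partial>lborel)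
    = ?c * (\<integral>z. W.outer_flux z \<partial>lborel)"
    using W.ball_flux_identity by simp
  finally have "(\<integral>z. W.outer_flux z \<partial>lborel) \<ge> 0" using c by (metis zero_le_mult_iff linorder_not_less)
  moreover have "W.outer_flux = (\<lambda>z. t * (outer_kernel s z * (G (t *\<^sub>R z) \<bullet> z)))"
    by (auto simp: W.outer_flux_def outer_kernel_def)
  ultimately show ?thesis using t by (simp add: zero_le_mult_iff)
qed

lemma outer_mean_integrable: "integrable lborel (\<lambda>z. outer_kernel s z * w (t *\<^sub>R z))"
proof (rule Bochner_Integration.integrable_bound[OF integrable_mult_left[OF integrable_outer_kernel[OF s], of M]])
  show "AE z in lborel. norm (outer_kernel s z * w (t *\<^sub>R z)) \<le> norm (outer_kernel s z * M)"
    using bnd M_nonneg by (intro AE_I2) (auto simp: abs_mult intro!: mult_left_mono)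
qed measurable

lemma radial_ftc:
  assumes "r \<le> \<rho>"
  shows "(\<integral>t. indicator {r..\<rho>} t *\<^sub>R (G (t *\<^sub>R z) \<bullet> z) \<partial>lborel) = w (\<rho> *\<^sub>R z) - w (r *\<^sub>R z)"
proof (rule integral_FTC_Icc[OF assms])
  fix x :: real
  have "((\<lambda>t. t *\<^sub>R z) has_derivative (\<lambda>h. h *\<^sub>R z)) (at x)" by (auto intro!: derivative_eq_intros)
  from has_derivative_compose[OF this deriv]
  have "((\<lambda>t. w (t *\<^sub>R z)) has_derivative (\<lambda>h. G (x *\<^sub>R z) \<bullet> (h *\<^sub>R z))) (at x)" .
  then show "((\<lambda>t. w (t *\<^sub>R z)) has_vector_derivative G (x *\<^sub>R z) \<bullet> z) (at x within {r..\<rho>})"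
    by (auto simp: has_vector_derivative_def intro: has_derivative_at_withinI)
next
  have "M-lipschitz_on UNIV G" using lipG M_nonneg by (intro lipschitz_onI) (auto simp: dist_norm)
  then have "continuous_on UNIV G" by (rule lipschitz_on_continuous_on)
  then show "continuous_on {r..\<rho>} (\<lambda>t. G (t *\<^sub>R z) \<bullet> z)"
    by (intro continuous_on_inner continuous_on_const) (rule continuous_on_compose2, auto intro!: continuous_intros)
qed

lemma outer_mean_mono:
  assumes r: "0 < r" "r \<le> \<rho>" and sub: "\<And>x. norm x < \<rho> \<Longrightarrow> sd_integral s w x \<le> 0"
  shows "outer_mean s w r \<le> outer_mean s w \<rho>"
proof -
  define F where "F = (\<lambda>z t. outer_kernel s z * (indicator {r..\<rho>} t *\<^sub>R (G (t *\<^sub>R z) \<bullet> z)))"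
  \<comment> \<open>The decay of G bounds |x| |G(x)| by M, so |G(t z) . z| is at most M / t
    uniformly in z. Staying above r > 0 keeps this bounded, and Fubini has a product
    majorant.\<close>
  have bound: "\<bar>F z t\<bar> \<le> outer_kernel s z * (indicator {r..\<rho>} t * (M / r))" for z t
  proof (cases "t \<in> {r..\<rho>}")
    case True
    then have t: "r \<le> t" "t > 0" using r by auto
    have "\<bar>G (t *\<^sub>R z) \<bullet> z\<bar> \<le> norm (G (t *\<^sub>R z)) * norm z" by (rule Cauchy_Schwarz_ineq2)
    also have "\<dots> * t = norm (G (t *\<^sub>R z)) * norm (t *\<^sub>R z)" using t by simp
    finally have "\<bar>G (t *\<^sub>R z) \<bullet> z\<bar> * t \<le> norm (G (t *\<^sub>R z)) * norm (t *\<^sub>R z)"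
      using t Cauchy_Schwarz_ineq2[of "G (t *\<^sub>R z)" z] by simp
    also have "\<dots> \<le> norm (G (t *\<^sub>R z)) * (1 + norm (t *\<^sub>R z))" by (intro mult_left_mono) auto
    also have "\<dots> \<le> M" by (rule decG)
    finally have "\<bar>G (t *\<^sub>R z) \<bullet> z\<bar> \<le> M / t" using t by (simp add: field_simps)
    also have "\<dots> \<le> M / r" using t r M_nonneg by (intro divide_left_mono) auto
    finally have "outer_kernel s z * \<bar>G (t *\<^sub>R z) \<bullet> z\<bar> \<le> outer_kernel s z * (M / r)" by (rule mult_left_mono) simp
    then show ?thesis using True by (simp add: F_def abs_mult)
  qed (simp add: F_def)
  have Fm: "(\<lambda>(z, t). F z t) \<in> borel_measurable (lborel \<Otimes>\<^sub>M lborel)" unfolding F_def by measurable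
  have Fb: "integrable lborel (\<lambda>t. outer_kernel s z * (indicator {r..\<rho>} t * (M / r)))" for z :: 'a
    using r by (intro integrable_mult_right integrable_mult_left integrable_real_indicator) auto
  have Ft: "integrable lborel (\<lambda>t. F z t)" for z
  proof (rule Bochner_Integration.integrable_bound)
    show "integrable lborel (\<lambda>t. outer_kernel s z * (indicator {r..\<rho>} t * (M / r)))" by (rule Fb)
    show "AE t in lborel. norm (F z t) \<le> norm (outer_kernel s z * (indicator {r..\<rho>} t * (M / r)))"
      by (intro AE_I2) (simp only: real_norm_def, rule order_trans[OF bound abs_ge_self])
  qed (unfold F_def, measurable)
  have F: "integrable (lborel \<Otimes>\<^sub>M lborel) (\<lambda>(z, t). F z t)"
  proof (rule lborel_pair.Fubini_integrable[OF Fm])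
    show "AE z in lborel. integrable lborel (\<lambda>t. (\<lambda>(z, t). F z t) (z, t))" using Ft by simp
    show "integrable lborel (\<lambda>z. \<integral>t. norm ((\<lambda>(z, t). F z t) (z, t)) \<partial>lborel)"
    proof (rule Bochner_Integration.integrable_bound)
      show "integrable lborel (\<lambda>z::'a. outer_kernel s z * ((\<rho> - r) * (M / r)))"
        by (intro integrable_mult_left integrable_outer_kernel s)
      show "(\<lambda>z. \<integral>t. norm ((\<lambda>(z, t). F z t) (z, t)) \<partial>lborel) \<in> borel_measurable lborel"
        using Fm by measurable
      show "AE z in lborel. norm (\<integral>t. norm ((\<lambda>(z, t). F z t) (z, t)) \<partial>lborel) \<le> norm (outer_kernel s z * ((\<rho> - r) * (M / r)))"
      proof (intro AE_I2)
        fix z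
        have "norm (\<integral>t. norm ((\<lambda>(z, t). F z t) (z, t)) \<partial>lborel) = (\<integral>t. \<bar>F z t\<bar> \<partial>lborel)" by simp
        also have "\<dots> \<le> (\<integral>t. outer_kernel s z * (indicator {r..\<rho>} t * (M / r)) \<partial>lborel)"
          by (intro integral_mono integrable_abs Ft Fb bound)
        also have "\<dots> = outer_kernel s z * ((\<rho> - r) * (M / r))" using r by simp
        also have "\<dots> \<le> norm (outer_kernel s z * ((\<rho> - r) * (M / r)))" by (simp only: real_norm_def abs_ge_self)
        finally show "norm (\<integral>t. norm ((\<lambda>(z, t). F z t) (z, t)) \<partial>lborel) \<le> norm (outer_kernel s z * ((\<rho> - r) * (M / r)))" .
      qed
    qed
  qed
  have "outer_mean s w \<rho> - outer_mean s w r = (\<integral>z. outer_kernel s z * (w (\<rho> *\<^sub>R z) - w (r *\<^sub>R z)) \<partial>lborel)"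
    unfolding outer_mean_def by (simp add: right_diff_distrib outer_mean_integrable)
  also have "\<dots> = (\<integral>z. (\<integral>t. F z t \<partial>lborel) \<partial>lborel)"
    unfolding F_def by (simp only: integral_mult_right_zero radial_ftc[OF r(2)])
  also have "\<dots> = (\<integral>t. (\<integral>z. F z t \<partial>lborel) \<partial>lborel)"
    by (rule lborel_pair.Fubini_integral[OF F, symmetric])
  also have "\<dots> = (\<integral>t. indicator {r..\<rho>} t * (\<integral>z. outer_kernel s z * (G (t *\<^sub>R z) \<bullet> z) \<partial>lborel) \<partial>lborel)"
  proof (rule Bochner_Integration.integral_cong[OF refl])
    fix t :: real
    show "(\<integral>z. F z t \<partial>lborel) = indicator {r..\<rho>} t * (\<integral>z. outer_kernel s z * (G (t *\<^sub>R z) \<bullet> z) \<partial>lborel)"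
      unfolding F_def by (cases "t \<in> {r..\<rho>}") auto
  qed
  also have "\<dots> \<ge> 0"
  proof (rule integral_nonneg_AE, rule AE_I2)
    fix t :: real
    show "0 \<le> indicator {r..\<rho>} t * (\<integral>z. outer_kernel s z * (G (t *\<^sub>R z) \<bullet> z) \<partial>lborel)"
      using flux_nonneg[of t] sub r by (auto split: split_indicator)
  qed
  finally show ?thesis by simp
qed

lemma outer_mean_bound: "\<bar>outer_mean s w t\<bar> \<le> M * (\<integral>z. outer_kernel s (z::'a) \<partial>lborel)"
proof -
  have "\<bar>outer_mean s w t\<bar> \<le> (\<integral>z. \<bar>outer_kernel s z * w (t *\<^sub>R z)\<bar> \<partial>lborel)"
    unfolding outer_mean_def by (rule integral_abs_bound)
  also have "\<dots> \<le> (\<integral>z. M * outer_kernel s (z::'a) \<partial>lborel)"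
  proof (intro integral_mono integrable_abs outer_mean_integrable integrable_mult_right integrable_outer_kernel s)
    fix z :: 'a
    show "\<bar>outer_kernel s z * w (t *\<^sub>R z)\<bar> \<le> M * outer_kernel s z"
      using mult_right_mono[OF bnd[of "t *\<^sub>R z"], of "outer_kernel s z"] by (simp add: abs_mult mult.commute)
  qed
  finally show ?thesis by simp
qed

end

section \<open>From the means to the functional\<close>

lemma Ksr_mean:
  fixes w :: "real^'n::finite \<Rightarrow> real"
  assumes r: "r > 0" and s: "0 < s"
  shows "set_lebesgue_integral lborel (- ball 0 r) (\<lambda>y. Ksr s r y * w y) = a_ns s TYPE('n) * outer_mean s w r"
proof -
  have "set_lebesgue_integral lborel (- ball 0 r) (\<lambda>y. Ksr s r y * w y) =
     r ^ DIM(real^'n) * (\<integral>z. indicator (- ball 0 r) (0 + r *\<^sub>R z) *\<^sub>R (Ksr s r (0 + r *\<^sub>R z) * w (0 + r *\<^sub>R z)) \<partial>lborel)"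
    unfolding set_lebesgue_integral_def using r by (subst integral_lborel_affine[where c=r and t=0]) auto
  also have "(\<lambda>z. indicator (- ball 0 r) (0 + r *\<^sub>R z) *\<^sub>R (Ksr s r (0 + r *\<^sub>R z) * w (0 + r *\<^sub>R z)))
     = (\<lambda>z. (a_ns s TYPE('n) / r ^ DIM(real^'n)) * (outer_kernel s z * w (r *\<^sub>R z)))"
  proof
    fix z :: "real^'n"
    have eq: "r\<^sup>2 / ((norm (r *\<^sub>R z))\<^sup>2 - r\<^sup>2) = 1 / ((norm z)\<^sup>2 - 1)"
    proof -
      have "(norm (r *\<^sub>R z))\<^sup>2 - r\<^sup>2 = r\<^sup>2 * ((norm z)\<^sup>2 - 1)" by (simp add: power_mult_distrib right_diff_distrib)
      then show ?thesis using r by simp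
    qed
    show "indicator (- ball 0 r) (0 + r *\<^sub>R z) *\<^sub>R (Ksr s r (0 + r *\<^sub>R z) * w (0 + r *\<^sub>R z))
      = (a_ns s TYPE('n) / r ^ DIM(real^'n)) * (outer_kernel s z * w (r *\<^sub>R z))"
    proof (cases "norm z > 1")
      case True
      then have z2: "(norm z)\<^sup>2 - 1 > 0" by simp
      have "(1 / ((norm z)\<^sup>2 - 1)) powr s = ((norm z)\<^sup>2 - 1) powr (- s)"
        using z2 by (simp add: powr_divide powr_minus_divide)
      moreover have "norm (r *\<^sub>R z) ^ CARD('n) = r ^ CARD('n) * norm z ^ CARD('n)" using r by (simp add: power_mult_distrib)
      moreover have "r *\<^sub>R z \<in> - ball 0 r" using True r by simp
      ultimately show ?thesis using True by (simp only: add_0 Ksr_def eq) (simp add: outer_kernel_def)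
    next
      case False
      show ?thesis
      proof (cases "norm z = 1")
        case True
        \<comment> \<open>On the sphere |y| = r the quotient inside \<open>Ksr\<close> has
          denominator 0 and is 0 by convention, and \<open>0 powr s = 0\<close>. This agrees with
          the strict inequality in \<open>outer_kernel\<close>.\<close>
        then have "Ksr s r (0 + r *\<^sub>R z) = 0" using r by (simp add: Ksr_def)
        with False show ?thesis by (simp add: outer_kernel_def)
      next
        case n1: False
        then have "norm z < 1" using False by simp
        then have "r *\<^sub>R z \<in> ball 0 r" using r by simp
        with False show ?thesis by (simp add: outer_kernel_def)
      qed
    qed
  qed
  also have "r ^ DIM(real^'n) * (\<integral>z. (a_ns s TYPE('n) / r ^ DIM(real^'n)) * (outer_kernel s z * w (r *\<^sub>R z)) \<partial>lborel) = a_ns s TYPE('n) * outer_mean s w r"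
    using r by (simp add: outer_mean_def)
  finally show ?thesis .
qed

lemma a_ns_nonneg: "0 < s \<Longrightarrow> s < 1 \<Longrightarrow> a_ns s TYPE('n::finite) \<ge> 0"
proof -
  assume s: "0 < s" "s < 1"
  have "sin (pi * s) > 0" using s by (intro sin_gt_zero) auto
  moreover have "Gamma (real CARD('n) / 2) > 0" by (intro Gamma_real_pos) simp
  ultimately show ?thesis by (simp add: a_ns_def)
qed

text \<open>After substituting r = R t, the R from dr and the R^s from r^s cancel the normalisation
  R^(1+s) exactly. R then occurs only inside the means, so their monotonicity passes through the
  integral.\<close>

lemma averaged_mean_mono:
  fixes w :: "real^'n::finite \<Rightarrow> real"
  assumes W: "acf_weight w G M s" and sub: "\<And>x. norm x < R0 \<Longrightarrow> sd_integral s w x \<le> 0"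
  shows "mono_on {0<..<R0} (\<lambda>R. 1 / R powr (1 + s) * (LBINT r=0..R. r powr s * set_lebesgue_integral lborel (- ball 0 r) (\<lambda>y. Ksr s r y * w y)))"
proof -
  interpret acf_weight w G M s by (rule W)
  let ?A = "outer_mean s w" and ?a = "a_ns s TYPE('n)"
  have Am[measurable]: "?A \<in> borel_measurable borel" unfolding outer_mean_def[abs_def] by measurable
  have J: "1 / R powr (1 + s) * (LBINT r=0..R. r powr s * set_lebesgue_integral lborel (- ball 0 r) (\<lambda>y. Ksr s r y * w y))
     = ?a * (\<integral>t. indicator {0<..<1} t * (t powr s * ?A (R * t)) \<partial>lborel)" if R: "R > 0" for R
  proof -
    have "(LBINT r=0..R. r powr s * set_lebesgue_integral lborel (- ball 0 r) (\<lambda>y. Ksr s r y * w y))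
       = (LBINT r:{0<..<R}. r powr s * set_lebesgue_integral lborel (- ball 0 r) (\<lambda>y. Ksr s r y * w y))"
      using R by (simp add: interval_integral_Ioo zero_ereal_def)
    also have "\<dots> = (LBINT r:{0<..<R}. r powr s * (?a * ?A r))"
      by (intro set_lebesgue_integral_cong allI impI) (auto simp: Ksr_mean s)
    also have "\<dots> = R * (\<integral>t. indicator {0<..<R} (0 + R * t) *\<^sub>R ((0 + R * t) powr s * (?a * ?A (0 + R * t))) \<partial>lborel)"
      unfolding set_lebesgue_integral_def using R by (subst lborel_integral_real_affine[where c=R and t=0]) auto
    also have "(\<lambda>t. indicator {0<..<R} (0 + R * t) *\<^sub>R ((0 + R * t) powr s * (?a * ?A (0 + R * t))))
       = (\<lambda>t. (R powr s * ?a) * (indicator {0<..<1} t * (t powr s * ?A (R * t))))"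
      using R by (auto simp: fun_eq_iff indicator_def powr_mult zero_less_mult_iff)
    also have "R * (\<integral>t. (R powr s * ?a) * (indicator {0<..<1} t * (t powr s * ?A (R * t))) \<partial>lborel)
       = (R * R powr s) * (?a * (\<integral>t. indicator {0<..<1} t * (t powr s * ?A (R * t)) \<partial>lborel))" by simp
    also have "R * R powr s = R powr (1 + s)" using R by (simp add: powr_add)
    finally show ?thesis using R by simp
  qed
  have int: "integrable lborel (\<lambda>t. indicator {0<..<1} t * (t powr s * ?A (R * t)))" for R
  proof (rule Bochner_Integration.integrable_bound)
    let ?B = "M * (\<integral>z. outer_kernel s (z::real^'n) \<partial>lborel)"
    show "integrable lborel (\<lambda>t::real. indicator {0<..<1} t * ?B)" by simp
    show "AE t in lborel. norm (indicator {0<..<1} t * (t powr s * ?A (R * t))) \<le> norm (indicator {0<..<1} t * ?B)"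
    proof (intro AE_I2)
      fix t :: real
      show "norm (indicator {0<..<1} t * (t powr s * ?A (R * t))) \<le> norm (indicator {0<..<1} t * ?B)"
      proof (cases "t \<in> {0<..<1}")
        case True
        have "t powr s \<le> 1" using True s by (intro powr_le1) auto
        then have "t powr s * \<bar>?A (R * t)\<bar> \<le> 1 * ?B" by (intro mult_mono outer_mean_bound) auto
        then show ?thesis using True abs_ge_self[of ?B] by (simp add: abs_mult)
      qed simp
    qed
  qed measurable
  show ?thesis
  proof (rule mono_onI)
    fix R R' assume R: "R \<in> {0<..<R0}" "R' \<in> {0<..<R0}" "R \<le> R'"
    have le: "(\<integral>t. indicator {0<..<1} t * (t powr s * ?A (R * t)) \<partial>lborel) \<le> (\<integral>t. indicator {0<..<1} t * (t powr s * ?A (R' * t)) \<partial>lborel)"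
    proof (rule integral_mono[OF int int])
      fix t :: real
      show "indicator {0<..<1} t * (t powr s * ?A (R * t)) \<le> indicator {0<..<1} t * (t powr s * ?A (R' * t))"
      proof (cases "t \<in> {0<..<1}")
        case True
        have lt: "R' * t \<le> R' * 1" using True R by (intro mult_left_mono) auto
        have "?A (R * t) \<le> ?A (R' * t)"
        proof (rule outer_mean_mono)
          show "0 < R * t" "R * t \<le> R' * t" using True R by (auto intro!: mult_right_mono)
          show "sd_integral s w x \<le> 0" if "norm x < R' * t" for x
          proof (rule sub)
            have "R' < R0" using R by simp
            then show "norm x < R0" using that lt by linarith
          qed
        qed
        then show ?thesis using True by (simp add: mult_left_mono)
      qed simp
    qed
    show "1 / R powr (1 + s) * (LBINT r=0..R. r powr s * set_lebesgue_integral lborel (- ball 0 r) (\<lambda>y. Ksr s r y * w y))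
      \<le> 1 / R' powr (1 + s) * (LBINT r=0..R'. r powr s * set_lebesgue_integral lborel (- ball 0 r) (\<lambda>y. Ksr s r y * w y))"
    proof -
      have "0 < R" "0 < R'" using R by auto
      then show ?thesis unfolding J[OF \<open>0 < R\<close>] J[OF \<open>0 < R'\<close>]
        by (intro mult_left_mono a_ns_nonneg[OF s] le)
    qed
  qed
qed

section \<open>Finite differences of smooth compactly supported functions\<close>

lemma pds_append: "pds (is @ js) g = pds is (pds js g)"
  by (induction "is") auto

text \<open>\<open>pds\<close> applies the head of its list last, so a derivative taken beforehand
  corresponds to an entry appended at the end.\<close>

lemma Ck_pd:
  assumes "Ck (Suc k) g" shows "Ck k (pd i g)"
  unfolding Ck_def
proof (intro conjI allI impI)
  have e: "pds js (pd i g) = pds (js @ [i]) g" for js by (simp add: pds_append)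
  fix js :: "'a list"
  {
    assume "length js \<le> k"
    then have "length (js @ [i]) \<le> Suc k" by simp
    then show "continuous_on UNIV (pds js (pd i g))" using assms unfolding e Ck_def by blast
  }
  fix i' x
  assume "length js < k"
  then have "length (js @ [i]) < Suc k" by simp
  then show "pdiff_at i' (pds js (pd i g)) x" using assms unfolding e Ck_def by blast
qed

text \<open>Off the closed support u vanishes near each point, hence on short axis segments through
  it, so the support does not grow.\<close>

lemma Cinf_c_pd:
  assumes "Cinf_c u" shows "Cinf_c (pd i u)"
proof -
  have sm: "smooth (pd i u)" using assms by (auto simp: Cinf_c_def smooth_def intro: Ck_pd)
  have "{x. pd i u x \<noteq> 0} \<subseteq> closure {x. u x \<noteq> 0}"
  proof
    fix x assume x: "x \<in> {x. pd i u x \<noteq> 0}"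
    show "x \<in> closure {x. u x \<noteq> 0}"
    proof (rule ccontr)
      assume nx: "x \<notin> closure {x. u x \<noteq> 0}"
      have op: "open (- closure {x. u x \<noteq> 0})" by auto
      have "((\<lambda>t. x + t *\<^sub>R axis i 1) \<longlongrightarrow> x + 0 *\<^sub>R axis i 1) (nhds (0::real))"
        by (intro tendsto_intros filterlim_ident)
      then have "((\<lambda>t. x + t *\<^sub>R axis i 1) \<longlongrightarrow> x) (nhds (0::real))" by simp
      then have "\<forall>\<^sub>F t in nhds (0::real). x + t *\<^sub>R axis i 1 \<in> - closure {x. u x \<noteq> 0}"
        using op by (rule topological_tendstoD) (use nx in simp)
      then have "\<forall>\<^sub>F t in nhds (0::real). u (x + t *\<^sub>R axis i 1) = 0"
        by eventually_elim (use closure_subset[of "{x. u x \<noteq> 0}"] in auto)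
      then have "deriv (\<lambda>t. u (x + t *\<^sub>R axis i 1)) 0 = deriv (\<lambda>t. 0) (0::real)"
        by (rule deriv_cong_ev) simp
      then have "pd i u x = 0" by (simp add: pd_def)
      with x show False by simp
    qed
  qed
  then have "closure {x. pd i u x \<noteq> 0} \<subseteq> closure {x. u x \<noteq> 0}" by (simp add: closure_minimal)
  then have "closure {x. u x \<noteq> 0} \<inter> closure {x. pd i u x \<noteq> 0} = closure {x. pd i u x \<noteq> 0}" by blast
  moreover have "compact (closure {x. u x \<noteq> 0} \<inter> closure {x. pd i u x \<noteq> 0})"
    using assms unfolding Cinf_c_def by (intro compact_Int_closed) auto
  ultimately have "compact (closure {x. pd i u x \<noteq> 0})" by metis
  with sm show ?thesis by (simp add: Cinf_c_def)
qed

lemma Cinf_c_continuous: "Cinf_c u \<Longrightarrow> continuous_on UNIV u"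
proof -
  assume "Cinf_c u"
  then have "Ck 0 u" by (simp add: Cinf_c_def smooth_def)
  then have "continuous_on UNIV (pds [] u)" unfolding Ck_def by blast
  then show ?thesis by simp
qed

lemma Cinf_c_pdiff: "Cinf_c u \<Longrightarrow> pdiff_at i u x"
proof -
  assume "Cinf_c u"
  then have "Ck (Suc 0) u" by (simp add: Cinf_c_def smooth_def)
  then have "pdiff_at i (pds [] u) x" unfolding Ck_def by blast
  then show ?thesis by simp
qed

lemma Cinf_c_borel: "Cinf_c u \<Longrightarrow> u \<in> borel_measurable borel"
  by (rule borel_measurable_continuous_onI) (rule Cinf_c_continuous)

lemma Cinf_c_support:
  assumes "Cinf_c u" shows "\<exists>R>0. \<forall>x. norm x \<ge> R \<longrightarrow> u x = 0"
proof -
  have "bounded (closure {x. u x \<noteq> 0})" using assms by (simp add: Cinf_c_def compact_imp_bounded)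
  then obtain B where B: "\<forall>x\<in>closure {x. u x \<noteq> 0}. norm x \<le> B" unfolding bounded_iff by blast
  have "u x = 0" if x: "norm x \<ge> \<bar>B\<bar> + 1" for x
  proof (rule ccontr)
    assume "u x \<noteq> 0"
    then have "x \<in> closure {x. u x \<noteq> 0}" using closure_subset[of "{x. u x \<noteq> 0}"] by blast
    with B have "norm x \<le> B" by blast
    with x show False by linarith
  qed
  then show ?thesis by (intro exI[of _ "\<bar>B\<bar> + 1"]) simp
qed

lemma Cinf_c_bounded:
  assumes "Cinf_c u" obtains A where "A \<ge> 0" "\<And>x. \<bar>u x\<bar> \<le> A"
proof -
  obtain R where R: "R > 0" "\<And>x. norm x \<ge> R \<Longrightarrow> u x = 0" using Cinf_c_support[OF assms] by blast
  have "compact (u ` cball 0 R)"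
    by (rule compact_continuous_image[OF continuous_on_subset[OF Cinf_c_continuous[OF assms]]]) auto
  then have "bounded (u ` cball 0 R)" by (rule compact_imp_bounded)
  then obtain B where B: "\<forall>y\<in>u ` cball 0 R. norm y \<le> B" unfolding bounded_iff by blast
  have "\<bar>u x\<bar> \<le> max B 0" for x
  proof (cases "norm x \<le> R")
    case True
    then have "u x \<in> u ` cball 0 R" by (simp add: image_eqI)
    then have "norm (u x) \<le> B" using B by blast
    then show ?thesis by simp
  next
    case False
    then show ?thesis using R(2)[of x] by simp
  qed
  then show thesis by (rule that[of "max B 0", rotated]) simp
qed

lemma pd_line_derivative:
  assumes "\<And>x. pdiff_at i g x"
  shows "((\<lambda>t. g (x + t *\<^sub>R axis i 1)) has_real_derivative pd i g (x + t *\<^sub>R axis i 1)) (at t)"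
proof -
  let ?x = "x + t *\<^sub>R axis i 1"
  have "(\<lambda>r. g (?x + r *\<^sub>R axis i 1)) differentiable (at 0)"
    using assms[of ?x] by (simp add: pdiff_at_def)
  then obtain D where "((\<lambda>r. g (?x + r *\<^sub>R axis i 1)) has_real_derivative D) (at 0)"
    by (auto simp: real_differentiable_def)
  moreover from DERIV_imp_deriv[OF this] have "D = pd i g ?x" by (simp add: pd_def)
  moreover have "?x + r *\<^sub>R axis i 1 = x + (r + t) *\<^sub>R axis i 1" for r by (simp add: algebra_simps)
  ultimately have "((\<lambda>r. g (x + (r + t) *\<^sub>R axis i 1)) has_real_derivative pd i g ?x) (at 0)" by simp
  then show ?thesis using DERIV_shift[of "\<lambda>t. g (x + t *\<^sub>R axis i 1)" "pd i g ?x" 0 t] by simp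
qed

text \<open>Smoothness is given through iterated axis derivatives, so total differentiability has to
  be derived. Coordinates are moved one at a time, each by the one-variable mean value theorem, and
  continuity of the partials compares the intermediate point with x at the cost of one e per
  coordinate.\<close>

lemma partials_imp_has_derivative:
  fixes g :: "real^'n::finite \<Rightarrow> real"
  assumes pdf: "\<And>i x. pdiff_at i g x" and cont: "\<And>i. continuous_on UNIV (pd i g)"
  shows "(g has_derivative (\<lambda>h. \<Sum>i\<in>UNIV. h $ i * pd i g x)) (at x)"
proof -
  have claim: "\<exists>\<delta>>0. \<forall>h. norm h < \<delta> \<longrightarrow>
      \<bar>g (x + (\<Sum>i\<in>S. h $ i *\<^sub>R axis i 1)) - g x - (\<Sum>i\<in>S. h $ i * pd i g x)\<bar> \<le> real (card S) * e * norm h"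
    if "e > 0" for S :: "'n set" and e :: real
  proof (induction S rule: finite_induct[OF finite])
    case 1
    show ?case by (intro exI[of _ 1]) auto
  next
    case (2 j S)
    then obtain \<delta> where \<delta>: "\<delta> > 0" "\<And>h. norm h < \<delta> \<Longrightarrow>
      \<bar>g (x + (\<Sum>i\<in>S. h $ i *\<^sub>R axis i 1)) - g x - (\<Sum>i\<in>S. h $ i * pd i g x)\<bar> \<le> real (card S) * e * norm h" by blast
    have "isCont (pd j g) x" using cont[of j] by (simp add: continuous_on_eq_continuous_at)
    then obtain d where d: "d > 0" "\<And>z. dist z x < d \<Longrightarrow> dist (pd j g z) (pd j g x) < e"
      using \<open>e > 0\<close> unfolding continuous_at_eps_delta by blast
    show ?case
    proof (intro exI[of _ "min \<delta> d"] conjI allI impI)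
      show "min \<delta> d > 0" using \<delta> d by simp
      fix h :: "real^'n" assume h: "norm h < min \<delta> d"
      let ?hS = "\<Sum>i\<in>S. h $ i *\<^sub>R axis i (1::real)"
      have hS: "?hS $ l = (if l \<in> S then h $ l else 0)" for l
        by (simp add: axis_def if_distrib[of "\<lambda>a. _ * a"] sum.delta cong: if_cong)
      have "\<exists>z. \<bar>z\<bar> \<le> \<bar>h $ j\<bar> \<and> g (x + ?hS + (h $ j) *\<^sub>R axis j 1) - g (x + ?hS + 0 *\<^sub>R axis j 1) = h $ j * pd j g (x + ?hS + z *\<^sub>R axis j 1)"
      proof -
        let ?F = "\<lambda>t. g (x + ?hS + t *\<^sub>R axis j 1)"
        have D: "(?F has_real_derivative pd j g (x + ?hS + t *\<^sub>R axis j 1)) (at t)" for t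
          by (rule pd_line_derivative) (rule pdf)
        consider "h $ j = 0" | "h $ j > 0" | "h $ j < 0" by linarith
        then show ?thesis
        proof cases
          case 1 then show ?thesis by (intro exI[of _ 0]) simp
        next
          case 2
          obtain z where "0 < z" "z < h $ j" "?F (h $ j) - ?F 0 = (h $ j - 0) * pd j g (x + ?hS + z *\<^sub>R axis j 1)"
            using MVT2[OF 2, of ?F "\<lambda>t. pd j g (x + ?hS + t *\<^sub>R axis j 1)"] D by blast
          then show ?thesis by (intro exI[of _ z]) auto
        next
          case 3
          obtain z where "h $ j < z" "z < 0" "?F 0 - ?F (h $ j) = (0 - h $ j) * pd j g (x + ?hS + z *\<^sub>R axis j 1)"
            using MVT2[OF 3, of ?F "\<lambda>t. pd j g (x + ?hS + t *\<^sub>R axis j 1)"] D by blast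
          then show ?thesis by (intro exI[of _ z]) (auto simp: algebra_simps)
        qed
      qed
      then obtain z where z: "\<bar>z\<bar> \<le> \<bar>h $ j\<bar>" "g (x + ?hS + (h $ j) *\<^sub>R axis j 1) - g (x + ?hS) = h $ j * pd j g (x + ?hS + z *\<^sub>R axis j 1)" by auto
      \<comment> \<open>Each component of the intermediate displacement is dominated by that of h,
        so the point stays inside the radius chosen from continuity of the partial
        derivative.\<close>
      have "norm (?hS + z *\<^sub>R axis j 1) \<le> norm h"
      proof (rule norm_le_componentwise_cart)
        fix l
        show "norm ((?hS + z *\<^sub>R axis j 1) $ l) \<le> norm (h $ l)"
          unfolding vector_add_component vector_scaleR_component hS
          using z(1) 2(2) by (cases "l = j") (auto simp: axis_def)
      qed
      then have "dist (x + ?hS + z *\<^sub>R axis j 1) x < d" using h by (simp add: dist_norm add.assoc)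
      then have "\<bar>pd j g (x + ?hS + z *\<^sub>R axis j 1) - pd j g x\<bar> \<le> e" using d(2) by (simp add: dist_real_def less_imp_le)
      then have "\<bar>h $ j\<bar> * \<bar>pd j g (x + ?hS + z *\<^sub>R axis j 1) - pd j g x\<bar> \<le> norm h * e"
        using component_le_norm_cart[of h j] by (intro mult_mono) auto
      then have j: "\<bar>h $ j * pd j g (x + ?hS + z *\<^sub>R axis j 1) - h $ j * pd j g x\<bar> \<le> e * norm h"
        by (simp add: abs_mult[symmetric] right_diff_distrib mult.commute)
      have S: "\<bar>g (x + ?hS) - g x - (\<Sum>i\<in>S. h $ i * pd i g x)\<bar> \<le> real (card S) * e * norm h"
        using \<delta>(2) h by simp
      have "g (x + (\<Sum>i\<in>insert j S. h $ i *\<^sub>R axis i 1)) - g x - (\<Sum>i\<in>insert j S. h $ i * pd i g x)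
         = (g (x + ?hS) - g x - (\<Sum>i\<in>S. h $ i * pd i g x)) + (h $ j * pd j g (x + ?hS + z *\<^sub>R axis j 1) - h $ j * pd j g x)"
        using 2 z(2) by (simp add: algebra_simps)
      also have "\<bar>\<dots>\<bar> \<le> real (card S) * e * norm h + e * norm h" using j S by linarith
      also have "\<dots> = real (card (insert j S)) * e * norm h" using 2 by (simp add: algebra_simps)
      finally show "\<bar>g (x + (\<Sum>i\<in>insert j S. h $ i *\<^sub>R axis i 1)) - g x - (\<Sum>i\<in>insert j S. h $ i * pd i g x)\<bar> \<le> real (card (insert j S)) * e * norm h" .
    qed
  qed
  show ?thesis
    unfolding has_derivative_at_alt
  proof (intro conjI allI impI)
    show "bounded_linear (\<lambda>h. \<Sum>i\<in>UNIV. h $ i * pd i g x)"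
      by (intro bounded_linear_sum bounded_linear_mult_left[THEN bounded_linear_compose] bounded_linear_vec_nth)
    fix e :: real assume e: "e > 0"
    let ?e = "e / real CARD('n)"
    have "?e > 0" using e by simp
    from claim[OF this, of UNIV] obtain \<delta> where \<delta>: "\<delta> > 0" "\<And>h. norm h < \<delta> \<Longrightarrow>
      \<bar>g (x + (\<Sum>i\<in>UNIV. h $ i *\<^sub>R axis i 1)) - g x - (\<Sum>i\<in>UNIV. h $ i * pd i g x)\<bar> \<le> real CARD('n) * ?e * norm h" by blast
    have b: "(\<Sum>i\<in>UNIV. h $ i *\<^sub>R axis i 1) = h" for h :: "real^'n"
      using basis_expansion[of h] by (simp add: scalar_mult_eq_scaleR)
    show "\<exists>d>0. \<forall>y. norm (y - x) < d \<longrightarrow> norm (g y - g x - (\<Sum>i\<in>UNIV. (y - x) $ i * pd i g x)) \<le> e * norm (y - x)"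
    proof (intro exI[of _ \<delta>] conjI allI impI)
      fix y assume "norm (y - x) < \<delta>"
      from \<delta>(2)[OF this] show "norm (g y - g x - (\<Sum>i\<in>UNIV. (y - x) $ i * pd i g x)) \<le> e * norm (y - x)"
        unfolding b by simp
    qed (rule \<delta>(1))
  qed
qed

lemma Cinf_c_has_derivative:
  fixes u :: "real^'n::finite \<Rightarrow> real"
  assumes "Cinf_c u"
  shows "(u has_derivative (\<lambda>h. \<Sum>i\<in>UNIV. h $ i * pd i u x)) (at x)"
  by (rule partials_imp_has_derivative) (auto intro: Cinf_c_pdiff Cinf_c_continuous Cinf_c_pd assms)

section \<open>Uniform bounds for increments of first and higher order\<close>

lemma linear_form_bound:
  fixes h :: "real^'n::finite"
  assumes "\<And>i. \<bar>D i\<bar> \<le> A"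
  shows "\<bar>\<Sum>i\<in>UNIV. h $ i * D i\<bar> \<le> real CARD('n) * A * norm h"
proof -
  have "\<bar>\<Sum>i\<in>UNIV. h $ i * D i\<bar> \<le> (\<Sum>i\<in>UNIV. \<bar>h $ i * D i\<bar>)" by (rule sum_abs)
  also have "\<dots> \<le> (\<Sum>i\<in>(UNIV::'n set). norm h * A)"
    using assms component_le_norm_cart[of h] by (intro sum_mono) (auto simp: abs_mult intro!: mult_mono)
  finally show ?thesis by (simp add: mult_ac)
qed

lemma increment_bound_on:
  fixes F :: "real^'n::finite \<Rightarrow> real"
  assumes d: "\<And>z. z \<in> S \<Longrightarrow> (F has_derivative (\<lambda>h. \<Sum>i\<in>UNIV. h $ i * D i z)) (at z)"
    and A: "\<And>i z. z \<in> S \<Longrightarrow> \<bar>D i z\<bar> \<le> A" and S: "convex S" "x \<in> S" "y \<in> S"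
  shows "\<bar>F y - F x\<bar> \<le> real CARD('n) * A * norm (y - x)"
proof -
  have "norm (F y - F x) \<le> (real CARD('n) * A) * norm (y - x)"
  proof (rule differentiable_bound[OF S(1) _ _ S(3) S(2)])
    fix z assume z: "z \<in> S"
    show "(F has_derivative (\<lambda>h. \<Sum>i\<in>UNIV. h $ i * D i z)) (at z within S)"
      using d[OF z] by (rule has_derivative_at_withinI)
    show "onorm (\<lambda>h. \<Sum>i\<in>UNIV. h $ i * D i z) \<le> real CARD('n) * A"
    proof (rule onorm_bound)
      have "0 \<le> A" using order_trans[OF abs_ge_zero A[OF z]] .
      then show "0 \<le> real CARD('n) * A" by simp
      show "norm (\<Sum>i\<in>UNIV. h $ i * D i z) \<le> real CARD('n) * A * norm h" for h
        using linear_form_bound[of "\<lambda>i. D i z" A h] A[OF z] by simp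
    qed
  qed
  then show ?thesis by simp
qed

text \<open>A single A bounds the function and its partials, so one estimate covers short and long
  steps. It can be applied again to differences of functions, where A acquires a factor depending on
  h.\<close>

lemma increment_bound:
  fixes F :: "real^'n::finite \<Rightarrow> real"
  assumes d: "\<And>z. (F has_derivative (\<lambda>h. \<Sum>i\<in>UNIV. h $ i * D i z)) (at z)"
    and A: "\<And>i z. \<bar>D i z\<bar> \<le> A" and FA: "\<And>z. \<bar>F z\<bar> \<le> A"
  shows "\<bar>F (x + k) - F x\<bar> \<le> 2 * real CARD('n) * A * min 1 (norm k)"
proof -
  have A0: "A \<ge> 0" using order_trans[OF abs_ge_zero FA] .
  have n: "real CARD('n) \<ge> 1" by (simp add: Suc_leI)
  have 1: "\<bar>F (x + k) - F x\<bar> \<le> real CARD('n) * A * norm k"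
    using increment_bound_on[of UNIV F D A x "x + k"] d A by simp
  also have "\<dots> \<le> 2 * real CARD('n) * A * norm k" using A0 by (intro mult_right_mono) auto
  finally have 1: "\<bar>F (x + k) - F x\<bar> \<le> 2 * real CARD('n) * A * norm k" .
  have "\<bar>F (x + k) - F x\<bar> \<le> 2 * 1 * A" using FA[of x] FA[of "x + k"] by linarith
  also have "\<dots> \<le> 2 * real CARD('n) * A" using n A0 by (intro mult_right_mono mult_left_mono) auto
  finally have 2: "\<bar>F (x + k) - F x\<bar> \<le> 2 * real CARD('n) * A" .
  show ?thesis
  proof (cases "norm k \<le> 1")
    case True then show ?thesis using 1 by (simp add: min_absorb2)
  next
    case False then show ?thesis using 2 by (simp add: min_absorb1)
  qed
qed

text \<open>Over a finite index type the sum of the individual constants serves for all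
  indices.\<close>

lemma uniform_bound_finite:
  fixes Q :: "'n::finite \<Rightarrow> real \<Rightarrow> bool"
  assumes "\<And>i. \<exists>A\<ge>0. Q i A" and mono: "\<And>i A B. Q i A \<Longrightarrow> A \<le> B \<Longrightarrow> Q i B"
  shows "\<exists>A\<ge>0. \<forall>i. Q i A"
proof -
  obtain A where A: "\<And>i. A i \<ge> 0 \<and> Q i (A i)" using assms(1) by metis
  have "A i \<le> (\<Sum>i\<in>UNIV. A i)" for i using A by (intro member_le_sum) auto
  then have "Q i (\<Sum>i\<in>UNIV. A i)" for i using A mono by blast
  moreover have "(\<Sum>i\<in>UNIV. A i) \<ge> 0" using A by (intro sum_nonneg) auto
  ultimately show ?thesis by blast
qed

lemma has_derivative_shift:
  fixes u :: "real^'n::finite \<Rightarrow> real"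
  assumes "\<And>x. (u has_derivative (\<lambda>h. \<Sum>i\<in>UNIV. h $ i * D i x)) (at x)"
  shows "((\<lambda>x. u (x + a)) has_derivative (\<lambda>h. \<Sum>i\<in>UNIV. h $ i * D i (x + a))) (at x)"
proof -
  have "((\<lambda>x. x + a) has_derivative (\<lambda>h. h)) (at x)" by (auto intro!: derivative_eq_intros)
  from has_derivative_compose[OF this assms[of "x + a"]] show ?thesis by simp
qed

lemma Cinf_c_increment:
  fixes u :: "real^'n::finite \<Rightarrow> real"
  assumes u: "Cinf_c u"
  shows "\<exists>C\<ge>0. \<forall>x k. \<bar>u (x + k) - u x\<bar> \<le> C * min 1 (norm k)"
proof -
  have ex: "\<exists>A\<ge>0. \<forall>x. \<bar>v x\<bar> \<le> A" if "Cinf_c v" for v :: "real^'n \<Rightarrow> real"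
    using Cinf_c_bounded[OF that] by metis
  have "\<exists>A\<ge>0. \<forall>i. \<forall>x. \<bar>pd i u x\<bar> \<le> A"
    by (rule uniform_bound_finite) (auto intro: ex Cinf_c_pd u order_trans)
  then obtain A where A: "A \<ge> 0" "\<And>i x. \<bar>pd i u x\<bar> \<le> A" by blast
  obtain B where B: "B \<ge> 0" "\<And>x. \<bar>u x\<bar> \<le> B" using Cinf_c_bounded[OF u] by metis
  have "\<bar>u (x + k) - u x\<bar> \<le> 2 * real CARD('n) * (A + B) * min 1 (norm k)" for x k
  proof (rule increment_bound[OF Cinf_c_has_derivative[OF u]])
    show "\<bar>pd i u z\<bar> \<le> A + B" for i z using A(2)[of i z] B(1) by linarith
    show "\<bar>u z\<bar> \<le> A + B" for z using B(2)[of z] A(1) by linarith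
  qed
  moreover have "2 * real CARD('n) * (A + B) \<ge> 0" using A B by simp
  ultimately show ?thesis by blast
qed

text \<open>\<open>increment_bound\<close> is applied in k to the function u(x+h) - u(x) of x. Its
  values and partials are already of order min 1 |h| by the first-order bound, so the two gains
  multiply.\<close>

lemma Cinf_c_increment2:
  fixes u :: "real^'n::finite \<Rightarrow> real"
  assumes u: "Cinf_c u"
  shows "\<exists>C\<ge>0. \<forall>x h k. \<bar>(u (x + k + h) - u (x + k)) - (u (x + h) - u x)\<bar> \<le> C * min 1 (norm h) * min 1 (norm k)"
proof -
  have "\<exists>A\<ge>0. \<forall>i. \<forall>x k. \<bar>pd i u (x + k) - pd i u x\<bar> \<le> A * min 1 (norm k)"
  proof (rule uniform_bound_finite)
    fix i
    show "\<exists>A\<ge>0. \<forall>x k. \<bar>pd i u (x + k) - pd i u x\<bar> \<le> A * min 1 (norm k)"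
      by (rule Cinf_c_increment) (rule Cinf_c_pd[OF u])
  next
    fix i A B assume "\<forall>x k. \<bar>pd i u (x + k) - pd i u x\<bar> \<le> A * min 1 (norm k)" "A \<le> (B::real)"
    then show "\<forall>x k. \<bar>pd i u (x + k) - pd i u x\<bar> \<le> B * min 1 (norm k)"
      by (meson mult_right_mono norm_ge_zero order_trans min.boundedI zero_le_one)
  qed
  then obtain A where A: "A \<ge> 0" "\<And>i x k. \<bar>pd i u (x + k) - pd i u x\<bar> \<le> A * min 1 (norm k)" by blast
  obtain B where B: "B \<ge> 0" "\<And>x k. \<bar>u (x + k) - u x\<bar> \<le> B * min 1 (norm k)" using Cinf_c_increment[OF u] by blast
  have "\<bar>(u (x + k + h) - u (x + k)) - (u (x + h) - u x)\<bar> \<le> 2 * real CARD('n) * (A + B) * min 1 (norm h) * min 1 (norm k)" for x h k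
  proof -
    let ?m = "min 1 (norm h)"
    let ?F = "\<lambda>x. u (x + h) - u x"
    have "\<bar>?F (x + k) - ?F x\<bar> \<le> 2 * real CARD('n) * ((A + B) * ?m) * min 1 (norm k)"
    proof (rule increment_bound)
      fix z :: "real^'n"
      show "(?F has_derivative (\<lambda>h'. \<Sum>i\<in>UNIV. h' $ i * (pd i u (z + h) - pd i u z))) (at z)"
        using has_derivative_diff[OF has_derivative_shift[OF Cinf_c_has_derivative[OF u]] Cinf_c_has_derivative[OF u]]
        by (simp add: right_diff_distrib sum_subtractf)
      show "\<bar>pd i u (z + h) - pd i u z\<bar> \<le> (A + B) * ?m" for i
      proof (rule order_trans[OF A(2)])
        show "A * ?m \<le> (A + B) * ?m" using B(1) by (intro mult_right_mono) auto
      qed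
      show "\<bar>?F z\<bar> \<le> (A + B) * ?m"
      proof (rule order_trans[OF B(2)])
        show "B * ?m \<le> (A + B) * ?m" using A(1) by (intro mult_right_mono) auto
      qed
    qed
    then show ?thesis by (simp add: mult_ac)
  qed
  moreover have "2 * real CARD('n) * (A + B) \<ge> 0" using A B by simp
  ultimately show ?thesis by blast
qed

lemma min_square: "min 1 a * min 1 a = min 1 (a\<^sup>2)" if "a \<ge> (0::real)"
proof (cases "a \<le> 1")
  case True
  then have "a\<^sup>2 \<le> 1" using that by (simp add: power_le_one)
  then show ?thesis using True by (simp add: power2_eq_square min_absorb2)
next
  case False
  then have "a\<^sup>2 \<ge> 1" by (simp add: one_le_power)
  then show ?thesis using False by (simp add: min_absorb1)
qed

text \<open>The second difference is a mixed increment with k = -h.\<close>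

lemma Cinf_c_second_diff:
  fixes u :: "real^'n::finite \<Rightarrow> real"
  assumes u: "Cinf_c u"
  shows "\<exists>C\<ge>0. \<forall>x h. \<bar>second_diff u h x\<bar> \<le> C * min 1 ((norm h)\<^sup>2)"
proof -
  obtain C where C: "C \<ge> 0" "\<And>x h k. \<bar>(u (x + k + h) - u (x + k)) - (u (x + h) - u x)\<bar> \<le> C * min 1 (norm h) * min 1 (norm k)"
    using Cinf_c_increment2[OF u] by blast
  have "\<bar>second_diff u h x\<bar> \<le> C * min 1 ((norm h)\<^sup>2)" for x h
  proof -
    have "\<bar>second_diff u h x\<bar> = \<bar>(u (x + (- h) + h) - u (x + (- h))) - (u (x + h) - u x)\<bar>"
      unfolding second_diff_def by simp
    also have "\<dots> \<le> C * min 1 (norm h) * min 1 (norm (- h))" by (rule C(2))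
    also have "\<dots> = C * min 1 ((norm h)\<^sup>2)" by (simp only: norm_minus_cancel mult.assoc min_square[OF norm_ge_zero])
    finally show ?thesis .
  qed
  with C(1) show ?thesis by blast
qed

text \<open>Smallness quadratic in h and linear in k is what lets the kernel of the fractional
  Laplacian in h and that of the fractional gradient in k converge absolutely together.\<close>

lemma Cinf_c_second_diff_increment:
  fixes u :: "real^'n::finite \<Rightarrow> real"
  assumes u: "Cinf_c u"
  shows "\<exists>C\<ge>0. \<forall>x h k. \<bar>second_diff u h (x + k) - second_diff u h x\<bar> \<le> C * min 1 ((norm h)\<^sup>2) * min 1 (norm k)"
proof -
  have "\<exists>A\<ge>0. \<forall>i. \<forall>x h. \<bar>second_diff (pd i u) h x\<bar> \<le> A * min 1 ((norm h)\<^sup>2)"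
  proof (rule uniform_bound_finite)
    fix i
    show "\<exists>A\<ge>0. \<forall>x h. \<bar>second_diff (pd i u) h x\<bar> \<le> A * min 1 ((norm h)\<^sup>2)"
      by (rule Cinf_c_second_diff) (rule Cinf_c_pd[OF u])
  next
    fix i A B assume "\<forall>x h. \<bar>second_diff (pd i u) h x\<bar> \<le> A * min 1 ((norm h)\<^sup>2)" "A \<le> (B::real)"
    then show "\<forall>x h. \<bar>second_diff (pd i u) h x\<bar> \<le> B * min 1 ((norm h)\<^sup>2)"
      by (meson mult_right_mono zero_le_power2 order_trans min.boundedI zero_le_one)
  qed
  then obtain A where A: "A \<ge> 0" "\<And>i x h. \<bar>second_diff (pd i u) h x\<bar> \<le> A * min 1 ((norm h)\<^sup>2)" by blast
  obtain B where B: "B \<ge> 0" "\<And>x h. \<bar>second_diff u h x\<bar> \<le> B * min 1 ((norm h)\<^sup>2)" using Cinf_c_second_diff[OF u] by blast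
  have "\<bar>second_diff u h (x + k) - second_diff u h x\<bar> \<le> 2 * real CARD('n) * (A + B) * min 1 ((norm h)\<^sup>2) * min 1 (norm k)" for x h k
  proof -
    let ?m = "min 1 ((norm h)\<^sup>2)"
    have "\<bar>second_diff u h (x + k) - second_diff u h x\<bar> \<le> 2 * real CARD('n) * ((A + B) * ?m) * min 1 (norm k)"
    proof (rule increment_bound[where D="\<lambda>i. second_diff (pd i u) h"])
      fix z :: "real^'n"
      have sh: "((\<lambda>x. u (x - h)) has_derivative (\<lambda>h'. \<Sum>i\<in>UNIV. h' $ i * pd i u (z - h))) (at z)"
        using has_derivative_shift[OF Cinf_c_has_derivative[OF u], of "- h" z] by simp
      show "(second_diff u h has_derivative (\<lambda>h'. \<Sum>i\<in>UNIV. h' $ i * second_diff (pd i u) h z)) (at z)"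
        unfolding second_diff_def[abs_def]
        using has_derivative_diff[OF has_derivative_diff[OF has_derivative_mult_right[OF Cinf_c_has_derivative[OF u], of 2]
            has_derivative_shift[OF Cinf_c_has_derivative[OF u]]] sh, of h]
        by (simp add: right_diff_distrib sum_subtractf sum_distrib_left mult.left_commute)
      show "\<bar>second_diff (pd i u) h z\<bar> \<le> (A + B) * ?m" for i
      proof (rule order_trans[OF A(2)])
        show "A * ?m \<le> (A + B) * ?m" using B(1) by (intro mult_right_mono) auto
      qed
      show "\<bar>second_diff u h z\<bar> \<le> (A + B) * ?m"
      proof (rule order_trans[OF B(2)])
        show "B * ?m \<le> (A + B) * ?m" using A(1) by (intro mult_right_mono) auto
      qed
    qed
    then show ?thesis by (simp add: mult_ac)
  qed
  moreover have "2 * real CARD('n) * (A + B) \<ge> 0" using A B by simp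
  ultimately show ?thesis by blast
qed

definition taylor_rem :: "(real^'n::finite \<Rightarrow> real) \<Rightarrow> real^'n \<Rightarrow> real^'n \<Rightarrow> real" where
  "taylor_rem u h x = u (x + h) - u x - (\<Sum>j\<in>UNIV. h $ j * pd j u x)"

text \<open>Prepares the differentiation of the fractional gradient: the error must be quadratic in
  h and still gain min 1 |k| against the singular kernel in k.\<close>

lemma Cinf_c_taylor_increment:
  fixes u :: "real^'n::finite \<Rightarrow> real"
  assumes u: "Cinf_c u"
  shows "\<exists>C\<ge>0. \<forall>x h k. \<bar>taylor_rem u h (x + k) - taylor_rem u h x\<bar> \<le> C * (norm h)\<^sup>2 * min 1 (norm k)"
proof -
  have "\<exists>A\<ge>0. \<forall>i. \<forall>x h k. \<bar>(pd i u (x + k + h) - pd i u (x + k)) - (pd i u (x + h) - pd i u x)\<bar> \<le> A * min 1 (norm h) * min 1 (norm k)"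
  proof (rule uniform_bound_finite)
    fix i
    show "\<exists>A\<ge>0. \<forall>x h k. \<bar>(pd i u (x + k + h) - pd i u (x + k)) - (pd i u (x + h) - pd i u x)\<bar> \<le> A * min 1 (norm h) * min 1 (norm k)"
      by (rule Cinf_c_increment2) (rule Cinf_c_pd[OF u])
  next
    fix i A B
    assume h: "\<forall>x h k. \<bar>(pd i u (x + k + h) - pd i u (x + k)) - (pd i u (x + h) - pd i u x)\<bar> \<le> A * min 1 (norm h) * min 1 (norm k)" "A \<le> (B::real)"
    have "A * min 1 (norm h) * min 1 (norm k) \<le> B * min 1 (norm h) * min 1 (norm k)" for h k :: "real^'n"
      using h(2) by (intro mult_right_mono) auto
    with h(1) show "\<forall>x h k. \<bar>(pd i u (x + k + h) - pd i u (x + k)) - (pd i u (x + h) - pd i u x)\<bar> \<le> B * min 1 (norm h) * min 1 (norm k)"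
      by (meson order_trans)
  qed
  then obtain A where A: "A \<ge> 0" "\<And>i x h k. \<bar>(pd i u (x + k + h) - pd i u (x + k)) - (pd i u (x + h) - pd i u x)\<bar> \<le> A * min 1 (norm h) * min 1 (norm k)" by blast
  have "\<bar>taylor_rem u h (x + k) - taylor_rem u h x\<bar> \<le> (real CARD('n) * A) * (norm h)\<^sup>2 * min 1 (norm k)" for x h k
  proof -
    let ?c = "\<lambda>j. pd j u (x + k) - pd j u x"
    \<comment> \<open>The linear part is frozen at x, so the partials of this function vanish at z =
      x and are of order |h| on the ball of radius |h|. The mean value inequality adds the second
      factor |h|.\<close>
    let ?F = "\<lambda>z. (u (z + k) - u z) - (\<Sum>j\<in>UNIV. z $ j * ?c j)"
    have "\<bar>?F (x + h) - ?F x\<bar> \<le> real CARD('n) * (A * norm h * min 1 (norm k)) * norm (x + h - x)"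
    proof (rule increment_bound_on[where S="cball x (norm h)" and D="\<lambda>i z. (pd i u (z + k) - pd i u z) - ?c i"])
      fix z assume z: "z \<in> cball x (norm h)"
      have "((\<lambda>z. \<Sum>j\<in>UNIV. z $ j * ?c j) has_derivative (\<lambda>h. \<Sum>j\<in>UNIV. h $ j * ?c j)) (at z)"
        by (intro bounded_linear_imp_has_derivative bounded_linear_sum bounded_linear_mult_left[THEN bounded_linear_compose] bounded_linear_vec_nth)
      from has_derivative_diff[OF has_derivative_diff[OF has_derivative_shift[OF Cinf_c_has_derivative[OF u]] Cinf_c_has_derivative[OF u]] this]
      show "(?F has_derivative (\<lambda>h. \<Sum>i\<in>UNIV. h $ i * ((pd i u (z + k) - pd i u z) - ?c i))) (at z)"
        by (simp only: right_diff_distrib sum_subtractf)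
      fix i
      have "(pd i u (z + k) - pd i u z) - ?c i = (pd i u (x + k + (z - x)) - pd i u (x + k)) - (pd i u (x + (z - x)) - pd i u x)"
        by (simp add: algebra_simps)
      also have "\<bar>\<dots>\<bar> \<le> A * min 1 (norm (z - x)) * min 1 (norm k)" by (rule A(2))
      also have "\<dots> \<le> A * norm h * min 1 (norm k)"
        using z A(1) by (intro mult_right_mono mult_left_mono) (auto simp: dist_norm norm_minus_commute)
      finally show "\<bar>(pd i u (z + k) - pd i u z) - ?c i\<bar> \<le> A * norm h * min 1 (norm k)" .
    qed (auto simp: dist_norm)
    moreover have "?F (x + h) - ?F x = taylor_rem u h (x + k) - taylor_rem u h x"
      by (simp add: taylor_rem_def distrib_right right_diff_distrib sum.distrib sum_subtractf algebra_simps)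
    ultimately show ?thesis by (simp add: power2_eq_square mult_ac)
  qed
  moreover have "real CARD('n) * A \<ge> 0" using A by simp
  ultimately show ?thesis by blast
qed

section \<open>The fractional gradient and the fractional Laplacian\<close>

definition fgrad :: "real \<Rightarrow> 'n::finite \<Rightarrow> (real^'n \<Rightarrow> real) \<Rightarrow> real^'n \<Rightarrow> real" where
  "fgrad s i g x = (\<integral>k. k $ i * (g (x + k) - g x) / norm k powr (real CARD('n) + s + 1) \<partial>lborel)"

lemma frac_pd_eq_fgrad: "frac_pd s i u x = mu_ns s TYPE('n::finite) * fgrad s (i::'n) u x"
  unfolding frac_pd_def fgrad_def
  by (subst integral_lborel_affine[where c=1 and t=x]) (auto simp: algebra_simps)

text \<open>Majorant for the fractional gradient of any function whose increments at a point are of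
  order min 1 |k|. Relative to the dimension its exponents are 1 - s at 0 and -s at
  infinity.\<close>

definition fgrad_dom :: "real \<Rightarrow> real^'n::finite \<Rightarrow> real" where
  "fgrad_dom s k = min 1 (norm k) * norm k / norm k powr (real CARD('n) + s + 1)"

lemma fgrad_dom_nonneg[simp]: "fgrad_dom s k \<ge> 0" by (simp add: fgrad_dom_def)

lemma fgrad_dom_integrable:
  assumes s: "0 < s" "s < 1"
  shows "integrable lborel (fgrad_dom s :: real^'n::finite \<Rightarrow> real)"
proof (rule integrable_radial_bound[where a="1 - s" and b="- s" and B=1])
  show "fgrad_dom s \<in> borel_measurable borel" unfolding fgrad_dom_def[abs_def] by measurable
  fix k :: "real^'n"
  have pw: "norm k powr c / norm k powr (real CARD('n) + s + 1) = norm k powr (c - 1 - s - real CARD('n))" for c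
  proof -
    have "c - (real CARD('n) + s + 1) = c - 1 - s - real CARD('n)" by simp
    then show ?thesis by (metis powr_diff)
  qed
  {
    assume k: "k \<noteq> 0" "norm k \<le> 1"
    have "min 1 (norm k) * norm k = norm k powr 2" using k by (simp add: powr_numeral min_absorb2 power2_eq_square)
    then have "fgrad_dom s k = norm k powr (2 - 1 - s - real CARD('n))" unfolding fgrad_dom_def by (simp only: pw)
    then show "\<bar>fgrad_dom s k\<bar> \<le> 1 * norm k powr (1 - s - real DIM(real^'n))" by simp
  }
  {
    assume k: "1 \<le> norm k"
    then have "k \<noteq> 0" by auto
    then have "min 1 (norm k) * norm k = norm k powr 1" using k by (simp add: min_absorb1)
    then have "fgrad_dom s k = norm k powr (1 - 1 - s - real CARD('n))" unfolding fgrad_dom_def by (simp only: pw)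
    then show "\<bar>fgrad_dom s k\<bar> \<le> 1 * norm k powr (- s - real DIM(real^'n))" by simp
  }
qed (use s in auto)

lemma fgrad_integrand_bound:
  fixes g :: "real^'n::finite \<Rightarrow> real"
  assumes b: "\<bar>g (x + k) - g x\<bar> \<le> A * min 1 (norm k)"
  shows "\<bar>k $ i * (g (x + k) - g x) / norm k powr (real CARD('n) + s + 1)\<bar> \<le> A * fgrad_dom s k"
proof -
  have A: "0 \<le> A * min 1 (norm k)" using order_trans[OF abs_ge_zero b] .
  have "\<bar>k $ i\<bar> * \<bar>g (x + k) - g x\<bar> \<le> norm k * (A * min 1 (norm k))"
    using component_le_norm_cart[of k i] b by (intro mult_mono) auto
  then have "\<bar>k $ i\<bar> * \<bar>g (x + k) - g x\<bar> / norm k powr (real CARD('n) + s + 1) \<le> norm k * (A * min 1 (norm k)) / norm k powr (real CARD('n) + s + 1)"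
    by (rule divide_right_mono) simp
  then show ?thesis by (simp add: fgrad_dom_def abs_mult abs_divide mult_ac)
qed

lemma fgrad_integrable:
  fixes g :: "real^'n::finite \<Rightarrow> real"
  assumes s: "0 < s" "s < 1" and [measurable]: "g \<in> borel_measurable borel"
    and b: "\<And>k. \<bar>g (x + k) - g x\<bar> \<le> A * min 1 (norm k)"
  shows "integrable lborel (\<lambda>k. k $ i * (g (x + k) - g x) / norm k powr (real CARD('n) + s + 1))"
proof (rule Bochner_Integration.integrable_bound[OF integrable_mult_right[OF fgrad_dom_integrable[OF s], of A]])
  show "AE k in lborel. norm (k $ i * (g (x + k) - g x) / norm k powr (real CARD('n) + s + 1)) \<le> norm (A * fgrad_dom s k)"
  proof (rule AE_I2)
    fix k :: "real^'n"
    show "norm (k $ i * (g (x + k) - g x) / norm k powr (real CARD('n) + s + 1)) \<le> norm (A * fgrad_dom s k)"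
      unfolding real_norm_def using fgrad_integrand_bound[OF b, of k i s] abs_ge_self order_trans by blast
  qed
qed measurable

lemma fgrad_bound:
  fixes g :: "real^'n::finite \<Rightarrow> real"
  assumes s: "0 < s" "s < 1" and g: "g \<in> borel_measurable borel"
    and b: "\<And>k. \<bar>g (x + k) - g x\<bar> \<le> A * min 1 (norm k)"
  shows "\<bar>fgrad s i g x\<bar> \<le> A * (\<integral>k. fgrad_dom s (k :: real^'n) \<partial>lborel)"
proof -
  have "\<bar>fgrad s i g x\<bar> \<le> (\<integral>k. \<bar>k $ i * (g (x + k) - g x) / norm k powr (real CARD('n) + s + 1)\<bar> \<partial>lborel)"
    unfolding fgrad_def by (rule integral_abs_bound)
  also have "\<dots> \<le> (\<integral>k. A * fgrad_dom s (k :: real^'n) \<partial>lborel)"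
    by (intro integral_mono integrable_abs fgrad_integrable[OF s g b] integrable_mult_right fgrad_dom_integrable s fgrad_integrand_bound b)
  finally show ?thesis by simp
qed

lemma fgrad_dom_integral_nonneg: "(\<integral>k. fgrad_dom s (k :: real^'n::finite) \<partial>lborel) \<ge> 0"
  by simp

lemma Cinf_c_fgrad_integrable:
  fixes u :: "real^'n::finite \<Rightarrow> real"
  assumes s: "0 < s" "s < 1" and u: "Cinf_c u"
  shows "integrable lborel (\<lambda>k. k $ i * (u (x + k) - u x) / norm k powr (real CARD('n) + s + 1))"
proof -
  obtain C where "\<And>x k. \<bar>u (x + k) - u x\<bar> \<le> C * min 1 (norm k)" using Cinf_c_increment[OF u] by blast
  then show ?thesis by (intro fgrad_integrable[OF s Cinf_c_borel[OF u], where A=C])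
qed

text \<open>\<open>fgrad\<close> is linear and commutes with translations, so differences in x can
  be moved onto u. Increment bounds for the differenced function then become estimates through
  \<open>fgrad_bound\<close>; the second difference and the Taylor remainder below follow the same
  pattern.\<close>

lemma fgrad_shift_diff:
  fixes u :: "real^'n::finite \<Rightarrow> real"
  assumes s: "0 < s" "s < 1" and u: "Cinf_c u"
  shows "fgrad s i (\<lambda>x. u (x + h) - u x) x = fgrad s i u (x + h) - fgrad s i u x"
proof -
  have "fgrad s i u (x + h) - fgrad s i u x = (\<integral>k. k $ i * (u (x + h + k) - u (x + h)) / norm k powr (real CARD('n) + s + 1)
      - k $ i * (u (x + k) - u x) / norm k powr (real CARD('n) + s + 1) \<partial>lborel)"
    unfolding fgrad_def by (intro Bochner_Integration.integral_diff[symmetric] Cinf_c_fgrad_integrable s u)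
  also have "\<dots> = fgrad s i (\<lambda>x. u (x + h) - u x) x"
    unfolding fgrad_def by (intro Bochner_Integration.integral_cong) (auto simp: algebra_simps diff_divide_distrib add_divide_distrib)
  finally show ?thesis by simp
qed

lemma fgrad_second_diff:
  fixes u :: "real^'n::finite \<Rightarrow> real"
  assumes s: "0 < s" "s < 1" and u: "Cinf_c u"
  shows "fgrad s i (second_diff u h) x = second_diff (fgrad s i u) h x"
proof -
  define q where "q = (\<lambda>x k. k $ i * (u (x + k) - u x) / norm k powr (real CARD('n) + s + 1))"
  have int: "integrable lborel (q x)" for x unfolding q_def by (rule Cinf_c_fgrad_integrable[OF s u])
  have fg: "fgrad s i u x = (\<integral>k. q x k \<partial>lborel)" for x by (simp add: fgrad_def q_def)
  have "second_diff (fgrad s i u) h x = (\<integral>k. 2 * q x k - q (x + h) k - q (x - h) k \<partial>lborel)"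
    unfolding second_diff_def fg using int by simp
  also have "\<dots> = fgrad s i (second_diff u h) x"
    unfolding fgrad_def second_diff_def q_def
    by (intro Bochner_Integration.integral_cong) (auto simp: algebra_simps diff_divide_distrib add_divide_distrib)
  finally show ?thesis by simp
qed

lemma fgrad_taylor_rem:
  fixes u :: "real^'n::finite \<Rightarrow> real"
  assumes s: "0 < s" "s < 1" and u: "Cinf_c u"
  shows "fgrad s i (taylor_rem u h) x = fgrad s i u (x + h) - fgrad s i u x - (\<Sum>j\<in>UNIV. h $ j * fgrad s i (pd j u) x)"
proof -
  let ?N = "\<lambda>k::real^'n. norm k powr (real CARD('n) + s + 1)"
  define q where "q = (\<lambda>g x k. k $ i * (g (x + k) - g x) / ?N k)"
  have int: "integrable lborel (q u x)" for x unfolding q_def by (rule Cinf_c_fgrad_integrable[OF s u])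
  have intj: "integrable lborel (q (pd j u) x)" for j x
    unfolding q_def by (rule Cinf_c_fgrad_integrable[OF s Cinf_c_pd[OF u]])
  have fg: "fgrad s i g x = (\<integral>k. q g x k \<partial>lborel)" for g x by (simp add: fgrad_def q_def)
  have "fgrad s i u (x + h) - fgrad s i u x - (\<Sum>j\<in>UNIV. h $ j * fgrad s i (pd j u) x)
     = (\<integral>k. q u (x + h) k - q u x k - (\<Sum>j\<in>UNIV. h $ j * q (pd j u) x k) \<partial>lborel)"
    unfolding fg using int intj by simp
  also have "\<dots> = fgrad s i (taylor_rem u h) x"
    unfolding fg
  proof (rule Bochner_Integration.integral_cong[OF refl])
    fix k :: "real^'n"
    have "(\<Sum>j\<in>UNIV. h $ j * q (pd j u) x k) = k $ i * ((\<Sum>j\<in>UNIV. h $ j * pd j u (x + k)) - (\<Sum>j\<in>UNIV. h $ j * pd j u x)) / ?N k"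
      by (simp add: q_def sum_subtractf[symmetric] sum_distrib_left sum_divide_distrib algebra_simps)
    then show "q u (x + h) k - q u x k - (\<Sum>j\<in>UNIV. h $ j * q (pd j u) x k) = q (taylor_rem u h) x k"
      by (simp add: q_def taylor_rem_def algebra_simps diff_divide_distrib add_divide_distrib)
  qed
  finally show ?thesis by simp
qed

lemma fgrad_increment:
  fixes u :: "real^'n::finite \<Rightarrow> real"
  assumes s: "0 < s" "s < 1" and u: "Cinf_c u"
  shows "\<exists>C\<ge>0. \<forall>x h. \<bar>fgrad s i u (x + h) - fgrad s i u x\<bar> \<le> C * min 1 (norm h)"
proof -
  obtain C where C: "C \<ge> 0" "\<And>x h k. \<bar>(u (x + k + h) - u (x + k)) - (u (x + h) - u x)\<bar> \<le> C * min 1 (norm h) * min 1 (norm k)"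
    using Cinf_c_increment2[OF u] by blast
  let ?I = "\<integral>k. fgrad_dom s (k :: real^'n) \<partial>lborel"
  note [measurable] = Cinf_c_borel[OF u]
  have "\<bar>fgrad s i u (x + h) - fgrad s i u x\<bar> \<le> (C * ?I) * min 1 (norm h)" for x h
  proof -
    have "\<bar>fgrad s i (\<lambda>x. u (x + h) - u x) x\<bar> \<le> (C * min 1 (norm h)) * ?I"
      by (rule fgrad_bound[OF s]) (measurable, rule C(2))
    then show ?thesis unfolding fgrad_shift_diff[OF s u] by (simp add: mult_ac)
  qed
  moreover have "C * ?I \<ge> 0" using C(1) fgrad_dom_integral_nonneg by (rule mult_nonneg_nonneg)
  ultimately show ?thesis by blast
qed

lemma fgrad_bounded:
  fixes u :: "real^'n::finite \<Rightarrow> real"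
  assumes s: "0 < s" "s < 1" and u: "Cinf_c u"
  shows "\<exists>C\<ge>0. \<forall>x. \<bar>fgrad s i u x\<bar> \<le> C"
proof -
  obtain C where C: "C \<ge> 0" "\<And>x k. \<bar>u (x + k) - u x\<bar> \<le> C * min 1 (norm k)" using Cinf_c_increment[OF u] by blast
  let ?I = "\<integral>k. fgrad_dom s (k :: real^'n) \<partial>lborel"
  have "\<bar>fgrad s i u x\<bar> \<le> C * ?I" for x by (rule fgrad_bound[OF s Cinf_c_borel[OF u] C(2)])
  moreover have "C * ?I \<ge> 0" using C(1) fgrad_dom_integral_nonneg by (rule mult_nonneg_nonneg)
  ultimately show ?thesis by blast
qed

text \<open>The Taylor remainder of the fractional gradient is the fractional gradient of the Taylor
  remainder of u, hence quadratic in h.\<close>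

lemma fgrad_has_derivative:
  fixes u :: "real^'n::finite \<Rightarrow> real"
  assumes s: "0 < s" "s < 1" and u: "Cinf_c u"
  shows "(fgrad s i u has_derivative (\<lambda>h. \<Sum>j\<in>UNIV. h $ j * fgrad s i (pd j u) x)) (at x)"
proof -
  obtain C where C: "C \<ge> 0" "\<And>x h k. \<bar>taylor_rem u h (x + k) - taylor_rem u h x\<bar> \<le> C * (norm h)\<^sup>2 * min 1 (norm k)"
    using Cinf_c_taylor_increment[OF u] by blast
  let ?I = "\<integral>k. fgrad_dom s (k :: real^'n) \<partial>lborel"
  have m: "taylor_rem u h \<in> borel_measurable borel" for h
  proof -
    have [measurable]: "u \<in> borel_measurable borel" "pd j u \<in> borel_measurable borel" for j
      by (auto intro: Cinf_c_borel Cinf_c_pd u)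
    show ?thesis unfolding taylor_rem_def[abs_def] by measurable
  qed
  have b: "\<bar>fgrad s i u (x + h) - fgrad s i u x - (\<Sum>j\<in>UNIV. h $ j * fgrad s i (pd j u) x)\<bar> \<le> (C * ?I) * (norm h)\<^sup>2" for h
  proof -
    have "\<bar>fgrad s i (taylor_rem u h) x\<bar> \<le> C * (norm h)\<^sup>2 * ?I" by (rule fgrad_bound[OF s m C(2)])
    then show ?thesis unfolding fgrad_taylor_rem[OF s u] by (simp add: mult_ac)
  qed
  have K: "C * ?I \<ge> 0" using C(1) fgrad_dom_integral_nonneg by (rule mult_nonneg_nonneg)
  show ?thesis
    unfolding has_derivative_at_alt
  proof (intro conjI allI impI)
    show "bounded_linear (\<lambda>h. \<Sum>j\<in>UNIV. h $ j * fgrad s i (pd j u) x)"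
      by (intro bounded_linear_sum bounded_linear_mult_left[THEN bounded_linear_compose] bounded_linear_vec_nth)
    fix e :: real assume e: "e > 0"
    show "\<exists>d>0. \<forall>y. norm (y - x) < d \<longrightarrow> norm (fgrad s i u y - fgrad s i u x - (\<Sum>j\<in>UNIV. (y - x) $ j * fgrad s i (pd j u) x)) \<le> e * norm (y - x)"
    proof (intro exI[of _ "e / (C * ?I + 1)"] conjI allI impI)
      show "e / (C * ?I + 1) > 0" using e K by (intro divide_pos_pos) linarith+
      fix y assume y: "norm (y - x) < e / (C * ?I + 1)"
      have "norm (fgrad s i u y - fgrad s i u x - (\<Sum>j\<in>UNIV. (y - x) $ j * fgrad s i (pd j u) x)) \<le> (C * ?I) * (norm (y - x))\<^sup>2"
        using b[of "y - x"] by simp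
      also have "\<dots> = ((C * ?I) * norm (y - x)) * norm (y - x)" by (simp add: power2_eq_square)
      also have "\<dots> \<le> e * norm (y - x)"
      proof (rule mult_right_mono)
        have "(C * ?I) * norm (y - x) \<le> (C * ?I + 1) * norm (y - x)" by (rule mult_right_mono) auto
        also have "\<dots> \<le> e" using y K by (simp add: pos_less_divide_eq mult.commute less_imp_le)
        finally show "(C * ?I) * norm (y - x) \<le> e" .
      qed simp
      finally show "norm (fgrad s i u y - fgrad s i u x - (\<Sum>j\<in>UNIV. (y - x) $ j * fgrad s i (pd j u) x)) \<le> e * norm (y - x)" .
    qed
  qed
qed

lemma Cinf_c_integrable:
  fixes u :: "real^'n::finite \<Rightarrow> real"
  assumes u: "Cinf_c u" shows "integrable lborel u"
proof -
  obtain R where R: "R > 0" "\<And>x. norm x \<ge> R \<Longrightarrow> u x = 0" using Cinf_c_support[OF u] by blast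
  obtain A where A: "A \<ge> 0" "\<And>x. \<bar>u x\<bar> \<le> A" using Cinf_c_bounded[OF u] by blast
  have i: "integrable lborel (\<lambda>x::real^'n. indicator (cball 0 R) x * A)"
    by (intro integrable_mult_left integrable_real_indicator) (auto intro: emeasure_lborel_cball_finite[unfolded infinity_ennreal_def])
  show ?thesis
  proof (rule Bochner_Integration.integrable_bound[OF i])
    show "AE x in lborel. norm (u x) \<le> norm (indicator (cball 0 R) x * A)"
    proof (rule AE_I2)
      fix x
      show "norm (u x) \<le> norm (indicator (cball 0 R) x * A)"
        using A R(2)[of x] by (cases "norm x \<le> R") auto
    qed
  qed (use Cinf_c_borel[OF u] in simp)
qed

text \<open>Far from the support u(x) = 0, and u(x+k) is nonzero only for |k| >= |x| / 2. There |k|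
  times the kernel is at most 1 / |k| because n + s + 1 >= 2, so the integral is at most 2 / |x|
  times the L^1 norm of u. The kernel would give the rate |x|^(-n-s); a single power is extracted,
  as \<open>acf_weight\<close> asks.\<close>

lemma fgrad_decay:
  fixes u :: "real^'n::finite \<Rightarrow> real"
  assumes s: "0 < s" "s < 1" and u: "Cinf_c u"
  shows "\<exists>C\<ge>0. \<forall>x. \<bar>fgrad s i u x\<bar> * (1 + norm x) \<le> C"
proof -
  obtain R where R: "R > 0" "\<And>x. norm x \<ge> R \<Longrightarrow> u x = 0" using Cinf_c_support[OF u] by blast
  obtain B where B: "B \<ge> 0" "\<And>x. \<bar>fgrad s i u x\<bar> \<le> B" using fgrad_bounded[OF s u] by blast
  let ?U = "\<integral>x. \<bar>u x\<bar> \<partial>lborel"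
  have U: "?U \<ge> 0" by simp
  have iu: "integrable lborel u" by (rule Cinf_c_integrable[OF u])
  \<comment> \<open>The threshold makes |x + k| < R imply |k| >= |x| / 2 >= 1.\<close>
  have far: "\<bar>fgrad s i u x\<bar> \<le> 2 / norm x * ?U" if x: "norm x \<ge> 2 * R + 2" for x
  proof -
    have x2: "norm x / 2 \<ge> 1" using x R(1) by linarith
    have ux: "u x = 0" using x R by (intro R(2)) linarith
    have pt: "\<bar>k $ i * (u (x + k) - u x) / norm k powr (real CARD('n) + s + 1)\<bar> \<le> 2 / norm x * \<bar>u (x + 1 *\<^sub>R k)\<bar>" for k
    proof (cases "norm (x + k) \<ge> R")
      case True then show ?thesis using R(2) ux by simp
    next
      case False
      have "norm x \<le> norm (x + k) + norm k" by (metis add_diff_cancel_right' norm_triangle_ineq4)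
      then have k: "norm k \<ge> norm x / 2" using False x by linarith
      then have k1: "norm k \<ge> 1" using x2 by linarith
      have "norm k / norm k powr (real CARD('n) + s + 1) \<le> 1 / norm k"
      proof -
        have "norm k * norm k = norm k powr 2" using k1 by (simp add: powr_numeral power2_eq_square)
        also have "\<dots> \<le> norm k powr (real CARD('n) + s + 1)"
        proof (rule powr_mono)
          have "1 \<le> CARD('n)" by (simp add: Suc_leI)
          then show "2 \<le> real CARD('n) + s + 1" using s by linarith
        qed (rule k1)
        finally have "norm k / norm k powr (real CARD('n) + s + 1) \<le> norm k / (norm k * norm k)"
          using k1 by (intro divide_left_mono mult_pos_pos) auto
        then show ?thesis using k1 by (auto split: if_splits)
      qed
      also have "\<dots> \<le> 1 / (norm x / 2)" using k x2 by (intro divide_left_mono) (auto intro!: mult_pos_pos)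
      finally have kb: "norm k / norm k powr (real CARD('n) + s + 1) \<le> 2 / norm x" by simp
      have "\<bar>k $ i * (u (x + k) - u x) / norm k powr (real CARD('n) + s + 1)\<bar> = \<bar>k $ i\<bar> / norm k powr (real CARD('n) + s + 1) * \<bar>u (x + k)\<bar>"
        using ux by (simp add: abs_mult abs_divide)
      also have "\<dots> \<le> 2 / norm x * \<bar>u (x + k)\<bar>"
      proof (rule mult_right_mono)
        have "\<bar>k $ i\<bar> / norm k powr (real CARD('n) + s + 1) \<le> norm k / norm k powr (real CARD('n) + s + 1)"
          using component_le_norm_cart[of k i] by (intro divide_right_mono) auto
        with kb show "\<bar>k $ i\<bar> / norm k powr (real CARD('n) + s + 1) \<le> 2 / norm x" by linarith
      qed simp
      finally show ?thesis by simp
    qed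
    have "\<bar>fgrad s i u x\<bar> \<le> (\<integral>k. \<bar>k $ i * (u (x + k) - u x) / norm k powr (real CARD('n) + s + 1)\<bar> \<partial>lborel)"
      unfolding fgrad_def by (rule integral_abs_bound)
    also have "\<dots> \<le> (\<integral>k. 2 / norm x * \<bar>u (x + 1 *\<^sub>R k)\<bar> \<partial>lborel)"
      by (intro integral_mono integrable_abs Cinf_c_fgrad_integrable[OF s u] integrable_mult_right pt integrable_lborel_affine[OF iu]) simp
    also have "\<dots> = 2 / norm x * ?U"
      using integral_lborel_affine[of 1 "\<lambda>x. \<bar>u x\<bar>" x] by simp
    finally show ?thesis .
  qed
  let ?C = "B * (2 * R + 3) + 4 * ?U"
  have "\<bar>fgrad s i u x\<bar> * (1 + norm x) \<le> ?C" for x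
  proof (cases "norm x \<ge> 2 * R + 2")
    case True
    have x1: "norm x \<ge> 1" using True R(1) by linarith
    have "\<bar>fgrad s i u x\<bar> * (1 + norm x) \<le> (2 / norm x * ?U) * (2 * norm x)"
      using x1 far[OF True] U by (intro mult_mono) auto
    also have "\<dots> = 4 * ?U"
    proof -
      have "x \<noteq> 0" using x1 by auto
      then show ?thesis by simp
    qed
    also have "\<dots> \<le> ?C" using B(1) R(1) by simp
    finally show ?thesis .
  next
    case False
    have "\<bar>fgrad s i u x\<bar> * (1 + norm x) \<le> B * (2 * R + 3)"
      using False B by (intro mult_mono) auto
    also have "\<dots> \<le> ?C" using U by simp
    finally show ?thesis .
  qed
  moreover have "?C \<ge> 0" using B(1) R(1) U by simp
  ultimately show ?thesis by blast
qed

lemma norm_frac_grad_sq: "(norm (frac_grad s u x))\<^sup>2 = (\<Sum>i\<in>UNIV. (mu_ns s TYPE('n::finite) * fgrad s (i::'n) u x)\<^sup>2)"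
  unfolding power2_norm_eq_inner inner_vec_def frac_grad_def
  by (simp add: frac_pd_eq_fgrad power2_eq_square)

text \<open>For w = sum_i V_i^2 the gradient is G_j = 2 sum_i V_i d_j V_i, and d_j V_i is the
  component V_i formed with d_j u, which is again smooth with compact support. In each product one
  factor decays while the other is bounded, and the product rule for increments gives the Lipschitz
  bound.\<close>

lemma frac_grad_weight:
  fixes u :: "real^'n::finite \<Rightarrow> real"
  assumes s: "0 < s" "s < 1" and u: "Cinf_c u"
  shows "\<exists>G M. acf_weight (\<lambda>x. (norm (frac_grad s u x))\<^sup>2) G M s"
proof -
  let ?m = "mu_ns s TYPE('n)"
  define V where "V = (\<lambda>i x. ?m * fgrad s i u x)"
  define W where "W = (\<lambda>i j x. ?m * fgrad s i (pd j u) x)"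
  have bd: "\<exists>A\<ge>0. (\<forall>x. \<bar>?m * fgrad s i v x\<bar> \<le> A) \<and> (\<forall>x. \<bar>?m * fgrad s i v x\<bar> * (1 + norm x) \<le> A)
      \<and> (\<forall>x y. \<bar>?m * fgrad s i v x - ?m * fgrad s i v y\<bar> \<le> A * norm (x - y))" if v: "Cinf_c v" for v :: "real^'n \<Rightarrow> real" and i
  proof -
    obtain A1 where A1: "A1 \<ge> 0" "\<And>x. \<bar>fgrad s i v x\<bar> \<le> A1" using fgrad_bounded[OF s v] by blast
    obtain A2 where A2: "A2 \<ge> 0" "\<And>x. \<bar>fgrad s i v x\<bar> * (1 + norm x) \<le> A2" using fgrad_decay[OF s v] by blast
    obtain A3 where A3: "A3 \<ge> 0" "\<And>x h. \<bar>fgrad s i v (x + h) - fgrad s i v x\<bar> \<le> A3 * min 1 (norm h)" using fgrad_increment[OF s v] by blast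
    let ?A = "\<bar>?m\<bar> * (A1 + A2 + A3)"
    have "\<bar>?m * fgrad s i v x\<bar> \<le> ?A" for x
      unfolding abs_mult using A1(2)[of x] A2(1) A3(1) by (intro mult_left_mono) auto
    moreover have "\<bar>?m * fgrad s i v x\<bar> * (1 + norm x) \<le> ?A" for x
      unfolding abs_mult mult.assoc using A2(2)[of x] A1(1) A3(1) by (intro mult_left_mono) auto
    moreover have "\<bar>?m * fgrad s i v x - ?m * fgrad s i v y\<bar> \<le> ?A * norm (x - y)" for x y
    proof -
      have "\<bar>fgrad s i v (y + (x - y)) - fgrad s i v y\<bar> \<le> A3 * min 1 (norm (x - y))" by (rule A3(2))
      also have "\<dots> \<le> (A1 + A2 + A3) * norm (x - y)" using A1(1) A2(1) A3(1) by (intro mult_mono) auto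
      finally have "\<bar>?m\<bar> * \<bar>fgrad s i v x - fgrad s i v y\<bar> \<le> \<bar>?m\<bar> * ((A1 + A2 + A3) * norm (x - y))"
        by (intro mult_left_mono) auto
      then show ?thesis by (simp add: abs_mult[symmetric] right_diff_distrib mult.assoc)
    qed
    moreover have "?A \<ge> 0" using A1(1) A2(1) A3(1) by simp
    ultimately show ?thesis by blast
  qed
  have monoQ: "(\<forall>x. \<bar>f x\<bar> \<le> B) \<and> (\<forall>x. \<bar>f x\<bar> * (1 + norm x) \<le> B) \<and> (\<forall>x y. \<bar>f x - f y\<bar> \<le> B * norm (x - y))"
    if "(\<forall>x. \<bar>f x\<bar> \<le> A) \<and> (\<forall>x. \<bar>f x\<bar> * (1 + norm x) \<le> A) \<and> (\<forall>x y. \<bar>f x - f y\<bar> \<le> A * norm (x - y))" "A \<le> B"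
    for f :: "real^'n \<Rightarrow> real" and A B
  proof (intro conjI allI)
    fix x y
    show "\<bar>f x\<bar> \<le> B" "\<bar>f x\<bar> * (1 + norm x) \<le> B" using that by (blast intro: order_trans)+
    have "\<bar>f x - f y\<bar> \<le> A * norm (x - y)" using that by blast
    also have "\<dots> \<le> B * norm (x - y)" using that(2) by (rule mult_right_mono) simp
    finally show "\<bar>f x - f y\<bar> \<le> B * norm (x - y)" .
  qed
  have "\<exists>A\<ge>0. \<forall>i. (\<forall>x. \<bar>V i x\<bar> \<le> A) \<and> (\<forall>x. \<bar>V i x\<bar> * (1 + norm x) \<le> A) \<and> (\<forall>x y. \<bar>V i x - V i y\<bar> \<le> A * norm (x - y))"
    unfolding V_def by (rule uniform_bound_finite) (rule bd[OF u], rule monoQ)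
  then obtain A where A: "A \<ge> 0" "\<And>i x. \<bar>V i x\<bar> \<le> A" "\<And>i x. \<bar>V i x\<bar> * (1 + norm x) \<le> A"
    "\<And>i x y. \<bar>V i x - V i y\<bar> \<le> A * norm (x - y)" by blast
  have "\<exists>A\<ge>0. \<forall>p. (\<forall>x. \<bar>W (fst p) (snd p) x\<bar> \<le> A) \<and> (\<forall>x. \<bar>W (fst p) (snd p) x\<bar> * (1 + norm x) \<le> A)
     \<and> (\<forall>x y. \<bar>W (fst p) (snd p) x - W (fst p) (snd p) y\<bar> \<le> A * norm (x - y))"
    unfolding W_def by (rule uniform_bound_finite) (rule bd[OF Cinf_c_pd[OF u]], rule monoQ)
  then obtain B where B0: "B \<ge> 0" "\<And>p. (\<forall>x. \<bar>W (fst p) (snd p) x\<bar> \<le> B) \<and> (\<forall>x. \<bar>W (fst p) (snd p) x\<bar> * (1 + norm x) \<le> B)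
     \<and> (\<forall>x y. \<bar>W (fst p) (snd p) x - W (fst p) (snd p) y\<bar> \<le> B * norm (x - y))" by blast
  have B: "B \<ge> 0" "\<bar>W i j x\<bar> \<le> B" "\<bar>W i j x - W i j y\<bar> \<le> B * norm (x - y)" for i j x y
    using B0(1) B0(2)[of "(i, j)"] by simp_all
  define g where "g = (\<lambda>j x. 2 * (\<Sum>i\<in>UNIV. V i x * W i j x))"
  define G where "G = (\<lambda>x. \<chi> j. g j x)"
  let ?n = "real CARD('n)"
  have n1: "?n \<ge> 1" by (simp add: Suc_leI)
  \<comment> \<open>The first term covers the Lipschitz and decay bounds for G, the second the bound
    on the weight itself.\<close>
  define M where "M = ?n * (4 * ?n * (A * B)) + ?n * A\<^sup>2"
  have normG: "norm v \<le> ?n * K" if "\<And>j. \<bar>v $ j\<bar> \<le> K" for v :: "real^'n" and K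
  proof -
    have "norm v \<le> (\<Sum>j\<in>UNIV. \<bar>v $ j\<bar>)" by (rule norm_le_l1_cart)
    also have "\<dots> \<le> (\<Sum>j\<in>(UNIV::'n set). K)" by (intro sum_mono that)
    finally show ?thesis by simp
  qed
  have "acf_weight (\<lambda>x. (norm (frac_grad s u x))\<^sup>2) G M s"
  proof
    fix x y :: "real^'n"
    have w: "(\<lambda>x. (norm (frac_grad s u x))\<^sup>2) = (\<lambda>x. \<Sum>i\<in>UNIV. V i x * V i x)"
    proof -
      have "(\<lambda>x. (norm (frac_grad s u x))\<^sup>2) = (\<lambda>x. \<Sum>i\<in>UNIV. (V i x)\<^sup>2)"
        by (simp only: norm_frac_grad_sq V_def)
      then show ?thesis by (simp only: power2_eq_square[of "V _ _"])
    qed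
    have dV: "(V i has_derivative (\<lambda>h. \<Sum>j\<in>UNIV. h $ j * W i j x)) (at x)" for i
      unfolding V_def W_def
      using has_derivative_mult_right[OF fgrad_has_derivative[OF s u], of ?m i x]
      by (simp add: sum_distrib_left mult.left_commute)
    have "((\<lambda>x. \<Sum>i\<in>UNIV. V i x * V i x) has_derivative (\<lambda>h. \<Sum>i\<in>UNIV. V i x * (\<Sum>j\<in>UNIV. h $ j * W i j x) + (\<Sum>j\<in>UNIV. h $ j * W i j x) * V i x)) (at x)"
      by (intro has_derivative_sum has_derivative_mult dV)
    moreover have "(\<Sum>i\<in>UNIV. V i x * (\<Sum>j\<in>UNIV. h $ j * W i j x) + (\<Sum>j\<in>UNIV. h $ j * W i j x) * V i x) = G x \<bullet> h" for h
    proof -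
      have "(\<Sum>i\<in>UNIV. V i x * (\<Sum>j\<in>UNIV. h $ j * W i j x) + (\<Sum>j\<in>UNIV. h $ j * W i j x) * V i x)
        = (\<Sum>i\<in>UNIV. \<Sum>j\<in>UNIV. 2 * (V i x * (h $ j * W i j x)))"
      proof (rule sum.cong[OF refl])
        fix i
        have "V i x * S + S * V i x = 2 * (V i x * S)" for S by simp
        from this[of "\<Sum>j\<in>UNIV. h $ j * W i j x"]
        show "V i x * (\<Sum>j\<in>UNIV. h $ j * W i j x) + (\<Sum>j\<in>UNIV. h $ j * W i j x) * V i x = (\<Sum>j\<in>UNIV. 2 * (V i x * (h $ j * W i j x)))"
          by (rule trans) (simp only: sum_distrib_left)
      qed
      also have "\<dots> = (\<Sum>j\<in>UNIV. \<Sum>i\<in>UNIV. 2 * (V i x * (h $ j * W i j x)))" by (rule sum.swap)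
      also have "\<dots> = (\<Sum>j\<in>UNIV. g j x * h $ j)"
      proof (rule sum.cong[OF refl])
        fix j
        show "(\<Sum>i\<in>UNIV. 2 * (V i x * (h $ j * W i j x))) = g j x * h $ j"
          unfolding g_def sum_distrib_left sum_distrib_right by (rule sum.cong[OF refl]) simp
      qed
      also have "\<dots> = G x \<bullet> h" by (simp add: inner_vec_def G_def)
      finally show ?thesis .
    qed
    ultimately show "((\<lambda>x. (norm (frac_grad s u x))\<^sup>2) has_derivative (\<lambda>h. G x \<bullet> h)) (at x)" unfolding w by simp
    have "\<bar>g j x - g j y\<bar> \<le> 4 * ?n * (A * B) * norm (x - y)" for j
    proof -
      have t: "\<bar>V i x * W i j x - V i y * W i j y\<bar> \<le> 2 * (A * B) * norm (x - y)" for i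
      proof -
        have "V i x * W i j x - V i y * W i j y = V i x * (W i j x - W i j y) + (V i x - V i y) * W i j y"
          by (simp add: algebra_simps)
        also have "\<bar>\<dots>\<bar> \<le> \<bar>V i x\<bar> * \<bar>W i j x - W i j y\<bar> + \<bar>V i x - V i y\<bar> * \<bar>W i j y\<bar>"
          by (rule order_trans[OF abs_triangle_ineq]) (simp only: abs_mult)
        also have "\<dots> \<le> A * (B * norm (x - y)) + (A * norm (x - y)) * B"
        proof (rule add_mono)
          show "\<bar>V i x\<bar> * \<bar>W i j x - W i j y\<bar> \<le> A * (B * norm (x - y))"
            by (rule mult_mono[OF A(2) B(3) A(1)]) simp
          have "0 \<le> A * norm (x - y)" using A(1) by simp
          then show "\<bar>V i x - V i y\<bar> * \<bar>W i j y\<bar> \<le> (A * norm (x - y)) * B"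
            by (rule mult_mono[OF A(4) B(2)]) simp
        qed
        also have "\<dots> = 2 * (A * B) * norm (x - y)" by simp
        finally show ?thesis .
      qed
      have "\<bar>g j x - g j y\<bar> = 2 * \<bar>\<Sum>i\<in>UNIV. V i x * W i j x - V i y * W i j y\<bar>"
      proof -
        have "g j x - g j y = 2 * (\<Sum>i\<in>UNIV. V i x * W i j x - V i y * W i j y)"
          unfolding g_def sum_subtractf by simp
        then show ?thesis by (simp only: abs_mult abs_numeral)
      qed
      also have "\<dots> \<le> 2 * (\<Sum>i\<in>(UNIV::'n set). 2 * (A * B) * norm (x - y))"
        by (intro mult_left_mono order_trans[OF sum_abs] sum_mono t) auto
      finally show ?thesis by simp
    qed
    then have "norm (G x - G y) \<le> ?n * (4 * ?n * (A * B) * norm (x - y))"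
      by (intro normG) (simp add: G_def)
    also have "\<dots> = ?n * (4 * ?n * (A * B)) * norm (x - y)" by simp
    also have "\<dots> \<le> M * norm (x - y)" by (rule mult_right_mono) (auto simp: M_def)
    finally show "norm (G x - G y) \<le> M * norm (x - y)" .
    have "\<bar>g j x\<bar> * (1 + norm x) \<le> 2 * ?n * (A * B)" for j
    proof -
      have t: "\<bar>V i x * W i j x\<bar> * (1 + norm x) \<le> A * B" for i
      proof -
        have "\<bar>V i x * W i j x\<bar> * (1 + norm x) = (\<bar>V i x\<bar> * (1 + norm x)) * \<bar>W i j x\<bar>" by (simp add: abs_mult)
        also have "\<dots> \<le> A * B" by (rule mult_mono[OF A(3) B(2) A(1)]) simp
        finally show ?thesis .
      qed
      have "\<bar>g j x\<bar> * (1 + norm x) \<le> 2 * ((\<Sum>i\<in>UNIV. \<bar>V i x * W i j x\<bar>) * (1 + norm x))"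
      proof -
        have "\<bar>g j x\<bar> \<le> 2 * (\<Sum>i\<in>UNIV. \<bar>V i x * W i j x\<bar>)"
          unfolding g_def abs_mult[of 2] using sum_abs[of "\<lambda>i. V i x * W i j x" UNIV] by simp
        then have "\<bar>g j x\<bar> * (1 + norm x) \<le> 2 * (\<Sum>i\<in>UNIV. \<bar>V i x * W i j x\<bar>) * (1 + norm x)"
          by (rule mult_right_mono) simp
        then show ?thesis by (simp only: mult.assoc)
      qed
      also have "\<dots> \<le> 2 * (\<Sum>i\<in>(UNIV::'n set). A * B)"
        unfolding sum_distrib_right by (intro mult_left_mono sum_mono t) auto
      finally show ?thesis by simp
    qed
    then have "\<bar>((1 + norm x) *\<^sub>R G x) $ j\<bar> \<le> 2 * ?n * (A * B)" for j
      by (simp add: G_def abs_mult mult.commute)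
    then have "norm ((1 + norm x) *\<^sub>R G x) \<le> ?n * (2 * ?n * (A * B))" by (rule normG)
    also have "\<dots> \<le> M" unfolding M_def using A(1) B(1) by simp
    finally show "norm (G x) * (1 + norm x) \<le> M" by (simp add: mult.commute)
    have "\<bar>(norm (frac_grad s u x))\<^sup>2\<bar> = (norm (frac_grad s u x))\<^sup>2" by (rule abs_of_nonneg) (rule zero_le_power2)
    also have "\<dots> = (\<Sum>i\<in>UNIV. (V i x)\<^sup>2)" by (simp only: norm_frac_grad_sq V_def)
    also have "\<dots> \<le> (\<Sum>i\<in>(UNIV::'n set). A\<^sup>2)"
    proof (rule sum_mono)
      fix i
      show "(V i x)\<^sup>2 \<le> A\<^sup>2" using A(1) A(2)[of i x] by (simp add: abs_le_square_iff[symmetric])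
    qed
    also have "\<dots> \<le> M" unfolding M_def using A(1) B(1) by simp
    finally show "\<bar>(norm (frac_grad s u x))\<^sup>2\<bar> \<le> M" .
  qed (use s in auto)
  then show ?thesis by blast
qed

text \<open>Integrability has to be shown, as otherwise the integral would default to 0 and its
  inverse with it. It comes from 1 - cos t <= 2 min 1 (t^2); positivity follows because the
  integrand is strictly positive on a ball of radius 1/2 around an axis vector, where the chosen
  coordinate lies between 0 and pi.\<close>

lemma C_ns_pos:
  assumes s: "0 < s" "s < 1"
  shows "C_ns s TYPE('n::finite) > 0"
proof -
  let ?F = "\<lambda>z::real^'n. (1 - cos (z $ idx1)) / norm z powr (real CARD('n) + 2 * s)"
  have nn: "?F z \<ge> 0" for z by simp
  have "integrable lborel (\<lambda>z::real^'n. 2 * (min 1 ((norm z)\<^sup>2) / norm z powr (real DIM(real^'n) + 2 * s)))"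
    by (intro integrable_mult_right sd_dom_integrable s)
  then have int: "integrable lborel ?F"
  proof (rule Bochner_Integration.integrable_bound)
    show "AE z in lborel. norm (?F z) \<le> norm (2 * (min 1 ((norm z)\<^sup>2) / norm z powr (real DIM(real^'n) + 2 * s)))"
    proof (rule AE_I2)
      fix z :: "real^'n"
      have "1 - cos (z $ idx1) = 2 * (sin (z $ idx1 / 2))\<^sup>2" using cos_double_sin[of "z $ idx1 / 2"] by simp
      also have "\<dots> \<le> 2 * (z $ idx1 / 2)\<^sup>2"
        using abs_sin_x_le_abs_x[of "z $ idx1 / 2"] by (intro mult_left_mono) (auto simp: abs_le_square_iff[symmetric])
      also have "\<dots> \<le> 2 * (z $ idx1)\<^sup>2" by (simp add: power2_eq_square)
      also have "(z $ idx1)\<^sup>2 \<le> (norm z)\<^sup>2"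
        using component_le_norm_cart[of z idx1] by (simp add: abs_le_square_iff[symmetric])
      finally have "1 - cos (z $ idx1) \<le> 2 * (norm z)\<^sup>2" by simp
      moreover have "1 - cos (z $ idx1) \<le> 2" using cos_ge_minus_one[of "z $ idx1"] by simp
      ultimately have "1 - cos (z $ idx1) \<le> 2 * min 1 ((norm z)\<^sup>2)" by (auto simp: min_def)
      then have "?F z \<le> 2 * min 1 ((norm z)\<^sup>2) / norm z powr (real CARD('n) + 2 * s)" by (rule divide_right_mono) simp
      then show "norm (?F z) \<le> norm (2 * (min 1 ((norm z)\<^sup>2) / norm z powr (real DIM(real^'n) + 2 * s)))"
        using nn[of z] by simp
    qed
  qed measurable
  have "integral\<^sup>L lborel ?F \<noteq> 0"
  proof
    assume "integral\<^sup>L lborel ?F = 0"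
    then have ae: "AE z in lborel. ?F z = 0"
      using integral_nonneg_eq_0_iff_AE[OF int] nn by simp
    let ?z = "axis idx1 1 :: real^'n"
    have "AE z in lborel. z \<notin> ball ?z (1 / 2)"
      using ae
    proof eventually_elim
      case (elim z)
      show ?case
      proof
        assume z: "z \<in> ball ?z (1 / 2)"
        then have "\<bar>(z - ?z) $ idx1\<bar> < 1 / 2"
          using component_le_norm_cart[of "z - ?z" idx1] by (simp add: dist_norm norm_minus_commute)
        then have "\<bar>z $ idx1 - 1\<bar> < 1 / 2" by (simp add: axis_def)
        then have b: "0 < z $ idx1" "z $ idx1 < pi" using pi_gt3 by linarith+
        then have "cos (z $ idx1) < 1" using cos_monotone_0_pi[of 0 "z $ idx1"] by simp
        moreover have "z \<noteq> 0" using b by auto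
        ultimately show False using elim by simp
      qed
    qed
    then have "emeasure lborel {z \<in> space lborel. z \<in> ball ?z (1 / 2)} = 0"
      by (intro emeasure_eq_0_AE) simp
    moreover have "{z \<in> space lborel. z \<in> ball ?z (1 / 2)} = ball ?z (1 / 2)" by auto
    ultimately have "emeasure lborel (ball ?z (1 / 2)) = 0" by metis
    moreover have "emeasure lborel (ball ?z (1 / 2)) > 0"
      by (subst emeasure_ball) (auto simp: unit_ball_vol_pos ennreal_zero_less_mult_iff)
    ultimately show False by simp
  qed
  moreover have "integral\<^sup>L lborel ?F \<ge> 0" using nn by (intro integral_nonneg_AE) auto
  ultimately have "integral\<^sup>L lborel ?F > 0" by (metis order.not_eq_order_implies_strict)
  then show ?thesis unfolding C_ns_def by (rule positive_imp_inverse_positive)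
qed

lemma cut_integrable:
  fixes u :: "real^'n::finite \<Rightarrow> real"
  assumes s: "0 < s" and [measurable]: "u \<in> borel_measurable borel" and A: "\<And>x. \<bar>u x\<bar> \<le> A" and e: "0 < e"
  shows "integrable lborel (\<lambda>h. indicator (- ball 0 e) h * ((u x - u (x + h)) / norm h powr (real CARD('n) + 2 * s)))"
proof (rule integrable_radial_bound[where a="real CARD('n)" and b="- 2 * s" and B="2 * A * (1 + e powr (- (real CARD('n) + 2 * s)))"])
  let ?p = "real CARD('n) + 2 * s"
  have A0: "A \<ge> 0" using order_trans[OF abs_ge_zero A] .
  fix h :: "real^'n"
  have ub: "\<bar>u x - u (x + h)\<bar> \<le> 2 * A" using A[of x] A[of "x + h"] by linarith
  have b: "\<bar>(u x - u (x + h)) / norm h powr ?p\<bar> \<le> 2 * A * norm h powr (- ?p)"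
  proof -
    have "(u x - u (x + h)) / norm h powr ?p = (u x - u (x + h)) * norm h powr (- ?p)"
      by (simp only: powr_minus divide_inverse)
    then show ?thesis using mult_right_mono[OF ub, of "norm h powr (- ?p)"] by (simp only: abs_mult) simp
  qed
  have K: "2 * A * norm h powr (- ?p) \<le> 2 * A * (1 + e powr (- ?p))" if "norm h powr (- ?p) \<le> 1 + e powr (- ?p)"
    using that A0 by (intro mult_left_mono) auto
  {
    assume h: "h \<noteq> 0" "norm h \<le> 1"
    show "\<bar>indicator (- ball 0 e) h * ((u x - u (x + h)) / norm h powr ?p)\<bar> \<le> 2 * A * (1 + e powr (- ?p)) * norm h powr (real CARD('n) - real DIM(real^'n))"
    proof (cases "norm h < e")
      case True
      then show ?thesis using A0 by simp
    next
      case False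
      then have "norm h powr (- ?p) \<le> e powr (- ?p)" using e s by (intro powr_mono2') auto
      then have "2 * A * norm h powr (- ?p) \<le> 2 * A * (1 + e powr (- ?p))" by (intro K) linarith
      with b have "\<bar>(u x - u (x + h)) / norm h powr ?p\<bar> \<le> 2 * A * (1 + e powr (- ?p))" by linarith
      then show ?thesis using False h by (simp add: abs_mult)
    qed
  }
  {
    assume h: "1 \<le> norm h"
    have "\<bar>indicator (- ball 0 e) h * ((u x - u (x + h)) / norm h powr ?p)\<bar> \<le> \<bar>(u x - u (x + h)) / norm h powr ?p\<bar>"
      by (auto simp: indicator_def)
    also note b
    also have "2 * A * norm h powr (- ?p) \<le> 2 * A * (1 + e powr (- ?p)) * norm h powr (- ?p)"
      using A0 by (intro mult_right_mono) (auto simp: algebra_simps)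
    finally have F: "\<bar>indicator (- ball 0 e) h * ((u x - u (x + h)) / norm h powr ?p)\<bar> \<le> 2 * A * (1 + e powr (- ?p)) * norm h powr (- ?p)" .
    have "- ?p = - 2 * s - real DIM(real^'n)" by simp
    then have "norm h powr (- ?p) = norm h powr (- 2 * s - real DIM(real^'n))" by (rule arg_cong)
    from F[unfolded this] show "\<bar>indicator (- ball 0 e) h * ((u x - u (x + h)) / norm h powr ?p)\<bar> \<le> 2 * A * (1 + e powr (- ?p)) * norm h powr (- 2 * s - real DIM(real^'n))" .
  }
qed (use s in auto)

text \<open>Averaging the truncated integral over h and -h replaces u(x) - u(x+h) by half a second
  difference, whence the factor 1/2. The result is absolutely integrable, so dominated convergence
  removes the truncation and f is determined pointwise by u.\<close>

lemma frac_lap_value: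
  fixes u f :: "real^'n::finite \<Rightarrow> real"
  assumes s: "0 < s" "s < 1" and u: "Cinf_c u" and f: "frac_lap_eq s u f"
  shows "f x = C_ns s TYPE('n) / 2 * sd_integral s u x"
proof -
  let ?p = "real CARD('n) + 2 * s" and ?C = "C_ns s TYPE('n)"
  have [measurable]: "u \<in> borel_measurable borel" by (rule Cinf_c_borel[OF u])
  obtain A where A: "\<And>x. \<bar>u x\<bar> \<le> A" using Cinf_c_bounded[OF u] by blast
  obtain B where B: "\<And>x h. \<bar>second_diff u h x\<bar> \<le> B * min 1 ((norm h)\<^sup>2)" using Cinf_c_second_diff[OF u] by blast
  have isd: "integrable lborel (\<lambda>h. second_diff u h x / norm h powr ?p)"
    using sd_integrand_integrable[OF s \<open>u \<in> borel_measurable borel\<close> B] by simp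
  define Q where "Q = (\<lambda>e h. indicator (- ball 0 e) h * ((u x - u (x + h)) / norm h powr ?p))"
  have cut: "set_lebesgue_integral lborel (- ball x e) (\<lambda>y. (u x - u y) / dist x y powr ?p)
     = 1 / 2 * (\<integral>h. indicator (- ball 0 e) h * (second_diff u h x / norm h powr ?p) \<partial>lborel)" if e: "e > 0" for e
  proof -
    have iQ: "integrable lborel (Q e)" unfolding Q_def by (rule cut_integrable[OF s(1) _ A e]) measurable
    have iQ': "integrable lborel (\<lambda>h. Q e (- h))" using integrable_lborel_affine[OF iQ, of "-1" 0] by simp
    have eQ': "(\<integral>h. Q e (- h) \<partial>lborel) = (\<integral>h. Q e h \<partial>lborel)" using integral_lborel_affine[of "-1" "Q e" 0] by simp
    have "set_lebesgue_integral lborel (- ball x e) (\<lambda>y. (u x - u y) / dist x y powr ?p)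
       = (\<integral>h. indicator (- ball x e) (x + 1 *\<^sub>R h) *\<^sub>R ((u x - u (x + 1 *\<^sub>R h)) / dist x (x + 1 *\<^sub>R h) powr ?p) \<partial>lborel)"
      unfolding set_lebesgue_integral_def by (subst integral_lborel_affine[where c=1 and t=x]) auto
    also have "\<dots> = (\<integral>h. Q e h \<partial>lborel)"
      by (intro Bochner_Integration.integral_cong) (auto simp: Q_def indicator_def dist_norm)
    also have "\<dots> = 1 / 2 * (\<integral>h. Q e h + Q e (- h) \<partial>lborel)" using iQ iQ' eQ' by simp
    also have "(\<integral>h. Q e h + Q e (- h) \<partial>lborel) = (\<integral>h. indicator (- ball 0 e) h * (second_diff u h x / norm h powr ?p) \<partial>lborel)"
      by (intro Bochner_Integration.integral_cong)
         (auto simp: Q_def indicator_def second_diff_def add_divide_distrib[symmetric])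
    finally show ?thesis .
  qed
  define e where "e = (\<lambda>n::nat. 1 / real (Suc n))"
  have e0: "e n > 0" for n by (simp add: e_def)
  have elim0: "e \<longlonglongrightarrow> 0" unfolding e_def using LIMSEQ_inverse_real_of_nat by (simp add: inverse_eq_divide)
  have filt: "filterlim e (at_right 0) sequentially"
    using elim0 e0 less_imp_neq[OF e0] by (auto simp: filterlim_at eventually_sequentially)
  have "((\<lambda>e. ?C * set_lebesgue_integral lborel (- ball x e) (\<lambda>y. (u x - u y) / dist x y powr ?p)) \<longlongrightarrow> f x) (at_right 0)"
    using f unfolding frac_lap_eq_def by blast
  from filterlim_compose[OF this filt]
  have l1: "(\<lambda>n. ?C * (1 / 2 * (\<integral>h. indicator (- ball 0 (e n)) h * (second_diff u h x / norm h powr ?p) \<partial>lborel))) \<longlonglongrightarrow> f x"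
    by (simp only: cut[OF e0])
  have "(\<lambda>n. \<integral>h. indicator (- ball 0 (e n)) h * (second_diff u h x / norm h powr ?p) \<partial>lborel) \<longlonglongrightarrow> sd_integral s u x"
    unfolding sd_integral_def
  proof (rule integral_dominated_convergence[where w="\<lambda>h. norm (second_diff u h x / norm h powr ?p)"])
    have m: "(\<lambda>h. second_diff u h x / norm h powr ?p) \<in> borel_measurable lborel"
      by (rule borel_measurable_integrable[OF isd])
    show "(\<lambda>h. second_diff u h x / norm h powr (real DIM(real^'n) + 2 * s)) \<in> borel_measurable lborel" using m by simp
    show "(\<lambda>h. indicator (- ball 0 (e n)) h * (second_diff u h x / norm h powr ?p)) \<in> borel_measurable lborel" for n
      using m by measurable
    show "integrable lborel (\<lambda>h. norm (second_diff u h x / norm h powr ?p))" using isd by (rule integrable_norm)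
    show "AE h in lborel. norm (indicator (- ball 0 (e n)) h * (second_diff u h x / norm h powr ?p)) \<le> norm (second_diff u h x / norm h powr ?p)" for n
      by (intro AE_I2) (auto simp: indicator_def)
    show "AE h in lborel. (\<lambda>n. indicator (- ball 0 (e n)) h * (second_diff u h x / norm h powr ?p)) \<longlonglongrightarrow> second_diff u h x / norm h powr (real DIM(real^'n) + 2 * s)"
      using AE_lborel_singleton[of "0::real^'n"]
    proof eventually_elim
      case (elim h)
      then have "norm h > 0" by simp
      then have "\<forall>\<^sub>F n in sequentially. e n < norm h" by (rule order_tendstoD(2)[OF elim0])
      then have "\<forall>\<^sub>F n in sequentially. indicator (- ball 0 (e n)) h * (second_diff u h x / norm h powr ?p) = second_diff u h x / norm h powr (real DIM(real^'n) + 2 * s)"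
        by eventually_elim (simp add: indicator_def)
      then show ?case by (rule tendsto_eventually)
    qed
  qed
  then have "(\<lambda>n. ?C * (1 / 2 * (\<integral>h. indicator (- ball 0 (e n)) h * (second_diff u h x / norm h powr ?p) \<partial>lborel))) \<longlonglongrightarrow> ?C * (1 / 2 * sd_integral s u x)"
    by (intro tendsto_intros)
  from LIMSEQ_unique[OF l1 this] show ?thesis by simp
qed

text \<open>Both operators integrate translates of u, so commuting them is Fubini for a double
  integral in k and h. Its majorant is a product of \<open>fgrad_dom\<close> in k and the
  second-difference majorant in h, supplied by \<open>Cinf_c_second_diff_increment\<close>.\<close>

lemma fgrad_sd_commute:
  fixes u :: "real^'n::finite \<Rightarrow> real"
  assumes s: "0 < s" "s < 1" and u: "Cinf_c u"
  shows "fgrad s i (sd_integral s u) x = sd_integral s (fgrad s i u) x"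
proof -
  let ?p = "real CARD('n) + 2 * s" and ?q = "real CARD('n) + s + 1"
  have u_borel[measurable]: "u \<in> borel_measurable borel" by (rule Cinf_c_borel[OF u])
  obtain C where C: "C \<ge> 0" "\<And>x h k. \<bar>second_diff u h (x + k) - second_diff u h x\<bar> \<le> C * min 1 ((norm h)\<^sup>2) * min 1 (norm k)"
    using Cinf_c_second_diff_increment[OF u] by blast
  obtain B where B: "\<And>x h. \<bar>second_diff u h x\<bar> \<le> B * min 1 ((norm h)\<^sup>2)" using Cinf_c_second_diff[OF u] by blast
  have isd: "integrable lborel (\<lambda>h. second_diff u h x / norm h powr ?p)" for x
    using sd_integrand_integrable[OF s u_borel B] by simp
  define J where "J = (\<lambda>(k::real^'n) h. k $ i * (second_diff u h (x + k) - second_diff u h x) / norm k powr ?q / norm h powr ?p)"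
  let ?dh = "\<lambda>h::real^'n. min 1 ((norm h)\<^sup>2) / norm h powr ?p"
  have dh: "integrable lborel ?dh" using sd_dom_integrable[OF s, where 'a="real^'n"] by simp
  have Jb: "\<bar>J k h\<bar> \<le> C * fgrad_dom s k * ?dh h" for k h
  proof -
    have "\<bar>k $ i * (second_diff u h (x + k) - second_diff u h x) / norm k powr ?q\<bar> \<le> (C * min 1 ((norm h)\<^sup>2)) * fgrad_dom s k"
      by (rule fgrad_integrand_bound) (rule C(2))
    then have "\<bar>k $ i * (second_diff u h (x + k) - second_diff u h x) / norm k powr ?q\<bar> / norm h powr ?p \<le> (C * min 1 ((norm h)\<^sup>2)) * fgrad_dom s k / norm h powr ?p"
      by (rule divide_right_mono) simp
    then show ?thesis by (simp add: J_def abs_divide mult_ac)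
  qed
  define c where "c = (\<lambda>k::real^'n. k $ i)"
  have [measurable]: "c \<in> borel_measurable borel" unfolding c_def by measurable
  have Jm: "(\<lambda>(k, h). J k h) \<in> borel_measurable (lborel \<Otimes>\<^sub>M lborel)"
    unfolding J_def second_diff_def c_def[THEN fun_cong, symmetric] by measurable
  have Jh: "integrable lborel (J k)" for k
  proof (rule Bochner_Integration.integrable_bound[OF integrable_mult_right[OF dh, of "C * fgrad_dom s k"]])
    show "J k \<in> borel_measurable lborel" unfolding J_def second_diff_def by measurable
    show "AE h in lborel. norm (J k h) \<le> norm (C * fgrad_dom s k * ?dh h)"
      by (intro AE_I2) (simp only: real_norm_def, rule order_trans[OF Jb abs_ge_self])
  qed
  let ?D = "\<integral>h. ?dh h \<partial>lborel"
  have J: "integrable (lborel \<Otimes>\<^sub>M lborel) (\<lambda>(k, h). J k h)"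
  proof (rule lborel_pair.Fubini_integrable[OF Jm])
    show "AE k in lborel. integrable lborel (\<lambda>h. (\<lambda>(k, h). J k h) (k, h))" using Jh by simp
    show "integrable lborel (\<lambda>k. \<integral>h. norm ((\<lambda>(k, h). J k h) (k, h)) \<partial>lborel)"
    proof (rule Bochner_Integration.integrable_bound[OF integrable_mult_left[OF fgrad_dom_integrable[OF s], of "C * ?D"]])
      show "(\<lambda>k. \<integral>h. norm ((\<lambda>(k, h). J k h) (k, h)) \<partial>lborel) \<in> borel_measurable lborel"
        using Jm by measurable
      show "AE k in lborel. norm (\<integral>h. norm ((\<lambda>(k, h). J k h) (k, h)) \<partial>lborel) \<le> norm (fgrad_dom s k * (C * ?D))"
      proof (rule AE_I2)
        fix k :: "real^'n"
        have "norm (\<integral>h. norm ((\<lambda>(k, h). J k h) (k, h)) \<partial>lborel) = (\<integral>h. \<bar>J k h\<bar> \<partial>lborel)" by simp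
        also have "\<dots> \<le> (\<integral>h. C * fgrad_dom s k * ?dh h \<partial>lborel)"
          by (rule integral_mono[OF integrable_abs[OF Jh] integrable_mult_right[OF dh] Jb])
        also have "\<dots> = C * fgrad_dom s k * ?D" by (rule integral_mult_right_zero)
        also have "\<dots> = fgrad_dom s k * (C * ?D)" by (simp only: mult_ac)
        also have "\<dots> \<le> norm (fgrad_dom s k * (C * ?D))" by (simp only: real_norm_def abs_ge_self)
        finally show "norm (\<integral>h. norm ((\<lambda>(k, h). J k h) (k, h)) \<partial>lborel) \<le> norm (fgrad_dom s k * (C * ?D))" .
      qed
    qed
  qed
  have "fgrad s i (sd_integral s u) x = (\<integral>k. (\<integral>h. J k h \<partial>lborel) \<partial>lborel)"
    unfolding fgrad_def
  proof (rule Bochner_Integration.integral_cong[OF refl])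
    fix k :: "real^'n"
    have "sd_integral s u (x + k) - sd_integral s u x = (\<integral>h. second_diff u h (x + k) / norm h powr ?p - second_diff u h x / norm h powr ?p \<partial>lborel)"
      unfolding sd_integral_def using isd by simp
    then have "k $ i * (sd_integral s u (x + k) - sd_integral s u x) / norm k powr ?q
       = (k $ i / norm k powr ?q) * (\<integral>h. second_diff u h (x + k) / norm h powr ?p - second_diff u h x / norm h powr ?p \<partial>lborel)" by simp
    also have "\<dots> = (\<integral>h. (k $ i / norm k powr ?q) * (second_diff u h (x + k) / norm h powr ?p - second_diff u h x / norm h powr ?p) \<partial>lborel)"
      by (rule integral_mult_right_zero[symmetric])
    also have "\<dots> = (\<integral>h. J k h \<partial>lborel)"
      by (intro Bochner_Integration.integral_cong) (auto simp: J_def right_diff_distrib diff_divide_distrib mult_ac)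
    finally show "k $ i * (sd_integral s u (x + k) - sd_integral s u x) / norm k powr ?q = (\<integral>h. J k h \<partial>lborel)" .
  qed
  also have "\<dots> = (\<integral>h. (\<integral>k. J k h \<partial>lborel) \<partial>lborel)"
    by (rule lborel_pair.Fubini_integral[OF J, symmetric])
  also have "\<dots> = sd_integral s (fgrad s i u) x"
    unfolding sd_integral_def
  proof (rule Bochner_Integration.integral_cong[OF refl])
    fix h :: "real^'n"
    have "(\<integral>k. J k h \<partial>lborel) = fgrad s i (second_diff u h) x / norm h powr ?p"
      unfolding J_def fgrad_def by (rule integral_divide_zero)
    then show "(\<integral>k. J k h \<partial>lborel) = second_diff (fgrad s i u) h x / norm h powr (real DIM(real^'n) + 2 * s)"
      unfolding fgrad_second_diff[OF s u] by simp
  qed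
  finally show ?thesis .
qed

lemma fgrad_continuous:
  fixes u :: "real^'n::finite \<Rightarrow> real"
  assumes s: "0 < s" "s < 1" and u: "Cinf_c u"
  shows "continuous_on UNIV (fgrad s i u)"
  by (auto intro!: continuous_at_imp_continuous_on has_derivative_continuous[OF fgrad_has_derivative[OF s u]])

lemma fgrad_second_diff_bound:
  fixes u :: "real^'n::finite \<Rightarrow> real"
  assumes s: "0 < s" "s < 1" and u: "Cinf_c u"
  shows "\<exists>C. \<forall>x h. \<bar>second_diff (fgrad s i u) h x\<bar> \<le> C * min 1 ((norm h)\<^sup>2)"
proof -
  obtain C where C: "C \<ge> 0" "\<And>x h k. \<bar>second_diff u h (x + k) - second_diff u h x\<bar> \<le> C * min 1 ((norm h)\<^sup>2) * min 1 (norm k)"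
    using Cinf_c_second_diff_increment[OF u] by blast
  have [measurable]: "u \<in> borel_measurable borel" by (rule Cinf_c_borel[OF u])
  have m: "second_diff u h \<in> borel_measurable borel" for h unfolding second_diff_def[abs_def] by measurable
  let ?I = "\<integral>k. fgrad_dom s (k :: real^'n) \<partial>lborel"
  have "\<bar>second_diff (fgrad s i u) h x\<bar> \<le> (C * ?I) * min 1 ((norm h)\<^sup>2)" for x h
  proof -
    have "\<bar>fgrad s i (second_diff u h) x\<bar> \<le> C * min 1 ((norm h)\<^sup>2) * ?I" by (rule fgrad_bound[OF s m C(2)])
    then show ?thesis unfolding fgrad_second_diff[OF s u] by (simp add: mult_ac)
  qed
  then show ?thesis by blast
qed

text \<open>The right side minus the left side is (v(x+h) - v(x))^2 + (v(x-h) - v(x))^2.\<close>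

lemma second_diff_square_le: "second_diff (\<lambda>x. (v x)\<^sup>2) h x \<le> 2 * v x * second_diff v h x"
proof -
  have "2 * v x * second_diff v h x - second_diff (\<lambda>x. (v x)\<^sup>2) h x = (v (x + h) - v x)\<^sup>2 + (v (x - h) - v x)\<^sup>2"
    by (simp add: second_diff_def power2_eq_square algebra_simps)
  then show ?thesis by (smt (verit) zero_le_power2)
qed

text \<open>The pointwise square inequality is summed over the components of the fractional gradient
  and integrated in h; integrability for each component lets the coefficients frozen at x leave the
  integral.\<close>

lemma sd_integral_frac_grad_sq_le:
  fixes u :: "real^'n::finite \<Rightarrow> real"
  assumes s: "0 < s" "s < 1" and u: "Cinf_c u"
  shows "sd_integral s (\<lambda>x. (norm (frac_grad s u x))\<^sup>2) x
    \<le> 2 * (\<Sum>i\<in>UNIV. frac_pd s i u x * (mu_ns s TYPE('n) * sd_integral s (fgrad s i u) x))"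
proof -
  let ?m = "mu_ns s TYPE('n)" and ?p = "real CARD('n) + 2 * s"
  obtain G M where W: "acf_weight (\<lambda>x. (norm (frac_grad s u x))\<^sup>2) G M s" using frac_grad_weight[OF s u] by blast
  interpret acf_weight "\<lambda>x. (norm (frac_grad s u x))\<^sup>2" G M s by (rule W)
  let ?w = "\<lambda>x. (norm (frac_grad s u x))\<^sup>2"
  have iw: "integrable lborel (\<lambda>h. second_diff ?w h x / norm h powr ?p)"
    using sd_integrand_integrable[OF s w_borel second_diff_bound] by simp
  have iv: "integrable lborel (\<lambda>h. second_diff (fgrad s i u) h x / norm h powr ?p)" for i
  proof -
    obtain C where "\<And>x h. \<bar>second_diff (fgrad s i u) h x\<bar> \<le> C * min 1 ((norm h)\<^sup>2)" using fgrad_second_diff_bound[OF s u] by blast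
    from sd_integrand_integrable[OF s borel_measurable_continuous_onI[OF fgrad_continuous[OF s u]] this] show ?thesis by simp
  qed
  have pt: "second_diff ?w h x \<le> 2 * (\<Sum>i\<in>UNIV. frac_pd s i u x * (?m * second_diff (fgrad s i u) h x))" for h
  proof -
    have w: "?w = (\<lambda>x. \<Sum>i\<in>UNIV. (?m * fgrad s i u x)\<^sup>2)" by (rule ext) (rule norm_frac_grad_sq)
    have "second_diff ?w h x = (\<Sum>i\<in>UNIV. second_diff (\<lambda>x. (?m * fgrad s i u x)\<^sup>2) h x)"
      unfolding w second_diff_def by (simp add: sum_subtractf sum_distrib_left)
    also have "\<dots> \<le> (\<Sum>i\<in>UNIV. 2 * (?m * fgrad s i u x) * second_diff (\<lambda>x. ?m * fgrad s i u x) h x)"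
      by (intro sum_mono second_diff_square_le)
    also have "\<dots> = (\<Sum>i\<in>UNIV. 2 * (frac_pd s i u x * (?m * second_diff (fgrad s i u) h x)))"
      by (intro sum.cong refl) (simp add: frac_pd_eq_fgrad second_diff_def algebra_simps)
    finally show ?thesis by (simp add: sum_distrib_left)
  qed
  define q where "q = (\<lambda>i h. second_diff (fgrad s i u) h x / norm h powr ?p)"
  have iq: "integrable lborel (q i)" for i unfolding q_def by (rule iv)
  have "sd_integral s ?w x \<le> (\<integral>h. 2 * (\<Sum>i\<in>UNIV. frac_pd s i u x * (?m * q i h)) \<partial>lborel)"
    unfolding sd_integral_def
  proof (rule integral_mono)
    show "integrable lborel (\<lambda>h. second_diff ?w h x / norm h powr (real DIM(real^'n) + 2 * s))" using iw by simp
    show "integrable lborel (\<lambda>h. 2 * (\<Sum>i\<in>UNIV. frac_pd s i u x * (?m * q i h)))"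
      by (intro integrable_mult_right Bochner_Integration.integrable_sum iq)
    fix h :: "real^'n"
    have "second_diff ?w h x / norm h powr ?p \<le> 2 * (\<Sum>i\<in>UNIV. frac_pd s i u x * (?m * second_diff (fgrad s i u) h x)) / norm h powr ?p"
      by (rule divide_right_mono[OF pt]) simp
    also have "\<dots> = 2 * (\<Sum>i\<in>UNIV. frac_pd s i u x * (?m * q i h))"
      unfolding q_def sum_distrib_left sum_divide_distrib by simp
    finally show "second_diff ?w h x / norm h powr (real DIM(real^'n) + 2 * s) \<le> 2 * (\<Sum>i\<in>UNIV. frac_pd s i u x * (?m * q i h))" by simp
  qed
  also have "\<dots> = 2 * (\<Sum>i\<in>UNIV. frac_pd s i u x * (?m * (\<integral>h. q i h \<partial>lborel)))"
    using iq by simp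
  also have "(\<lambda>i. \<integral>h. q i h \<partial>lborel) = (\<lambda>i. sd_integral s (fgrad s i u) x)"
    by (simp add: q_def sd_integral_def)
  finally show ?thesis by simp
qed

lemma fgrad_cmult: "fgrad s i (\<lambda>x. c * g x) x = c * fgrad s i g x"
proof -
  have "fgrad s i (\<lambda>x. c * g x) x = (\<integral>k. c * (k $ i * (g (x + k) - g x) / norm k powr (real CARD('a) + s + 1)) \<partial>lborel)"
    unfolding fgrad_def by (intro Bochner_Integration.integral_cong) (auto simp: algebra_simps)
  also have "\<dots> = c * fgrad s i g x" unfolding fgrad_def by (rule integral_mult_right_zero)
  finally show ?thesis .
qed

theorem theorem1p6:
  fixes u f :: "real^'n::finite \<Rightarrow> real" and s \<epsilon> :: real
  assumes "0 < s" "s < 1" "0 < \<epsilon>"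
    and "Cinf_c u"
    and "frac_lap_eq s u f"
    and "C_gamma_loc (s + \<epsilon>) f" "L1_w (s / 2) f"
    and "\<exists>U. open U \<and> 0 \<in> U \<and> (\<forall>x\<in>U. frac_grad s u x \<bullet> frac_grad s f x \<le> 0)"
  shows "\<exists>R0>0. mono_on {0<..<R0} (J_ACF s u)"
proof -
  note s = assms(1,2) and u = assms(4)
  let ?m = "mu_ns s TYPE('n)" and ?C = "C_ns s TYPE('n)"
  obtain U where U: "open U" "0 \<in> U" "\<And>x. x \<in> U \<Longrightarrow> frac_grad s u x \<bullet> frac_grad s f x \<le> 0"
    using assms(8) by blast
  then obtain R0 where R0: "R0 > 0" "ball 0 R0 \<subseteq> U" unfolding open_contains_ball by blast
  obtain G M where W: "acf_weight (\<lambda>x. (norm (frac_grad s u x))\<^sup>2) G M s" using frac_grad_weight[OF s u] by blast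
  \<comment> \<open>With f expressed through u, its fractional gradient is found by commuting the
    two operators on u, although f itself need not have compact support.\<close>
  have f: "f = (\<lambda>x. ?C / 2 * sd_integral s u x)" by (rule ext) (rule frac_lap_value[OF s u assms(5)])
  have gf: "frac_pd s i f x = ?C / 2 * (?m * sd_integral s (fgrad s i u) x)" for i x
    unfolding frac_pd_eq_fgrad f fgrad_cmult fgrad_sd_commute[OF s u] by simp
  \<comment> \<open>Up to the positive factor C_{n,s} / 2, the sum in the square inequality is the
    inner product of the two fractional gradients, so the sign hypothesis transfers to the ball
    contained in U.\<close>
  have sub: "sd_integral s (\<lambda>x. (norm (frac_grad s u x))\<^sup>2) x \<le> 0" if x: "norm x < R0" for x
  proof -
    let ?S = "\<Sum>i\<in>UNIV. frac_pd s i u x * (?m * sd_integral s (fgrad s i u) x)"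
    have "x \<in> ball 0 R0" using x by simp
    then have "frac_grad s u x \<bullet> frac_grad s f x \<le> 0" using R0(2) U(3) by blast
    moreover have "frac_grad s u x \<bullet> frac_grad s f x = ?C / 2 * ?S"
      unfolding inner_vec_def frac_grad_def by (simp add: gf sum_distrib_left mult_ac)
    ultimately have "?C / 2 * ?S \<le> 0" by simp
    then have "?S \<le> 0" using C_ns_pos[OF s, where 'n='n] by (simp add: mult_le_0_iff)
    then show ?thesis using sd_integral_frac_grad_sq_le[OF s u, of x] by linarith
  qed
  have "J_ACF s u = (\<lambda>R. 1 / R powr (1 + s) * (LBINT r=0..R. r powr s * set_lebesgue_integral lborel (- ball 0 r) (\<lambda>y. Ksr s r y * (norm (frac_grad s u y))\<^sup>2)))"
    by (rule ext) (rule J_ACF_def)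
  then have "mono_on {0<..<R0} (J_ACF s u)" using averaged_mean_mono[OF W sub] by simp
  with R0(1) show ?thesis by blast
qed

end
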